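(* Assume $0<\alpha_1\le\varrho_0+\rho_s\le\alpha_2<\infty$ for constants $\alpha_1,\alpha_2$, $(\mathbf{u}_0,\varrho_0)\in H^2(\Omega)\times L^\infty(\Omega)$ and $f\in W^{2,\infty}(\Omega)$, and let $(\mathbf{u},\varrho)$ be the solution, with initial data $(\mathbf{u}_0,\varrho_0)$, of the perturbation system with $\mathbf{u}|_{\partial\Omega}=\mathbf{0}$ described in the context. Then: (1) $\displaystyle\int_\Omega\varrho(t)f\,d\mathbf{x}\to0$ as $t\to\infty$ if and only if there exist $\gamma>0$ and $\beta\in\mathbb{R}$ such that $$\|\varrho_0+\rho_s+\gamma f-\beta\|_{L^2}^2-\lim_{t\to+\infty}\|\varrho(t)+\rho_s+\gamma f-\beta\|_{L^2}^2=2\gamma\int_\Omega\varrho_0f\,d\mathbf{x}.$$ (2) There exist $\gamma>0$ and $\beta\in\mathbb{R}$ such that $$\|\varrho(t)+\rho_s-(-\gamma f+\beta)\|_{L^2}\to0\quad\text{as }t\to\infty$$ if and only if there exist $\gamma>0$ and $\beta\in\mathbb{R}$ such that $$\lim_{t\to\infty}2\gamma\int_\Omega(\varrho_0-\varrho(t))f\,d\mathbf{x}=\|\varrho_0+\rho_s+\gamma f-\beta\|_{L^2}^2.$$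
   Context: $\Omega\subset\mathbb{R}^2$ is a bounded domain with smooth boundary; $\nu>0$ is a constant; $f>0$ is a smooth potential function. $(\mathbf{0},\rho_s,p_s)$ is a given smooth steady state (hydrostatic equilibrium): $\rho_s=\rho_s(\mathbf{x})$, $p_s=p_s(\mathbf{x})$ with $\nabla p_s=-\rho_s\nabla f$ in $\Omega$. The perturbation system around it, for velocity $\mathbf{u}$, density perturbation $\varrho$ and pressure $P$, is $$(\varrho+\rho_s)\partial_t\mathbf{u}+(\varrho+\rho_s)(\mathbf{u}\cdot\nabla)\mathbf{u}=\nu\Delta\mathbf{u}-\nabla P-\varrho\nabla f,\quad \partial_t\varrho+(\mathbf{u}\cdot\nabla)\varrho+(\mathbf{u}\cdot\nabla)\rho_s=0,\quad \nabla\cdot\mathbf{u}=0\quad\text{in }\Omega,$$ with $\mathbf{u}|_{\partial\Omega}=\mathbf{0}$ and $(\mathbf{u},\varrho)|_{t=0}=(\mathbf{u}_0,\varrho_0)$, where $\nabla\cdot\mathbf{u}_0=0$ and $\mathbf{u}_0|_{\partial\Omega}=\mathbf{0}$. "Solution" means the (global) strong solution: on bounded time intervals $\mathbf{u}\in L^\infty(0,T;H^2)$, $\mathbf{u}_t\in L^2(0,T;H^1)$, $\sqrt{\varrho+\rho_s}\,\mathbf{u}_t\in L^\infty(0,T;L^2)$, $\nabla P\in L^\infty(0,T;L^2)$, and the equations hold (the transport equation in the sense of distributions when $\varrho$ is only bounded). *)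

theory Defs
  imports "HOL-Analysis.Analysis"
begin

section \<open>Smooth functions, test functions, smooth domains\<close>

text \<open>Everything in this section is meant for open \<open>S\<close>; \<open>pderiv_dir i g\<close> is the classical
  partial derivative in the direction of the basis vector \<open>i\<close>.\<close>

definition pderiv_dir :: "'a::euclidean_space \<Rightarrow> ('a \<Rightarrow> 'b::real_normed_vector) \<Rightarrow> 'a \<Rightarrow> 'b" where
  "pderiv_dir i g x = frechet_derivative g (at x) i"

definition grad :: "('a::euclidean_space \<Rightarrow> real) \<Rightarrow> 'a \<Rightarrow> 'a" where
  "grad g x = (\<Sum>i\<in>Basis. pderiv_dir i g x *\<^sub>R i)"

primrec Ck_on :: "nat \<Rightarrow> 'a::euclidean_space set \<Rightarrow> ('a \<Rightarrow> 'b::real_normed_vector) \<Rightarrow> bool" where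
  "Ck_on 0 S g \<longleftrightarrow> continuous_on S g"
| "Ck_on (Suc k) S g \<longleftrightarrow>
     (\<forall>x\<in>S. g differentiable (at x)) \<and> (\<forall>i\<in>Basis. Ck_on k S (pderiv_dir i g))"

definition smooth_fun_on :: "'a::euclidean_space set \<Rightarrow> ('a \<Rightarrow> 'b::real_normed_vector) \<Rightarrow> bool" where
  "smooth_fun_on S g \<longleftrightarrow> (\<forall>k. Ck_on k S g)"

definition test_fun :: "'a::euclidean_space set \<Rightarrow> ('a \<Rightarrow> 'b::real_normed_vector) \<Rightarrow> bool" where
  "test_fun S \<phi> \<longleftrightarrow> smooth_fun_on UNIV \<phi> \<and>
     compact (closure {x. \<phi> x \<noteq> 0}) \<and> closure {x. \<phi> x \<noteq> 0} \<subseteq> S"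

text \<open>Near each boundary point, after a rigid motion \<open>R\<close> fixing the origin, the domain is the
  strict epigraph of a smooth function.\<close>

definition smooth_boundary :: "(real^2) set \<Rightarrow> bool" where
  "smooth_boundary \<Omega> \<longleftrightarrow>
     (\<forall>p \<in> frontier \<Omega>. \<exists>r>0. \<exists>R :: real^2 \<Rightarrow> real^2. \<exists>h :: real \<Rightarrow> real.
        orthogonal_transformation R \<and> smooth_fun_on UNIV h \<and>
        (\<forall>x \<in> ball p r. x \<in> \<Omega> \<longleftrightarrow> h (R x $ 1) < R x $ 2))"

definition smooth_bounded_domain :: "(real^2) set \<Rightarrow> bool" where
  "smooth_bounded_domain \<Omega> \<longleftrightarrow>
     open \<Omega> \<and> connected \<Omega> \<and> \<Omega> \<noteq> {} \<and> bounded \<Omega> \<and> smooth_boundary \<Omega>"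


section \<open>Lebesgue and Sobolev spaces\<close>

definition in_L2 :: "'a::euclidean_space set \<Rightarrow> ('a \<Rightarrow> 'b::euclidean_space) \<Rightarrow> bool" where
  "in_L2 S g \<longleftrightarrow> g \<in> borel_measurable (lebesgue_on S) \<and>
     integrable (lebesgue_on S) (\<lambda>x. (norm (g x))\<^sup>2)"

definition L2norm :: "'a::euclidean_space set \<Rightarrow> ('a \<Rightarrow> 'b::euclidean_space) \<Rightarrow> real" where
  "L2norm S g = sqrt (\<integral>x. (norm (g x))\<^sup>2 \<partial>lebesgue_on S)"

definition in_Linf :: "'a::euclidean_space set \<Rightarrow> ('a \<Rightarrow> 'b::euclidean_space) \<Rightarrow> bool" where
  "in_Linf S g \<longleftrightarrow> g \<in> borel_measurable (lebesgue_on S) \<and>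
     (\<exists>C. AE x in lebesgue_on S. norm (g x) \<le> C)"

definition in_L1loc :: "'a::euclidean_space set \<Rightarrow> ('a \<Rightarrow> 'b::euclidean_space) \<Rightarrow> bool" where
  "in_L1loc S g \<longleftrightarrow> (\<forall>K. compact K \<and> K \<subseteq> S \<longrightarrow> integrable (lebesgue_on K) g)"

definition has_weak_pderiv ::
    "'a::euclidean_space set \<Rightarrow> 'a \<Rightarrow> ('a \<Rightarrow> 'b::euclidean_space) \<Rightarrow> ('a \<Rightarrow> 'b) \<Rightarrow> bool" where
  "has_weak_pderiv S i g v \<longleftrightarrow> in_L1loc S g \<and> in_L1loc S v \<and>
     (\<forall>\<phi> :: 'a \<Rightarrow> real. test_fun S \<phi> \<longrightarrow>
        (\<integral>x. pderiv_dir i \<phi> x *\<^sub>R g x \<partial>lebesgue_on S) = - (\<integral>x. \<phi> x *\<^sub>R v x \<partial>lebesgue_on S))"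

text \<open>A representative of the weak derivative. It is determined only up to null sets, so it may
  be used only in statements that are insensitive to null sets (norms, equations a.e.).\<close>

definition weak_pderiv ::
    "'a::euclidean_space set \<Rightarrow> 'a \<Rightarrow> ('a \<Rightarrow> 'b::euclidean_space) \<Rightarrow> 'a \<Rightarrow> 'b" where
  "weak_pderiv S i g = (SOME v. has_weak_pderiv S i g v)"

text \<open>\<open>in_sobolev X S k g\<close>: all weak derivatives of \<open>g\<close> up to order \<open>k\<close> exist and satisfy \<open>X S\<close>,
  so \<open>X = in_L2\<close> gives $H^k$ and \<open>X = in_Linf\<close> gives $W^{k,\infty}$.\<close>

primrec in_sobolev ::
    "('a::euclidean_space set \<Rightarrow> ('a \<Rightarrow> 'b::euclidean_space) \<Rightarrow> bool) \<Rightarrow> 'a set \<Rightarrow> nat \<Rightarrow>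
     ('a \<Rightarrow> 'b) \<Rightarrow> bool" where
  "in_sobolev X S 0 g \<longleftrightarrow> X S g"
| "in_sobolev X S (Suc k) g \<longleftrightarrow> X S g \<and>
     (\<forall>i\<in>Basis. \<exists>v. has_weak_pderiv S i g v \<and> in_sobolev X S k v)"

abbreviation in_H :: "nat \<Rightarrow> 'a::euclidean_space set \<Rightarrow> ('a \<Rightarrow> 'b::euclidean_space) \<Rightarrow> bool" where
  "in_H k S \<equiv> in_sobolev in_L2 S k"

abbreviation in_Winf :: "nat \<Rightarrow> 'a::euclidean_space set \<Rightarrow> ('a \<Rightarrow> 'b::euclidean_space) \<Rightarrow> bool" where
  "in_Winf k S \<equiv> in_sobolev in_Linf S k"

text \<open>Mixed derivatives are counted once for each order of differentiation; this is one of the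
  usual equivalent norms of $H^k$.\<close>

primrec Hnorm_sq :: "nat \<Rightarrow> 'a::euclidean_space set \<Rightarrow> ('a \<Rightarrow> 'b::euclidean_space) \<Rightarrow> real" where
  "Hnorm_sq 0 S g = (L2norm S g)\<^sup>2"
| "Hnorm_sq (Suc k) S g = (L2norm S g)\<^sup>2 + (\<Sum>i\<in>Basis. Hnorm_sq k S (weak_pderiv S i g))"

definition Hnorm :: "nat \<Rightarrow> 'a::euclidean_space set \<Rightarrow> ('a \<Rightarrow> 'b::euclidean_space) \<Rightarrow> real" where
  "Hnorm k S g = sqrt (Hnorm_sq k S g)"

text \<open>The closure of the test functions in $H^1$; \<open>in_H10 \<Omega> g\<close> expresses \<open>g = 0\<close> on the boundary
  of \<open>\<Omega>\<close> for Sobolev functions \<open>g\<close>.\<close>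

definition in_H10 :: "'a::euclidean_space set \<Rightarrow> ('a \<Rightarrow> 'b::euclidean_space) \<Rightarrow> bool" where
  "in_H10 S g \<longleftrightarrow> in_H 1 S g \<and>
     (\<exists>\<phi> :: nat \<Rightarrow> 'a \<Rightarrow> 'b. (\<forall>n. test_fun S (\<phi> n)) \<and>
        (\<lambda>n. Hnorm 1 S (\<lambda>x. g x - \<phi> n x)) \<longlonglongrightarrow> 0)"

definition weak_grad :: "'a::euclidean_space set \<Rightarrow> ('a \<Rightarrow> real) \<Rightarrow> 'a \<Rightarrow> 'a" where
  "weak_grad S g x = (\<Sum>i\<in>Basis. weak_pderiv S i g x *\<^sub>R i)"

definition weak_div :: "'a::euclidean_space set \<Rightarrow> ('a \<Rightarrow> 'a) \<Rightarrow> 'a \<Rightarrow> real" where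
  "weak_div S w x = (\<Sum>i\<in>Basis. weak_pderiv S i w x \<bullet> i)"

definition weak_laplacian ::
    "'a::euclidean_space set \<Rightarrow> ('a \<Rightarrow> 'b::euclidean_space) \<Rightarrow> 'a \<Rightarrow> 'b" where
  "weak_laplacian S g x = (\<Sum>i\<in>Basis. weak_pderiv S i (weak_pderiv S i g) x)"

text \<open>The convective term $(w\cdot\nabla) g$.\<close>

definition weak_advect ::
    "'a::euclidean_space set \<Rightarrow> ('a \<Rightarrow> 'a) \<Rightarrow> ('a \<Rightarrow> 'b::euclidean_space) \<Rightarrow> 'a \<Rightarrow> 'b" where
  "weak_advect S w g x = (\<Sum>i\<in>Basis. (w x \<bullet> i) *\<^sub>R weak_pderiv S i g x)"

definition in_L2_weak_grad :: "'a::euclidean_space set \<Rightarrow> ('a \<Rightarrow> real) \<Rightarrow> bool" where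
  "in_L2_weak_grad S g \<longleftrightarrow> (\<forall>i\<in>Basis. \<exists>v. has_weak_pderiv S i g v \<and> in_L2 S v)"


section \<open>Time-dependent functions\<close>

text \<open>$L^\infty(0,T;X)$ and $L^2(0,T;X)$ for the space \<open>X\<close> of functions on \<open>S\<close> with norm \<open>N\<close>.
  Elements are represented by functions that are jointly Lebesgue measurable in \<open>(t, x)\<close>, which for
  the (separable) Hilbert spaces used here amounts to strong measurability in \<open>t\<close>.\<close>

definition jointly_measurable ::
    "real set \<Rightarrow> 'a::euclidean_space set \<Rightarrow> (real \<Rightarrow> 'a \<Rightarrow> 'b::euclidean_space) \<Rightarrow> bool" where
  "jointly_measurable I S w \<longleftrightarrow> (\<lambda>(t, x). w t x) \<in> borel_measurable (lebesgue_on (I \<times> S))"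

definition in_Linf_time ::
    "real \<Rightarrow> 'a::euclidean_space set \<Rightarrow> (('a \<Rightarrow> 'b::euclidean_space) \<Rightarrow> bool) \<Rightarrow>
     (('a \<Rightarrow> 'b) \<Rightarrow> real) \<Rightarrow> (real \<Rightarrow> 'a \<Rightarrow> 'b) \<Rightarrow> bool" where
  "in_Linf_time T S X N w \<longleftrightarrow> jointly_measurable {0<..<T} S w \<and>
     (\<exists>C. AE t in lebesgue_on {0<..<T}. X (w t) \<and> N (w t) \<le> C)"

definition in_L2_time ::
    "real \<Rightarrow> 'a::euclidean_space set \<Rightarrow> (('a \<Rightarrow> 'b::euclidean_space) \<Rightarrow> bool) \<Rightarrow>
     (('a \<Rightarrow> 'b) \<Rightarrow> real) \<Rightarrow> (real \<Rightarrow> 'a \<Rightarrow> 'b) \<Rightarrow> bool" where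
  "in_L2_time T S X N w \<longleftrightarrow> jointly_measurable {0<..<T} S w \<and>
     (AE t in lebesgue_on {0<..<T}. X (w t)) \<and>
     integrable (lebesgue_on {0<..<T}) (\<lambda>t. (N (w t))\<^sup>2)"

definition L2_continuous :: "'a::euclidean_space set \<Rightarrow> (real \<Rightarrow> 'a \<Rightarrow> 'b::euclidean_space) \<Rightarrow> bool" where
  "L2_continuous S w \<longleftrightarrow> (\<forall>t\<ge>0. in_L2 S (w t)) \<and>
     (\<forall>t\<ge>0. ((\<lambda>s. L2norm S (\<lambda>x. w s x - w t x)) \<longlongrightarrow> 0) (at t within {0..}))"

definition L2_weakly_continuous :: "'a::euclidean_space set \<Rightarrow> (real \<Rightarrow> 'a \<Rightarrow> real) \<Rightarrow> bool" where
  "L2_weakly_continuous S w \<longleftrightarrow> (\<forall>t\<ge>0. in_L2 S (w t)) \<and>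
     (\<forall>g. in_L2 S g \<longrightarrow> continuous_on {0..} (\<lambda>t. \<integral>x. w t x * g x \<partial>lebesgue_on S))"


section \<open>The perturbation system\<close>

text \<open>\<open>(0, \<rho>\<^sub>s, p\<^sub>s)\<close> is a smooth hydrostatic equilibrium.\<close>

definition steady_state ::
    "(real^2) set \<Rightarrow> (real^2 \<Rightarrow> real) \<Rightarrow> (real^2 \<Rightarrow> real) \<Rightarrow> (real^2 \<Rightarrow> real) \<Rightarrow> bool" where
  "steady_state \<Omega> f \<rho>\<^sub>s p\<^sub>s \<longleftrightarrow> smooth_fun_on \<Omega> \<rho>\<^sub>s \<and> smooth_fun_on \<Omega> p\<^sub>s \<and>
     (\<forall>x\<in>\<Omega>. grad p\<^sub>s x = - (\<rho>\<^sub>s x *\<^sub>R grad f x))"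

definition momentum_equation ::
    "(real^2) set \<Rightarrow> real \<Rightarrow> (real^2 \<Rightarrow> real) \<Rightarrow> (real^2 \<Rightarrow> real) \<Rightarrow>
     (real \<Rightarrow> real^2 \<Rightarrow> real^2) \<Rightarrow> (real \<Rightarrow> real^2 \<Rightarrow> real^2) \<Rightarrow> (real \<Rightarrow> real^2 \<Rightarrow> real) \<Rightarrow>
     (real \<Rightarrow> real^2 \<Rightarrow> real) \<Rightarrow> bool" where
  "momentum_equation \<Omega> \<nu> f \<rho>\<^sub>s u u\<^sub>t \<rho> P \<longleftrightarrow>
     (AE t in lebesgue_on {0<..}. AE x in lebesgue_on \<Omega>.
        (\<rho> t x + \<rho>\<^sub>s x) *\<^sub>R u\<^sub>t t x + (\<rho> t x + \<rho>\<^sub>s x) *\<^sub>R weak_advect \<Omega> (u t) (u t) x =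
        \<nu> *\<^sub>R weak_laplacian \<Omega> (u t) x - weak_grad \<Omega> (P t) x - \<rho> t x *\<^sub>R grad f x)"

text \<open>$\partial_t\rho + (u\cdot\nabla)\rho + (u\cdot\nabla)\rho_s = 0$ as distributions on
  $(0,\infty)\times\Omega$, where $(u\cdot\nabla)\rho = \nabla\cdot(\rho u)$ because
  $\nabla\cdot u = 0$. The derivative of \<open>\<phi>\<close> in the direction \<open>(1, u t x)\<close> is
  $\partial_t\phi + u\cdot\nabla\phi$.\<close>

definition transport_equation ::
    "(real^2) set \<Rightarrow> (real^2 \<Rightarrow> real) \<Rightarrow> (real \<Rightarrow> real^2 \<Rightarrow> real^2) \<Rightarrow>
     (real \<Rightarrow> real^2 \<Rightarrow> real) \<Rightarrow> bool" where
  "transport_equation \<Omega> \<rho>\<^sub>s u \<rho> \<longleftrightarrow>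
     (\<forall>\<phi> :: real \<times> (real^2) \<Rightarrow> real. test_fun ({0<..} \<times> \<Omega>) \<phi> \<longrightarrow>
        (\<integral>(t, x). \<rho> t x * frechet_derivative \<phi> (at (t, x)) (1, u t x)
                  - (u t x \<bullet> grad \<rho>\<^sub>s x) * \<phi> (t, x) \<partial>lebesgue_on ({0<..} \<times> \<Omega>)) = 0)"

text \<open>Here \<open>\<rho>\<close> is the density perturbation (the total density is \<open>\<rho> + \<rho>\<^sub>s\<close>) and \<open>u\<^sub>t\<close> the weak time
  derivative of \<open>u\<close> on $(0,\infty)\times\Omega$. Since values at individual times occur (initial
  data, limits as $t\to\infty$), \<open>u\<close> and \<open>\<rho>\<close> are taken to be the representatives that are
  (respectively weakly) continuous in time with values in $L^2$.\<close>

definition strong_solution ::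
    "(real^2) set \<Rightarrow> real \<Rightarrow> (real^2 \<Rightarrow> real) \<Rightarrow> (real^2 \<Rightarrow> real) \<Rightarrow>
     (real^2 \<Rightarrow> real^2) \<Rightarrow> (real^2 \<Rightarrow> real) \<Rightarrow>
     (real \<Rightarrow> real^2 \<Rightarrow> real^2) \<Rightarrow> (real \<Rightarrow> real^2 \<Rightarrow> real) \<Rightarrow> (real \<Rightarrow> real^2 \<Rightarrow> real) \<Rightarrow> bool" where
  "strong_solution \<Omega> \<nu> f \<rho>\<^sub>s u\<^sub>0 \<rho>\<^sub>0 u \<rho> P \<longleftrightarrow>
     (\<exists>u\<^sub>t. has_weak_pderiv ({0<..} \<times> \<Omega>) (1, 0) (\<lambda>(t, x). u t x) (\<lambda>(t, x). u\<^sub>t t x) \<and>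
        (\<forall>T>0.
           in_Linf_time T \<Omega> (in_H 2 \<Omega>) (Hnorm 2 \<Omega>) u \<and>
           in_L2_time T \<Omega> (in_H 1 \<Omega>) (Hnorm 1 \<Omega>) u\<^sub>t \<and>
           in_Linf_time T \<Omega> (in_L2 \<Omega>) (L2norm \<Omega>) (\<lambda>t x. sqrt (\<rho> t x + \<rho>\<^sub>s x) *\<^sub>R u\<^sub>t t x) \<and>
           in_Linf_time T \<Omega> (in_L2_weak_grad \<Omega>) (\<lambda>g. L2norm \<Omega> (weak_grad \<Omega> g)) P \<and>
           in_Linf ({0<..<T} \<times> \<Omega>) (\<lambda>(t, x). \<rho> t x)) \<and>
        momentum_equation \<Omega> \<nu> f \<rho>\<^sub>s u u\<^sub>t \<rho> P) \<and>
     transport_equation \<Omega> \<rho>\<^sub>s u \<rho> \<and>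
     (AE t in lebesgue_on {0<..}. AE x in lebesgue_on \<Omega>. weak_div \<Omega> (u t) x = 0) \<and>
     (AE t in lebesgue_on {0<..}. in_H10 \<Omega> (u t)) \<and>
     L2_continuous \<Omega> u \<and> (AE x in lebesgue_on \<Omega>. u 0 x = u\<^sub>0 x) \<and>
     L2_weakly_continuous \<Omega> \<rho> \<and> (AE x in lebesgue_on \<Omega>. \<rho> 0 x = \<rho>\<^sub>0 x)"

end

theory Submission
  imports Defs
begin

text \<open>
  The total density \<open>r = \<varrho> + \<rho>\<^sub>s\<close> is transported by the divergence-free field \<open>u\<close>, which vanishes on the
  boundary, so both \<open>\<integral>r\<close> and \<open>\<integral>r\<^sup>2\<close> are independent of time. Expanding the square,
  \<open>\<parallel>r + \<gamma>f - \<beta>\<parallel>\<^sup>2\<close> therefore changes between times \<open>0\<close> and \<open>t\<close> by exactly \<open>-2\<gamma>\<integral>(\<varrho>\<^sub>0 - \<varrho>(t))f\<close>, and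
  both equivalences are algebra.

  Conservation of \<open>\<integral>r\<^sup>2\<close> for a merely bounded \<open>r\<close> is the renormalisation property of DiPerna and Lions.
  Testing the equation with the mollification of \<open>r\<close> produces a double integral of \<open>r(x) r(y)\<close> against
  \<open>(u(x) - u(y)) \<bullet> \<nabla>\<eta>\<^sub>\<epsilon>(x - y)\<close>. Because \<open>div u = 0\<close>, the product may be replaced by \<open>-(r(x) - r(y))\<^sup>2 / 2\<close>;
  the kernel is bounded in \<open>L\<^sup>1\<close> by \<open>\<parallel>\<nabla>u\<parallel>\<close>, and the integral vanishes with \<open>\<epsilon>\<close> since translation is continuous.
  At the boundary \<open>u\<close> is extended by zero, which is legitimate because \<open>u\<close> lies in \<open>H\<^sup>1\<^sub>0\<close>.
\<close>

section \<open>Calculus of smooth functions\<close>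

text \<open>Three obstacles shape the argument. The density is only weakly continuous in time, so
  mollifying in space does not yet allow its square to be differentiated in time; the energy is
  therefore treated as a form in two separate time variables. The equation is given against test
  functions with compact support in the domain, while the commutator argument needs mollifiers
  centred everywhere, also across the boundary; these are reached as limits of test functions cut
  off near the boundary. Finally, for a merely bounded density only L^1 continuity of translations
  is at hand. It suffices: with |r| \<le> C the L^2 norm of (r(x) - r(x - z))^2 is at most the
  square root of 8 C^3 d, where d bounds the L^1 norm of r(x) - r(x - z). The velocity difference
  supplies the factor |z| that compensates the 1/\<epsilon> in the gradient of the kernel, so no
  rate of convergence is required of the density. Fubini's theorem is applied to Borel versions of
  all fields, set to zero outside the domain and at a null set of bad times.\<close>

lemma pderiv_dir_eq: "(g has_derivative g') (at x) \<Longrightarrow> pderiv_dir i g x = g' i"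
  unfolding pderiv_dir_def by (metis frechet_derivative_at)

text \<open>A derivative at a point depends only on the germ there, and openness of \<open>S\<close>
  turns agreement on \<open>S\<close> into agreement of germs. The closure lemmas below use this to
  replace \<open>pderiv_dir i\<close> of a compound function by its formula, which is known on
  \<open>S\<close> only.\<close>

lemma Ck_on_cong:
  assumes "open S" "\<And>x. x \<in> S \<Longrightarrow> f x = g x" "Ck_on k S f"
  shows "Ck_on k S g"
  using assms(2,3)
proof (induction k arbitrary: f g)
  case 0
  then show ?case by (simp add: continuous_on_eq)
next
  case (Suc k)
  have diff: "(g has_derivative frechet_derivative f (at x)) (at x)" if "x \<in> S" for x
  proof -
    have "(f has_derivative frechet_derivative f (at x)) (at x)"
      using Suc.prems(2) that frechet_derivative_works by auto
    then show ?thesis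
      using has_derivative_transform_within_open[OF _ assms(1) that] Suc.prems(1) by blast
  qed
  have "Ck_on k S (pderiv_dir i g)" if "i \<in> Basis" for i
    by (rule Suc.IH[of "pderiv_dir i f"])
      (use Suc.prems(2) that in \<open>auto simp: pderiv_dir_eq[OF diff], simp add: pderiv_dir_def\<close>)
  then show ?case using diff by (auto simp: differentiable_def)
qed

lemma Ck_on_Suc_imp: "Ck_on (Suc k) S f \<Longrightarrow> Ck_on k S f"
proof (induction k arbitrary: f)
  case 0
  then show ?case
    by (auto intro!: continuous_at_imp_continuous_on differentiable_imp_continuous_within)
next
  case (Suc k)
  then have "\<forall>x\<in>S. f differentiable (at x)" and "\<And>i. i \<in> Basis \<Longrightarrow> Ck_on (Suc k) S (pderiv_dir i f)"
    unfolding Ck_on.simps(2)[of "Suc k"] by blast+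
  then show ?case using Suc.IH unfolding Ck_on.simps(2)[of k S f] by blast
qed

lemma Ck_on_subset: "Ck_on k S f \<Longrightarrow> T \<subseteq> S \<Longrightarrow> Ck_on k T f"
  by (induction k arbitrary: f) (auto intro: continuous_on_subset)

text \<open>Differentiability refers to full neighbourhoods, so only continuity at order 0 has to be
  glued. Applied to the complement of a closed set, it extends functions by zero.\<close>

lemma Ck_on_Un:
  "open S \<Longrightarrow> open T \<Longrightarrow> Ck_on k S f \<Longrightarrow> Ck_on k T f \<Longrightarrow> Ck_on k (S \<union> T) f"
  by (induction k arbitrary: f) (auto intro: continuous_on_open_Un)

lemma Ck_on_const: "Ck_on k S (\<lambda>x. c)"
proof (induction k arbitrary: c)
  case (Suc k)
  have "pderiv_dir i (\<lambda>x. c) = (\<lambda>x. 0)" for i :: 'a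
    by (rule ext) (simp add: pderiv_dir_eq[OF has_derivative_const])
  then show ?case using Suc by simp
qed auto

lemma Ck_on_linear:
  assumes "bounded_linear L"
  shows "Ck_on k S L"
proof (cases k)
  case 0
  then show ?thesis using assms by (simp add: linear_continuous_on)
next
  case (Suc n)
  have "pderiv_dir i L = (\<lambda>x. L i)" for i
    by (rule ext) (simp add: pderiv_dir_eq[OF bounded_linear_imp_has_derivative[OF assms]])
  then show ?thesis
    using Suc assms by (simp add: Ck_on_const bounded_linear_imp_differentiable)
qed

lemma Ck_on_add:
  assumes "open S"
  shows "Ck_on k S f \<Longrightarrow> Ck_on k S g \<Longrightarrow> Ck_on k S (\<lambda>x. f x + g x)"
proof (induction k arbitrary: f g)
  case 0
  then show ?case by (auto intro: continuous_on_add)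
next
  case (Suc k)
  have "Ck_on k S (pderiv_dir i (\<lambda>x. f x + g x))" if i: "i \<in> Basis" for i
  proof (rule Ck_on_cong[OF assms])
    show "Ck_on k S (\<lambda>x. pderiv_dir i f x + pderiv_dir i g x)"
      using Suc i by auto
    show "pderiv_dir i f x + pderiv_dir i g x = pderiv_dir i (\<lambda>x. f x + g x) x" if "x \<in> S" for x
      using Suc.prems that unfolding pderiv_dir_def
      by (subst frechet_derivative_at[OF has_derivative_add, symmetric])
        (auto simp: frechet_derivative_works)
  qed
  then show ?case using Suc.prems by (auto intro: differentiable_add)
qed

lemma Ck_on_scaleR:
  fixes f :: "'a::euclidean_space \<Rightarrow> real"
  assumes "open S"
  shows "Ck_on k S f \<Longrightarrow> Ck_on k S g \<Longrightarrow> Ck_on k S (\<lambda>x. f x *\<^sub>R g x)"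
proof (induction k arbitrary: f g)
  case 0
  then show ?case by (auto intro: continuous_on_scaleR)
next
  case (Suc k)
  have d: "((\<lambda>x. f x *\<^sub>R g x) has_derivative
     (\<lambda>h. f x *\<^sub>R frechet_derivative g (at x) h + frechet_derivative f (at x) h *\<^sub>R g x)) (at x)"
    if "x \<in> S" for x
    using Suc.prems that by (intro has_derivative_scaleR) (auto simp: frechet_derivative_works)
  have "Ck_on k S (pderiv_dir i (\<lambda>x. f x *\<^sub>R g x))" if i: "i \<in> Basis" for i
  proof (rule Ck_on_cong[OF assms])
    show "Ck_on k S (\<lambda>x. f x *\<^sub>R pderiv_dir i g x + pderiv_dir i f x *\<^sub>R g x)"
      by (intro Ck_on_add[OF assms] Suc.IH Ck_on_Suc_imp[OF Suc.prems(1)] Ck_on_Suc_imp[OF Suc.prems(2)])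
        (use Suc.prems i in auto)
    show "f x *\<^sub>R pderiv_dir i g x + pderiv_dir i f x *\<^sub>R g x = pderiv_dir i (\<lambda>x. f x *\<^sub>R g x) x"
      if "x \<in> S" for x
      using pderiv_dir_eq[OF d[OF that]] by (simp add: pderiv_dir_def)
  qed
  then show ?case using d by (auto simp: differentiable_def)
qed

lemma Ck_on_mult:
  fixes f g :: "'a::euclidean_space \<Rightarrow> real"
  assumes "open S" "Ck_on k S f" "Ck_on k S g"
  shows "Ck_on k S (\<lambda>x. f x * g x)"
  using Ck_on_scaleR[OF assms] by simp

lemma Ck_on_diff:
  fixes f g :: "'a::euclidean_space \<Rightarrow> 'b::real_normed_vector"
  assumes "open S" "Ck_on k S f" "Ck_on k S g"
  shows "Ck_on k S (\<lambda>x. f x - g x)"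
  using Ck_on_add[OF assms(1,2) Ck_on_scaleR[OF assms(1) Ck_on_const[of _ _ "-1"] assms(3)]] by simp

lemma Ck_on_sum:
  assumes "open S" "\<And>i. i \<in> I \<Longrightarrow> Ck_on k S (f i)"
  shows "Ck_on k S (\<lambda>x. \<Sum>i\<in>I. f i x)"
  using assms(2) by (induction I rule: infinite_finite_induct) (auto simp: Ck_on_const intro: Ck_on_add[OF assms(1)])

text \<open>The induction generalises the outer function, because the derivative is the product of a
  derivative of \<open>f\<close> with \<open>pderiv_dir 1 h\<close> composed with the same
  \<open>f\<close>.\<close>

lemma Ck_on_compose_real:
  fixes f :: "'a::euclidean_space \<Rightarrow> real" and h :: "real \<Rightarrow> real"
  assumes "open S"
  shows "Ck_on k UNIV h \<Longrightarrow> Ck_on k S f \<Longrightarrow> Ck_on k S (\<lambda>x. h (f x))"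
proof (induction k arbitrary: h)
  case 0
  then show ?case by (auto intro: continuous_on_compose2)
next
  case (Suc k)
  have d: "((\<lambda>x. h (f x)) has_derivative (\<lambda>v. frechet_derivative f (at x) v * pderiv_dir 1 h (f x))) (at x)"
    if "x \<in> S" for x
  proof -
    have h: "(h has_derivative frechet_derivative h (at (f x))) (at (f x))"
      using Suc.prems by (auto simp: frechet_derivative_works)
    have "frechet_derivative h (at (f x)) c = c * pderiv_dir 1 h (f x)" for c
      using linear_cmul[OF has_derivative_linear[OF h], of c 1] by (simp add: pderiv_dir_def)
    then show ?thesis
      using has_derivative_compose[of f "frechet_derivative f (at x)" x UNIV, OF _ h] Suc.prems that
      by (simp add: frechet_derivative_works)
  qed
  have "Ck_on k S (pderiv_dir i (\<lambda>x. h (f x)))" if i: "i \<in> Basis" for i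
  proof (rule Ck_on_cong[OF assms])
    have "Ck_on k S (\<lambda>x. pderiv_dir 1 h (f x))"
      by (rule Suc.IH) (use Suc.prems(1) Ck_on_Suc_imp[OF Suc.prems(2)] in auto)
    then show "Ck_on k S (\<lambda>x. pderiv_dir i f x * pderiv_dir 1 h (f x))"
      using Suc.prems i by (intro Ck_on_mult[OF assms]) auto
    show "pderiv_dir i f x * pderiv_dir 1 h (f x) = pderiv_dir i (\<lambda>x. h (f x)) x" if "x \<in> S" for x
      using pderiv_dir_eq[OF d[OF that]] by (simp add: pderiv_dir_def)
  qed
  then show ?case using d by (auto simp: differentiable_def)
qed

text \<open>The derivative of 1/f is built from 1/f itself and a derivative of \<open>f\<close>, so
  the induction hypothesis is used for the same function.\<close>

lemma Ck_on_inverse: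
  fixes f :: "'a::euclidean_space \<Rightarrow> real"
  assumes "open S" and nz: "\<And>x. x \<in> S \<Longrightarrow> f x \<noteq> 0"
  shows "Ck_on k S f \<Longrightarrow> Ck_on k S (\<lambda>x. inverse (f x))"
proof (induction k)
  case 0
  then show ?case using nz by (auto intro: continuous_on_inverse)
next
  case (Suc k)
  have d: "((\<lambda>x. inverse (f x)) has_derivative
      (\<lambda>v. - (inverse (f x) * frechet_derivative f (at x) v * inverse (f x)))) (at x)" if "x \<in> S" for x
    using Suc.prems that nz by (intro Deriv.has_derivative_inverse) (auto simp: frechet_derivative_works)
  have IH: "Ck_on k S (\<lambda>x. inverse (f x))"
    using Suc.IH Ck_on_Suc_imp[OF Suc.prems] by blast
  have "Ck_on k S (pderiv_dir i (\<lambda>x. inverse (f x)))" if i: "i \<in> Basis" for i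
  proof (rule Ck_on_cong[OF assms(1)])
    show "Ck_on k S (\<lambda>x. (-1) * (inverse (f x) * pderiv_dir i f x * inverse (f x)))"
      by (intro Ck_on_mult[OF assms(1)] IH Ck_on_const) (use Suc.prems i in auto)
    show "(-1) * (inverse (f x) * pderiv_dir i f x * inverse (f x)) = pderiv_dir i (\<lambda>x. inverse (f x)) x"
      if "x \<in> S" for x
      using pderiv_dir_eq[OF d[OF that]] by (simp add: pderiv_dir_def)
  qed
  then show ?case using d by (auto simp: differentiable_def)
qed

text \<open>The inner derivative is constant, so the chain rule gives a combination, with
  coefficients \<open>L i \<bullet> j\<close>, of derivatives of \<open>f\<close> composed with the
  same affine map. This serves translations, reflections and the projection
  \<open>snd\<close>.\<close>

lemma Ck_on_compose_affine:
  fixes L :: "'a::euclidean_space \<Rightarrow> 'c::euclidean_space"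
  assumes L: "bounded_linear L"
  shows "Ck_on k UNIV f \<Longrightarrow> Ck_on k UNIV (\<lambda>x. f (L x + c))"
proof (induction k arbitrary: f)
  case 0
  have "continuous_on UNIV (\<lambda>x. L x + c)"
    using L by (intro continuous_intros linear_continuous_on)
  then show ?case using 0 by (auto intro: continuous_on_compose2[of UNIV f])
next
  case (Suc k)
  have f: "(f has_derivative frechet_derivative f (at y)) (at y)" for y
    using Suc.prems by (auto simp: frechet_derivative_works)
  have d: "((\<lambda>x. f (L x + c)) has_derivative (\<lambda>v. frechet_derivative f (at (L x + c)) (L v))) (at x)" for x
    by (rule has_derivative_compose[OF _ f, of "\<lambda>x. L x + c" L])
      (auto intro!: derivative_eq_intros bounded_linear_imp_has_derivative[OF L])
  have e: "frechet_derivative f (at y) w = (\<Sum>j\<in>Basis. (w \<bullet> j) *\<^sub>R pderiv_dir j f y)" for y w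
  proof -
    have lin: "linear (frechet_derivative f (at y))"
      using f has_derivative_linear by blast
    have "frechet_derivative f (at y) (\<Sum>j\<in>Basis. (w \<bullet> j) *\<^sub>R j) = (\<Sum>j\<in>Basis. (w \<bullet> j) *\<^sub>R frechet_derivative f (at y) j)"
      by (simp add: linear_sum[OF lin] linear_cmul[OF lin])
    then show ?thesis by (simp add: euclidean_representation pderiv_dir_def)
  qed
  have "Ck_on k UNIV (pderiv_dir i (\<lambda>x. f (L x + c)))" if i: "i \<in> Basis" for i
  proof -
    have "pderiv_dir i (\<lambda>x. f (L x + c)) = (\<lambda>x. \<Sum>j\<in>Basis. (L i \<bullet> j) *\<^sub>R pderiv_dir j f (L x + c))"
      using pderiv_dir_eq[OF d] e by auto
    then show ?thesis
      by (simp only:) (intro Ck_on_sum Ck_on_scaleR Ck_on_const open_UNIV Suc.IH; use Suc.prems in simp)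
  qed
  then show ?case using d by (auto simp: differentiable_def)
qed

section \<open>Gradients and test functions\<close>

lemma smooth_fun_on_diff:
  assumes "smooth_fun_on S g" "x \<in> S"
  shows "g differentiable (at x)"
  using assms(1)[unfolded smooth_fun_on_def, rule_format, of 1] assms(2) by simp

lemma smooth_fun_on_pderiv:
  assumes "smooth_fun_on S g" "i \<in> Basis"
  shows "smooth_fun_on S (pderiv_dir i g)"
  unfolding smooth_fun_on_def
proof
  fix k show "Ck_on k S (pderiv_dir i g)"
    using assms(1)[unfolded smooth_fun_on_def, rule_format, of "Suc k"] assms(2) by simp
qed

lemma smooth_fun_on_continuous: "smooth_fun_on S g \<Longrightarrow> continuous_on S g"
  unfolding smooth_fun_on_def by (drule spec[of _ 0]) simp

lemma frechet_derivative_Basis_sum: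
  fixes g :: "'a::euclidean_space \<Rightarrow> 'b::real_normed_vector"
  assumes "g differentiable (at x)"
  shows "frechet_derivative g (at x) v = (\<Sum>i\<in>Basis. (v \<bullet> i) *\<^sub>R pderiv_dir i g x)"
proof -
  have lin: "linear (frechet_derivative g (at x))"
    using assms linear_frechet_derivative by blast
  have "frechet_derivative g (at x) (\<Sum>i\<in>Basis. (v \<bullet> i) *\<^sub>R i) = (\<Sum>i\<in>Basis. (v \<bullet> i) *\<^sub>R frechet_derivative g (at x) i)"
    by (simp add: linear_sum[OF lin] linear_cmul[OF lin])
  then show ?thesis by (simp add: euclidean_representation pderiv_dir_def)
qed

lemma frechet_derivative_eq_grad:
  assumes "g differentiable (at x)"
  shows "frechet_derivative g (at x) v = v \<bullet> grad g x"
  by (simp add: frechet_derivative_Basis_sum[OF assms] grad_def inner_sum_right mult.commute)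

lemma grad_eqI:
  assumes "(g has_derivative (\<lambda>v. v \<bullet> w)) (at x)"
  shows "grad g x = w"
  unfolding grad_def pderiv_dir_eq[OF assms] by (subst inner_commute) (rule euclidean_representation)

lemma has_derivative_grad:
  assumes "g differentiable (at x)"
  shows "(g has_derivative (\<lambda>v. v \<bullet> grad g x)) (at x)"
proof -
  have "frechet_derivative g (at x) = (\<lambda>v. v \<bullet> grad g x)"
    by (rule ext) (rule frechet_derivative_eq_grad[OF assms])
  then show ?thesis using assms[unfolded frechet_derivative_works] by simp
qed

lemma continuous_on_grad:
  assumes "smooth_fun_on S g"
  shows "continuous_on S (grad g)"
  unfolding grad_def
  by (intro continuous_intros smooth_fun_on_continuous smooth_fun_on_pderiv assms)

lemma grad_mult:
  assumes "g differentiable (at x)" "h differentiable (at x)"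
  shows "grad (\<lambda>x. g x * h x) x = g x *\<^sub>R grad h x + h x *\<^sub>R grad g x"
proof (rule grad_eqI)
  show "((\<lambda>x. g x * h x) has_derivative (\<lambda>v. v \<bullet> (g x *\<^sub>R grad h x + h x *\<^sub>R grad g x))) (at x)"
    by (rule has_derivative_eq_rhs[OF has_derivative_mult[OF has_derivative_grad[OF assms(1)] has_derivative_grad[OF assms(2)]]])
      (simp add: inner_add_right mult.commute)
qed

text \<open>\<open>S\<close> and the complement of \<open>K\<close> cover the space, and on the
  latter \<open>g\<close> is zero. In this way the product of a test function with the steady
  density, which is smooth only inside the domain, becomes a test function.\<close>

lemma smooth_fun_on_cutoff:
  fixes g :: "'a::euclidean_space \<Rightarrow> real"
  assumes "open S" "smooth_fun_on S g" "closed K" "K \<subseteq> S" "\<And>x. x \<notin> K \<Longrightarrow> g x = 0"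
  shows "smooth_fun_on UNIV g"
  unfolding smooth_fun_on_def
proof
  fix k
  have "Ck_on k (S \<union> - K) g"
  proof (rule Ck_on_Un)
    show "Ck_on k (- K) g"
      by (rule Ck_on_cong[OF _ _ Ck_on_const[of k "-K" 0]]) (use assms in auto)
  qed (use assms in \<open>auto simp: smooth_fun_on_def\<close>)
  moreover have "S \<union> - K = UNIV" using assms by auto
  ultimately show "Ck_on k UNIV g" by simp
qed

text \<open>Any compact set outside which \<phi> vanishes will do: being closed it contains the
  support, so supports never have to be computed.\<close>

lemma test_funI:
  assumes "smooth_fun_on UNIV \<phi>" "compact K" "K \<subseteq> S" "\<And>x. x \<notin> K \<Longrightarrow> \<phi> x = 0"
  shows "test_fun S \<phi>"
proof -
  have "closure {x. \<phi> x \<noteq> 0} \<subseteq> K"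
    by (rule closure_minimal) (use assms compact_imp_closed in auto)
  then show ?thesis
    using assms unfolding test_fun_def
    by (meson bounded_subset closed_closure compact_eq_bounded_closed subset_trans)
qed

lemma test_fun_compactE:
  assumes "test_fun S \<phi>"
  obtains K where "compact K" "K \<subseteq> S" "\<And>x. x \<notin> K \<Longrightarrow> \<phi> x = 0"
proof (rule that[of "closure {x. \<phi> x \<noteq> 0}"])
  fix x assume "x \<notin> closure {x. \<phi> x \<noteq> 0}"
  then show "\<phi> x = 0" using closure_subset[of "{x. \<phi> x \<noteq> 0}"] by auto
qed (use assms in \<open>auto simp: test_fun_def\<close>)

lemma grad_zero_outside:
  assumes "closed K" "\<And>x. x \<notin> K \<Longrightarrow> g x = 0" "x \<notin> K"
  shows "grad g x = 0"
proof (rule grad_eqI)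
  have "((\<lambda>x. 0) has_derivative (\<lambda>v. v \<bullet> 0)) (at x)" by simp
  then show "(g has_derivative (\<lambda>v. v \<bullet> 0)) (at x)"
    by (rule has_derivative_transform_within_open[where s="-K"]) (use assms in auto)
qed

section \<open>Bump functions\<close>

text \<open>The exponent is a parameter because derivatives of exp(-1/x) are combinations of such
  functions; the family spans a space closed under differentiation, and smoothness at 0 becomes an
  induction.\<close>

definition flat :: "nat \<Rightarrow> real \<Rightarrow> real" where
  "flat n x = (if x > 0 then inverse x ^ n * exp (- inverse x) else 0)"

lemma flat_tendsto_0: "((\<lambda>x. flat n x) \<longlongrightarrow> 0) (at_right 0)"
proof -
  have "((\<lambda>y::real. y ^ n / exp y) \<longlongrightarrow> 0) at_top" by (rule tendsto_power_div_exp_0)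
  then have "((\<lambda>x::real. inverse x ^ n / exp (inverse x)) \<longlongrightarrow> 0) (at_right 0)"
    by (rule filterlim_compose[OF _ filterlim_inverse_at_top_right])
  then show ?thesis
    by (rule Lim_transform_eventually)
      (simp add: eventually_at_filter flat_def exp_minus divide_inverse)
qed

lemma flat_has_derivative:
  "(flat n has_real_derivative (flat (n + 2) x - real n * flat (n + 1) x)) (at x)"
proof -
  consider "x > 0" | "x < 0" | "x = 0" by linarith
  then show ?thesis
  proof cases
    case 1
    have "((\<lambda>x. inverse x ^ n * exp (- inverse x)) has_real_derivative (flat (n + 2) x - real n * flat (n + 1) x)) (at x)"
      using 1 by (auto intro!: derivative_eq_intros simp: flat_def)
        (cases n; auto simp: algebra_simps power2_eq_square)
    then show ?thesis
      by (rule has_field_derivative_transform_within_open[where S="{0<..}"]) (use 1 in \<open>auto simp: flat_def\<close>)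
  next
    case 2
    have "((\<lambda>x. 0) has_real_derivative (flat (n + 2) x - real n * flat (n + 1) x)) (at x)"
      using 2 by (simp add: flat_def)
    then show ?thesis
      by (rule has_field_derivative_transform_within_open[where S="{..<0}"]) (use 2 in \<open>auto simp: flat_def\<close>)
  next
    case 3
    have "((\<lambda>h. (flat n (0 + h) - flat n 0) / h) \<longlongrightarrow> 0) (at 0)"
    proof (rule filterlim_split_at)
      show "((\<lambda>h. (flat n (0 + h) - flat n 0) / h) \<longlongrightarrow> 0) (at_left 0)"
        by (rule Lim_transform_eventually[OF tendsto_const[of 0]])
          (auto simp: flat_def eventually_at_filter)
      \<comment> \<open>For h > 0 the difference quotient of \<open>flat n\<close> at 0 is
        \<open>flat (Suc n) h\<close>, so the limit is again one for a member of the family.\<close>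
      show "((\<lambda>h. (flat n (0 + h) - flat n 0) / h) \<longlongrightarrow> 0) (at_right 0)"
        by (rule Lim_transform_eventually[OF flat_tendsto_0[of "Suc n"]])
          (auto simp: flat_def eventually_at_filter field_simps)
    qed
    then show ?thesis using 3 by (simp add: DERIV_def flat_def)
  qed
qed

lemma Ck_on_flat: "Ck_on k UNIV (flat n)"
proof (induction k arbitrary: n)
  case 0
  then show ?case
    using flat_has_derivative by (auto intro!: continuous_at_imp_continuous_on DERIV_isCont)
next
  case (Suc k)
  have "pderiv_dir 1 (flat n) = (\<lambda>x. flat (n + 2) x - real n * flat (n + 1) x)"
    using pderiv_dir_eq[OF flat_has_derivative[unfolded has_field_derivative_def]] by auto
  then have "Ck_on k UNIV (pderiv_dir 1 (flat n))"
    using Suc by (simp only:) (intro Ck_on_diff Ck_on_mult Ck_on_const open_UNIV)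
  then show ?case
    using flat_has_derivative by (auto simp: real_differentiable_def)
qed

lemma continuous_flat: "continuous_on S (flat n)"
  using Ck_on_flat[of 0 n] continuous_on_subset by auto

lemma flat_nonneg: "flat n x \<ge> 0" and flat_pos: "x > 0 \<Longrightarrow> flat n x > 0" and flat_0: "x \<le> 0 \<Longrightarrow> flat n x = 0"
  by (auto simp: flat_def)

lemma flat_0_le_1: "flat 0 x \<le> 1"
  by (auto simp: flat_def)

text \<open>\<open>flat 2\<close> is the derivative of \<open>flat 0\<close>, and the mollifier
  evaluates it at 1 - |z|^2/\<epsilon>^2, which never exceeds 1.\<close>

lemma flat_2_bound:
  obtains E where "E > 0" "\<And>x. x \<le> 1 \<Longrightarrow> flat 2 x \<le> E"
proof -
  have "compact (flat 2 ` {0..1})"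
    by (intro compact_continuous_image continuous_flat) auto
  then obtain E where E: "\<And>x. x \<in> {0..1} \<Longrightarrow> norm (flat 2 x) \<le> E"
    using compact_imp_bounded bounded_iff by (metis imageI)
  show thesis
    by (rule that[of "max 1 E"]) (use E in \<open>force simp: flat_def max_def split: if_splits\<close>)+
qed

text \<open>The usual smooth transition from 0 to 1: at least one of \<open>x\<close> and
  \<open>1 - x\<close> is positive, so the denominator never vanishes. It serves both for cutoffs
  near the boundary and for cutoffs in time.\<close>

definition step :: "real \<Rightarrow> real" where
  "step x = flat 0 x * inverse (flat 0 x + flat 0 (1 - x))"

lemma step_denom: "flat 0 x + flat 0 (1 - x) > 0"
  using flat_nonneg[of 0 x] flat_nonneg[of 0 "1 - x"] flat_pos[of x 0] flat_pos[of "1 - x" 0] by linarith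

lemma step_0: "x \<le> 0 \<Longrightarrow> step x = 0" and step_1: "x \<ge> 1 \<Longrightarrow> step x = 1"
  using step_denom[of x] by (auto simp: step_def flat_0)

lemma step_bounds: "0 \<le> step x" "step x \<le> 1"
  using step_denom[of x] flat_nonneg[of 0 x] flat_nonneg[of 0 "1 - x"] by (auto simp: step_def field_simps)

lemma Ck_on_step: "Ck_on k UNIV step"
proof -
  have "Ck_on k UNIV (\<lambda>x. flat 0 ((-1) *\<^sub>R x + 1))"
    by (rule Ck_on_compose_affine[OF _ Ck_on_flat]) (rule bounded_linear_scaleR_right)
  then have "Ck_on k UNIV (\<lambda>x. flat 0 x * inverse (flat 0 x + flat 0 (1 - x)))"
    using step_denom by (intro Ck_on_mult Ck_on_inverse Ck_on_add Ck_on_flat) (auto simp: less_le)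
  then show ?thesis by (simp add: step_def[abs_def])
qed

text \<open>That s' vanishes outside [0,1] makes its rescalings an approximate identity in time and
  confines the gradient of the spatial cutoff to a strip.\<close>

lemma step_deriv_exists:
  obtains s' E where "\<And>x. (step has_real_derivative s' x) (at x)" "continuous_on UNIV s'"
    "\<And>x. \<bar>s' x\<bar> \<le> E" "E > 0" "\<And>x. x < 0 \<or> x > 1 \<Longrightarrow> s' x = 0"
proof -
  define s' where "s' = pderiv_dir 1 step"
  have C: "Ck_on (Suc 0) UNIV step" by (rule Ck_on_step)
  have d: "(step has_real_derivative s' x) (at x)" for x
  proof -
    have "step differentiable (at x)" using C by simp
    then obtain D where "(step has_real_derivative D) (at x)" by (auto simp: real_differentiable_def)
    then show ?thesis using pderiv_dir_eq[of step "(*) D" x 1] by (auto simp: s'_def has_field_derivative_def)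
  qed
  have c: "continuous_on UNIV s'" using C by (simp add: s'_def)
  have z: "s' x = 0" if "x < 0 \<or> x > 1" for x
    using that
  proof
    assume "x < 0"
    have "((\<lambda>x. 0) has_real_derivative 0) (at x)" by simp
    then have "(step has_real_derivative 0) (at x)"
      by (rule has_field_derivative_transform_within_open[where S="{..<0}"]) (use \<open>x < 0\<close> step_0 in auto)
    then show ?thesis using d DERIV_unique by blast
  next
    assume "x > 1"
    have "((\<lambda>x. 1) has_real_derivative 0) (at x)" by simp
    then have "(step has_real_derivative 0) (at x)"
      by (rule has_field_derivative_transform_within_open[where S="{1<..}"]) (use \<open>x > 1\<close> step_1 in auto)
    then show ?thesis using d DERIV_unique by blast
  qed
  have "compact (s' ` {0..1})"
    by (intro compact_continuous_image continuous_on_subset[OF c]) auto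
  then obtain E where E: "\<And>x. x \<in> {0..1} \<Longrightarrow> norm (s' x) \<le> E"
    using compact_imp_bounded bounded_iff by (metis imageI)
  show thesis
  proof (rule that[of s' "max 1 E"])
    fix x show "\<bar>s' x\<bar> \<le> max 1 E"
    proof (cases "x \<in> {0..1}")
      case True
      then show ?thesis using E[OF True] by simp
    next
      case False
      then show ?thesis using z[of x] by auto
    qed
  qed (use d c z in auto)
qed

section \<open>The mollifier\<close>

text \<open>Not normalised: the values stay in [0,1], and the mass is divided out at the end. The
  square \<open>z \<bullet> z\<close> in place of the norm keeps the function smooth at the
  origin.\<close>

definition moll :: "real \<Rightarrow> 'a::euclidean_space \<Rightarrow> real" where
  "moll \<epsilon> z = flat 0 (1 - (z \<bullet> z) / \<epsilon>\<^sup>2)"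

definition moll_grad :: "real \<Rightarrow> 'a::euclidean_space \<Rightarrow> 'a" where
  "moll_grad \<epsilon> z = (- (2 / \<epsilon>\<^sup>2) * flat 2 (1 - (z \<bullet> z) / \<epsilon>\<^sup>2)) *\<^sub>R z"

lemma Ck_on_inner_self: "Ck_on k UNIV (\<lambda>z::'a::euclidean_space. z \<bullet> z)"
proof (cases k)
  case (Suc n)
  have d: "((\<lambda>z::'a. z \<bullet> z) has_derivative (\<lambda>v. 2 * (v \<bullet> z))) (at z)" for z :: 'a
    by (auto intro!: derivative_eq_intros simp: inner_commute)
  have "pderiv_dir i (\<lambda>z::'a. z \<bullet> z) = (\<lambda>z. 2 * (i \<bullet> z))" for i :: 'a
    using pderiv_dir_eq[OF d] by auto
  then show ?thesis
    using Suc d Ck_on_linear[OF bounded_linear_const_mult[OF bounded_linear_inner_right]]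
    by (auto simp: differentiable_def)
qed (auto intro!: continuous_intros)

lemma Ck_on_moll: "Ck_on k UNIV (moll \<epsilon>)"
proof -
  have "Ck_on k UNIV (\<lambda>z::'a. flat 0 (1 - (z \<bullet> z) * inverse (\<epsilon>\<^sup>2)))"
    by (rule Ck_on_compose_real[OF open_UNIV Ck_on_flat])
      (intro Ck_on_diff Ck_on_mult Ck_on_const Ck_on_inner_self open_UNIV)
  then show ?thesis unfolding moll_def[abs_def] divide_inverse .
qed

text \<open>For n = 0 the derivative formula of \<open>flat\<close> reduces to
  \<open>flat 2\<close>, which explains the closed form of \<open>moll_grad\<close>. Its oddness,
  visible from this form, drives the symmetrisation of the commutator.\<close>

lemma moll_has_derivative: "(moll \<epsilon> has_derivative (\<lambda>v. v \<bullet> moll_grad \<epsilon> z)) (at z)"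
proof -
  have a: "((\<lambda>z. 1 - (z \<bullet> z) / \<epsilon>\<^sup>2) has_derivative (\<lambda>v. 0 - (z \<bullet> v + v \<bullet> z) / \<epsilon>\<^sup>2)) (at z)"
    unfolding divide_inverse
    by (rule has_derivative_diff has_derivative_const has_derivative_mult_left has_derivative_inner has_derivative_ident)+
  have b: "(flat 0 has_derivative (\<lambda>h. flat 2 y * h)) (at y)" for y
    using flat_has_derivative[of 0 y]
    by (simp only: has_field_derivative_def add_0 of_nat_0 mult_zero_left diff_0_right)
  have "(\<lambda>v. flat 2 (1 - (z \<bullet> z) / \<epsilon>\<^sup>2) * (0 - (z \<bullet> v + v \<bullet> z) / \<epsilon>\<^sup>2)) = (\<lambda>v. v \<bullet> moll_grad \<epsilon> z)"
  proof
    fix v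
    have "z \<bullet> v = v \<bullet> z" by (rule inner_commute)
    then show "flat 2 (1 - (z \<bullet> z) / \<epsilon>\<^sup>2) * (0 - (z \<bullet> v + v \<bullet> z) / \<epsilon>\<^sup>2) = v \<bullet> moll_grad \<epsilon> z"
      unfolding moll_grad_def inner_scaleR_right by (simp only:) (simp add: divide_inverse)
  qed
  then show ?thesis
    using has_derivative_compose[OF a b] unfolding moll_def[abs_def] by (simp only:)
qed

lemma moll_even: "moll \<epsilon> (- z) = moll \<epsilon> z" and moll_grad_odd: "moll_grad \<epsilon> (- z) = - moll_grad \<epsilon> z"
  by (auto simp: moll_def moll_grad_def)

lemma moll_nonneg: "moll \<epsilon> z \<ge> 0" and moll_le_1: "moll \<epsilon> z \<le> 1"
  by (auto simp: moll_def flat_nonneg flat_0_le_1)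

lemma moll_support:
  assumes "\<epsilon> > 0" "z \<notin> cball 0 \<epsilon>"
  shows "moll \<epsilon> z = 0" "moll_grad \<epsilon> z = 0"
proof -
  have "\<epsilon>\<^sup>2 < z \<bullet> z"
    using assms power_strict_mono[of \<epsilon> "norm z" 2] unfolding power2_norm_eq_inner by simp
  then have "1 - (z \<bullet> z) / \<epsilon>\<^sup>2 \<le> 0" using assms by (simp add: field_simps)
  then show "moll \<epsilon> z = 0" "moll_grad \<epsilon> z = 0" by (auto simp: moll_def moll_grad_def flat_0)
qed

lemma continuous_moll: "continuous_on S (moll \<epsilon>)"
  using Ck_on_moll[of 0] continuous_on_subset by fastforce

lemma continuous_moll_grad: "continuous_on S (moll_grad \<epsilon>)"
  unfolding moll_grad_def divide_inverse
  by (intro continuous_intros continuous_on_compose2[OF continuous_flat[of UNIV]]) auto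

lemma moll_shift_test:
  fixes y :: "'a::euclidean_space"
  assumes "\<epsilon> > 0" "cball y \<epsilon> \<subseteq> S"
  shows "test_fun S (\<lambda>x. moll \<epsilon> (x - y))"
proof (rule test_funI)
  show "smooth_fun_on UNIV (\<lambda>x. moll \<epsilon> (x - y))"
    using Ck_on_compose_affine[OF bounded_linear_ident Ck_on_moll, of _ _ "- y"] by (auto simp: smooth_fun_on_def)
  show "moll \<epsilon> (x - y) = 0" if "x \<notin> cball y \<epsilon>" for x
    using that assms by (intro moll_support) (auto simp: dist_norm norm_minus_commute)
qed (use assms in auto)

lemma grad_moll_shift: "grad (\<lambda>x. moll \<epsilon> (x - y)) x = moll_grad \<epsilon> (x - y)"
  by (rule grad_eqI)
    (rule has_derivative_compose[OF _ moll_has_derivative, of "\<lambda>x. x - y" "\<lambda>v. v"], auto intro!: derivative_eq_intros)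

section \<open>Integration on Euclidean space\<close>

lemma lborel_distr_translation: "distr lborel borel (\<lambda>x. x - z) = (lborel :: 'a::euclidean_space measure)"
proof -
  have "(\<lambda>x. x - z) = (+) (- z)" by auto
  then show ?thesis by (simp only: lborel_distr_plus)
qed

lemma lborel_distr_reflect: "distr lborel borel (\<lambda>x. z - x) = (lborel :: 'a::euclidean_space measure)"
proof -
  have "lborel = density (distr lborel borel (\<lambda>x. z + (-1) *\<^sub>R x)) (\<lambda>_. ennreal (\<bar>-1\<bar>^DIM('a)))"
    using lborel_affine[of "-1" z] by simp
  then show ?thesis by (simp add: density_1)
qed

lemma integral_translation:
  fixes f :: "'a::euclidean_space \<Rightarrow> 'b::{banach, second_countable_topology}"
  assumes "f \<in> borel_measurable borel"
  shows "(\<integral>x. f (x - z) \<partial>lborel) = (\<integral>x. f x \<partial>lborel)"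
    and "integrable lborel (\<lambda>x. f (x - z)) \<longleftrightarrow> integrable lborel f"
  using integral_distr[of "\<lambda>x. x - z" lborel borel f] integrable_distr_eq[of "\<lambda>x. x - z" lborel borel f] assms
  by (simp_all add: lborel_distr_translation)

lemma integral_reflect:
  fixes f :: "'a::euclidean_space \<Rightarrow> 'b::{banach, second_countable_topology}"
  assumes "f \<in> borel_measurable borel"
  shows "(\<integral>x. f (z - x) \<partial>lborel) = (\<integral>x. f x \<partial>lborel)"
    and "integrable lborel (\<lambda>x. f (z - x)) \<longleftrightarrow> integrable lborel f"
  using integral_distr[of "\<lambda>x. z - x" lborel borel f] integrable_distr_eq[of "\<lambda>x. z - x" lborel borel f] assms
  by (simp_all add: lborel_distr_reflect)

lemma integrable_indicator_cball:
  "integrable lborel (\<lambda>x::'a::euclidean_space. indicator (cball 0 a) x * (C::real))"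
proof -
  have "integrable lborel (indicator (cball (0::'a) a) :: 'a \<Rightarrow> real)"
    using emeasure_bounded_finite[OF bounded_cball[of "0::'a" a]] by (intro integrable_real_indicator) auto
  then show ?thesis by simp
qed

lemma integrable_bounded_compact_support:
  fixes f :: "'a::euclidean_space \<Rightarrow> 'b::euclidean_space"
  assumes "f \<in> borel_measurable borel" "\<And>x. norm (f x) \<le> C" "bounded S" "\<And>x. x \<notin> S \<Longrightarrow> f x = 0"
  shows "integrable lborel f"
proof -
  obtain a where a: "S \<subseteq> cball 0 a"
    using assms(3) unfolding bounded_iff by (auto simp: subset_iff)
  show ?thesis
    using integrable_indicator_cball[of a C]
  proof (rule Bochner_Integration.integrable_bound)
    show "AE x in lborel. norm (f x) \<le> norm (indicator (cball 0 a) x * C)"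
    proof (rule AE_I2)
      fix x :: 'a
      have "C \<ge> 0" using assms(2)[of x] norm_ge_zero order_trans by blast
      then show "norm (f x) \<le> norm (indicator (cball 0 a) x * C)"
        using assms a by (cases "x \<in> S") (auto simp: indicator_def)
    qed
  qed (use assms in auto)
qed

text \<open>Young's inequality with a free weight s is integrated and then optimised over s; the
  weight 1 already gives integrability of the product.\<close>

lemma integral_Cauchy_Schwarz:
  fixes a b :: "'a \<Rightarrow> real"
  assumes [measurable]: "a \<in> borel_measurable M" "b \<in> borel_measurable M"
    and a: "integrable M (\<lambda>x. (a x)\<^sup>2)" and b: "integrable M (\<lambda>x. (b x)\<^sup>2)"
  shows "integrable M (\<lambda>x. a x * b x)"
    and "(\<integral>x. \<bar>a x * b x\<bar> \<partial>M) \<le> sqrt (\<integral>x. (a x)\<^sup>2 \<partial>M) * sqrt (\<integral>x. (b x)\<^sup>2 \<partial>M)"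
proof -
  have young: "\<bar>x * y\<bar> \<le> (s * x\<^sup>2 + y\<^sup>2 / s) / 2" if "s > 0" for s x y :: real
  proof -
    have "0 \<le> (sqrt s * \<bar>x\<bar> - \<bar>y\<bar> / sqrt s)\<^sup>2" by simp
    also have "\<dots> = s * x\<^sup>2 + y\<^sup>2 / s - 2 * \<bar>x * y\<bar>"
      using that by (simp add: power2_diff power_mult_distrib power_divide abs_mult)
    finally show ?thesis by simp
  qed
  show i: "integrable M (\<lambda>x. a x * b x)"
  proof (rule Bochner_Integration.integrable_bound)
    show "integrable M (\<lambda>x. (a x)\<^sup>2 + (b x)\<^sup>2)" using a b by simp
    show "AE x in M. norm (a x * b x) \<le> norm ((a x)\<^sup>2 + (b x)\<^sup>2)"
    proof (rule AE_I2)
      fix x show "norm (a x * b x) \<le> norm ((a x)\<^sup>2 + (b x)\<^sup>2)"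
        using young[of 1 "a x" "b x"] by simp
    qed
  qed simp
  define A where "A = (\<integral>x. (a x)\<^sup>2 \<partial>M)"
  define B where "B = (\<integral>x. (b x)\<^sup>2 \<partial>M)"
  have AB: "A \<ge> 0" "B \<ge> 0" by (auto simp: A_def B_def)
  have y: "(\<integral>x. \<bar>a x * b x\<bar> \<partial>M) \<le> (s * A + B / s) / 2" if "s > 0" for s
  proof -
    have "(\<integral>x. \<bar>a x * b x\<bar> \<partial>M) \<le> (\<integral>x. (s * (a x)\<^sup>2 + (b x)\<^sup>2 / s) / 2 \<partial>M)"
      by (rule integral_mono) (use i a b young[OF that] in auto)
    also have "\<dots> = (s * A + B / s) / 2" using a b by (simp add: A_def B_def)
    finally show ?thesis .
  qed
  show "(\<integral>x. \<bar>a x * b x\<bar> \<partial>M) \<le> sqrt A * sqrt B"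
  \<comment> \<open>When one of the two integrals vanishes there is no optimal weight, but then the
    product vanishes almost everywhere.\<close>
  proof (cases "A = 0 \<or> B = 0")
    case True
    then have "AE x in M. a x * b x = 0"
    proof
      assume "A = 0"
      then have "AE x in M. (a x)\<^sup>2 = 0" unfolding A_def using integral_nonneg_eq_0_iff_AE[OF a] by simp
      then show ?thesis by auto
    next
      assume "B = 0"
      then have "AE x in M. (b x)\<^sup>2 = 0" unfolding B_def using integral_nonneg_eq_0_iff_AE[OF b] by simp
      then show ?thesis by auto
    qed
    then have "(\<integral>x. \<bar>a x * b x\<bar> \<partial>M) = (\<integral>x. 0 \<partial>M)" by (intro integral_cong_AE) auto
    then show ?thesis using AB by simp
  next
    case False
    then have p: "sqrt A > 0" "sqrt B > 0" using AB by auto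
    have "A = sqrt A * sqrt A" "B = sqrt B * sqrt B" using AB by auto
    \<comment> \<open>The weight \<open>sqrt B / sqrt A\<close> balances the two terms of Young's
      inequality.\<close>
    then have "(sqrt B / sqrt A * A + B / (sqrt B / sqrt A)) / 2 = sqrt A * sqrt B"
      using p by (simp add: field_simps)
    then show ?thesis using y[of "sqrt B / sqrt A"] p by simp
  qed
qed

section \<open>Continuity of translations in the mean\<close>

text \<open>Two truncations come first: values are clamped to [-N, N], and a continuous cutoff
  restricts to a ball. The continuous functions converging almost everywhere to \<open>g\<close>,
  clamped and cut off in the same way, are then dominated by one integrable function.\<close>

lemma integrable_approx_continuous:
  fixes g :: "'a::euclidean_space \<Rightarrow> real"
  assumes g: "integrable lborel g" and "e > 0"
  obtains h M where "continuous_on UNIV h" "\<And>x. x \<notin> cball 0 M \<Longrightarrow> h x = 0" "integrable lborel h"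
    "(\<integral>x. \<bar>g x - h x\<bar> \<partial>lborel) < e"
proof -
  have [measurable]: "g \<in> borel_measurable borel" using g by simp
  define cut where "cut N x = max 0 (min 1 (real N + 1 - norm x))" for N and x :: 'a
  define cl where "cl N y = max (- real N) (min (real N) y)" for N and y :: real
  have contcut: "continuous_on UNIV (cut N)" for N
    unfolding cut_def by (intro continuous_intros)
  then have [measurable]: "cut N \<in> borel_measurable borel" for N
    by (rule borel_measurable_continuous_onI)
  have [measurable]: "cl N \<in> borel_measurable borel" for N
    unfolding cl_def by (intro borel_measurable_continuous_onI continuous_intros)
  have cut01: "0 \<le> cut N x" "cut N x \<le> 1" for N x by (auto simp: cut_def)
  have clb: "\<bar>cl N y\<bar> \<le> \<bar>y\<bar>" "\<bar>cl N y\<bar> \<le> real N" for N y by (auto simp: cl_def)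
  have "(\<lambda>N. \<integral>x. \<bar>g x - cl N (g x) * cut N x\<bar> \<partial>lborel) \<longlonglongrightarrow> (\<integral>x. 0 \<partial>(lborel::'a measure))"
  proof (rule integral_dominated_convergence)
    show "integrable lborel (\<lambda>x. 2 * \<bar>g x\<bar>)" using g by simp
    show "AE x in lborel. norm \<bar>g x - cl N (g x) * cut N x\<bar> \<le> 2 * \<bar>g x\<bar>" for N
    proof (rule AE_I2)
      fix x
      have "\<bar>cl N (g x) * cut N x\<bar> \<le> \<bar>g x\<bar> * 1"
        unfolding abs_mult using clb cut01 by (intro mult_mono) auto
      then show "norm \<bar>g x - cl N (g x) * cut N x\<bar> \<le> 2 * \<bar>g x\<bar>" by simp
    qed
    show "AE x in lborel. (\<lambda>N. \<bar>g x - cl N (g x) * cut N x\<bar>) \<longlonglongrightarrow> 0"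
    proof (rule AE_I2)
      fix x
      have "eventually (\<lambda>N. real N > \<bar>g x\<bar> \<and> real N > norm x) sequentially"
        by (intro eventually_conj) (use filterlim_real_sequentially in \<open>auto simp: filterlim_at_top_dense\<close>)
      then have "eventually (\<lambda>N. \<bar>g x - cl N (g x) * cut N x\<bar> = 0) sequentially"
        by eventually_elim (auto simp: cl_def cut_def)
      then show "(\<lambda>N. \<bar>g x - cl N (g x) * cut N x\<bar>) \<longlonglongrightarrow> 0"
        by (rule tendsto_eventually)
    qed
  qed auto
  then have "eventually (\<lambda>N. (\<integral>x. \<bar>g x - cl N (g x) * cut N x\<bar> \<partial>lborel) < e / 2) sequentially"
    using \<open>e > 0\<close> by (intro order_tendstoD(2)) auto
  then obtain N where N: "(\<integral>x. \<bar>g x - cl N (g x) * cut N x\<bar> \<partial>lborel) < e / 2"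
    by (meson eventually_happens trivial_limit_sequentially)
  have "g measurable_on UNIV"
    by (rule lebesgue_measurable_imp_measurable_on_real) (auto intro: measurable_completion)
  then obtain Z \<phi> where Z: "negligible Z" and \<phi>: "\<And>n. continuous_on UNIV (\<phi> n)"
    and lim: "\<And>x. x \<notin> Z \<Longrightarrow> (\<lambda>n. \<phi> n x) \<longlonglongrightarrow> g x"
    by (auto simp: measurable_on_def)
  have [measurable]: "\<phi> n \<in> borel_measurable borel" for n
    using \<phi> by (rule borel_measurable_continuous_onI)
  have AEZ: "AE x in lborel. x \<notin> Z"
    using Z negligible_iff_null_sets AE_completion_iff AE_not_in by blast
  have "(\<lambda>n. \<integral>x. \<bar>cl N (g x) * cut N x - cl N (\<phi> n x) * cut N x\<bar> \<partial>lborel) \<longlonglongrightarrow> (\<integral>x. 0 \<partial>(lborel::'a measure))"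
  proof (rule integral_dominated_convergence)
    show "integrable lborel (\<lambda>x::'a. indicator (cball 0 (real N + 1)) x * (2 * real N))"
      by (rule integrable_indicator_cball)
    show "AE x in lborel. norm \<bar>cl N (g x) * cut N x - cl N (\<phi> n x) * cut N x\<bar>
        \<le> indicator (cball 0 (real N + 1)) x * (2 * real N)" for n
    proof (rule AE_I2)
      fix x
      show "norm \<bar>cl N (g x) * cut N x - cl N (\<phi> n x) * cut N x\<bar>
        \<le> indicator (cball 0 (real N + 1)) x * (2 * real N)"
      proof (cases "x \<in> cball 0 (real N + 1)")
        case True
        have "\<bar>(cl N (g x) - cl N (\<phi> n x)) * cut N x\<bar> \<le> (2 * real N) * 1"
          unfolding abs_mult using clb(2)[of N "g x"] clb(2)[of N "\<phi> n x"] cut01 by (intro mult_mono) auto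
        then show ?thesis using True by (simp add: left_diff_distrib)
      next
        case False
        then have "cut N x = 0" by (simp add: cut_def)
        then show ?thesis by simp
      qed
    qed
    show "AE x in lborel. (\<lambda>n. \<bar>cl N (g x) * cut N x - cl N (\<phi> n x) * cut N x\<bar>) \<longlonglongrightarrow> 0"
      using AEZ
    proof eventually_elim
      case (elim x)
      have "(\<lambda>n. \<bar>cl N (g x) * cut N x - cl N (\<phi> n x) * cut N x\<bar>) \<longlonglongrightarrow> \<bar>cl N (g x) * cut N x - cl N (g x) * cut N x\<bar>"
        unfolding cl_def by (intro tendsto_intros lim elim)
      then show ?case by simp
    qed
  qed auto
  then have "eventually (\<lambda>n. (\<integral>x. \<bar>cl N (g x) * cut N x - cl N (\<phi> n x) * cut N x\<bar> \<partial>lborel) < e / 2) sequentially"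
    using \<open>e > 0\<close> by (intro order_tendstoD(2)) auto
  then obtain n where n: "(\<integral>x. \<bar>cl N (g x) * cut N x - cl N (\<phi> n x) * cut N x\<bar> \<partial>lborel) < e / 2"
    by (meson eventually_happens trivial_limit_sequentially)
  define h where "h x = cl N (\<phi> n x) * cut N x" for x
  have hc: "continuous_on UNIV h"
    unfolding h_def cl_def by (intro continuous_intros contcut \<phi>)
  have h0: "h x = 0" if "x \<notin> cball 0 (real N + 1)" for x
    using that by (simp add: h_def cut_def)
  have hb: "norm (h x) \<le> real N * 1" for x
    unfolding h_def real_norm_def abs_mult using clb(2) cut01 by (intro mult_mono) auto
  have hi: "integrable lborel h"
    by (rule integrable_bounded_compact_support[OF borel_measurable_continuous_onI[OF hc] hb bounded_cball h0])
  have fi: "integrable lborel (\<lambda>x. cl N (g x) * cut N x)"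
  proof (rule Bochner_Integration.integrable_bound[OF g])
    show "AE x in lborel. norm (cl N (g x) * cut N x) \<le> norm (g x)"
    proof (rule AE_I2)
      fix x
      have "\<bar>cl N (g x) * cut N x\<bar> \<le> \<bar>g x\<bar> * 1"
        unfolding abs_mult using clb cut01 by (intro mult_mono) auto
      then show "norm (cl N (g x) * cut N x) \<le> norm (g x)" by simp
    qed
  qed simp
  have "(\<integral>x. \<bar>g x - h x\<bar> \<partial>lborel) \<le> (\<integral>x. \<bar>g x - cl N (g x) * cut N x\<bar> + \<bar>cl N (g x) * cut N x - h x\<bar> \<partial>lborel)"
    by (rule integral_mono) (use g hi fi in auto)
  also have "\<dots> = (\<integral>x. \<bar>g x - cl N (g x) * cut N x\<bar> \<partial>lborel) + (\<integral>x. \<bar>cl N (g x) * cut N x - h x\<bar> \<partial>lborel)"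
    using g hi fi by (intro Bochner_Integration.integral_add) auto
  also have "\<dots> < e" using N n by (simp add: h_def)
  finally show thesis using that[OF hc h0 hi] by blast
qed

text \<open>For a continuous function of compact support this is uniform continuity. The general
  case is an e/3 argument in which the translated error equals the original one by invariance of
  Lebesgue measure.\<close>

lemma translation_continuous_L1:
  fixes g :: "'a::euclidean_space \<Rightarrow> real"
  assumes g: "integrable lborel g" and "e > 0"
  obtains d where "d > 0" "\<And>z. norm z \<le> d \<Longrightarrow> (\<integral>x. \<bar>g x - g (x - z)\<bar> \<partial>lborel) < e"
proof -
  obtain h M where h: "continuous_on UNIV h" "\<And>x. x \<notin> cball 0 M \<Longrightarrow> h x = 0" "integrable lborel h"
    and gh: "(\<integral>x. \<bar>g x - h x\<bar> \<partial>lborel) < e / 3"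
    using integrable_approx_continuous[OF g, of "e / 3"] \<open>e > 0\<close> by (metis divide_pos_pos zero_less_numeral)
  have [measurable]: "h \<in> borel_measurable borel" "g \<in> borel_measurable borel" using h(3) g by auto
  have tr: "integrable lborel (\<lambda>x. g (x - z))" "integrable lborel (\<lambda>x. h (x - z))" for z
    using integral_translation(2)[of g z] integral_translation(2)[of h z] g h(3) by auto
  define V where "V = measure lborel (cball (0::'a) (M + 1))"
  have "V \<ge> 0" by (simp add: V_def)
  \<comment> \<open>\<open>V + 1\<close> avoids a division by zero, and 6 instead of 3 leaves room
    for the strict inequality \<open>e' * V < e / 3\<close>.\<close>
  define e' where "e' = e / (6 * (V + 1))"
  have "e' > 0" using \<open>e > 0\<close> \<open>V \<ge> 0\<close> by (simp add: e'_def)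
  have "e' * V \<le> e' * (V + 1)" using \<open>e' > 0\<close> by simp
  also have "\<dots> = e / 6" using \<open>V \<ge> 0\<close> unfolding e'_def by (simp add: divide_simps)
  finally have e'V: "e' * V < e / 3" using \<open>e > 0\<close> by linarith
  \<comment> \<open>For |z| \<le> 1 the difference h x - h (x - z) is supported in the ball of
    radius M + 1, and x - z then lies in the ball of radius M + 2.\<close>
  have "uniformly_continuous_on (cball 0 (M + 1 + 1)) h"
    by (intro compact_uniformly_continuous continuous_on_subset[OF h(1)]) auto
  then obtain d where d: "d > 0" and
    ud: "\<And>x y. x \<in> cball 0 (M + 2) \<Longrightarrow> y \<in> cball 0 (M + 2) \<Longrightarrow> dist y x < d \<Longrightarrow> dist (h y) (h x) < e'"
    unfolding uniformly_continuous_on_def using \<open>e' > 0\<close> by (metis add.assoc one_add_one)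
  show thesis
  proof (rule that[of "min (d / 2) 1"])
    show "min (d / 2) 1 > 0" using d by auto
    fix z :: 'a assume z: "norm z \<le> min (d / 2) 1"
    have hz: "\<bar>h x - h (x - z)\<bar> \<le> indicator (cball 0 (M + 1)) x * e'" for x
    proof (cases "x \<in> cball 0 (M + 1)")
      case True
      have "norm (x - z) \<le> norm x + norm z" by (rule norm_triangle_ineq4)
      then have "dist (h x) (h (x - z)) < e'"
        using True z d by (intro ud) (auto simp: dist_norm norm_minus_commute)
      then show ?thesis using True by (simp add: dist_real_def)
    next
      case False
      have "norm x \<le> norm (x - z) + norm z" by (metis diff_add_cancel norm_triangle_ineq)
      then have "x - z \<notin> cball 0 M" "x \<notin> cball 0 M" using False z by auto
      then show ?thesis using h(2) False by simp
    qed
    have ib: "integrable lborel (\<lambda>x::'a. indicator (cball 0 (M + 1)) x * e')"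
      by (rule integrable_indicator_cball)
    have 2: "(\<integral>x. \<bar>h x - h (x - z)\<bar> \<partial>lborel) \<le> (\<integral>x. indicator (cball 0 (M + 1)) x * e' \<partial>(lborel::'a measure))"
      by (rule integral_mono[OF _ ib hz]) (use h(3) tr in auto)
    have 3: "(\<integral>x. \<bar>g (x - z) - h (x - z)\<bar> \<partial>lborel) = (\<integral>x. \<bar>g x - h x\<bar> \<partial>lborel)"
      by (rule integral_translation) simp
    have "(\<integral>x. \<bar>g x - g (x - z)\<bar> \<partial>lborel) \<le>
      (\<integral>x. \<bar>g x - h x\<bar> + \<bar>h x - h (x - z)\<bar> + \<bar>g (x - z) - h (x - z)\<bar> \<partial>lborel)"
      by (rule integral_mono) (use g h(3) tr in auto)
    also have "\<dots> = (\<integral>x. \<bar>g x - h x\<bar> \<partial>lborel) + (\<integral>x. \<bar>h x - h (x - z)\<bar> \<partial>lborel) + (\<integral>x. \<bar>g (x - z) - h (x - z)\<bar> \<partial>lborel)"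
      using g h(3) tr by simp
    also have "\<dots> < e" using 2 3 gh e'V by (simp add: V_def mult.commute)
    finally show "(\<integral>x. \<bar>g x - g (x - z)\<bar> \<partial>lborel) < e" .
  qed
qed

section \<open>Lebesgue measurable functions and Borel representatives\<close>

text \<open>Fubini and Tonelli are applied to products of \<open>lborel\<close>, whose sigma-algebra
  is not complete; Lebesgue measurable functions are therefore replaced by Borel ones, coordinate by
  coordinate.\<close>

lemma lebesgue_ex_borel:
  fixes f :: "'a::euclidean_space \<Rightarrow> 'b::euclidean_space"
  assumes "f \<in> borel_measurable lebesgue"
  obtains g where "g \<in> borel_measurable borel" "AE x in lborel. f x = g x"
proof -
  have "\<exists>g\<in>borel_measurable lborel. AE x in lborel. f x \<bullet> b = (g x :: real)" for b
    using assms by (intro completion_ex_borel_measurable_real) auto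
  then obtain g where g: "\<And>b. g b \<in> borel_measurable lborel" "\<And>b. AE x in lborel. f x \<bullet> b = g b x"
    by metis
  show thesis
  proof (rule that[of "\<lambda>x. \<Sum>b\<in>Basis. g b x *\<^sub>R b"])
    show "(\<lambda>x. \<Sum>b\<in>Basis. g b x *\<^sub>R b) \<in> borel_measurable borel" using g by auto
    have "AE x in lborel. \<forall>b\<in>Basis. f x \<bullet> b = g b x"
      using g by (intro AE_finite_allI) auto
    then show "AE x in lborel. f x = (\<Sum>b\<in>Basis. g b x *\<^sub>R b)"
    proof eventually_elim
      case (elim x)
      then have "(\<Sum>b\<in>Basis. g b x *\<^sub>R b) = (\<Sum>b\<in>Basis. (f x \<bullet> b) *\<^sub>R b)"
        by (intro sum.cong) auto
      then show ?case by (simp add: euclidean_representation)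
    qed
  qed
qed

lemma AE_lborel_imp_lebesgue: "AE x in lborel. P x \<Longrightarrow> AE x in lebesgue. P x"
  by (rule AE_completion)

lemma lebesgue_integral_borel_rep:
  fixes f :: "'a::euclidean_space \<Rightarrow> 'b::euclidean_space"
  assumes "f \<in> borel_measurable lebesgue" "g \<in> borel_measurable borel" "AE x in lborel. f x = g x"
  shows "(\<integral>x. f x \<partial>lebesgue) = (\<integral>x. g x \<partial>lborel)"
    and "integrable lebesgue f \<longleftrightarrow> integrable lborel g"
proof -
  have g: "g \<in> borel_measurable lebesgue" using assms(2) by (auto intro: measurable_completion)
  have ae: "AE x in lebesgue. f x = g x" using assms(3) by (rule AE_lborel_imp_lebesgue)
  show "(\<integral>x. f x \<partial>lebesgue) = (\<integral>x. g x \<partial>lborel)"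
    using integral_cong_AE[OF assms(1) g ae] integral_completion[of g lborel] assms(2) by simp
  show "integrable lebesgue f \<longleftrightarrow> integrable lborel g"
    using integrable_cong_AE[OF assms(1) g ae] integrable_completion[of g lborel] assms(2) by simp
qed

lemma integrable_lebesgue_on:
  fixes f :: "'a::euclidean_space \<Rightarrow> 'b::euclidean_space"
  assumes "S \<in> sets lebesgue"
  shows "integrable (lebesgue_on S) f \<longleftrightarrow> integrable lebesgue (\<lambda>x. indicator S x *\<^sub>R f x)"
    and "(\<integral>x. f x \<partial>lebesgue_on S) = (\<integral>x. indicator S x *\<^sub>R f x \<partial>lebesgue)"
    and "f \<in> borel_measurable (lebesgue_on S) \<longleftrightarrow> (\<lambda>x. indicator S x *\<^sub>R f x) \<in> borel_measurable lebesgue"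
    and "(AE x in lebesgue_on S. P x) \<longleftrightarrow> (AE x in lborel. x \<in> S \<longrightarrow> P x)"
  using assms
  by (simp_all add: integrable_restrict_space integral_restrict_space borel_measurable_restrict_space_iff
      AE_restrict_space_iff AE_completion_iff)

lemma open_sets_lebesgue: "open S \<Longrightarrow> S \<in> sets lebesgue"
  by (simp add: borel_open)

lemma integrable_test_scaleR:
  fixes \<psi> :: "'a::euclidean_space \<Rightarrow> real" and v :: "'a \<Rightarrow> 'b::euclidean_space"
  assumes S: "open S" and K: "compact K" "K \<subseteq> S" "\<And>x. x \<notin> K \<Longrightarrow> \<psi> x = 0"
    and c: "continuous_on UNIV \<psi>" and v: "in_L1loc S v"
  shows "integrable (lebesgue_on S) (\<lambda>x. \<psi> x *\<^sub>R v x)"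
proof -
  have KL: "K \<in> sets lebesgue" using K(1) by (simp add: borel_closed compact_imp_closed)
  have iv: "integrable lebesgue (\<lambda>x. indicator K x *\<^sub>R v x)"
    using v K(1,2) integrable_lebesgue_on(1)[OF KL, of v] unfolding in_L1loc_def by blast
  obtain B where B: "\<And>x. \<bar>\<psi> x\<bar> \<le> B"
  proof -
    have "bounded (\<psi> ` K)"
      by (intro compact_imp_bounded compact_continuous_image continuous_on_subset[OF c] K) auto
    then obtain B where "\<And>x. x \<in> K \<Longrightarrow> \<bar>\<psi> x\<bar> \<le> B" by (auto simp: bounded_iff)
    then show thesis using K(3) that[of "max B 0"] by (metis abs_zero max.cobounded2 max.coboundedI1)
  qed
  have \<psi>: "\<psi> \<in> borel_measurable lebesgue"
    using borel_measurable_continuous_onI[OF c] by (auto intro: measurable_completion)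
  have "integrable lebesgue (\<lambda>x. \<psi> x *\<^sub>R (indicator K x *\<^sub>R v x))"
  proof (rule Bochner_Integration.integrable_bound)
    show "integrable lebesgue (\<lambda>x. B *\<^sub>R (indicator K x *\<^sub>R v x))"
      by (intro integrable_scaleR_right iv)
    show "AE x in lebesgue. norm (\<psi> x *\<^sub>R (indicator K x *\<^sub>R v x)) \<le> norm (B *\<^sub>R (indicator K x *\<^sub>R v x))"
      by (intro AE_I2) (auto intro!: mult_right_mono order_trans[OF B abs_ge_self] simp: abs_mult)
    show "(\<lambda>x. \<psi> x *\<^sub>R (indicator K x *\<^sub>R v x)) \<in> borel_measurable lebesgue"
      by (rule borel_measurable_scaleR[OF \<psi> borel_measurable_integrable[OF iv]])
  qed
  also have "(\<lambda>x. \<psi> x *\<^sub>R (indicator K x *\<^sub>R v x)) = (\<lambda>x. indicator S x *\<^sub>R (\<psi> x *\<^sub>R v x))"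
    using K by (auto simp: indicator_def fun_eq_iff)
  finally show ?thesis
    using integrable_lebesgue_on(1)[OF open_sets_lebesgue[OF S]] by blast
qed

section \<open>Mass of the mollifier\<close>

lemma borel_measurable_moll [measurable]: "moll \<epsilon> \<in> borel_measurable borel"
  "moll_grad \<epsilon> \<in> borel_measurable borel"
  by (intro borel_measurable_continuous_onI continuous_moll continuous_moll_grad)+

lemma integrable_moll:
  assumes "\<epsilon> > 0"
  shows "integrable lborel (moll \<epsilon> :: 'a::euclidean_space \<Rightarrow> real)"
  by (rule integrable_bounded_compact_support[where C=1 and S="cball 0 \<epsilon>"])
    (auto simp: moll_nonneg moll_le_1 abs_of_nonneg intro: moll_support[OF assms])

text \<open>On the support |z| \<le> \<epsilon> the factor |z|/\<epsilon>^2 is at most 1/\<epsilon>;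
  the other factor is controlled by \<open>flat_2_bound\<close>.\<close>

lemma moll_grad_bound:
  obtains E where "E > 0" "\<And>\<epsilon> z::'a::euclidean_space. \<epsilon> > 0 \<Longrightarrow> norm (moll_grad \<epsilon> z) \<le> E / \<epsilon>"
proof -
  obtain E where E: "E > 0" "\<And>x. x \<le> 1 \<Longrightarrow> flat 2 x \<le> E" using flat_2_bound by blast
  show thesis
  proof (rule that[of "2 * E"])
    fix \<epsilon> :: real and z :: 'a assume "\<epsilon> > 0"
    show "norm (moll_grad \<epsilon> z) \<le> 2 * E / \<epsilon>"
    proof (cases "z \<in> cball 0 \<epsilon>")
      case True
      have "flat 2 (1 - z \<bullet> z / \<epsilon>\<^sup>2) \<le> E" by (rule E) simp
      then have "norm (moll_grad \<epsilon> z) \<le> (2 / \<epsilon>\<^sup>2 * E) * \<epsilon>"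
        using True \<open>\<epsilon> > 0\<close> flat_nonneg[of 2 "1 - z \<bullet> z / \<epsilon>\<^sup>2"] E(1) unfolding moll_grad_def norm_scaleR
        by (intro mult_mono) (auto simp: abs_mult divide_right_mono)
      then show ?thesis using \<open>\<epsilon> > 0\<close> by (simp add: power2_eq_square)
    next
      case False
      then show ?thesis using moll_support[OF \<open>\<epsilon> > 0\<close> False] E \<open>\<epsilon> > 0\<close> by simp
    qed
  qed (use E in simp)
qed

lemma integrable_moll_grad:
  assumes "\<epsilon> > 0"
  shows "integrable lborel (moll_grad \<epsilon> :: 'a::euclidean_space \<Rightarrow> 'a)"
proof -
  obtain E where E: "\<And>\<epsilon> z::'a. \<epsilon> > 0 \<Longrightarrow> norm (moll_grad \<epsilon> z) \<le> E / \<epsilon>" using moll_grad_bound by blast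
  show ?thesis
    by (rule integrable_bounded_compact_support[OF _ E[OF assms] bounded_cball[of 0 \<epsilon>] moll_support(2)[OF assms]]) auto
qed

text \<open>The mass depends on the dimension of the space, which the type of \<epsilon> does not
  determine; hence the argument of type \<open>itself\<close>.\<close>

definition moll_mass :: "'a::euclidean_space itself \<Rightarrow> real \<Rightarrow> real" where
  "moll_mass _ \<epsilon> = (\<integral>z. moll \<epsilon> (z::'a) \<partial>lborel)"

text \<open>On the ball of half the radius, 1 - |z|^2/\<epsilon>^2 is at least 3/4, and exp(-4/3) is
  the value of \<open>flat 0\<close> at 3/4.\<close>

lemma moll_mass_lower:
  assumes "\<epsilon> > 0"
  shows "moll_mass TYPE('a::euclidean_space) \<epsilon> \<ge> exp (- 4 / 3) * measure lborel (cball (0::'a) (\<epsilon> / 2))"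
proof -
  have "exp (- 4 / 3) * measure lborel (cball (0::'a) (\<epsilon> / 2)) = (\<integral>z. indicator (cball (0::'a) (\<epsilon> / 2)) z * exp (- 4 / 3) \<partial>lborel)"
    by simp
  also have "\<dots> \<le> moll_mass TYPE('a) \<epsilon>"
    unfolding moll_mass_def
  proof (rule integral_mono[OF integrable_indicator_cball integrable_moll[OF assms]])
    fix z :: 'a
    show "indicator (cball 0 (\<epsilon> / 2)) z * exp (- 4 / 3) \<le> moll \<epsilon> z"
    proof (cases "z \<in> cball 0 (\<epsilon> / 2)")
      case True
      then have "norm z ^ 2 \<le> (\<epsilon> / 2) ^ 2" by (intro power_mono) auto
      then have "(z \<bullet> z) / \<epsilon>\<^sup>2 \<le> 1 / 4"
        using assms by (simp add: power2_norm_eq_inner power_divide field_simps)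
      then have y: "1 - (z \<bullet> z) / \<epsilon>\<^sup>2 \<ge> 3 / 4" by simp
      then have pos: "1 - (z \<bullet> z) / \<epsilon>\<^sup>2 > 0" by linarith
      have "inverse (1 - (z \<bullet> z) / \<epsilon>\<^sup>2) \<le> inverse (3 / 4)"
        using y by (intro le_imp_inverse_le) auto
      then have "exp (- 4 / 3) \<le> flat 0 (1 - (z \<bullet> z) / \<epsilon>\<^sup>2)"
        using pos by (simp add: flat_def del: diff_gt_0_iff_gt)
      then show ?thesis using True by (simp add: moll_def)
    qed (simp add: moll_nonneg)
  qed
  finally show ?thesis .
qed

lemma moll_mass_pos:
  assumes "\<epsilon> > 0"
  shows "moll_mass TYPE('a::euclidean_space) \<epsilon> > 0"
proof -
  have "measure lborel (cball (0::'a) (\<epsilon> / 2)) > 0" using assms by (intro content_cball_pos) auto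
  then show ?thesis using moll_mass_lower[OF assms, where 'a='a] by (smt (verit) exp_gt_zero mult_pos_pos)
qed

text \<open>This is scale invariance: |z| times the gradient is bounded by a constant on the ball of
  radius \<epsilon>, whose volume is 2^n times that of the ball of half the radius, and the latter
  volume is bounded by the mass. That A does not depend on \<epsilon> keeps the commutator under
  control as \<epsilon> shrinks.\<close>

lemma moll_grad_moment:
  obtains A where "A > 0" "\<And>\<epsilon>. \<epsilon> > 0 \<Longrightarrow>
    (\<integral>z. norm (z::'a::euclidean_space) * norm (moll_grad \<epsilon> z) \<partial>lborel) \<le> A * moll_mass TYPE('a) \<epsilon>"
proof -
  obtain E where E: "E > 0" "\<And>\<epsilon> z::'a. \<epsilon> > 0 \<Longrightarrow> norm (moll_grad \<epsilon> z) \<le> E / \<epsilon>" using moll_grad_bound by blast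
  show thesis
  proof (rule that[of "E * 2 ^ DIM('a) * exp (4 / 3)"])
    fix \<epsilon> :: real assume e: "\<epsilon> > 0"
    have b: "norm z * norm (moll_grad \<epsilon> z) \<le> indicator (cball 0 \<epsilon>) z * E" for z :: 'a
    proof (cases "z \<in> cball 0 \<epsilon>")
      case True
      then have "norm z * norm (moll_grad \<epsilon> z) \<le> \<epsilon> * (E / \<epsilon>)" using e E by (intro mult_mono) auto
      then show ?thesis using True e by simp
    next
      case False
      then show ?thesis using moll_support[OF e False] by simp
    qed
    have "(\<integral>z. norm (z::'a) * norm (moll_grad \<epsilon> z) \<partial>lborel) \<le> (\<integral>z. indicator (cball (0::'a) \<epsilon>) z * E \<partial>lborel)"
    proof (rule integral_mono[OF _ integrable_indicator_cball b])
      show "integrable lborel (\<lambda>z::'a. norm z * norm (moll_grad \<epsilon> z))"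
        by (rule Bochner_Integration.integrable_bound[OF integrable_indicator_cball[of \<epsilon> E]])
          (use b E in \<open>auto intro!: AE_I2 order_trans[OF b]\<close>)
    qed
    also have "\<dots> = measure lborel (cball (0::'a) \<epsilon>) * E" by simp
    also have "measure lborel (cball (0::'a) \<epsilon>) = 2 ^ DIM('a) * measure lborel (cball (0::'a) (\<epsilon> / 2))"
      using e by (simp add: content_cball power_divide)
    also have "\<dots> * E = (E * 2 ^ DIM('a) * exp (4 / 3)) * (exp (- 4 / 3) * measure lborel (cball (0::'a) (\<epsilon> / 2)))"
      by (simp add: exp_minus)
    also have "\<dots> \<le> (E * 2 ^ DIM('a) * exp (4 / 3)) * moll_mass TYPE('a) \<epsilon>"
      using moll_mass_lower[OF e, where 'a='a] E by (intro mult_left_mono) auto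
    finally show "(\<integral>z. norm (z::'a) * norm (moll_grad \<epsilon> z) \<partial>lborel) \<le> (E * 2 ^ DIM('a) * exp (4 / 3)) * moll_mass TYPE('a) \<epsilon>" .
  qed (use E in simp)
qed

section \<open>The fundamental lemma of the calculus of variations\<close>

text \<open>Comparing g(y) with its vanishing mollification bounds c |g(y)| by an average of |g(y) -
  g(y + z)| over short shifts z. After integration over y and an exchange of integrals, the L^1 norm
  of \<open>g\<close> on the ball is bounded by its L^1 modulus of translation, which is arbitrarily
  small.\<close>

lemma mollified_zero_imp_zero:
  fixes g :: "'a::euclidean_space \<Rightarrow> real"
  assumes g: "integrable lborel g" and "\<rho> > 0"
    and z: "\<And>y \<epsilon>. y \<in> cball p \<rho> \<Longrightarrow> 0 < \<epsilon> \<Longrightarrow> \<epsilon> \<le> \<rho> \<Longrightarrow> (\<integral>x. moll \<epsilon> (x - y) * g x \<partial>lborel) = 0"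
  shows "AE x in lborel. x \<in> cball p \<rho> \<longrightarrow> g x = 0"
proof -
  have [measurable]: "g \<in> borel_measurable borel" using g by simp
  have [measurable]: "cball p \<rho> \<in> sets borel" by simp
  have le: "(\<integral>\<^sup>+y. ennreal \<bar>g y\<bar> * indicator (cball p \<rho>) y \<partial>lborel) \<le> ennreal e" if "e > 0" for e
  proof -
    obtain d where d: "d > 0" "\<And>z. norm z \<le> d \<Longrightarrow> (\<integral>x. \<bar>g x - g (x - z)\<bar> \<partial>lborel) < e"
      using translation_continuous_L1[OF g \<open>e > 0\<close>] by blast
    define \<epsilon> where "\<epsilon> = min d \<rho>"
    have e: "\<epsilon> > 0" "\<epsilon> \<le> \<rho>" "\<epsilon> \<le> d" using d \<open>\<rho> > 0\<close> by (auto simp: \<epsilon>_def)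
    define c where "c = moll_mass TYPE('a) \<epsilon>"
    have c: "c > 0" unfolding c_def by (rule moll_mass_pos[OF e(1)])
    have pt: "ennreal (c * \<bar>g y\<bar>) \<le> (\<integral>\<^sup>+z. ennreal (moll \<epsilon> z * \<bar>g y - g (y + z)\<bar>) \<partial>lborel)" if y: "y \<in> cball p \<rho>" for y
    proof -
      have gi: "integrable lborel (\<lambda>z. g (y + z))"
        using integral_translation(2)[of g "- y"] g by (simp add: add.commute)
      have i1: "integrable lborel (\<lambda>z. moll \<epsilon> z * g (y + z))"
        by (rule Bochner_Integration.integrable_bound[OF gi])
          (auto intro!: AE_I2 mult_left_le_one_le simp: abs_mult moll_nonneg moll_le_1)
      have i2: "integrable lborel (\<lambda>z::'a. moll \<epsilon> z * g y)"
        using integrable_moll[OF e(1), where 'a='a] by simp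
      have "(\<integral>z. moll \<epsilon> z * g (y + z) \<partial>lborel) = (\<integral>x. moll \<epsilon> (x - y) * g x \<partial>lborel)"
        using integral_translation(1)[of "\<lambda>z. moll \<epsilon> z * g (y + z)" y] by simp
      then have 0: "(\<integral>z. moll \<epsilon> z * g (y + z) \<partial>lborel) = 0" using z[OF y e(1,2)] by simp
      have "c * g y = (\<integral>z. moll \<epsilon> (z::'a) * g y \<partial>lborel) - (\<integral>z. moll \<epsilon> z * g (y + z) \<partial>lborel)"
        unfolding 0 c_def moll_mass_def by simp
      also have "\<dots> = (\<integral>z. moll \<epsilon> z * (g y - g (y + z)) \<partial>lborel)"
        using i1 i2 by (simp add: right_diff_distrib)
      finally have "c * \<bar>g y\<bar> = \<bar>\<integral>z. moll \<epsilon> z * (g y - g (y + z)) \<partial>lborel\<bar>"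
        using c by (metis abs_mult abs_of_pos)
      also have "\<dots> \<le> (\<integral>z. \<bar>moll \<epsilon> z * (g y - g (y + z))\<bar> \<partial>lborel)"
        by (rule integral_abs_bound)
      also have "\<dots> = (\<integral>z. moll \<epsilon> z * \<bar>g y - g (y + z)\<bar> \<partial>lborel)"
        by (simp add: abs_mult moll_nonneg)
      finally have "ennreal (c * \<bar>g y\<bar>) \<le> ennreal (\<integral>z. moll \<epsilon> z * \<bar>g y - g (y + z)\<bar> \<partial>lborel)"
        by (rule ennreal_leI)
      also have "\<dots> = (\<integral>\<^sup>+z. ennreal (moll \<epsilon> z * \<bar>g y - g (y + z)\<bar>) \<partial>lborel)"
      proof (rule nn_integral_eq_integral[symmetric])
        have "integrable lborel (\<lambda>z. \<bar>moll \<epsilon> z * g y - moll \<epsilon> z * g (y + z)\<bar>)" using i1 i2 by simp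
        then show "integrable lborel (\<lambda>z. moll \<epsilon> z * \<bar>g y - g (y + z)\<bar>)"
          by (simp add: right_diff_distrib[symmetric] abs_mult moll_nonneg)
      qed (simp add: moll_nonneg)
      finally show ?thesis .
    qed
    have inner: "(\<integral>\<^sup>+y. ennreal \<bar>g y - g (y + z)\<bar> \<partial>lborel) \<le> ennreal e" if "moll \<epsilon> z \<noteq> 0" for z :: 'a
    proof -
      have "norm (- z) \<le> d" using that moll_support(1)[OF e(1), of z] e by force
      then have l: "(\<integral>x. \<bar>g x - g (x + z)\<bar> \<partial>lborel) < e" using d(2)[of "- z"] by simp
      have "integrable lborel (\<lambda>x. g (x + z))" using integral_translation(2)[of g "- z"] g by simp
      then have "(\<integral>\<^sup>+y. ennreal \<bar>g y - g (y + z)\<bar> \<partial>lborel) = ennreal (\<integral>x. \<bar>g x - g (x + z)\<bar> \<partial>lborel)"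
        using g by (intro nn_integral_eq_integral) auto
      then show ?thesis using l by (simp add: ennreal_leI)
    qed
    have "ennreal c * (\<integral>\<^sup>+y. ennreal \<bar>g y\<bar> * indicator (cball p \<rho>) y \<partial>lborel)
        = (\<integral>\<^sup>+y. ennreal (c * \<bar>g y\<bar>) * indicator (cball p \<rho>) y \<partial>lborel)"
      using c by (subst nn_integral_cmult[symmetric]) (auto simp: ennreal_mult mult.assoc)
    also have "\<dots> \<le> (\<integral>\<^sup>+y. \<integral>\<^sup>+z. ennreal (moll \<epsilon> z * \<bar>g y - g (y + z)\<bar>) \<partial>lborel \<partial>lborel)"
      by (intro nn_integral_mono) (use pt in \<open>auto simp: indicator_def\<close>)
    also have "\<dots> = (\<integral>\<^sup>+z. \<integral>\<^sup>+y. ennreal (moll \<epsilon> z * \<bar>g y - g (y + z)\<bar>) \<partial>lborel \<partial>lborel)"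
      by (rule lborel_pair.Fubini') measurable
    also have "\<dots> = (\<integral>\<^sup>+z. ennreal (moll \<epsilon> z) * (\<integral>\<^sup>+y. ennreal \<bar>g y - g (y + z)\<bar> \<partial>lborel) \<partial>lborel)"
      by (intro nn_integral_cong) (simp add: ennreal_mult moll_nonneg nn_integral_cmult)
    also have "\<dots> \<le> (\<integral>\<^sup>+z. ennreal (moll \<epsilon> (z::'a)) * ennreal e \<partial>lborel)"
    proof (rule nn_integral_mono)
      fix z :: 'a
      show "ennreal (moll \<epsilon> z) * (\<integral>\<^sup>+y. ennreal \<bar>g y - g (y + z)\<bar> \<partial>lborel) \<le> ennreal (moll \<epsilon> z) * ennreal e"
        using inner[of z] by (cases "moll \<epsilon> z = 0") (auto intro: mult_left_mono)
    qed
    also have "\<dots> = ennreal c * ennreal e"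
      unfolding c_def moll_mass_def
      by (subst nn_integral_multc) (auto simp: nn_integral_eq_integral[OF integrable_moll[OF e(1)]] moll_nonneg)
    finally show ?thesis using c by (simp add: ennreal_mult_le_mult_iff)
  qed
  have "(\<integral>\<^sup>+y. ennreal \<bar>g y\<bar> * indicator (cball p \<rho>) y \<partial>lborel) \<le> 0"
    by (rule ennreal_le_epsilon) (use le in auto)
  then have "AE y in lborel. ennreal \<bar>g y\<bar> * indicator (cball p \<rho>) y = 0"
    by (subst nn_integral_0_iff_AE[symmetric]) auto
  then show ?thesis by eventually_elim (auto simp: indicator_def)
qed

text \<open>Near a point \<open>g\<close> is restricted to a closed ball K of radius r, where it is
  integrable; mollifiers of radius at most r/2 centred within r/2 of the point are supported in K
  and so are test functions. Countably many such neighbourhoods cover \<open>S\<close>.\<close>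

lemma L1loc_test_zero:
  fixes g :: "'a::euclidean_space \<Rightarrow> real"
  assumes S: "open S" and g: "in_L1loc S g"
    and z: "\<And>\<psi>. test_fun S \<psi> \<Longrightarrow> (\<integral>x. \<psi> x * g x \<partial>lebesgue_on S) = 0"
  shows "AE x in lebesgue_on S. g x = 0"
proof -
  have "\<exists>\<rho>>0. AE x in lborel. x \<in> ball p \<rho> \<longrightarrow> g x = 0" if "p \<in> S" for p
  proof -
    obtain r where r: "r > 0" "cball p r \<subseteq> S" using S \<open>p \<in> S\<close> open_contains_cball by blast
    define K where "K = cball p r"
    have K: "compact K" "K \<subseteq> S" "K \<in> sets lebesgue" using r by (auto simp: K_def)
    have iK: "integrable lebesgue (\<lambda>x. indicator K x *\<^sub>R g x)"
      using g K(1,2) integrable_lebesgue_on(1)[OF K(3), of g] unfolding in_L1loc_def by blast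
    then obtain g' where g': "g' \<in> borel_measurable borel" "AE x in lborel. indicator K x *\<^sub>R g x = g' x"
      using lebesgue_ex_borel[of "\<lambda>x. indicator K x *\<^sub>R g x"] by auto
    have ig': "integrable lborel g'"
      using lebesgue_integral_borel_rep(2)[OF _ g'] iK by auto
    have "AE x in lborel. x \<in> cball p (r / 2) \<longrightarrow> g' x = 0"
    proof (rule mollified_zero_imp_zero[OF ig'])
      fix y \<epsilon> assume y: "y \<in> cball p (r / 2)" and e: "0 < \<epsilon>" "\<epsilon> \<le> r / 2"
      have sub: "cball y \<epsilon> \<subseteq> K"
      proof
        fix x assume "x \<in> cball y \<epsilon>"
        then show "x \<in> K" using y e dist_triangle[of p x y] by (auto simp: K_def)
      qed
      have m0: "moll \<epsilon> (x - y) = 0" if "x \<notin> K" for x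
      proof (rule moll_support(1)[OF e(1)])
        have "x \<notin> cball y \<epsilon>" using that sub by blast
        then show "x - y \<notin> cball 0 \<epsilon>" by (simp add: dist_norm norm_minus_commute)
      qed
      have "test_fun S (\<lambda>x. moll \<epsilon> (x - y))"
        using sub K e by (intro moll_shift_test) auto
      then have "0 = (\<integral>x. moll \<epsilon> (x - y) * g x \<partial>lebesgue_on S)" by (rule z[symmetric])
      also have "\<dots> = (\<integral>x. indicator S x *\<^sub>R (moll \<epsilon> (x - y) * g x) \<partial>lebesgue)"
        by (rule integrable_lebesgue_on(2)[OF open_sets_lebesgue[OF S]])
      also have "(\<lambda>x. indicator S x *\<^sub>R (moll \<epsilon> (x - y) * g x)) = (\<lambda>x. moll \<epsilon> (x - y) * (indicator K x *\<^sub>R g x))"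
        using K m0 by (auto simp: fun_eq_iff indicator_def)
      also have "(\<integral>x. moll \<epsilon> (x - y) * (indicator K x *\<^sub>R g x) \<partial>lebesgue) = (\<integral>x. moll \<epsilon> (x - y) * g' x \<partial>lborel)"
      proof (rule lebesgue_integral_borel_rep(1))
        have "(\<lambda>x. moll \<epsilon> (x - y)) \<in> borel_measurable lebesgue"
          by (rule measurable_completion) simp
        then show "(\<lambda>x. moll \<epsilon> (x - y) * (indicator K x *\<^sub>R g x)) \<in> borel_measurable lebesgue"
          using iK by (intro borel_measurable_times) auto
      qed (use g' in auto)
      finally show "(\<integral>x. moll \<epsilon> (x - y) * g' x \<partial>lborel) = 0" by simp
    qed (use r in simp)
    with g'(2) have "AE x in lborel. x \<in> ball p (r / 2) \<longrightarrow> g x = 0"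
      by eventually_elim (use r in \<open>auto simp: K_def indicator_def split: if_splits\<close>)
    then show ?thesis using r by (intro exI[of _ "r / 2"]) auto
  qed
  then obtain \<rho> where \<rho>: "\<And>p. p \<in> S \<Longrightarrow> \<rho> p > 0" "\<And>p. p \<in> S \<Longrightarrow> AE x in lborel. x \<in> ball p (\<rho> p) \<longrightarrow> g x = 0"
    by metis
  obtain F where F: "F \<subseteq> (\<lambda>p. ball p (\<rho> p)) ` S" "countable F" "\<Union>F = \<Union>((\<lambda>p. ball p (\<rho> p)) ` S)"
    by (rule Lindelof[of "(\<lambda>p. ball p (\<rho> p)) ` S"]) auto
  have "AE x in lborel. \<forall>B\<in>F. x \<in> B \<longrightarrow> g x = 0"
    unfolding AE_ball_countable[OF F(2)] using F(1) \<rho>(2) by auto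
  then have "AE x in lborel. x \<in> S \<longrightarrow> g x = 0"
  proof eventually_elim
    case (elim x)
    have "x \<in> \<Union>F" if "x \<in> S" unfolding F(3) using \<rho>(1) that by (intro UN_I[OF that]) auto
    then show ?case using elim by auto
  qed
  then show ?thesis using integrable_lebesgue_on(4)[OF open_sets_lebesgue[OF S]] by blast
qed

text \<open>\<open>weak_pderiv\<close> is an arbitrary choice, so whatever is known of one weak
  derivative has to be transferred to the chosen one; uniqueness almost everywhere permits
  this.\<close>

lemma weak_pderiv_unique:
  fixes g :: "'a::euclidean_space \<Rightarrow> 'b::euclidean_space"
  assumes S: "open S" and v: "has_weak_pderiv S i g v" and w: "has_weak_pderiv S i g w"
  shows "AE x in lebesgue_on S. v x = w x"
proof -
  have L: "in_L1loc S v" "in_L1loc S w" using v w by (auto simp: has_weak_pderiv_def)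
  have "AE x in lebesgue_on S. (v x - w x) \<bullet> b = 0" if "b \<in> Basis" for b
  proof (rule L1loc_test_zero[OF S])
    show "in_L1loc S (\<lambda>x. (v x - w x) \<bullet> b)"
      using L unfolding in_L1loc_def by (auto intro!: integrable_inner_left)
    fix \<psi> :: "'a \<Rightarrow> real" assume \<psi>: "test_fun S \<psi>"
    obtain K where K: "compact K" "K \<subseteq> S" "\<And>x. x \<notin> K \<Longrightarrow> \<psi> x = 0"
      by (rule test_fun_compactE[OF \<psi>]) blast
    have c: "continuous_on UNIV \<psi>" using \<psi> by (simp add: test_fun_def smooth_fun_on_continuous)
    have iv: "integrable (lebesgue_on S) (\<lambda>x. \<psi> x *\<^sub>R v x)" and iw: "integrable (lebesgue_on S) (\<lambda>x. \<psi> x *\<^sub>R w x)"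
      using integrable_test_scaleR[OF S K c] L by auto
    have "(\<integral>x. \<psi> x *\<^sub>R v x \<partial>lebesgue_on S) = (\<integral>x. \<psi> x *\<^sub>R w x \<partial>lebesgue_on S)"
      using v w \<psi> unfolding has_weak_pderiv_def by (metis neg_equal_iff_equal)
    then have "0 = ((\<integral>x. \<psi> x *\<^sub>R v x \<partial>lebesgue_on S) - (\<integral>x. \<psi> x *\<^sub>R w x \<partial>lebesgue_on S)) \<bullet> b" by simp
    also have "\<dots> = (\<integral>x. (\<psi> x *\<^sub>R v x - \<psi> x *\<^sub>R w x) \<bullet> b \<partial>lebesgue_on S)"
      using iv iw by simp
    also have "\<dots> = (\<integral>x. \<psi> x * ((v x - w x) \<bullet> b) \<partial>lebesgue_on S)"
      by (simp add: inner_diff_left right_diff_distrib)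
    finally show "(\<integral>x. \<psi> x * ((v x - w x) \<bullet> b) \<partial>lebesgue_on S) = 0" by simp
  qed
  then have "AE x in lebesgue_on S. \<forall>b\<in>Basis. (v x - w x) \<bullet> b = 0"
    by (intro AE_finite_allI) auto
  then show ?thesis
    by eventually_elim (metis euclidean_all_zero_iff right_minus_eq)
qed

section \<open>Translation estimates for Sobolev functions vanishing on the boundary\<close>

lemma smooth_difference_eq_integral:
  fixes \<phi> :: "'a::euclidean_space \<Rightarrow> 'b::euclidean_space"
  assumes "smooth_fun_on UNIV \<phi>"
  shows "\<phi> x - \<phi> (x - z) =
    (\<integral>\<theta>. indicator {0..1} \<theta> *\<^sub>R (\<Sum>i\<in>Basis. (z \<bullet> i) *\<^sub>R pderiv_dir i \<phi> (x - \<theta> *\<^sub>R z)) \<partial>lborel)"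
proof -
  \<comment> \<open>The path x - \<theta> z runs backwards, hence the sign: F 1 - F 0 is \<phi> x -
    \<phi> (x - z).\<close>
  define F where "F \<theta> = - \<phi> (x - \<theta> *\<^sub>R z)" for \<theta> :: real
  have d: "\<phi> differentiable (at y)" for y using smooth_fun_on_diff[OF assms] by auto
  have e: "frechet_derivative \<phi> (at y) z = (\<Sum>i\<in>Basis. (z \<bullet> i) *\<^sub>R pderiv_dir i \<phi> y)" for y
    using d by (rule frechet_derivative_Basis_sum)
  have "(F has_vector_derivative (\<Sum>i\<in>Basis. (z \<bullet> i) *\<^sub>R pderiv_dir i \<phi> (x - \<theta> *\<^sub>R z))) (at \<theta> within {0..1})" for \<theta>
  proof -
    have lin: "linear (frechet_derivative \<phi> (at (x - \<theta> *\<^sub>R z)))" using d linear_frechet_derivative by blast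
    have "((\<lambda>\<theta>. x - \<theta> *\<^sub>R z) has_derivative (\<lambda>h. - (h *\<^sub>R z))) (at \<theta> within {0..1})"
      by (auto intro!: derivative_eq_intros)
    then have "((\<lambda>\<theta>. \<phi> (x - \<theta> *\<^sub>R z)) has_derivative (\<lambda>h. frechet_derivative \<phi> (at (x - \<theta> *\<^sub>R z)) (- (h *\<^sub>R z)))) (at \<theta> within {0..1})"
      using d by (intro has_derivative_compose[of "\<lambda>\<theta>. x - \<theta> *\<^sub>R z" _ _ _ \<phi>]) (auto simp: frechet_derivative_works)
    then have "((\<lambda>\<theta>. - \<phi> (x - \<theta> *\<^sub>R z)) has_derivative (\<lambda>h. - frechet_derivative \<phi> (at (x - \<theta> *\<^sub>R z)) (- (h *\<^sub>R z)))) (at \<theta> within {0..1})"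
      by (rule has_derivative_minus)
    then show ?thesis
      unfolding has_vector_derivative_def F_def e[symmetric] linear_neg[OF lin] linear_cmul[OF lin] by simp
  qed
  then have "(\<integral>\<theta>. indicator {0..1} \<theta> *\<^sub>R (\<Sum>i\<in>Basis. (z \<bullet> i) *\<^sub>R pderiv_dir i \<phi> (x - \<theta> *\<^sub>R z)) \<partial>lborel) = F 1 - F 0"
    by (intro integral_FTC_atLeastAtMost)
      (auto intro!: continuous_intros continuous_on_compose2[OF smooth_fun_on_continuous[OF smooth_fun_on_pderiv[OF assms]]])
  then show ?thesis by (simp add: F_def)
qed

lemma borel_measurable_smooth: "smooth_fun_on UNIV \<phi> \<Longrightarrow> \<phi> \<in> borel_measurable borel"
  for \<phi> :: "'a::euclidean_space \<Rightarrow> 'b::euclidean_space"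
  by (intro borel_measurable_continuous_onI smooth_fun_on_continuous)

lemma test_fun_pderiv:
  assumes "test_fun S \<phi>" "i \<in> Basis"
  shows "test_fun S (pderiv_dir i \<phi>)"
proof -
  obtain K where K: "compact K" "K \<subseteq> S" "\<And>x. x \<notin> K \<Longrightarrow> \<phi> x = 0"
    by (rule test_fun_compactE[OF assms(1)]) blast
  have "pderiv_dir i \<phi> x = 0" if "x \<notin> K" for x
  proof -
    have "((\<lambda>x. 0) has_derivative (\<lambda>v. 0)) (at x)" by simp
    then have "(\<phi> has_derivative (\<lambda>v. 0)) (at x)"
      by (rule has_derivative_transform_within_open[where s="-K"]) (use K that compact_imp_closed in auto)
    then show ?thesis by (rule pderiv_dir_eq)
  qed
  then show ?thesis
    using assms K by (intro test_funI[of _ K]) (auto simp: test_fun_def intro: smooth_fun_on_pderiv)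
qed

lemma test_fun_bounded:
  fixes \<phi> :: "'a::euclidean_space \<Rightarrow> 'b::euclidean_space"
  assumes "test_fun S \<phi>"
  obtains B M where "\<And>x. norm (\<phi> x) \<le> B" "\<And>x. x \<notin> cball 0 M \<Longrightarrow> \<phi> x = 0" "B \<ge> 0" "M \<ge> 0"
proof -
  obtain K where K: "compact K" "K \<subseteq> S" "\<And>x. x \<notin> K \<Longrightarrow> \<phi> x = 0"
    by (rule test_fun_compactE[OF assms(1)]) blast
  have c: "continuous_on K \<phi>"
    using assms smooth_fun_on_continuous continuous_on_subset unfolding test_fun_def by blast
  obtain B where B: "\<And>x. x \<in> K \<Longrightarrow> norm (\<phi> x) \<le> B"
    using compact_imp_bounded[OF compact_continuous_image[OF c K(1)]] by (auto simp: bounded_iff)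
  obtain M where M: "\<And>x. x \<in> K \<Longrightarrow> norm x \<le> M"
    using compact_imp_bounded[OF K(1)] by (auto simp: bounded_iff)
  show thesis
  proof (rule that[of "max B 0" "max M 0"])
    show "norm (\<phi> x) \<le> max B 0" for x using B[of x] K(3)[of x] by (cases "x \<in> K") auto
    show "\<phi> x = 0" if "x \<notin> cball 0 (max M 0)" for x using M[of x] K(3)[of x] that by (cases "x \<in> K") auto
  qed auto
qed

lemma test_fun_integrable:
  fixes \<phi> :: "'a::euclidean_space \<Rightarrow> 'b::euclidean_space"
  assumes "test_fun S \<phi>"
  shows "integrable lborel \<phi>" "integrable lborel (\<lambda>x. (norm (\<phi> x))\<^sup>2)"
proof -
  obtain B M where B: "\<And>x. norm (\<phi> x) \<le> B" "\<And>x. x \<notin> cball 0 M \<Longrightarrow> \<phi> x = 0" by (rule test_fun_bounded[OF assms]) blast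
  have m[measurable]: "\<phi> \<in> borel_measurable borel" using assms by (simp add: test_fun_def borel_measurable_smooth)
  show "integrable lborel \<phi>"
    by (rule integrable_bounded_compact_support[OF m B(1) bounded_cball B(2)])
  show "integrable lborel (\<lambda>x. (norm (\<phi> x))\<^sup>2)"
    by (rule integrable_bounded_compact_support[where C="B\<^sup>2" and S="cball 0 M"])
      (use B in \<open>auto intro: power_mono\<close>)
qed

text \<open>Translation invariance does the work of integration by parts: h(x) - h(x - i) has
  integral zero, and it is the average over \<theta> in [0,1] of the derivative at x - \<theta> i,
  whose integral in x does not depend on \<theta>.\<close>

lemma integral_pderiv_test_fun:
  fixes h :: "'a::euclidean_space \<Rightarrow> 'b::euclidean_space"
  assumes h: "test_fun UNIV h" and i: "i \<in> Basis"
  shows "(\<integral>x. pderiv_dir i h x \<partial>lborel) = 0"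
proof -
  have sm: "smooth_fun_on UNIV h" using h by (simp add: test_fun_def)
  let ?p = "pderiv_dir i h"
  have tp: "test_fun UNIV ?p" by (rule test_fun_pderiv[OF h i])
  have [measurable]: "?p \<in> borel_measurable borel" "h \<in> borel_measurable borel"
    using tp h by (simp_all add: test_fun_def borel_measurable_smooth)
  obtain B M where B: "\<And>x. norm (?p x) \<le> B" "\<And>x. x \<notin> cball 0 M \<Longrightarrow> ?p x = 0" "B \<ge> 0" "M \<ge> 0"
    by (rule test_fun_bounded[OF tp]) blast
  have ne: "norm i = 1" using i by simp
  have line: "h x - h (x - i) = (\<integral>\<theta>. indicator {0..1} \<theta> *\<^sub>R ?p (x - \<theta> *\<^sub>R i) \<partial>lborel)" for x
  proof -
    have "(\<Sum>j\<in>Basis. (i \<bullet> j) *\<^sub>R pderiv_dir j h y) = ?p y" for y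
      using i by (subst sum.cong[OF refl, of _ _ "\<lambda>j. if j = i then ?p y else 0"]) (auto simp: inner_Basis)
    then show ?thesis using smooth_difference_eq_integral[OF sm, of x i] by simp
  qed
  have int: "integrable (lborel \<Otimes>\<^sub>M lborel) (\<lambda>(x, \<theta>). indicator {0..1} \<theta> *\<^sub>R ?p (x - \<theta> *\<^sub>R i))"
    unfolding lborel_prod
  \<comment> \<open>Shifts of length at most 1 enlarge the support from radius M to M + 1.\<close>
  proof (rule integrable_bounded_compact_support[where C=B and S="cball 0 (M + 1) \<times> {0..1}"])
    show "(\<lambda>(x, \<theta>). indicator {0..1} \<theta> *\<^sub>R ?p (x - \<theta> *\<^sub>R i)) \<in> borel_measurable borel"
      unfolding borel_prod[symmetric] by measurable
    show "norm (case y of (x, \<theta>) \<Rightarrow> indicator {0..1} \<theta> *\<^sub>R ?p (x - \<theta> *\<^sub>R i)) \<le> B" for y :: "'a \<times> real"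
      using B by (auto simp: indicator_def split: prod.splits)
    show "bounded (cball (0::'a) (M + 1) \<times> {0..1::real})" by (intro bounded_Times) auto
    show "(case y of (x, \<theta>) \<Rightarrow> indicator {0..1} \<theta> *\<^sub>R ?p (x - \<theta> *\<^sub>R i)) = 0"
      if "y \<notin> cball 0 (M + 1) \<times> {0..1}" for y :: "'a \<times> real"
    proof (cases y)
      case (Pair x \<theta>)
      show ?thesis
      proof (cases "\<theta> \<in> {0..1}")
        case True
        then have "norm x > M + 1" using that Pair by auto
        moreover have "norm x \<le> norm (x - \<theta> *\<^sub>R i) + norm (\<theta> *\<^sub>R i)" by (metis diff_add_cancel norm_triangle_ineq)
        ultimately have "norm (x - \<theta> *\<^sub>R i) > M" using True ne by auto
        then show ?thesis using B(2) Pair by auto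
      qed (simp add: Pair)
    qed
  qed
  have "0 = (\<integral>x. h x - h (x - i) \<partial>lborel)"
    using integral_translation[of h i] test_fun_integrable(1)[OF h] by simp
  also have "\<dots> = (\<integral>x. \<integral>\<theta>. indicator {0..1} \<theta> *\<^sub>R ?p (x - \<theta> *\<^sub>R i) \<partial>lborel \<partial>lborel)"
    by (simp only: line)
  also have "\<dots> = (\<integral>\<theta>. \<integral>x. indicator {0..1} \<theta> *\<^sub>R ?p (x - \<theta> *\<^sub>R i) \<partial>lborel \<partial>lborel)"
    by (rule lborel_pair.Fubini_integral[OF int, symmetric])
  also have "\<dots> = (\<integral>\<theta>. indicator {0..1::real} \<theta> *\<^sub>R (\<integral>x. ?p x \<partial>lborel) \<partial>lborel)"
    by (simp add: integral_translation)
  also have "\<dots> = (\<integral>x. ?p x \<partial>lborel)" by simp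
  finally show ?thesis by simp
qed

lemma pderiv_dir_scaleR:
  assumes "(\<psi>::'a::euclidean_space \<Rightarrow> real) differentiable (at x)" "\<phi> differentiable (at x)"
  shows "pderiv_dir i (\<lambda>x. \<psi> x *\<^sub>R \<phi> x) x = \<psi> x *\<^sub>R pderiv_dir i \<phi> x + pderiv_dir i \<psi> x *\<^sub>R \<phi> x"
  using pderiv_dir_eq[OF has_derivative_scaleR[OF assms[unfolded frechet_derivative_works]]]
  by (simp add: pderiv_dir_def)

lemma smooth_fun_on_scaleR:
  fixes \<psi> :: "'a::euclidean_space \<Rightarrow> real"
  shows "open S \<Longrightarrow> smooth_fun_on S \<psi> \<Longrightarrow> smooth_fun_on S \<phi> \<Longrightarrow> smooth_fun_on S (\<lambda>x. \<psi> x *\<^sub>R \<phi> x)"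
  by (simp add: smooth_fun_on_def Ck_on_scaleR)

lemma in_L1loc_continuous:
  fixes \<phi> :: "'a::euclidean_space \<Rightarrow> 'b::euclidean_space"
  assumes "continuous_on UNIV \<phi>"
  shows "in_L1loc S \<phi>"
  unfolding in_L1loc_def
proof safe
  fix K :: "'a set" assume K: "compact K"
  have m: "\<phi> \<in> borel_measurable borel" by (rule borel_measurable_continuous_onI[OF assms])
  have KB: "K \<in> sets borel" using K compact_imp_closed borel_closed by blast
  have "integrable lborel (\<lambda>x. indicator K x *\<^sub>R \<phi> x)"
    by (rule borel_integrable_compact[OF K continuous_on_subset[OF assms]]) auto
  then have "integrable lebesgue (\<lambda>x. indicator K x *\<^sub>R \<phi> x)"
    using m KB by (subst integrable_completion) auto
  then show "integrable (lebesgue_on K) \<phi>"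
    using KB integrable_lebesgue_on(1)[of K \<phi>] by auto
qed

text \<open>This is \<open>integral_pderiv_test_fun\<close> for the product \<psi> \<phi>. All terms
  vanish off \<open>S\<close>, so integrals over \<open>S\<close> and over the whole space
  agree.\<close>

lemma has_weak_pderiv_test_fun:
  fixes \<phi> :: "'a::euclidean_space \<Rightarrow> 'b::euclidean_space"
  assumes S: "open S" and \<phi>: "test_fun S \<phi>" and i: "i \<in> Basis"
  shows "has_weak_pderiv S i \<phi> (pderiv_dir i \<phi>)"
  unfolding has_weak_pderiv_def
proof (intro conjI allI impI)
  have tp: "test_fun S (pderiv_dir i \<phi>)" by (rule test_fun_pderiv[OF \<phi> i])
  have sm: "smooth_fun_on UNIV \<phi>" "smooth_fun_on UNIV (pderiv_dir i \<phi>)" using \<phi> tp by (auto simp: test_fun_def)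
  show "in_L1loc S \<phi>" "in_L1loc S (pderiv_dir i \<phi>)"
    by (intro in_L1loc_continuous smooth_fun_on_continuous sm)+
  fix \<psi> :: "'a \<Rightarrow> real" assume \<psi>: "test_fun S \<psi>"
  have sp: "smooth_fun_on UNIV \<psi>" using \<psi> by (simp add: test_fun_def)
  have tpp: "test_fun S (pderiv_dir i \<psi>)" by (rule test_fun_pderiv[OF \<psi> i])
  obtain K where K: "compact K" "K \<subseteq> S" "\<And>x. x \<notin> K \<Longrightarrow> \<psi> x = 0"
    by (rule test_fun_compactE[OF \<psi>]) blast
  obtain K' where K': "compact K'" "K' \<subseteq> S" "\<And>x. x \<notin> K' \<Longrightarrow> pderiv_dir i \<psi> x = 0"
    by (rule test_fun_compactE[OF tpp]) blast
  have tprod: "test_fun UNIV (\<lambda>x. \<psi> x *\<^sub>R \<phi> x)"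
    by (rule test_funI[of _ K]) (use K sp sm in \<open>auto intro!: smooth_fun_on_scaleR\<close>)
  have t1: "test_fun UNIV (\<lambda>x. \<psi> x *\<^sub>R pderiv_dir i \<phi> x)"
    by (rule test_funI[of _ K]) (use K sp sm in \<open>auto intro!: smooth_fun_on_scaleR\<close>)
  have t2: "test_fun UNIV (\<lambda>x. pderiv_dir i \<psi> x *\<^sub>R \<phi> x)"
    by (rule test_funI[of _ K']) (use K' tpp sm in \<open>auto simp: test_fun_def intro!: smooth_fun_on_scaleR\<close>)
  have conv: "(\<integral>x. g x \<partial>lebesgue_on S) = (\<integral>x. g x \<partial>lborel)"
    if "smooth_fun_on UNIV g" "\<And>x. x \<notin> S \<Longrightarrow> g x = 0" for g :: "'a \<Rightarrow> 'b"
  proof -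
    have "(\<lambda>x. indicator S x *\<^sub>R g x) = g" using that by (auto simp: indicator_def fun_eq_iff)
    then show ?thesis
      using integrable_lebesgue_on(2)[OF open_sets_lebesgue[OF S], of g] that
      by (simp add: integral_completion borel_measurable_smooth)
  qed
  have "0 = (\<integral>x. pderiv_dir i (\<lambda>x. \<psi> x *\<^sub>R \<phi> x) x \<partial>lborel)"
    by (rule integral_pderiv_test_fun[OF tprod i, symmetric])
  also have "\<dots> = (\<integral>x. \<psi> x *\<^sub>R pderiv_dir i \<phi> x + pderiv_dir i \<psi> x *\<^sub>R \<phi> x \<partial>lborel)"
    using smooth_fun_on_diff[OF sp] smooth_fun_on_diff[OF sm(1)] by (simp add: pderiv_dir_scaleR)
  also have "\<dots> = (\<integral>x. \<psi> x *\<^sub>R pderiv_dir i \<phi> x \<partial>lborel) + (\<integral>x. pderiv_dir i \<psi> x *\<^sub>R \<phi> x \<partial>lborel)"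
    by (rule Bochner_Integration.integral_add[OF test_fun_integrable(1)[OF t1] test_fun_integrable(1)[OF t2]])
  also have "(\<integral>x. \<psi> x *\<^sub>R pderiv_dir i \<phi> x \<partial>lborel) = (\<integral>x. \<psi> x *\<^sub>R pderiv_dir i \<phi> x \<partial>lebesgue_on S)"
    by (rule conv[symmetric]) (use t1 K in \<open>auto simp: test_fun_def\<close>)
  also have "(\<integral>x. pderiv_dir i \<psi> x *\<^sub>R \<phi> x \<partial>lborel) = (\<integral>x. pderiv_dir i \<psi> x *\<^sub>R \<phi> x \<partial>lebesgue_on S)"
    by (rule conv[symmetric]) (use t2 K' in \<open>auto simp: test_fun_def\<close>)
  finally show "(\<integral>x. pderiv_dir i \<psi> x *\<^sub>R \<phi> x \<partial>lebesgue_on S) = - (\<integral>x. \<psi> x *\<^sub>R pderiv_dir i \<phi> x \<partial>lebesgue_on S)"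
    by (simp add: eq_neg_iff_add_eq_0 add.commute)
qed

lemma norm_sum_Basis_le:
  fixes p :: "'a::euclidean_space \<Rightarrow> 'b::real_normed_vector"
  shows "(norm (\<Sum>i\<in>Basis. (z \<bullet> i) *\<^sub>R p i))\<^sup>2 \<le> (norm z)\<^sup>2 * (\<Sum>i\<in>Basis. (norm (p i))\<^sup>2)"
proof -
  have "norm (\<Sum>i\<in>Basis. (z \<bullet> i) *\<^sub>R p i) \<le> (\<Sum>i\<in>Basis. \<bar>z \<bullet> i\<bar> * norm (p i))"
    by (rule order_trans[OF norm_sum]) simp
  then have "(norm (\<Sum>i\<in>Basis. (z \<bullet> i) *\<^sub>R p i))\<^sup>2 \<le> (\<Sum>i\<in>Basis. \<bar>z \<bullet> i\<bar> * norm (p i))\<^sup>2"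
    by (rule power_mono) simp
  also have "\<dots> \<le> (\<Sum>i\<in>Basis. \<bar>z \<bullet> i\<bar>\<^sup>2) * (\<Sum>i\<in>Basis. (norm (p i))\<^sup>2)"
    by (rule Cauchy_Schwarz_ineq_sum)
  also have "(\<Sum>i\<in>Basis. \<bar>z \<bullet> i\<bar>\<^sup>2) = (norm z)\<^sup>2"
    unfolding power2_norm_eq_inner by (subst euclidean_inner) (simp add: power2_eq_square)
  finally show ?thesis .
qed

text \<open>The increment is an average of directional derivatives along a segment, so its square is
  at most the average of their squares; Tonelli and translation invariance then remove the
  shift.\<close>

lemma test_fun_translation_L2:
  fixes \<phi> :: "'a::euclidean_space \<Rightarrow> 'b::euclidean_space"
  assumes \<phi>: "test_fun S \<phi>"
  shows "(\<integral>x. (norm (\<phi> x - \<phi> (x - z)))\<^sup>2 \<partial>lborel) \<le>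
    (norm z)\<^sup>2 * (\<Sum>i\<in>Basis. \<integral>x. (norm (pderiv_dir i \<phi> x))\<^sup>2 \<partial>lborel)"
proof -
  have sm: "smooth_fun_on UNIV \<phi>" using \<phi> by (simp add: test_fun_def)
  have [measurable]: "\<phi> \<in> borel_measurable borel" by (rule borel_measurable_smooth[OF sm])
  have pm[measurable]: "i \<in> Basis \<Longrightarrow> pderiv_dir i \<phi> \<in> borel_measurable borel" for i
    by (intro borel_measurable_smooth smooth_fun_on_pderiv sm)
  define G where "G x = (\<Sum>i\<in>Basis. (norm (pderiv_dir i \<phi> x))\<^sup>2)" for x
  have [measurable]: "G \<in> borel_measurable borel" unfolding G_def by measurable
  have iG: "integrable lborel G"
    unfolding G_def by (intro Bochner_Integration.integrable_sum test_fun_integrable(2)[OF test_fun_pderiv[OF \<phi>]])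
  have G0: "G x \<ge> 0" for x by (simp add: G_def sum_nonneg)
  define f where "f x \<theta> = (\<Sum>i\<in>Basis. (z \<bullet> i) *\<^sub>R pderiv_dir i \<phi> (x - \<theta> *\<^sub>R z))" for x and \<theta> :: real
  have fb: "(norm (f x \<theta>))\<^sup>2 \<le> (norm z)\<^sup>2 * G (x - \<theta> *\<^sub>R z)" for x \<theta>
    unfolding f_def G_def by (rule norm_sum_Basis_le)
  have cont: "continuous_on UNIV (\<lambda>\<theta>. pderiv_dir i \<phi> (x - \<theta> *\<^sub>R z))" if "i \<in> Basis" for i x
    by (intro continuous_on_compose2[OF smooth_fun_on_continuous[OF smooth_fun_on_pderiv[OF sm that]]] continuous_intros) auto
  have contf: "continuous_on UNIV (f x)" for x
    unfolding f_def by (intro continuous_intros cont)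
  have contG: "continuous_on UNIV (\<lambda>\<theta>. G (x - \<theta> *\<^sub>R z))" for x
    unfolding G_def by (intro continuous_intros cont)
  have pt: "ennreal ((norm (\<phi> x - \<phi> (x - z)))\<^sup>2) \<le>
      (\<integral>\<^sup>+\<theta>. ennreal (indicator {0..1} \<theta> * ((norm z)\<^sup>2 * G (x - \<theta> *\<^sub>R z))) \<partial>lborel)" for x
  proof -
    have i2: "integrable lborel (\<lambda>\<theta>. indicator {0..1} \<theta> *\<^sub>R (norm (f x \<theta>))\<^sup>2)"
      by (intro borel_integrable_compact continuous_intros continuous_on_subset[OF contf]) auto
    have i3: "integrable lborel (\<lambda>\<theta>. indicator {0..1} \<theta> *\<^sub>R ((norm z)\<^sup>2 * G (x - \<theta> *\<^sub>R z)))"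
      by (intro borel_integrable_compact continuous_intros continuous_on_subset[OF contG]) auto
    have fm[measurable]: "f x \<in> borel_measurable borel" by (rule borel_measurable_continuous_onI[OF contf])
    have "norm (\<phi> x - \<phi> (x - z)) \<le> (\<integral>\<theta>. norm (indicator {0..1} \<theta> *\<^sub>R f x \<theta>) \<partial>lborel)"
      unfolding smooth_difference_eq_integral[OF sm] f_def[symmetric] by (rule integral_norm_bound)
    also have "\<dots> = (\<integral>\<theta>. \<bar>indicator {0..1} \<theta> * (indicator {0..1} \<theta> * norm (f x \<theta>))\<bar> \<partial>lborel)"
      by (intro Bochner_Integration.integral_cong) (auto simp: indicator_def)
    also have "\<dots> \<le> sqrt (\<integral>\<theta>. (indicat_real {0..1::real} \<theta>)\<^sup>2 \<partial>lborel) * sqrt (\<integral>\<theta>. (indicator {0..1} \<theta> * norm (f x \<theta>))\<^sup>2 \<partial>lborel)"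
    proof (rule integral_Cauchy_Schwarz(2))
      show "integrable lborel (\<lambda>\<theta>. (indicat_real {0..1::real} \<theta>)\<^sup>2)"
      proof -
        have "(\<lambda>\<theta>. (indicat_real {0..1::real} \<theta>)\<^sup>2) = indicat_real {0..1}"
          by (auto simp: fun_eq_iff indicator_def)
        then show ?thesis by (simp add: integrable_real_indicator)
      qed
      have "(\<lambda>\<theta>. (indicator {0..1} \<theta> * norm (f x \<theta>))\<^sup>2) = (\<lambda>\<theta>. indicator {0..1} \<theta> *\<^sub>R (norm (f x \<theta>))\<^sup>2)"
        by (auto simp: fun_eq_iff indicator_def)
      then show "integrable lborel (\<lambda>\<theta>. (indicator {0..1} \<theta> * norm (f x \<theta>))\<^sup>2)" using i2 by simp
    qed auto
    also have "(\<integral>\<theta>. (indicat_real {0..1::real} \<theta>)\<^sup>2 \<partial>lborel) = (\<integral>\<theta>. indicat_real {0..1::real} \<theta> \<partial>lborel)"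
      by (intro Bochner_Integration.integral_cong) (auto simp: indicator_def)
    also have "\<dots> = (1::real)" by simp
    also have "(\<integral>\<theta>. (indicator {0..1} \<theta> * norm (f x \<theta>))\<^sup>2 \<partial>lborel) = (\<integral>\<theta>. indicator {0..1} \<theta> *\<^sub>R (norm (f x \<theta>))\<^sup>2 \<partial>lborel)"
      by (intro Bochner_Integration.integral_cong) (auto simp: indicator_def)
    finally have "(norm (\<phi> x - \<phi> (x - z)))\<^sup>2 \<le> (\<integral>\<theta>. indicator {0..1} \<theta> *\<^sub>R (norm (f x \<theta>))\<^sup>2 \<partial>lborel)"
      using power_mono[of "norm (\<phi> x - \<phi> (x - z))" "sqrt (\<integral>\<theta>. indicator {0..1} \<theta> *\<^sub>R (norm (f x \<theta>))\<^sup>2 \<partial>lborel)" 2]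
      by simp
    also have "\<dots> \<le> (\<integral>\<theta>. indicator {0..1} \<theta> *\<^sub>R ((norm z)\<^sup>2 * G (x - \<theta> *\<^sub>R z)) \<partial>lborel)"
      by (rule integral_mono[OF i2 i3]) (use fb in \<open>auto simp: indicator_def\<close>)
    finally have "ennreal ((norm (\<phi> x - \<phi> (x - z)))\<^sup>2) \<le> ennreal (\<integral>\<theta>. indicator {0..1} \<theta> *\<^sub>R ((norm z)\<^sup>2 * G (x - \<theta> *\<^sub>R z)) \<partial>lborel)"
      by (rule ennreal_leI)
    also have "\<dots> = (\<integral>\<^sup>+\<theta>. ennreal (indicator {0..1} \<theta> *\<^sub>R ((norm z)\<^sup>2 * G (x - \<theta> *\<^sub>R z))) \<partial>lborel)"
      by (rule nn_integral_eq_integral[OF i3, symmetric]) (auto simp: G0)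
    finally show ?thesis by simp
  qed
  define D where "D = (\<integral>x. G x \<partial>lborel)"
  have D0: "D \<ge> 0" unfolding D_def using G0 by simp
  have "(\<integral>\<^sup>+x. ennreal ((norm (\<phi> x - \<phi> (x - z)))\<^sup>2) \<partial>lborel) \<le>
    (\<integral>\<^sup>+x. \<integral>\<^sup>+\<theta>. ennreal (indicator {0..1} \<theta> * ((norm z)\<^sup>2 * G (x - \<theta> *\<^sub>R z))) \<partial>lborel \<partial>lborel)"
    by (intro nn_integral_mono pt)
  also have "\<dots> = (\<integral>\<^sup>+\<theta>. \<integral>\<^sup>+x. ennreal (indicator {0..1} \<theta> * ((norm z)\<^sup>2 * G (x - \<theta> *\<^sub>R z))) \<partial>lborel \<partial>lborel)"
    by (rule lborel_pair.Fubini') measurable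
  also have "\<dots> = (\<integral>\<^sup>+\<theta>. ennreal (indicator {0..1::real} \<theta>) * ennreal ((norm z)\<^sup>2 * D) \<partial>lborel)"
  proof (rule nn_integral_cong)
    fix \<theta> :: real
    have t: "(\<integral>\<^sup>+x. ennreal (G (x - \<theta> *\<^sub>R z)) \<partial>lborel) = ennreal D"
    proof -
      have "integrable lborel (\<lambda>x. G (x - \<theta> *\<^sub>R z))" using integral_translation(2)[of G] iG by simp
      then have "(\<integral>\<^sup>+x. ennreal (G (x - \<theta> *\<^sub>R z)) \<partial>lborel) = ennreal (\<integral>x. G (x - \<theta> *\<^sub>R z) \<partial>lborel)"
        by (rule nn_integral_eq_integral) (simp add: G0)
      then show ?thesis by (simp add: integral_translation D_def)
    qed
    have "(\<integral>\<^sup>+x. ennreal (indicator {0..1} \<theta> * ((norm z)\<^sup>2 * G (x - \<theta> *\<^sub>R z))) \<partial>lborel)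
        = ennreal (indicator {0..1} \<theta>) * (ennreal ((norm z)\<^sup>2) * (\<integral>\<^sup>+x. ennreal (G (x - \<theta> *\<^sub>R z)) \<partial>lborel))"
      by (simp add: ennreal_mult G0 nn_integral_cmult)
    then show "(\<integral>\<^sup>+x. ennreal (indicator {0..1} \<theta> * ((norm z)\<^sup>2 * G (x - \<theta> *\<^sub>R z))) \<partial>lborel)
        = ennreal (indicator {0..1} \<theta>) * ennreal ((norm z)\<^sup>2 * D)"
      unfolding t using D0 by (simp add: ennreal_mult)
  qed
  also have "\<dots> = (\<integral>\<^sup>+\<theta>. indicator {0..1::real} \<theta> * ennreal ((norm z)\<^sup>2 * D) \<partial>lborel)"
    by (intro nn_integral_cong) (auto simp: indicator_def)
  also have "\<dots> = ennreal ((norm z)\<^sup>2 * D)"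
    by (subst nn_integral_multc) auto
  finally have "(\<integral>x. (norm (\<phi> x - \<phi> (x - z)))\<^sup>2 \<partial>lborel) \<le> (norm z)\<^sup>2 * D"
    using D0 by (intro integral_real_bounded) auto
  also have "D = (\<Sum>i\<in>Basis. \<integral>x. (norm (pderiv_dir i \<phi> x))\<^sup>2 \<partial>lborel)"
    unfolding D_def G_def
    by (intro Bochner_Integration.integral_sum test_fun_integrable(2)[OF test_fun_pderiv[OF \<phi>]])
  finally show ?thesis .
qed

lemma in_L2_cong_AE:
  fixes v w :: "'a::euclidean_space \<Rightarrow> 'b::euclidean_space"
  assumes S: "S \<in> sets lebesgue" and v: "in_L2 S v" and ae: "AE x in lebesgue_on S. v x = w x"
  shows "in_L2 S w" "L2norm S w = L2norm S v"
proof -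
  have mv: "(\<lambda>x. indicator S x *\<^sub>R v x) \<in> borel_measurable lebesgue"
    using v integrable_lebesgue_on(3)[OF S] unfolding in_L2_def by blast
  have "AE x in lborel. x \<in> S \<longrightarrow> v x = w x" using ae integrable_lebesgue_on(4)[OF S, of "\<lambda>x. v x = w x"] by simp
  then have "AE x in lebesgue. indicator S x *\<^sub>R v x = indicator S x *\<^sub>R w x"
    by (intro AE_lborel_imp_lebesgue) (auto simp: indicator_def elim: eventually_mono)
  then have "(\<lambda>x. indicator S x *\<^sub>R w x) \<in> borel_measurable lebesgue"
    by (rule borel_measurable_AE[OF mv])
  then have mw: "w \<in> borel_measurable (lebesgue_on S)" using integrable_lebesgue_on(3)[OF S] by blast
  have mv': "v \<in> borel_measurable (lebesgue_on S)" using v by (simp add: in_L2_def)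
  have ae': "AE x in lebesgue_on S. (norm (v x))\<^sup>2 = (norm (w x))\<^sup>2" using ae by eventually_elim simp
  have "integrable (lebesgue_on S) (\<lambda>x. (norm (w x))\<^sup>2)"
    using integrable_cong_AE[of "\<lambda>x. (norm (v x))\<^sup>2" "lebesgue_on S" "\<lambda>x. (norm (w x))\<^sup>2"] ae' mw mv' v
    by (auto simp: in_L2_def)
  with mw show "in_L2 S w" by (simp add: in_L2_def)
  show "L2norm S w = L2norm S v"
    using integral_cong_AE[of "\<lambda>x. (norm (v x))\<^sup>2" "lebesgue_on S" "\<lambda>x. (norm (w x))\<^sup>2"] ae' mw mv'
    by (simp add: L2norm_def)
qed

section \<open>Weak derivatives, Sobolev norms and the extension by zero\<close>

lemma has_weak_pderiv_weak_pderiv: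
  "has_weak_pderiv S i g v \<Longrightarrow> has_weak_pderiv S i g (weak_pderiv S i g)"
  unfolding weak_pderiv_def by (rule someI[of "has_weak_pderiv S i g" v])

lemma in_H_imp_in_L2: "in_H k S v \<Longrightarrow> in_L2 S v"
  by (cases k) auto

text \<open>The derivative known to lie in H^k and the chosen representative may differ on a null
  set, hence the appeal to uniqueness.\<close>

lemma in_H_weak_pderiv:
  assumes S: "open S" and "in_H (Suc k) S g" "i \<in> Basis"
  shows "has_weak_pderiv S i g (weak_pderiv S i g)" "in_L2 S (weak_pderiv S i g)"
proof -
  obtain v where v: "has_weak_pderiv S i g v" "in_H k S v" using assms by auto
  show w: "has_weak_pderiv S i g (weak_pderiv S i g)" using v(1) by (rule has_weak_pderiv_weak_pderiv)
  show "in_L2 S (weak_pderiv S i g)"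
    using in_L2_cong_AE(1)[OF open_sets_lebesgue[OF S] in_H_imp_in_L2[OF v(2)] weak_pderiv_unique[OF S v(1) w]] .
qed

lemma has_weak_pderiv_diff:
  fixes g h :: "'a::euclidean_space \<Rightarrow> 'b::euclidean_space"
  assumes S: "open S" and i: "i \<in> Basis" and g: "has_weak_pderiv S i g v" and h: "has_weak_pderiv S i h w"
  shows "has_weak_pderiv S i (\<lambda>x. g x - h x) (\<lambda>x. v x - w x)"
  unfolding has_weak_pderiv_def
proof (intro conjI allI impI)
  have L: "in_L1loc S g" "in_L1loc S h" "in_L1loc S v" "in_L1loc S w" using g h by (auto simp: has_weak_pderiv_def)
  then show "in_L1loc S (\<lambda>x. g x - h x)" "in_L1loc S (\<lambda>x. v x - w x)" by (auto simp: in_L1loc_def)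
  fix \<psi> :: "'a \<Rightarrow> real" assume \<psi>: "test_fun S \<psi>"
  have I: "integrable (lebesgue_on S) (\<lambda>x. \<eta> x *\<^sub>R k x)" if \<eta>: "test_fun S \<eta>" and k: "in_L1loc S k"
    for \<eta> :: "'a \<Rightarrow> real" and k :: "'a \<Rightarrow> 'b"
  proof -
    obtain K where K: "compact K" "K \<subseteq> S" "\<And>x. x \<notin> K \<Longrightarrow> \<eta> x = 0"
      by (rule test_fun_compactE[OF \<eta>]) blast
    have "continuous_on UNIV \<eta>" using \<eta> by (simp add: test_fun_def smooth_fun_on_continuous)
    then show ?thesis using integrable_test_scaleR[where \<psi>=\<eta>, OF S K _ k] by blast
  qed
  have d\<psi>: "test_fun S (pderiv_dir i \<psi>)" by (rule test_fun_pderiv[OF \<psi> i])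
  show "(\<integral>x. pderiv_dir i \<psi> x *\<^sub>R (g x - h x) \<partial>lebesgue_on S) = - (\<integral>x. \<psi> x *\<^sub>R (v x - w x) \<partial>lebesgue_on S)"
    using g h \<psi> unfolding has_weak_pderiv_def scaleR_diff_right
    by (simp add: I[OF d\<psi> L(1)] I[OF d\<psi> L(2)] I[OF \<psi> L(3)] I[OF \<psi> L(4)])
qed

lemma L2norm_power2: "(L2norm S g)\<^sup>2 = (\<integral>x. (norm (g x))\<^sup>2 \<partial>lebesgue_on S)"
  by (simp add: L2norm_def)

lemma L2norm_nonneg: "L2norm S g \<ge> 0"
  by (simp add: L2norm_def)

lemma Hnorm_sq_nonneg: "Hnorm_sq k S g \<ge> 0"
  by (induction k arbitrary: g) (auto intro!: add_nonneg_nonneg sum_nonneg)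

lemma L2norm_sq_le_Hnorm_sq: "(L2norm S g)\<^sup>2 \<le> Hnorm_sq k S g"
  by (cases k) (auto intro!: sum_nonneg Hnorm_sq_nonneg)

lemma L2norm_le_Hnorm: "L2norm S g \<le> Hnorm k S g"
  unfolding Hnorm_def using L2norm_sq_le_Hnorm_sq real_le_rsqrt by blast

lemma L2norm_weak_pderiv_le_Hnorm:
  assumes "i \<in> Basis"
  shows "L2norm S (weak_pderiv S i g) \<le> Hnorm (Suc k) S g"
proof -
  have "(L2norm S (weak_pderiv S i g))\<^sup>2 \<le> Hnorm_sq k S (weak_pderiv S i g)" by (rule L2norm_sq_le_Hnorm_sq)
  also have "\<dots> \<le> (\<Sum>i\<in>Basis. Hnorm_sq k S (weak_pderiv S i g))"
    using assms by (intro member_le_sum) (auto intro: Hnorm_sq_nonneg)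
  also have "\<dots> \<le> Hnorm_sq (Suc k) S g" by simp
  finally show ?thesis unfolding Hnorm_def by (rule real_le_rsqrt)
qed

lemma norm_add_sq_le: "(norm (a + b))\<^sup>2 \<le> 2 * (norm a)\<^sup>2 + 2 * (norm b)\<^sup>2"
proof -
  have "(norm (a + b))\<^sup>2 \<le> (norm a + norm b)\<^sup>2" by (intro power_mono norm_triangle_ineq) simp
  also have "\<dots> \<le> 2 * (norm a)\<^sup>2 + 2 * (norm b)\<^sup>2"
    using zero_le_power2[of "norm a - norm b"] by (simp add: power2_sum power2_diff)
  finally show ?thesis .
qed

text \<open>Translations act on functions on the whole space; this relates their integrals to norms
  over \<open>S\<close>, through a Borel version of the extension by zero.\<close>

lemma L2norm_borel_rep:
  fixes g :: "'a::euclidean_space \<Rightarrow> 'b::euclidean_space"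
  assumes S: "S \<in> sets lebesgue" and g: "g \<in> borel_measurable (lebesgue_on S)"
    and U: "U \<in> borel_measurable borel" "AE x in lborel. U x = indicator S x *\<^sub>R g x"
  shows "(L2norm S g)\<^sup>2 = (\<integral>x. (norm (U x))\<^sup>2 \<partial>lborel)"
    and "in_L2 S g \<longleftrightarrow> integrable lborel (\<lambda>x. (norm (U x))\<^sup>2)"
proof -
  have m: "(\<lambda>x. indicator S x *\<^sub>R (norm (g x))\<^sup>2) \<in> borel_measurable lebesgue"
    using g integrable_lebesgue_on(3)[OF S, of "\<lambda>x. (norm (g x))\<^sup>2"] by auto
  have ae: "AE x in lborel. indicator S x *\<^sub>R (norm (g x))\<^sup>2 = (norm (U x))\<^sup>2"
    using U(2) by eventually_elim (simp add: indicator_def)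
  show "(L2norm S g)\<^sup>2 = (\<integral>x. (norm (U x))\<^sup>2 \<partial>lborel)"
    unfolding L2norm_power2 integrable_lebesgue_on(2)[OF S]
    by (rule lebesgue_integral_borel_rep(1)[OF m _ ae]) (use U in simp)
  show "in_L2 S g \<longleftrightarrow> integrable lborel (\<lambda>x. (norm (U x))\<^sup>2)"
    unfolding in_L2_def integrable_lebesgue_on(1)[OF S]
    using lebesgue_integral_borel_rep(2)[OF m _ ae] U g by simp
qed

lemma in_L2_test_fun:
  fixes \<phi> :: "'a::euclidean_space \<Rightarrow> 'b::euclidean_space"
  assumes S: "open S" and \<phi>: "test_fun S \<phi>"
  shows "in_L2 S \<phi>" "(L2norm S \<phi>)\<^sup>2 = (\<integral>x. (norm (\<phi> x))\<^sup>2 \<partial>lborel)"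
proof -
  obtain K where K: "compact K" "K \<subseteq> S" "\<And>x. x \<notin> K \<Longrightarrow> \<phi> x = 0"
    by (rule test_fun_compactE[OF \<phi>]) blast
  have b: "\<phi> \<in> borel_measurable borel" using \<phi> by (simp add: test_fun_def borel_measurable_smooth)
  have m: "\<phi> \<in> borel_measurable (lebesgue_on S)"
    by (rule measurable_restrict_space1) (rule measurable_completion, use b in simp)
  have ae: "AE x in lborel. \<phi> x = indicator S x *\<^sub>R \<phi> x"
    using K by (intro AE_I2) (auto simp: indicator_def)
  show "in_L2 S \<phi>" "(L2norm S \<phi>)\<^sup>2 = (\<integral>x. (norm (\<phi> x))\<^sup>2 \<partial>lborel)"
    using L2norm_borel_rep[OF open_sets_lebesgue[OF S] m b ae] test_fun_integrable(2)[OF \<phi>] by auto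
qed

text \<open>The extension by zero of a test function is smooth, so the translation estimate holds
  for the approximants and passes to the limit. The extension of a general H^1 function jumps at the
  boundary; here the vanishing trace enters.\<close>

lemma H10_translation:
  fixes g :: "'a::euclidean_space \<Rightarrow> 'b::euclidean_space"
  assumes S: "open S" and g: "in_H10 S g"
    and U: "U \<in> borel_measurable borel" "AE x in lborel. U x = indicator S x *\<^sub>R g x"
    and D: "\<And>i. i \<in> Basis \<Longrightarrow> L2norm S (weak_pderiv S i g) \<le> D"
  shows "integrable lborel (\<lambda>x. (norm (U x))\<^sup>2)"
    and "(\<integral>x. (norm (U x - U (x - z)))\<^sup>2 \<partial>lborel) \<le> 8 * real DIM('a) * D\<^sup>2 * (norm z)\<^sup>2"
proof -
  note [measurable] = U(1)
  have SL: "S \<in> sets lebesgue" by (rule open_sets_lebesgue[OF S])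
  have H1: "in_H (Suc 0) S g" using g unfolding in_H10_def by simp
  have gL: "in_L2 S g" using H1 by simp
  then have gm: "g \<in> borel_measurable (lebesgue_on S)" by (simp add: in_L2_def)
  show U2: "integrable lborel (\<lambda>x. (norm (U x))\<^sup>2)"
    using L2norm_borel_rep(2)[OF SL gm U] gL by simp
  obtain \<phi> :: "nat \<Rightarrow> 'a \<Rightarrow> 'b" where \<phi>: "\<And>n. test_fun S (\<phi> n)"
    and lim: "(\<lambda>n. Hnorm (Suc 0) S (\<lambda>x. g x - \<phi> n x)) \<longlonglongrightarrow> 0"
    using g unfolding in_H10_def by auto
  define h where "h n = (Hnorm (Suc 0) S (\<lambda>x. g x - \<phi> n x))\<^sup>2" for n
  have h0: "h \<longlonglongrightarrow> 0" unfolding h_def using tendsto_power[OF lim, of 2] by simp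
  have bm: "\<phi> n \<in> borel_measurable borel" for n using \<phi>[of n] by (simp add: test_fun_def borel_measurable_smooth)
  have \<phi>0: "\<phi> n x = 0" if "x \<notin> S" for n x
    using test_fun_compactE[OF \<phi>[of n]] that by (metis subsetD)
  have \<phi>m: "\<phi> n \<in> borel_measurable (lebesgue_on S)" for n
    using in_L2_test_fun(1)[OF S \<phi>] by (simp add: in_L2_def)
  have a: "integrable lborel (\<lambda>x. (norm (U x - \<phi> n x))\<^sup>2)" "(\<integral>x. (norm (U x - \<phi> n x))\<^sup>2 \<partial>lborel) \<le> h n" for n
  proof -
    have m: "(\<lambda>x. g x - \<phi> n x) \<in> borel_measurable (lebesgue_on S)" using gm \<phi>m by simp
    have ae: "AE x in lborel. U x - \<phi> n x = indicator S x *\<^sub>R (g x - \<phi> n x)"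
      using U(2) by eventually_elim (auto simp: indicator_def \<phi>0)
    have bm': "(\<lambda>x. U x - \<phi> n x) \<in> borel_measurable borel" using bm by simp
    show "integrable lborel (\<lambda>x. (norm (U x - \<phi> n x))\<^sup>2)"
    proof (rule Bochner_Integration.integrable_bound)
      show "integrable lborel (\<lambda>x. 2 * (norm (U x))\<^sup>2 + 2 * (norm (\<phi> n x))\<^sup>2)"
        using U2 test_fun_integrable(2)[OF \<phi>] by simp
      show "AE x in lborel. norm ((norm (U x - \<phi> n x))\<^sup>2) \<le> norm (2 * (norm (U x))\<^sup>2 + 2 * (norm (\<phi> n x))\<^sup>2)"
        using norm_add_sq_le[of "U x" "- \<phi> n x" for x] by (intro AE_I2) simp
    qed (use bm' in simp)
    have "(\<integral>x. (norm (U x - \<phi> n x))\<^sup>2 \<partial>lborel) = (L2norm S (\<lambda>x. g x - \<phi> n x))\<^sup>2"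
      by (rule L2norm_borel_rep(1)[OF SL m bm' ae, symmetric])
    also have "\<dots> \<le> h n"
      unfolding h_def by (intro power_mono L2norm_le_Hnorm L2norm_nonneg)
    finally show "(\<integral>x. (norm (U x - \<phi> n x))\<^sup>2 \<partial>lborel) \<le> h n" .
  qed
  \<comment> \<open>The gradient of the approximant is that of g minus the gradient of g - \<phi> n,
    and the square norm of the latter is at most \<open>h n\<close>.\<close>
  have b: "(\<integral>x. (norm (pderiv_dir i (\<phi> n) x))\<^sup>2 \<partial>lborel) \<le> 2 * D\<^sup>2 + 2 * h n" if i: "i \<in> Basis" for i n
  proof -
    let ?w = "weak_pderiv S i g" and ?p = "pderiv_dir i (\<phi> n)"
    let ?d = "weak_pderiv S i (\<lambda>x. g x - \<phi> n x)"
    have tp: "test_fun S ?p" by (rule test_fun_pderiv[OF \<phi> i])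
    have w: "has_weak_pderiv S i g ?w" "in_L2 S ?w" using in_H_weak_pderiv[OF S H1 i] by auto
    have hd: "has_weak_pderiv S i (\<lambda>x. g x - \<phi> n x) (\<lambda>x. ?w x - ?p x)"
      by (rule has_weak_pderiv_diff[OF S i w(1) has_weak_pderiv_test_fun[OF S \<phi> i]])
    have ae: "AE x in lebesgue_on S. ?w x - ?p x = ?d x"
      by (rule weak_pderiv_unique[OF S hd has_weak_pderiv_weak_pderiv[OF hd]])
    have wp2: "in_L2 S (\<lambda>x. ?w x - ?p x)"
      unfolding in_L2_def
    proof
      show m: "(\<lambda>x. ?w x - ?p x) \<in> borel_measurable (lebesgue_on S)"
        by (rule borel_measurable_diff) (use w(2) in_L2_test_fun(1)[OF S tp] in \<open>auto simp: in_L2_def\<close>)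
      show "integrable (lebesgue_on S) (\<lambda>x. (norm (?w x - ?p x))\<^sup>2)"
      proof (rule Bochner_Integration.integrable_bound)
        show "integrable (lebesgue_on S) (\<lambda>x. 2 * (norm (?w x))\<^sup>2 + 2 * (norm (?p x))\<^sup>2)"
          using w(2) in_L2_test_fun(1)[OF S tp] by (simp add: in_L2_def)
        show "AE x in lebesgue_on S. norm ((norm (?w x - ?p x))\<^sup>2) \<le> norm (2 * (norm (?w x))\<^sup>2 + 2 * (norm (?p x))\<^sup>2)"
          using norm_add_sq_le[of "?w x" "- ?p x" for x] by (intro AE_I2) simp
      qed (use m in simp)
    qed
    have "(\<integral>x. (norm (?p x))\<^sup>2 \<partial>lborel) = (\<integral>x. (norm (?p x))\<^sup>2 \<partial>lebesgue_on S)"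
      using in_L2_test_fun(2)[OF S tp] by (simp add: L2norm_power2)
    also have "\<dots> \<le> (\<integral>x. 2 * (norm (?w x))\<^sup>2 + 2 * (norm (?w x - ?p x))\<^sup>2 \<partial>lebesgue_on S)"
    proof (rule integral_mono)
      show "(norm (?p x))\<^sup>2 \<le> 2 * (norm (?w x))\<^sup>2 + 2 * (norm (?w x - ?p x))\<^sup>2" for x
        using norm_add_sq_le[of "?w x" "- (?w x - ?p x)"] by (simp add: norm_minus_commute)
    qed (use wp2 w(2) in_L2_test_fun(1)[OF S tp] in \<open>auto simp: in_L2_def\<close>)
    also have "\<dots> = 2 * (L2norm S ?w)\<^sup>2 + 2 * (L2norm S (\<lambda>x. ?w x - ?p x))\<^sup>2"
      using wp2 w(2) by (simp add: L2norm_power2 in_L2_def)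
    also have "L2norm S (\<lambda>x. ?w x - ?p x) = L2norm S ?d"
      using in_L2_cong_AE(2)[OF SL wp2 ae] by simp
    also have "2 * (L2norm S ?w)\<^sup>2 + 2 * (L2norm S ?d)\<^sup>2 \<le> 2 * D\<^sup>2 + 2 * h n"
      unfolding h_def
      by (intro add_mono mult_left_mono power_mono D i L2norm_weak_pderiv_le_Hnorm L2norm_nonneg) auto
    finally show ?thesis .
  qed
  have tr: "integrable lborel (\<lambda>x. (norm (U (x - z) - \<phi> n (x - z)))\<^sup>2)"
      "(\<integral>x. (norm (U (x - z) - \<phi> n (x - z)))\<^sup>2 \<partial>lborel) \<le> h n" for n
    using a[of n] integral_translation[of "\<lambda>x. (norm (U x - \<phi> n x))\<^sup>2" z] bm by auto
  have tU: "integrable lborel (\<lambda>x. (norm (U x - U (x - z)))\<^sup>2)"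
  proof (rule Bochner_Integration.integrable_bound)
    show "integrable lborel (\<lambda>x. 2 * (norm (U x))\<^sup>2 + 2 * (norm (U (x - z)))\<^sup>2)"
      using U2 integral_translation(2)[of "\<lambda>x. (norm (U x))\<^sup>2" z] by simp
    show "AE x in lborel. norm ((norm (U x - U (x - z)))\<^sup>2) \<le> norm (2 * (norm (U x))\<^sup>2 + 2 * (norm (U (x - z)))\<^sup>2)"
      using norm_add_sq_le[of "U x" "- U (x - z)" for x] by (intro AE_I2) simp
  qed simp
  have t\<phi>: "integrable lborel (\<lambda>x. (norm (\<phi> n x - \<phi> n (x - z)))\<^sup>2)" for n
  proof (rule Bochner_Integration.integrable_bound)
    show "integrable lborel (\<lambda>x. 2 * (norm (\<phi> n x))\<^sup>2 + 2 * (norm (\<phi> n (x - z)))\<^sup>2)"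
      using test_fun_integrable(2)[OF \<phi>] integral_translation(2)[of "\<lambda>x. (norm (\<phi> n x))\<^sup>2" z] bm by simp
    show "AE x in lborel. norm ((norm (\<phi> n x - \<phi> n (x - z)))\<^sup>2) \<le> norm (2 * (norm (\<phi> n x))\<^sup>2 + 2 * (norm (\<phi> n (x - z)))\<^sup>2)"
      using norm_add_sq_le[of "\<phi> n x" "- \<phi> n (x - z)" for x] by (intro AE_I2) simp
  qed (use bm in simp)
  \<comment> \<open>U x - U (x - z) consists of the approximation errors at x and at x - z and of
    the increment of \<phi> n. Squaring costs factors 4, 4 and 2; both errors have square integral
    at most \<open>h n\<close>.\<close>
  have est: "(\<integral>x. (norm (U x - U (x - z)))\<^sup>2 \<partial>lborel) \<le> 8 * h n + 2 * ((norm z)\<^sup>2 * (real DIM('a) * (2 * D\<^sup>2 + 2 * h n)))" for n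
  proof -
    have "(\<integral>x. (norm (U x - U (x - z)))\<^sup>2 \<partial>lborel) \<le>
      (\<integral>x. (4 * (norm (U x - \<phi> n x))\<^sup>2 + 4 * (norm (U (x - z) - \<phi> n (x - z)))\<^sup>2) + 2 * (norm (\<phi> n x - \<phi> n (x - z)))\<^sup>2 \<partial>lborel)"
    proof (rule integral_mono)
      fix x
      show "(norm (U x - U (x - z)))\<^sup>2 \<le> (4 * (norm (U x - \<phi> n x))\<^sup>2 + 4 * (norm (U (x - z) - \<phi> n (x - z)))\<^sup>2) + 2 * (norm (\<phi> n x - \<phi> n (x - z)))\<^sup>2"
      proof -
        define A where "A = U x - \<phi> n x"
        define B where "B = U (x - z) - \<phi> n (x - z)"
        define C where "C = \<phi> n x - \<phi> n (x - z)"
        have e: "U x - U (x - z) = (A - B) + C" by (simp add: A_def B_def C_def)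
        have "(norm ((A - B) + C))\<^sup>2 \<le> 2 * (norm (A - B))\<^sup>2 + 2 * (norm C)\<^sup>2"
          by (rule norm_add_sq_le)
        moreover have "(norm (A - B))\<^sup>2 \<le> 2 * (norm A)\<^sup>2 + 2 * (norm B)\<^sup>2"
          using norm_add_sq_le[of A "- B"] by simp
        ultimately show ?thesis unfolding e A_def[symmetric] B_def[symmetric] C_def[symmetric] by linarith
      qed
    qed (use tU a tr t\<phi> in auto)
    also have "\<dots> = 4 * (\<integral>x. (norm (U x - \<phi> n x))\<^sup>2 \<partial>lborel) + 4 * (\<integral>x. (norm (U (x - z) - \<phi> n (x - z)))\<^sup>2 \<partial>lborel)
        + 2 * (\<integral>x. (norm (\<phi> n x - \<phi> n (x - z)))\<^sup>2 \<partial>lborel)"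
      using a tr t\<phi> by simp
    also have "\<dots> \<le> 4 * h n + 4 * h n + 2 * ((norm z)\<^sup>2 * (real DIM('a) * (2 * D\<^sup>2 + 2 * h n)))"
    proof (intro add_mono mult_left_mono a tr order_trans[OF test_fun_translation_L2[OF \<phi>]])
      show "(\<Sum>i\<in>Basis. \<integral>x. (norm (pderiv_dir i (\<phi> n) x))\<^sup>2 \<partial>lborel) \<le> real DIM('a) * (2 * D\<^sup>2 + 2 * h n)"
        using sum_bounded_above[of Basis "\<lambda>i. \<integral>x. (norm (pderiv_dir i (\<phi> n) x))\<^sup>2 \<partial>lborel"] b by simp
    qed auto
    finally show ?thesis by simp
  qed
  have "(\<lambda>n. 8 * h n + 2 * ((norm z)\<^sup>2 * (real DIM('a) * (2 * D\<^sup>2 + 2 * h n)))) \<longlonglongrightarrow> 8 * 0 + 2 * ((norm z)\<^sup>2 * (real DIM('a) * (2 * D\<^sup>2 + 2 * 0)))"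
    by (intro tendsto_intros h0)
  then have "(\<integral>x. (norm (U x - U (x - z)))\<^sup>2 \<partial>lborel) \<le> 8 * 0 + 2 * ((norm z)\<^sup>2 * (real DIM('a) * (2 * D\<^sup>2 + 2 * 0)))"
    by (rule LIMSEQ_le_const) (use est in auto)
  \<comment> \<open>The limit carries the constant 4. The larger constant 8 gives 16, a perfect
    square, in dimension two.\<close>
  also have "\<dots> \<le> 8 * real DIM('a) * D\<^sup>2 * (norm z)\<^sup>2"
  proof -
    have "0 \<le> real DIM('a) * D\<^sup>2 * (norm z)\<^sup>2" by simp
    then show ?thesis by (simp add: algebra_simps)
  qed
  finally show "(\<integral>x. (norm (U x - U (x - z)))\<^sup>2 \<partial>lborel) \<le> 8 * real DIM('a) * D\<^sup>2 * (norm z)\<^sup>2" .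
qed

text \<open>The defining identities of the weak derivatives, each paired with its own basis vector
  and summed, turn the pointwise divergence condition into orthogonality to gradients of test
  functions.\<close>

lemma weak_div_zero_test:
  fixes g :: "'a::euclidean_space \<Rightarrow> 'a"
  assumes S: "open S" and g: "in_H (Suc k) S g" and div: "AE x in lebesgue_on S. weak_div S g x = 0"
    and U: "U \<in> borel_measurable borel" "AE x in lborel. U x = indicator S x *\<^sub>R g x"
    and \<psi>: "test_fun S \<psi>"
  shows "(\<integral>x. U x \<bullet> grad \<psi> x \<partial>lborel) = 0"
proof -
  have SL: "S \<in> sets lebesgue" by (rule open_sets_lebesgue[OF S])
  have w: "has_weak_pderiv S i g (weak_pderiv S i g)" if "i \<in> Basis" for i
    using in_H_weak_pderiv[OF S g that] by simp
  have I: "integrable (lebesgue_on S) (\<lambda>x. \<eta> x *\<^sub>R k x)" if \<eta>: "test_fun S \<eta>" and k: "in_L1loc S k"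
    for \<eta> :: "'a \<Rightarrow> real" and k :: "'a \<Rightarrow> 'a"
  proof -
    obtain K where K: "compact K" "K \<subseteq> S" "\<And>x. x \<notin> K \<Longrightarrow> \<eta> x = 0"
      by (rule test_fun_compactE[OF \<eta>]) blast
    have "continuous_on UNIV \<eta>" using \<eta> by (simp add: test_fun_def smooth_fun_on_continuous)
    then show ?thesis using integrable_test_scaleR[where \<psi>=\<eta>, OF S K _ k] by blast
  qed
  have I1: "integrable (lebesgue_on S) (\<lambda>x. pderiv_dir i \<psi> x *\<^sub>R g x)" if "i \<in> Basis" for i
    by (rule I[OF test_fun_pderiv[OF \<psi> that]]) (use w[OF that] in \<open>simp add: has_weak_pderiv_def\<close>)
  have I2: "integrable (lebesgue_on S) (\<lambda>x. \<psi> x *\<^sub>R weak_pderiv S i g x)" if "i \<in> Basis" for i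
    by (rule I[OF \<psi>]) (use w[OF that] in \<open>simp add: has_weak_pderiv_def\<close>)
  have eq: "g x \<bullet> grad \<psi> x = (\<Sum>i\<in>Basis. (pderiv_dir i \<psi> x *\<^sub>R g x) \<bullet> i)" for x
    by (simp add: grad_def inner_sum_right)
  have swap: "(\<integral>x. (\<Sum>i\<in>Basis. F i x \<bullet> i) \<partial>lebesgue_on S) = (\<Sum>i\<in>Basis. (\<integral>x. F i x \<partial>lebesgue_on S) \<bullet> i)"
    if "\<And>i. i \<in> Basis \<Longrightarrow> integrable (lebesgue_on S) (F i)" for F :: "'a \<Rightarrow> 'a \<Rightarrow> 'a"
    using that by (subst Bochner_Integration.integral_sum) auto
  have "(\<integral>x. g x \<bullet> grad \<psi> x \<partial>lebesgue_on S) = (\<Sum>i\<in>Basis. (\<integral>x. pderiv_dir i \<psi> x *\<^sub>R g x \<partial>lebesgue_on S) \<bullet> i)"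
    unfolding eq by (rule swap) (rule I1)
  also have "\<dots> = (\<Sum>i\<in>Basis. - ((\<integral>x. \<psi> x *\<^sub>R weak_pderiv S i g x \<partial>lebesgue_on S) \<bullet> i))"
    using w \<psi> by (intro sum.cong) (auto simp: has_weak_pderiv_def)
  also have "\<dots> = - (\<integral>x. (\<Sum>i\<in>Basis. (\<psi> x *\<^sub>R weak_pderiv S i g x) \<bullet> i) \<partial>lebesgue_on S)"
    by (subst swap) (auto simp: sum_negf intro: I2)
  also have "(\<integral>x. (\<Sum>i\<in>Basis. (\<psi> x *\<^sub>R weak_pderiv S i g x) \<bullet> i) \<partial>lebesgue_on S) = (\<integral>x. 0 \<partial>lebesgue_on S)"
  proof (rule integral_cong_AE)
    show "(\<lambda>x. \<Sum>i\<in>Basis. (\<psi> x *\<^sub>R weak_pderiv S i g x) \<bullet> i) \<in> borel_measurable (lebesgue_on S)"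
      using I2 by (intro borel_measurable_sum borel_measurable_inner) auto
    show "AE x in lebesgue_on S. (\<Sum>i\<in>Basis. (\<psi> x *\<^sub>R weak_pderiv S i g x) \<bullet> i) = 0"
      using div
    proof eventually_elim
      case (elim x)
      have "(\<Sum>i\<in>Basis. (\<psi> x *\<^sub>R weak_pderiv S i g x) \<bullet> i) = \<psi> x * weak_div S g x"
        by (simp add: weak_div_def sum_distrib_left)
      then show ?case using elim by simp
    qed
  qed simp
  finally have 0: "(\<integral>x. g x \<bullet> grad \<psi> x \<partial>lebesgue_on S) = 0" by simp
  have gm: "(\<lambda>x. g x \<bullet> grad \<psi> x) \<in> borel_measurable (lebesgue_on S)"
    unfolding eq using I1 by (intro borel_measurable_sum borel_measurable_inner) auto
  have "0 = (\<integral>x. indicator S x *\<^sub>R (g x \<bullet> grad \<psi> x) \<partial>lebesgue)"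
    using 0 integrable_lebesgue_on(2)[OF SL] by metis
  also have "\<dots> = (\<integral>x. U x \<bullet> grad \<psi> x \<partial>lborel)"
  proof (rule lebesgue_integral_borel_rep(1))
    show "(\<lambda>x. indicator S x *\<^sub>R (g x \<bullet> grad \<psi> x)) \<in> borel_measurable lebesgue"
      using gm integrable_lebesgue_on(3)[OF SL, of "\<lambda>x. g x \<bullet> grad \<psi> x"] by simp
    have "grad \<psi> \<in> borel_measurable borel"
      using \<psi> by (intro borel_measurable_continuous_onI continuous_on_grad) (simp add: test_fun_def)
    then show "(\<lambda>x. U x \<bullet> grad \<psi> x) \<in> borel_measurable borel" using U(1) by simp
    show "AE x in lborel. indicator S x *\<^sub>R (g x \<bullet> grad \<psi> x) = U x \<bullet> grad \<psi> x"
      using U(2) by eventually_elim simp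
  qed
  finally show ?thesis by simp
qed

section \<open>Conservation of mass and energy for a transported density\<close>

lemma nn_integral_reflect:
  fixes f :: "'a::euclidean_space \<Rightarrow> ennreal"
  assumes [measurable]: "f \<in> borel_measurable borel"
  shows "(\<integral>\<^sup>+y. f (x - y) \<partial>lborel) = (\<integral>\<^sup>+y. f y \<partial>lborel)"
proof -
  have "(\<integral>\<^sup>+y. f y \<partial>lborel) = (\<integral>\<^sup>+y. f y \<partial>distr lborel borel (\<lambda>y. x - y))"
    by (simp only: lborel_distr_reflect)
  also have "\<dots> = (\<integral>\<^sup>+y. f (x - y) \<partial>lborel)" by (rule nn_integral_distr) auto
  finally show ?thesis by simp
qed

text \<open>The substitution y = x - z and an exchange of integrals leave, for each shift z, an
  integral over x alone. Its bound is assumed only where the kernel is nonzero, because the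
  available estimates concern short shifts.\<close>

lemma nn_integral_convolution_bound:
  fixes k :: "'a::euclidean_space \<Rightarrow> real" and q :: "'a \<times> 'a \<Rightarrow> ennreal"
  assumes [measurable]: "k \<in> borel_measurable borel" "q \<in> borel_measurable borel"
    and k: "\<And>z. k z \<ge> 0"
    and q: "\<And>z. k z \<noteq> 0 \<Longrightarrow> (\<integral>\<^sup>+x. q (x, x - z) \<partial>lborel) \<le> b z"
  shows "(\<integral>\<^sup>+x. \<integral>\<^sup>+y. q (x, y) * ennreal (k (x - y)) \<partial>lborel \<partial>lborel) \<le> (\<integral>\<^sup>+z. b z * ennreal (k z) \<partial>lborel)"
proof -
  have qm[measurable]: "q \<in> borel_measurable (borel \<Otimes>\<^sub>M borel)" by (simp add: borel_prod)
  have "(\<integral>\<^sup>+x. \<integral>\<^sup>+y. q (x, y) * ennreal (k (x - y)) \<partial>lborel \<partial>lborel)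
      = (\<integral>\<^sup>+x. \<integral>\<^sup>+z. q (x, x - z) * ennreal (k z) \<partial>lborel \<partial>lborel)"
  proof (rule nn_integral_cong)
    fix x
    show "(\<integral>\<^sup>+y. q (x, y) * ennreal (k (x - y)) \<partial>lborel) = (\<integral>\<^sup>+z. q (x, x - z) * ennreal (k z) \<partial>lborel)"
      using nn_integral_reflect[of "\<lambda>y. q (x, y) * ennreal (k (x - y))" x] by simp
  qed
  also have "\<dots> = (\<integral>\<^sup>+z. \<integral>\<^sup>+x. q (x, x - z) * ennreal (k z) \<partial>lborel \<partial>lborel)"
    by (rule lborel_pair.Fubini') measurable
  also have "\<dots> = (\<integral>\<^sup>+z. (\<integral>\<^sup>+x. q (x, x - z) \<partial>lborel) * ennreal (k z) \<partial>lborel)"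
    by (intro nn_integral_cong nn_integral_multc) measurable
  also have "\<dots> \<le> (\<integral>\<^sup>+z. b z * ennreal (k z) \<partial>lborel)"
  proof (rule nn_integral_mono)
    fix z show "(\<integral>\<^sup>+x. q (x, x - z) \<partial>lborel) * ennreal (k z) \<le> b z * ennreal (k z)"
      by (cases "k z = 0") (auto intro: mult_right_mono q)
  qed
  finally show ?thesis .
qed

lemma integral_norm_le_integral:
  fixes f :: "'a \<Rightarrow> 'b::{banach, second_countable_topology}"
  assumes f: "f \<in> borel_measurable N" and g: "integrable N g" and le: "\<And>x. norm (f x) \<le> g x"
  shows "norm (\<integral>x. f x \<partial>N) \<le> (\<integral>x. g x \<partial>N)"
proof -
  have i: "integrable N f"
    by (rule Bochner_Integration.integrable_bound[OF g f]) (auto intro!: AE_I2 order_trans[OF le abs_ge_self])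
  have "norm (\<integral>x. f x \<partial>N) \<le> (\<integral>x. norm (f x) \<partial>N)" by (rule integral_norm_bound)
  also have "\<dots> \<le> (\<integral>x. g x \<partial>N)" by (rule integral_mono) (use i g le in auto)
  finally show ?thesis .
qed

lemma integrable_convolution_product:
  fixes a :: "'a::euclidean_space \<Rightarrow> real" and k :: "'a \<Rightarrow> real"
  assumes a: "integrable lborel a" and k: "integrable lborel k"
  shows "integrable (lborel \<Otimes>\<^sub>M lborel) (\<lambda>(x, y). a x * k (x - y))"
proof (rule lborel_pair.Fubini_integrable)
  have [measurable]: "a \<in> borel_measurable borel" "k \<in> borel_measurable borel" using a k by auto
  show "(\<lambda>(x, y). a x * k (x - y)) \<in> borel_measurable (lborel \<Otimes>\<^sub>M lborel)" by measurable
  have "(\<integral>y. norm (a x * k (x - y)) \<partial>lborel) = \<bar>a x\<bar> * (\<integral>y. \<bar>k y\<bar> \<partial>lborel)" for x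
    using integral_reflect(1)[of "\<lambda>y. \<bar>k y\<bar>" x] by (simp add: abs_mult)
  then show "integrable lborel (\<lambda>x. \<integral>y. norm (case (x, y) of (x, y) \<Rightarrow> a x * k (x - y)) \<partial>lborel)"
    using a by simp
  show "AE x in lborel. integrable lborel (\<lambda>y. case (x, y) of (x, y) \<Rightarrow> a x * k (x - y))"
    using integral_reflect(2)[of k] k by (intro AE_I2) simp
qed

lemma L1_bound_of_L2:
  fixes h :: "'a::euclidean_space \<Rightarrow> 'b::euclidean_space"
  assumes h[measurable]: "h \<in> borel_measurable borel" and i: "integrable lborel (\<lambda>x. (norm (h x))\<^sup>2)"
    and b: "(\<integral>x. (norm (h x))\<^sup>2 \<partial>lborel) \<le> D\<^sup>2" and D: "D \<ge> 0" and z: "\<And>x. x \<notin> cball 0 M \<Longrightarrow> h x = 0"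
  shows "integrable lborel (\<lambda>x. norm (h x))"
    and "(\<integral>x. norm (h x) \<partial>lborel) \<le> sqrt (measure lborel (cball (0::'a) M)) * D"
proof -
  have sq: "(\<lambda>x. (indicat_real (cball 0 M) x)\<^sup>2) = (indicat_real (cball (0::'a) M))"
    by (auto simp: indicator_def fun_eq_iff)
  have i1: "integrable lborel (\<lambda>x. (indicat_real (cball (0::'a) M) x)\<^sup>2)"
    unfolding sq using integrable_indicator_cball[of M 1] by simp
  have e: "(\<lambda>x. indicat_real (cball 0 M) x * norm (h x)) = (\<lambda>x. norm (h x))"
    using z by (auto simp: indicator_def fun_eq_iff)
  have m: "indicat_real (cball (0::'a) M) \<in> borel_measurable lborel"
    by (rule borel_measurable_indicator) simp
  have m2: "(\<lambda>x. norm (h x)) \<in> borel_measurable lborel" by simp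
  show "integrable lborel (\<lambda>x. norm (h x))"
    using integral_Cauchy_Schwarz(1)[OF m m2 i1 i] by (simp only: e)
  have "(\<integral>x. norm (h x) \<partial>lborel) = (\<integral>x. \<bar>indicat_real (cball 0 M) x * norm (h x)\<bar> \<partial>lborel)"
    using z by (intro Bochner_Integration.integral_cong) (auto simp: indicator_def)
  also have "\<dots> \<le> sqrt (\<integral>x. (indicat_real (cball (0::'a) M) x)\<^sup>2 \<partial>lborel) * sqrt (\<integral>x. (norm (h x))\<^sup>2 \<partial>lborel)"
    by (rule integral_Cauchy_Schwarz(2)[OF m m2 i1 i])
  also have "\<dots> \<le> sqrt (measure lborel (cball (0::'a) M)) * D"
    unfolding sq using real_sqrt_le_mono[OF b] D by (intro mult_mono) auto
  finally show "(\<integral>x. norm (h x) \<partial>lborel) \<le> sqrt (measure lborel (cball (0::'a) M)) * D" .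
qed

text \<open>The flux \<open>W\<close> is a jointly measurable version of \<open>r u\<close>; the equation is assumed only for mollifiers,
  with centres \<open>y\<close> inside or outside of \<open>\<Omega>\<close> alike.\<close>

locale transported_density =
  fixes \<Omega> :: "'a::euclidean_space set" and T M C D \<epsilon>\<^sub>0 :: real
    and r :: "real \<Rightarrow> 'a \<Rightarrow> real" and u :: "real \<Rightarrow> 'a \<Rightarrow> 'a" and W :: "real \<times> 'a \<Rightarrow> 'a"
  assumes T: "T > 0" and \<epsilon>\<^sub>0: "\<epsilon>\<^sub>0 > 0"
    and \<Omega>: "\<Omega> \<subseteq> cball 0 M"
    and r_meas: "\<And>t. r t \<in> borel_measurable borel"
    and r_bound: "\<And>t x. \<bar>r t x\<bar> \<le> C"
    and r_supp: "\<And>t x. x \<notin> \<Omega> \<Longrightarrow> r t x = 0"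
    and r_weak: "\<And>g B. g \<in> borel_measurable borel \<Longrightarrow> (\<And>x. \<bar>g x\<bar> \<le> B) \<Longrightarrow>
      continuous_on {0..T} (\<lambda>t. \<integral>x. r t x * g x \<partial>lborel)"
    and u_meas: "\<And>t. u t \<in> borel_measurable borel"
    and u_supp: "\<And>t x. x \<notin> \<Omega> \<Longrightarrow> u t x = 0"
    and u_int: "\<And>t. integrable lborel (\<lambda>x. (norm (u t x))\<^sup>2)"
    and u_bound: "\<And>t. (\<integral>x. (norm (u t x))\<^sup>2 \<partial>lborel) \<le> D\<^sup>2"
    and u_trans: "\<And>t z. (\<integral>x. (norm (u t x - u t (x - z)))\<^sup>2 \<partial>lborel) \<le> D\<^sup>2 * (norm z)\<^sup>2"
    and D: "D \<ge> 0"
    and W_meas: "W \<in> borel_measurable borel"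
    and W_eq: "\<And>t. t \<in> {0..T} \<Longrightarrow> AE x in lborel. W (t, x) = r t x *\<^sub>R u t x"
    and div: "\<And>t \<epsilon> y. 0 < \<epsilon> \<Longrightarrow> \<epsilon> \<le> \<epsilon>\<^sub>0 \<Longrightarrow> (\<integral>x. u t x \<bullet> moll_grad \<epsilon> (x - y) \<partial>lborel) = 0"
    and eq: "\<And>t \<epsilon> y. 0 < \<epsilon> \<Longrightarrow> \<epsilon> \<le> \<epsilon>\<^sub>0 \<Longrightarrow> t \<in> {0..T} \<Longrightarrow>
      ((\<lambda>s. \<integral>x. W (s, x) \<bullet> moll_grad \<epsilon> (x - y) \<partial>lborel) has_integral
        (\<integral>x. r t x * moll \<epsilon> (x - y) \<partial>lborel) - (\<integral>x. r 0 x * moll \<epsilon> (x - y) \<partial>lborel)) {0..t}"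
begin

declare r_meas [measurable] u_meas [measurable]

section \<open>The mollified density and its flux\<close>

lemma C0: "C \<ge> 0"
  using r_bound[of 0 0] by linarith

lemma r_out: "x \<notin> cball 0 M \<Longrightarrow> r t x = 0" and u_out: "x \<notin> cball 0 M \<Longrightarrow> u t x = 0"
  using \<Omega> r_supp u_supp by blast+

lemma r_int: "integrable lborel (r t)"
  by (rule integrable_bounded_compact_support[where C=C and S="cball 0 M"])
    (use r_bound r_out in auto)

lemma u_int1: "integrable lborel (\<lambda>x. norm (u t x))"
  and u_bound1: "(\<integral>x. norm (u t x) \<partial>lborel) \<le> sqrt (measure lborel (cball (0::'a) M)) * D"
  by (rule L1_bound_of_L2[OF u_meas u_int u_bound D u_out]; assumption)+

text \<open>\<open>m\<close> is the time derivative of the mollification \<open>F\<close> in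
  integrated form: by the assumption \<open>eq\<close>, the increment of
  \<open>F \<epsilon> t y\<close> from time 0 is the integral of \<open>m \<epsilon> s y\<close>. It
  is defined through \<open>W\<close>, not \<open>r\<close> and \<open>u\<close>, to be jointly
  measurable in (s, y).\<close>

definition m :: "real \<Rightarrow> real \<Rightarrow> 'a \<Rightarrow> real" where
  "m \<epsilon> s y = (\<integral>x. W (s, x) \<bullet> moll_grad \<epsilon> (x - y) \<partial>lborel)"

definition F :: "real \<Rightarrow> real \<Rightarrow> 'a \<Rightarrow> real" where
  "F \<epsilon> t y = (\<integral>x. r t x * moll \<epsilon> (x - y) \<partial>lborel)"

lemma W_meas' [measurable]: "W \<in> borel_measurable (borel \<Otimes>\<^sub>M borel)"
  using W_meas by (simp add: borel_prod)

lemma m_meas: "(\<lambda>(s, y). m \<epsilon> s y) \<in> borel_measurable (borel \<Otimes>\<^sub>M borel)"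
proof -
  have "(\<lambda>p. \<integral>x. W (fst p, x) \<bullet> moll_grad \<epsilon> (x - snd p) \<partial>lborel) \<in> borel_measurable (borel \<Otimes>\<^sub>M borel)"
    by measurable
  then show ?thesis by (simp add: m_def split_beta')
qed

lemma m_meas1 [measurable]: "m \<epsilon> s \<in> borel_measurable borel"
  using measurable_Pair2[OF m_meas, of s] by simp

lemma F_meas [measurable]: "F \<epsilon> t \<in> borel_measurable borel"
  unfolding F_def[abs_def] by measurable

lemma m_eq:
  assumes "s \<in> {0..T}"
  shows "m \<epsilon> s y = (\<integral>x. r s x * (u s x \<bullet> moll_grad \<epsilon> (x - y)) \<partial>lborel)"
  unfolding m_def
proof (rule integral_cong_AE)
  show "(\<lambda>x. W (s, x) \<bullet> moll_grad \<epsilon> (x - y)) \<in> borel_measurable lborel" by measurable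
  show "(\<lambda>x. r s x * (u s x \<bullet> moll_grad \<epsilon> (x - y))) \<in> borel_measurable lborel" by measurable
  show "AE x in lborel. W (s, x) \<bullet> moll_grad \<epsilon> (x - y) = r s x * (u s x \<bullet> moll_grad \<epsilon> (x - y))"
    using W_eq[OF assms] by eventually_elim simp
qed

text \<open>The bound degenerates as \<epsilon> tends to 0, but at fixed \<epsilon> its uniformity
  in time and centre justifies exchanging integrals and limits.\<close>

lemma m_bound:
  assumes "\<epsilon> > 0"
  obtains L where "L \<ge> 0" "\<And>s y. s \<in> {0..T} \<Longrightarrow> \<bar>m \<epsilon> s y\<bar> \<le> L"
proof -
  obtain E where E: "E > 0" "\<And>\<epsilon> z::'a. \<epsilon> > 0 \<Longrightarrow> norm (moll_grad \<epsilon> z) \<le> E / \<epsilon>" using moll_grad_bound by blast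
  define L where "L = C * (sqrt (measure lborel (cball (0::'a) M)) * D * (E / \<epsilon>))"
  have "\<bar>m \<epsilon> s y\<bar> \<le> L" if "s \<in> {0..T}" for s y
  proof -
    have b: "norm (r s x * (u s x \<bullet> moll_grad \<epsilon> (x - y))) \<le> C * (norm (u s x) * (E / \<epsilon>))" for x
    proof -
      have "\<bar>u s x \<bullet> moll_grad \<epsilon> (x - y)\<bar> \<le> norm (u s x) * norm (moll_grad \<epsilon> (x - y))"
        by (rule Cauchy_Schwarz_ineq2)
      also have "\<dots> \<le> norm (u s x) * (E / \<epsilon>)" using E assms by (intro mult_left_mono) auto
      finally show ?thesis
        unfolding real_norm_def abs_mult by (intro mult_mono r_bound C0) auto
    qed
    have "\<bar>m \<epsilon> s y\<bar> \<le> (\<integral>x. C * (norm (u s x) * (E / \<epsilon>)) \<partial>lborel)"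
      unfolding m_eq[OF that] real_norm_def[symmetric]
      by (rule integral_norm_le_integral[OF _ _ b]) (use u_int1 in auto)
    also have "\<dots> = C * ((\<integral>x. norm (u s x) \<partial>lborel) * (E / \<epsilon>))" by simp
    also have "\<dots> \<le> L"
      unfolding L_def using C0 E assms by (intro mult_left_mono mult_right_mono u_bound1) auto
    finally show ?thesis .
  qed
  moreover have "L \<ge> 0" unfolding L_def using C0 D E assms by simp
  ultimately show thesis using that by blast
qed

lemma F_bound: "\<bar>F \<epsilon> t y\<bar> \<le> (\<integral>x. \<bar>r t x\<bar> \<partial>lborel)"
proof -
  have b: "norm (r t x * moll \<epsilon> (x - y)) \<le> \<bar>r t x\<bar>" for x
    using mult_left_mono[OF moll_le_1[of \<epsilon> "x - y"], of "\<bar>r t x\<bar>"] by (simp add: abs_mult moll_nonneg)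
  have "norm (F \<epsilon> t y) \<le> (\<integral>x. \<bar>r t x\<bar> \<partial>lborel)"
    unfolding F_def
    by (rule integral_norm_le_integral[OF _ _ b]) (use r_int in auto)
  then show ?thesis by simp
qed

text \<open>The equation at each centre y is integrated against \<open>g\<close>. Its time integral
  is a gauge integral; boundedness of \<open>m\<close> makes it a Lebesgue integral, to which Fubini
  applies, and the result is translated back.\<close>

lemma bilinear_has_integral0:
  assumes e: "0 < \<epsilon>" "\<epsilon> \<le> \<epsilon>\<^sub>0" and g[measurable]: "g \<in> borel_measurable borel"
    and gb: "\<And>y. \<bar>g y\<bar> \<le> G" and gs: "\<And>y. y \<notin> cball 0 R \<Longrightarrow> g y = 0"
    and t: "t \<in> {0..T}"
  shows "((\<lambda>s. \<integral>y. m \<epsilon> s y * g y \<partial>lborel) has_integral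
    (\<integral>y. F \<epsilon> t y * g y \<partial>lborel) - (\<integral>y. F \<epsilon> 0 y * g y \<partial>lborel)) {0..t}"
proof -
  obtain L where L: "L \<ge> 0" "\<And>s y. s \<in> {0..T} \<Longrightarrow> \<bar>m \<epsilon> s y\<bar> \<le> L" using m_bound[OF e(1)] by blast
  have G0: "G \<ge> 0" using gb[of 0] by linarith
  have mm[measurable]: "(\<lambda>p. m \<epsilon> (fst p) (snd p)) \<in> borel_measurable (borel \<Otimes>\<^sub>M borel)"
    using m_meas[of \<epsilon>] by (simp add: split_beta')
  have "(\<lambda>s. m \<epsilon> (fst (s, y)) (snd (s, y))) \<in> borel_measurable borel" for y
    by (rule measurable_compose[OF _ mm]) measurable
  then have my[measurable]: "(\<lambda>s. m \<epsilon> s y) \<in> borel_measurable borel" for y by simp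
  have Fd: "F \<epsilon> t y - F \<epsilon> 0 y = (\<integral>s. indicator {0..t} s * m \<epsilon> s y \<partial>lborel)" for y
  proof -
    have "integrable lborel (\<lambda>s. indicator {0..t} s * m \<epsilon> s y)"
      by (rule integrable_bounded_compact_support[where C=L and S="{0..t}"])
        (use L t in \<open>auto simp: indicator_def\<close>)
    then have "((\<lambda>s. indicator {0..t} s * m \<epsilon> s y) has_integral (\<integral>s. indicator {0..t} s * m \<epsilon> s y \<partial>lborel)) UNIV"
      by (rule has_integral_integral_lborel)
    moreover have "(\<lambda>s. indicator {0..t} s * m \<epsilon> s y) = (\<lambda>s. if s \<in> {0..t} then m \<epsilon> s y else 0)"
      by (auto simp: indicator_def fun_eq_iff)
    ultimately have "((\<lambda>s. m \<epsilon> s y) has_integral (\<integral>s. indicator {0..t} s * m \<epsilon> s y \<partial>lborel)) {0..t}"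
      by (simp only: has_integral_restrict_UNIV)
    moreover have "((\<lambda>s. m \<epsilon> s y) has_integral (F \<epsilon> t y - F \<epsilon> 0 y)) {0..t}"
      using eq[OF e t] by (simp add: m_def[abs_def] F_def)
    ultimately show ?thesis using has_integral_unique by blast
  qed
  have int: "integrable (lborel \<Otimes>\<^sub>M lborel) (\<lambda>(s, y). indicator {0..t} s * m \<epsilon> s y * g y)"
    unfolding lborel_prod
  proof (rule integrable_bounded_compact_support[where C="L * G" and S="{0..t} \<times> cball 0 R"])
    show "(\<lambda>(s, y). indicator {0..t} s * m \<epsilon> s y * g y) \<in> borel_measurable borel"
      unfolding borel_prod[symmetric] split_beta' by measurable
    show "norm (case p of (s, y) \<Rightarrow> indicator {0..t} s * m \<epsilon> s y * g y) \<le> L * G" for p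
      using L G0 gb t by (auto simp: indicator_def abs_mult intro!: mult_mono split: prod.splits)
    show "bounded ({0..t} \<times> cball (0::'a) R)" by (intro bounded_Times) auto
    show "(case p of (s, y) \<Rightarrow> indicator {0..t} s * m \<epsilon> s y * g y) = 0" if "p \<notin> {0..t} \<times> cball 0 R" for p
      using that gs[of "snd p"] by (cases p) (auto simp: indicator_def)
  qed
  have Fi: "integrable lborel (\<lambda>y. F \<epsilon> t' y * g y)" for t'
  proof (rule integrable_bounded_compact_support[where C="(\<integral>x. \<bar>r t' x\<bar> \<partial>lborel) * G" and S="cball 0 R"])
    show "norm (F \<epsilon> t' y * g y) \<le> (\<integral>x. \<bar>r t' x\<bar> \<partial>lborel) * G" for y
      using F_bound[of \<epsilon> t' y] gb[of y] by (auto simp: abs_mult intro!: mult_mono)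
  qed (use gs in auto)
  have ii: "integrable lborel (\<lambda>s. indicator {0..t} s * (\<integral>y. m \<epsilon> s y * g y \<partial>lborel))"
    using lborel_pair.integrable_fst[OF int] by (simp add: mult.assoc)
  have "(\<integral>y. F \<epsilon> t y * g y \<partial>lborel) - (\<integral>y. F \<epsilon> 0 y * g y \<partial>lborel) = (\<integral>y. (F \<epsilon> t y - F \<epsilon> 0 y) * g y \<partial>lborel)"
    using Fi by (simp add: left_diff_distrib)
  also have "\<dots> = (\<integral>y. \<integral>s. indicator {0..t} s * m \<epsilon> s y * g y \<partial>lborel \<partial>lborel)"
    unfolding Fd by simp
  also have "\<dots> = (\<integral>s. \<integral>y. indicator {0..t} s * m \<epsilon> s y * g y \<partial>lborel \<partial>lborel)"
    by (rule lborel_pair.Fubini_integral[OF int])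
  also have "\<dots> = (\<integral>s. indicator {0..t} s * (\<integral>y. m \<epsilon> s y * g y \<partial>lborel) \<partial>lborel)"
    by (simp add: mult.assoc)
  finally have eqn: "(\<integral>y. F \<epsilon> t y * g y \<partial>lborel) - (\<integral>y. F \<epsilon> 0 y * g y \<partial>lborel) =
    (\<integral>s. indicator {0..t} s * (\<integral>y. m \<epsilon> s y * g y \<partial>lborel) \<partial>lborel)" .
  have "(\<lambda>s. indicator {0..t} s * (\<integral>y. m \<epsilon> s y * g y \<partial>lborel)) = (\<lambda>s. if s \<in> {0..t} then (\<integral>y. m \<epsilon> s y * g y \<partial>lborel) else 0)"
    by (auto simp: indicator_def fun_eq_iff)
  then show ?thesis
    using has_integral_integral_lborel[OF ii] unfolding eqn by (simp only: has_integral_restrict_UNIV)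
qed

lemma bilinear_has_integral:
  assumes e: "0 < \<epsilon>" "\<epsilon> \<le> \<epsilon>\<^sub>0" and g: "g \<in> borel_measurable borel"
    and gb: "\<And>y. \<bar>g y\<bar> \<le> G" and gs: "\<And>y. y \<notin> cball 0 R \<Longrightarrow> g y = 0"
    and t: "0 \<le> t" "t \<le> t'" "t' \<le> T"
  shows "((\<lambda>s. \<integral>y. m \<epsilon> s y * g y \<partial>lborel) has_integral
    (\<integral>y. F \<epsilon> t' y * g y \<partial>lborel) - (\<integral>y. F \<epsilon> t y * g y \<partial>lborel)) {t..t'}"
proof -
  let ?f = "\<lambda>s. \<integral>y. m \<epsilon> s y * g y \<partial>lborel"
  have 1: "(?f has_integral (\<integral>y. F \<epsilon> t y * g y \<partial>lborel) - (\<integral>y. F \<epsilon> 0 y * g y \<partial>lborel)) {0..t}"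
    by (rule bilinear_has_integral0[OF e g gb gs]) (use t in auto)
  have 2: "(?f has_integral (\<integral>y. F \<epsilon> t' y * g y \<partial>lborel) - (\<integral>y. F \<epsilon> 0 y * g y \<partial>lborel)) {0..t'}"
    by (rule bilinear_has_integral0[OF e g gb gs]) (use t in auto)
  have i: "?f integrable_on {0..t'}" using 2 by blast
  have i2: "?f integrable_on {t..t'}"
    by (rule integrable_on_subinterval[OF i]) (use t in auto)
  have "integral {0..t} ?f + integral {t..t'} ?f = integral {0..t'} ?f"
    by (rule Henstock_Kurzweil_Integration.integral_combine[OF t(1,2) i])
  then have eq: "integral {t..t'} ?f = (\<integral>y. F \<epsilon> t' y * g y \<partial>lborel) - (\<integral>y. F \<epsilon> t y * g y \<partial>lborel)"
    using integral_unique[OF 1] integral_unique[OF 2] by linarith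
  show ?thesis using integrable_integral[OF i2] unfolding eq .
qed

lemma moll_product_integrable:
  fixes a g :: "'a \<Rightarrow> real"
  assumes e: "0 < \<epsilon>" and a: "integrable lborel a" and g[measurable]: "g \<in> borel_measurable borel" and gb: "\<And>y. \<bar>g y\<bar> \<le> G"
  shows "integrable (lborel \<Otimes>\<^sub>M lborel) (\<lambda>(x, y). a x * moll \<epsilon> (x - y) * g y)"
proof (rule Bochner_Integration.integrable_bound)
  have [measurable]: "a \<in> borel_measurable borel" using a by simp
  have G0: "G \<ge> 0" using gb[of 0] by linarith
  show "integrable (lborel \<Otimes>\<^sub>M lborel) (\<lambda>p. G * (case p of (x, y) \<Rightarrow> a x * moll \<epsilon> (x - y)))"
    by (intro integrable_mult_right integrable_convolution_product a integrable_moll e)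
  show "(\<lambda>(x, y). a x * moll \<epsilon> (x - y) * g y) \<in> borel_measurable (lborel \<Otimes>\<^sub>M lborel)" by measurable
  show "AE p in lborel \<Otimes>\<^sub>M lborel. norm (case p of (x, y) \<Rightarrow> a x * moll \<epsilon> (x - y) * g y)
      \<le> norm (G * (case p of (x, y) \<Rightarrow> a x * moll \<epsilon> (x - y)))"
  proof (rule AE_I2)
    fix p :: "'a \<times> 'a"
    obtain x y where p: "p = (x, y)" by (cases p)
    show "norm (case p of (x, y) \<Rightarrow> a x * moll \<epsilon> (x - y) * g y) \<le> norm (G * (case p of (x, y) \<Rightarrow> a x * moll \<epsilon> (x - y)))"
      using mult_right_mono[OF gb[of y], of "\<bar>a x * moll \<epsilon> (x - y)\<bar>"] G0 by (simp add: p abs_mult mult_ac)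
  qed
qed

lemma flux_product_integrable:
  assumes e: "0 < \<epsilon>" and q: "(\<lambda>(x, y). q x y) \<in> borel_measurable (borel \<Otimes>\<^sub>M borel)" and qb: "\<And>x y. \<bar>q x y\<bar> \<le> G"
  shows "integrable (lborel \<Otimes>\<^sub>M lborel) (\<lambda>(x, y). q x y * (u t x \<bullet> moll_grad \<epsilon> (x - y)))"
proof (rule Bochner_Integration.integrable_bound)
  have G0: "G \<ge> 0" using qb[of 0 0] by linarith
  have [measurable]: "(\<lambda>p. q (fst p) (snd p)) \<in> borel_measurable (borel \<Otimes>\<^sub>M borel)"
    using q by (simp add: split_beta')
  show "integrable (lborel \<Otimes>\<^sub>M lborel) (\<lambda>p. G * (case p of (x, y) \<Rightarrow> norm (u t x) * norm (moll_grad \<epsilon> (x - y))))"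
    by (intro integrable_mult_right integrable_convolution_product[of _ "\<lambda>z. norm (moll_grad \<epsilon> z)"] u_int1 integrable_norm integrable_moll_grad e)
  show "(\<lambda>(x, y). q x y * (u t x \<bullet> moll_grad \<epsilon> (x - y))) \<in> borel_measurable (lborel \<Otimes>\<^sub>M lborel)"
    unfolding split_beta' by measurable
  show "AE p in lborel \<Otimes>\<^sub>M lborel. norm (case p of (x, y) \<Rightarrow> q x y * (u t x \<bullet> moll_grad \<epsilon> (x - y)))
      \<le> norm (G * (case p of (x, y) \<Rightarrow> norm (u t x) * norm (moll_grad \<epsilon> (x - y))))"
    using qb G0 by (intro AE_I2) (auto simp: abs_mult intro!: mult_mono Cauchy_Schwarz_ineq2 split: prod.splits)
qed

text \<open>The integrand is odd, so reflection identifies the integral with its negative.\<close>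

lemma integral_moll_grad: "(\<integral>z. moll_grad \<epsilon> (z::'a) \<partial>lborel) = 0"
proof -
  have "(\<integral>z. moll_grad \<epsilon> (z::'a) \<partial>lborel) = (\<integral>z. moll_grad \<epsilon> (0 - (z::'a)) \<partial>lborel)"
    by (rule integral_reflect(1)[symmetric]) measurable
  also have "\<dots> = - (\<integral>z. moll_grad \<epsilon> (z::'a) \<partial>lborel)"
    by (simp add: moll_grad_odd)
  finally show ?thesis by (simp add: eq_neg_iff_add_eq_0 flip: scaleR_2)
qed

lemma integral_flux_y:
  fixes a x :: 'a
  assumes "\<epsilon> > 0"
  shows "(\<integral>y. a \<bullet> moll_grad \<epsilon> (x - y) \<partial>lborel) = 0"
proof -
  have "integrable lborel (\<lambda>y. moll_grad \<epsilon> (x - y))"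
    using integral_reflect(2)[of "moll_grad \<epsilon>" x] integrable_moll_grad[OF assms] by simp
  then have "(\<integral>y. a \<bullet> moll_grad \<epsilon> (x - y) \<partial>lborel) = a \<bullet> (\<integral>y. moll_grad \<epsilon> (x - y) \<partial>lborel)"
    by (rule integral_inner_right)
  also have "(\<integral>y. moll_grad \<epsilon> (x - y) \<partial>lborel) = (\<integral>y. moll_grad \<epsilon> y \<partial>lborel)"
    by (rule integral_reflect(1)) measurable
  also have "\<dots> = 0" by (rule integral_moll_grad)
  finally show ?thesis by simp
qed

text \<open>Mollifiers of the one radius \<open>\<epsilon>\<^sub>0\<close> are integrated over all
  centres in a ball that contains the neighbourhood of \<Omega> of that radius. Together they act as
  a constant test function: the density side becomes a multiple of the mass, and the flux side
  vanishes because the mollifier gradient has integral zero. No limit is taken.\<close>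

theorem mass_conserved: "(\<integral>x. r T x \<partial>lborel) = (\<integral>x. r 0 x \<partial>lborel)"
proof -
  define g where "g = indicat_real (cball (0::'a) (M + \<epsilon>\<^sub>0))"
  have [measurable]: "g \<in> borel_measurable borel"
    unfolding g_def by (rule borel_measurable_indicator) simp
  have gb: "\<bar>g y\<bar> \<le> 1" for y by (simp add: g_def indicator_def)
  have near: "g y = 1" if "x \<in> \<Omega>" "x - y \<in> cball 0 \<epsilon>\<^sub>0" for x y
  proof -
    have "norm y \<le> norm x + norm (x - y)" by (metis add.commute diff_add_cancel norm_minus_commute norm_triangle_ineq)
    then show ?thesis using that \<Omega> by (auto simp: g_def indicator_def)
  qed
  define c where "c = moll_mass TYPE('a) \<epsilon>\<^sub>0"
  have c: "c > 0" unfolding c_def by (rule moll_mass_pos[OF \<epsilon>\<^sub>0])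
  have Fg: "(\<integral>y. F \<epsilon>\<^sub>0 t y * g y \<partial>lborel) = c * (\<integral>x. r t x \<partial>lborel)" for t
  proof -
    note int = moll_product_integrable[OF \<epsilon>\<^sub>0 r_int[of t] \<open>g \<in> borel_measurable borel\<close> gb]
    have "(\<integral>y. F \<epsilon>\<^sub>0 t y * g y \<partial>lborel) = (\<integral>y. \<integral>x. r t x * moll \<epsilon>\<^sub>0 (x - y) * g y \<partial>lborel \<partial>lborel)"
      by (simp add: F_def)
    also have "\<dots> = (\<integral>x. \<integral>y. r t x * moll \<epsilon>\<^sub>0 (x - y) * g y \<partial>lborel \<partial>lborel)"
      by (rule lborel_pair.Fubini_integral[OF int])
    also have "\<dots> = (\<integral>x. c * r t x \<partial>lborel)"
    proof (rule Bochner_Integration.integral_cong[OF refl])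
      fix x
      have "(\<integral>y. r t x * moll \<epsilon>\<^sub>0 (x - y) * g y \<partial>lborel) = (\<integral>y. r t x * moll \<epsilon>\<^sub>0 (x - y) \<partial>lborel)"
      proof (rule Bochner_Integration.integral_cong[OF refl])
        fix y show "r t x * moll \<epsilon>\<^sub>0 (x - y) * g y = r t x * moll \<epsilon>\<^sub>0 (x - y)"
          using near[of x y] r_supp[of x t] moll_support(1)[OF \<epsilon>\<^sub>0, of "x - y"] by fastforce
      qed
      also have "\<dots> = r t x * c"
        using integral_reflect(1)[of "moll \<epsilon>\<^sub>0" x] by (simp add: c_def moll_mass_def)
      finally show "(\<integral>y. r t x * moll \<epsilon>\<^sub>0 (x - y) * g y \<partial>lborel) = c * r t x" by simp
    qed
    finally show ?thesis by simp
  qed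
  have mg: "(\<integral>y. m \<epsilon>\<^sub>0 s y * g y \<partial>lborel) = 0" if s: "s \<in> {0..T}" for s
  proof -
    have int: "integrable (lborel \<Otimes>\<^sub>M lborel) (\<lambda>(x, y). (r s x * g y) * (u s x \<bullet> moll_grad \<epsilon>\<^sub>0 (x - y)))"
    proof (rule flux_product_integrable[OF \<epsilon>\<^sub>0])
      show "(\<lambda>(x, y). r s x * g y) \<in> borel_measurable (borel \<Otimes>\<^sub>M borel)" by measurable
      show "\<bar>r s x * g y\<bar> \<le> C * 1" for x y
        unfolding abs_mult using r_bound gb C0 by (intro mult_mono) auto
    qed
    have "(\<integral>y. m \<epsilon>\<^sub>0 s y * g y \<partial>lborel) = (\<integral>y. \<integral>x. (r s x * g y) * (u s x \<bullet> moll_grad \<epsilon>\<^sub>0 (x - y)) \<partial>lborel \<partial>lborel)"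
      unfolding m_eq[OF s] by (simp add: mult_ac flip: integral_mult_right_zero)
    also have "\<dots> = (\<integral>x. \<integral>y. (r s x * g y) * (u s x \<bullet> moll_grad \<epsilon>\<^sub>0 (x - y)) \<partial>lborel \<partial>lborel)"
      by (rule lborel_pair.Fubini_integral[OF int])
    also have "\<dots> = (\<integral>x. 0 \<partial>(lborel :: 'a measure))"
    proof (rule Bochner_Integration.integral_cong[OF refl])
      fix x
      have "(\<integral>y. (r s x * g y) * (u s x \<bullet> moll_grad \<epsilon>\<^sub>0 (x - y)) \<partial>lborel) = (\<integral>y. r s x * (u s x \<bullet> moll_grad \<epsilon>\<^sub>0 (x - y)) \<partial>lborel)"
      proof (rule Bochner_Integration.integral_cong[OF refl])
        fix y show "r s x * g y * (u s x \<bullet> moll_grad \<epsilon>\<^sub>0 (x - y)) = r s x * (u s x \<bullet> moll_grad \<epsilon>\<^sub>0 (x - y))"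
          using near[of x y] r_supp[of x s] moll_support(2)[OF \<epsilon>\<^sub>0, of "x - y"] by fastforce
      qed
      also have "\<dots> = 0" by (simp add: integral_flux_y[OF \<epsilon>\<^sub>0])
      finally show "(\<integral>y. (r s x * g y) * (u s x \<bullet> moll_grad \<epsilon>\<^sub>0 (x - y)) \<partial>lborel) = 0" .
    qed
    finally show ?thesis by simp
  qed
  have "((\<lambda>s. \<integral>y. m \<epsilon>\<^sub>0 s y * g y \<partial>lborel) has_integral
    (\<integral>y. F \<epsilon>\<^sub>0 T y * g y \<partial>lborel) - (\<integral>y. F \<epsilon>\<^sub>0 0 y * g y \<partial>lborel)) {0..T}"
    by (rule bilinear_has_integral[OF \<epsilon>\<^sub>0 order_refl \<open>g \<in> borel_measurable borel\<close> gb, where R="M + \<epsilon>\<^sub>0"]) (use T in \<open>auto simp: g_def\<close>)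
  then have "((\<lambda>s. 0) has_integral (c * (\<integral>x. r T x \<partial>lborel) - c * (\<integral>x. r 0 x \<partial>lborel))) {0..T}"
    unfolding Fg by (rule has_integral_eq[rotated]) (use mg in auto)
  then have "c * (\<integral>x. r T x \<partial>lborel) - c * (\<integral>x. r 0 x \<partial>lborel) = 0"
    using has_integral_unique[OF _ has_integral_0] by blast
  then show ?thesis using c by simp
qed

end

lemma integral_norm_le_nn_integral:
  fixes f :: "'a \<Rightarrow> 'b::{banach, second_countable_topology}"
  shows "ennreal (norm (\<integral>x. f x \<partial>N)) \<le> (\<integral>\<^sup>+x. ennreal (norm (f x)) \<partial>N)"
  by (cases "integrable N f") (auto simp: integral_norm_bound_ennreal not_integrable_integral_eq)

lemma integral_pair_fst:
  fixes f :: "'a::euclidean_space \<Rightarrow> 'b::euclidean_space \<Rightarrow> real"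
  assumes "integrable (lborel \<Otimes>\<^sub>M lborel) (\<lambda>(x, y). f x y)"
  shows "integral\<^sup>L (lborel \<Otimes>\<^sub>M lborel) (\<lambda>(x, y). f x y) = (\<integral>x. \<integral>y. f x y \<partial>lborel \<partial>lborel)"
  using lborel_pair.integral_fst'[OF assms] by simp

context transported_density
begin

section \<open>The energy as a form in two time variables\<close>

lemma r_sq_bound: "(r t x)\<^sup>2 \<le> C\<^sup>2"
  using power_mono[OF r_bound[of t x] abs_ge_zero, of 2] by simp

text \<open>A symmetric form in the densities at two times. Its diagonal, divided by the mass of the
  mollifier, tends to the integral of the squared density; \<open>K\<close> is its derivative in the
  first time, in integrated form.\<close>

definition B :: "real \<Rightarrow> real \<Rightarrow> real \<Rightarrow> real" where
  "B \<epsilon> t s = (\<integral>y. F \<epsilon> t y * r s y \<partial>lborel)"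

definition K :: "real \<Rightarrow> real \<Rightarrow> real \<Rightarrow> real" where
  "K \<epsilon> t s = (\<integral>y. m \<epsilon> t y * r s y \<partial>lborel)"

lemma B_eq_pair:
  assumes "\<epsilon> > 0"
  shows "B \<epsilon> t s = (\<integral>y. \<integral>x. r t x * moll \<epsilon> (x - y) * r s y \<partial>lborel \<partial>lborel)"
  by (simp add: B_def F_def)

lemma B_sym:
  assumes e: "\<epsilon> > 0"
  shows "B \<epsilon> t s = B \<epsilon> s t"
proof -
  have ev: "moll \<epsilon> (x - y) = moll \<epsilon> (y - x)" for x y :: 'a
    using moll_even[of \<epsilon> "x - y"] by simp
  have "B \<epsilon> t s = (\<integral>x. \<integral>y. r t x * moll \<epsilon> (x - y) * r s y \<partial>lborel \<partial>lborel)"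
    unfolding B_eq_pair[OF e]
    by (rule lborel_pair.Fubini_integral[OF moll_product_integrable[OF e r_int r_meas r_bound]])
  also have "\<dots> = (\<integral>x. \<integral>y. r s y * moll \<epsilon> (y - x) * r t x \<partial>lborel \<partial>lborel)"
  proof -
    have "r t x * moll \<epsilon> (x - y) * r s y = r s y * moll \<epsilon> (y - x) * r t x" for x y
      using ev[of x y] by simp
    then show ?thesis by (simp only:)
  qed
  also have "\<dots> = B \<epsilon> s t" unfolding B_eq_pair[OF e] ..
  finally show ?thesis .
qed

lemma K_has_integral:
  assumes "0 < \<epsilon>" "\<epsilon> \<le> \<epsilon>\<^sub>0" "0 \<le> t" "t \<le> t'" "t' \<le> T"
  shows "((\<lambda>\<tau>. K \<epsilon> \<tau> s) has_integral (B \<epsilon> t' s - B \<epsilon> t s)) {t..t'}"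
  unfolding K_def B_def
  by (rule bilinear_has_integral[OF assms(1,2) r_meas r_bound r_out assms(3-5)])

text \<open>For fixed t the function \<open>m \<epsilon> t\<close> is bounded and measurable, so
  weak continuity of \<open>r\<close> applies in the second time variable. In the first one only the
  bound \<open>K_bound\<close> is used.\<close>

lemma K_cont:
  assumes "0 < \<epsilon>" "t \<in> {0..T}"
  shows "continuous_on {0..T} (K \<epsilon> t)"
proof -
  obtain L where L: "\<And>s y. s \<in> {0..T} \<Longrightarrow> \<bar>m \<epsilon> s y\<bar> \<le> L" using m_bound[OF assms(1)] by blast
  have "continuous_on {0..T} (\<lambda>s. \<integral>x. r s x * m \<epsilon> t x \<partial>lborel)"
    by (rule r_weak[OF m_meas1 L[OF assms(2)]])
  then show ?thesis by (simp add: K_def[abs_def] mult.commute)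
qed

lemma K_bound:
  assumes "0 < \<epsilon>"
  obtains L where "\<And>t s. t \<in> {0..T} \<Longrightarrow> \<bar>K \<epsilon> t s\<bar> \<le> L"
proof -
  obtain L where L: "L \<ge> 0" "\<And>s y. s \<in> {0..T} \<Longrightarrow> \<bar>m \<epsilon> s y\<bar> \<le> L" using m_bound[OF assms(1)] by blast
  have "\<bar>K \<epsilon> t s\<bar> \<le> (\<integral>y. indicator (cball (0::'a) M) y * (L * C) \<partial>lborel)" if "t \<in> {0..T}" for t s
    unfolding K_def real_norm_def[symmetric]
  proof (rule integral_norm_le_integral[OF _ integrable_indicator_cball])
    show "norm (m \<epsilon> t y * r s y) \<le> indicator (cball 0 M) y * (L * C)" for y
    proof (cases "y \<in> cball 0 M")
      case True
      have "\<bar>m \<epsilon> t y\<bar> * \<bar>r s y\<bar> \<le> L * C" using L that r_bound by (intro mult_mono) auto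
      then show ?thesis using True by (simp add: abs_mult)
    qed (simp add: r_out)
  qed simp
  then show thesis using that by blast
qed

text \<open>Since \<open>r\<close> is only weakly continuous in time there is no chain rule for \<open>B \<epsilon> t t\<close>; its increment is
  collected from the increments in the two time variables separately, along a staircase.\<close>

lemma diagonal_partition:
  assumes e: "0 < \<epsilon>" "\<epsilon> \<le> \<epsilon>\<^sub>0" and n: "n > 0"
  defines "fl \<equiv> \<lambda>\<tau>. T * real_of_int \<lfloor>\<tau> * real n / T\<rfloor> / real n"
  shows "((\<lambda>\<tau>. K \<epsilon> \<tau> (fl \<tau>) + K \<epsilon> \<tau> (min T (fl \<tau> + T / real n))) has_integral (B \<epsilon> T T - B \<epsilon> 0 0)) {0..T}"
proof -
  \<comment> \<open>The \<open>min T\<close> in the statement acts only at \<tau> = T, since for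
    earlier \<tau> the next grid point is at most T; it keeps the second time inside [0,T].\<close>
  define p where "p i = T * real i / real n" for i :: nat
  define h where "h \<tau> = K \<epsilon> \<tau> (fl \<tau>) + K \<epsilon> \<tau> (min T (fl \<tau> + T / real n))" for \<tau>
  have "(h has_integral (B \<epsilon> (p i) (p i) - B \<epsilon> 0 0)) {0..p i}" if "i \<le> n" for i
    using that
  proof (induction i)
    case 0
    have "p 0 = 0" by (simp add: p_def)
    then show ?case by (simp add: has_integral_refl)
  next
    case (Suc i)
    have p0: "0 \<le> p i" using T by (simp add: p_def)
    have pi: "p i < p (Suc i)" using T n by (simp add: p_def divide_strict_right_mono)
    have pT: "p (Suc i) \<le> T" using Suc.prems n T by (simp add: p_def divide_simps)
    have step: "p (Suc i) = p i + T / real n" by (simp add: p_def field_simps add_divide_distrib)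
    \<comment> \<open>The first time moves across the cell twice, with the second time frozen at the
      left and at the right grid point. By symmetry the mixed terms cancel, and the diagonal
      increment remains.\<close>
    have "((\<lambda>\<tau>. K \<epsilon> \<tau> (p i) + K \<epsilon> \<tau> (p (Suc i))) has_integral
      (B \<epsilon> (p (Suc i)) (p i) - B \<epsilon> (p i) (p i)) + (B \<epsilon> (p (Suc i)) (p (Suc i)) - B \<epsilon> (p i) (p (Suc i)))) {p i..p (Suc i)}"
      by (intro has_integral_add K_has_integral e p0 less_imp_le[OF pi] pT)
    moreover have "(B \<epsilon> (p (Suc i)) (p i) - B \<epsilon> (p i) (p i)) + (B \<epsilon> (p (Suc i)) (p (Suc i)) - B \<epsilon> (p i) (p (Suc i)))
       = B \<epsilon> (p (Suc i)) (p (Suc i)) - B \<epsilon> (p i) (p i)"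
      using B_sym[OF e(1), of "p i" "p (Suc i)"] by simp
    ultimately have 1: "((\<lambda>\<tau>. K \<epsilon> \<tau> (p i) + K \<epsilon> \<tau> (p (Suc i))) has_integral
       (B \<epsilon> (p (Suc i)) (p (Suc i)) - B \<epsilon> (p i) (p i))) {p i..p (Suc i)}" by (simp only:)
    have fl: "fl \<tau> = p i" if "\<tau> \<in> {p i..p (Suc i)} - {p (Suc i)}" for \<tau>
    proof -
      have "real i \<le> \<tau> * real n / T" "\<tau> * real n / T < real i + 1"
        using that T n by (auto simp: p_def field_simps)
      then have "\<lfloor>\<tau> * real n / T\<rfloor> = int i" by (intro floor_unique) auto
      then show ?thesis by (simp add: fl_def p_def)
    qed
    have 2: "(h has_integral (B \<epsilon> (p (Suc i)) (p (Suc i)) - B \<epsilon> (p i) (p i))) {p i..p (Suc i)}"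
    \<comment> \<open>At the right end point the floor already takes the next value, which a single
      exceptional point absorbs.\<close>
    proof (rule has_integral_spike_finite[OF _ _ 1, of "{p (Suc i)}"])
      show "h \<tau> = K \<epsilon> \<tau> (p i) + K \<epsilon> \<tau> (p (Suc i))" if "\<tau> \<in> {p i..p (Suc i)} - {p (Suc i)}" for \<tau>
        unfolding h_def fl[OF that] step[symmetric] using pT by (simp add: min_absorb2)
    qed simp
    have "(h has_integral ((B \<epsilon> (p i) (p i) - B \<epsilon> 0 0) + (B \<epsilon> (p (Suc i)) (p (Suc i)) - B \<epsilon> (p i) (p i)))) {0..p (Suc i)}"
      by (rule has_integral_combine[OF p0 less_imp_le[OF pi] Suc.IH 2]) (use Suc.prems in simp)
    then show ?case by simp
  qed
  from this[of n] have "(h has_integral (B \<epsilon> (p n) (p n) - B \<epsilon> 0 0)) {0..p n}" by simp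
  moreover have "p n = T" using n by (simp add: p_def)
  ultimately show ?thesis by (simp add: h_def[abs_def])
qed

text \<open>As the grid is refined both frozen times tend to \<tau>, and continuity of
  \<open>K \<epsilon> \<tau>\<close> makes the staircase integrands converge pointwise to twice the
  diagonal value. They are uniformly bounded, while their integrals do not change with the
  grid.\<close>

lemma diagonal_has_integral:
  assumes e: "0 < \<epsilon>" "\<epsilon> \<le> \<epsilon>\<^sub>0"
  shows "((\<lambda>\<tau>. 2 * K \<epsilon> \<tau> \<tau>) has_integral (B \<epsilon> T T - B \<epsilon> 0 0)) {0..T}"
proof -
  define fl where "fl n \<tau> = T * real_of_int \<lfloor>\<tau> * real n / T\<rfloor> / real n" for n :: nat and \<tau>
  define h where "h n \<tau> = K \<epsilon> \<tau> (fl (Suc n) \<tau>) + K \<epsilon> \<tau> (min T (fl (Suc n) \<tau> + T / real (Suc n)))" for n \<tau>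
  have hi: "(h n has_integral (B \<epsilon> T T - B \<epsilon> 0 0)) {0..T}" for n
    unfolding h_def fl_def by (rule diagonal_partition[OF e]) simp
  obtain L where L: "\<And>t s. t \<in> {0..T} \<Longrightarrow> \<bar>K \<epsilon> t s\<bar> \<le> L" using K_bound[OF e(1)] by blast
  have tend: "(\<lambda>n. h n \<tau>) \<longlonglongrightarrow> 2 * K \<epsilon> \<tau> \<tau>" if \<tau>: "\<tau> \<in> {0..T}" for \<tau>
  proof -
    have b: "fl (Suc n) \<tau> \<le> \<tau>" "\<tau> - T / real (Suc n) \<le> fl (Suc n) \<tau>" "fl (Suc n) \<tau> \<ge> 0" for n
    proof -
      have "T * real_of_int \<lfloor>\<tau> * real (Suc n) / T\<rfloor> \<le> T * (\<tau> * real (Suc n) / T)"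
        using T by (intro mult_left_mono) auto
      also have "\<dots> = \<tau> * real (Suc n)" using T by simp
      finally show "fl (Suc n) \<tau> \<le> \<tau>" unfolding fl_def by (simp add: pos_divide_le_eq del: of_nat_Suc)
      have "\<tau> * real (Suc n) - T = T * (\<tau> * real (Suc n) / T - 1)" using T by (simp add: right_diff_distrib)
      also have "\<dots> \<le> T * real_of_int \<lfloor>\<tau> * real (Suc n) / T\<rfloor>"
        using T by (intro mult_left_mono) linarith+
      finally have "(\<tau> * real (Suc n) - T) / real (Suc n) \<le> fl (Suc n) \<tau>"
        unfolding fl_def by (rule divide_right_mono) simp
      then show "\<tau> - T / real (Suc n) \<le> fl (Suc n) \<tau>" by (simp add: diff_divide_distrib del: of_nat_Suc)
      show "fl (Suc n) \<tau> \<ge> 0" unfolding fl_def using T \<tau> by simp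
    qed
    have z: "(\<lambda>n. T / real (Suc n)) \<longlonglongrightarrow> 0"
      using tendsto_mult[OF tendsto_const[of T] LIMSEQ_inverse_real_of_nat] by (simp add: divide_inverse)
    have lz: "(\<lambda>n. \<tau> - T / real (Suc n)) \<longlonglongrightarrow> \<tau>"
      using tendsto_diff[OF tendsto_const[of \<tau>] z] by simp
    have f1: "(\<lambda>n. fl (Suc n) \<tau>) \<longlonglongrightarrow> \<tau>"
      by (rule tendsto_sandwich[OF _ _ lz tendsto_const]) (use b in auto)
    have f2: "(\<lambda>n. min T (fl (Suc n) \<tau> + T / real (Suc n))) \<longlonglongrightarrow> min T (\<tau> + 0)"
      by (intro tendsto_min tendsto_const tendsto_add f1 z)
    have min: "min T (\<tau> + 0) = \<tau>" using \<tau> by simp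
    have c: "(\<lambda>n. K \<epsilon> \<tau> (g n)) \<longlonglongrightarrow> K \<epsilon> \<tau> \<tau>" if "g \<longlonglongrightarrow> \<tau>" "\<And>n. g n \<in> {0..T}" for g
      by (rule continuous_on_tendsto_compose[OF K_cont[OF e(1) \<tau>] that(1) \<tau>]) (use that(2) in auto)
    have "(\<lambda>n. h n \<tau>) \<longlonglongrightarrow> K \<epsilon> \<tau> \<tau> + K \<epsilon> \<tau> \<tau>"
      unfolding h_def
    proof (intro tendsto_add c)
      show "(\<lambda>n. fl (Suc n) \<tau>) \<longlonglongrightarrow> \<tau>" by (rule f1)
      show "(\<lambda>n. min T (fl (Suc n) \<tau> + T / real (Suc n))) \<longlonglongrightarrow> \<tau>" using f2 min by simp
      show "fl (Suc n) \<tau> \<in> {0..T}" for n using b(1,3)[of n] \<tau> unfolding atLeastAtMost_iff by linarith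
      have "T / real (Suc n) \<ge> 0" for n using T by simp
      then show "min T (fl (Suc n) \<tau> + T / real (Suc n)) \<in> {0..T}" for n using b(3)[of n] T by (simp del: of_nat_Suc add: add_nonneg_nonneg)
    qed
    then show ?thesis by simp
  qed
  have int: "(\<lambda>\<tau>. 2 * K \<epsilon> \<tau> \<tau>) integrable_on {0..T}"
    and lim: "(\<lambda>n. integral {0..T} (h n)) \<longlonglongrightarrow> integral {0..T} (\<lambda>\<tau>. 2 * K \<epsilon> \<tau> \<tau>)"
  proof -
    have hb: "norm (h n \<tau>) \<le> 2 * L" if "\<tau> \<in> {0..T}" for n \<tau>
      using L[OF that, of "fl (Suc n) \<tau>"] L[OF that, of "min T (fl (Suc n) \<tau> + T / real (Suc n))"] by (simp add: h_def)
    show "(\<lambda>\<tau>. 2 * K \<epsilon> \<tau> \<tau>) integrable_on {0..T}"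
      by (rule dominated_convergence(1)[OF has_integral_integrable[OF hi] _ hb tend]) auto
    show "(\<lambda>n. integral {0..T} (h n)) \<longlonglongrightarrow> integral {0..T} (\<lambda>\<tau>. 2 * K \<epsilon> \<tau> \<tau>)"
      by (rule dominated_convergence(2)[OF has_integral_integrable[OF hi] _ hb tend]) auto
  qed
  have "(\<lambda>n. integral {0..T} (h n)) \<longlonglongrightarrow> B \<epsilon> T T - B \<epsilon> 0 0"
    using integral_unique[OF hi] by simp
  then have "integral {0..T} (\<lambda>\<tau>. 2 * K \<epsilon> \<tau> \<tau>) = B \<epsilon> T T - B \<epsilon> 0 0"
    using lim LIMSEQ_unique by blast
  then show ?thesis using integrable_integral[OF int] by simp
qed

text \<open>Since \<open>u\<close> is divergence free and the kernel is odd, \<open>r(x) r(y)\<close> may be replaced by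
  \<open>- (r(x) - r(y))\<^sup>2 / 2\<close>; symmetrising then brings in the difference quotient of \<open>u\<close>.\<close>

lemma K_symmetrized:
  assumes e: "0 < \<epsilon>" "\<epsilon> \<le> \<epsilon>\<^sub>0" and t: "t \<in> {0..T}"
  shows "- 4 * K \<epsilon> t t =
    (\<integral>x. \<integral>y. (r t x - r t y)\<^sup>2 * ((u t x - u t y) \<bullet> moll_grad \<epsilon> (x - y)) \<partial>lborel \<partial>lborel)"
proof -
  define k where "k x y = u t x \<bullet> moll_grad \<epsilon> (x - y)" for x y
  have sq: "\<bar>(r t x)\<^sup>2\<bar> \<le> C * C" for x
    using mult_mono[OF r_bound[of t x] r_bound[of t x]] C0 by (simp add: power2_eq_square abs_mult)
  have pr: "\<bar>r t x * r t y\<bar> \<le> C * C" for x y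
    unfolding abs_mult by (intro mult_mono r_bound C0) auto
  have i1: "integrable (lborel \<Otimes>\<^sub>M lborel) (\<lambda>(x, y). (r t x)\<^sup>2 * k x y)"
    unfolding k_def by (rule flux_product_integrable[OF e(1) _ sq]) measurable
  have i2: "integrable (lborel \<Otimes>\<^sub>M lborel) (\<lambda>(x, y). (r t y)\<^sup>2 * k x y)"
    unfolding k_def by (rule flux_product_integrable[OF e(1) _ sq]) measurable
  have i3: "integrable (lborel \<Otimes>\<^sub>M lborel) (\<lambda>(x, y). (r t x * r t y) * k x y)"
    unfolding k_def by (rule flux_product_integrable[OF e(1) _ pr]) measurable
  let ?I = "\<lambda>f. integral\<^sup>L (lborel \<Otimes>\<^sub>M lborel) (\<lambda>(x::'a, y::'a). f x y) :: real"
  \<comment> \<open>The square does not depend on y, and the mollifier gradient integrates to zero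
    in y.\<close>
  have I1: "?I (\<lambda>x y. (r t x)\<^sup>2 * k x y) = 0"
  proof -
    have "?I (\<lambda>x y. (r t x)\<^sup>2 * k x y) = (\<integral>x. \<integral>y. (r t x)\<^sup>2 * k x y \<partial>lborel \<partial>lborel)"
      by (rule integral_pair_fst[OF i1])
    also have "\<dots> = 0" unfolding k_def by (simp add: integral_flux_y[OF e(1)])
    finally show ?thesis .
  qed
  \<comment> \<open>The square does not depend on x, and the integral over x vanishes by the
    divergence condition tested with mollifiers.\<close>
  have I2: "?I (\<lambda>x y. (r t y)\<^sup>2 * k x y) = 0"
  proof -
    have "?I (\<lambda>x y. (r t y)\<^sup>2 * k x y) = (\<integral>y. \<integral>x. (r t y)\<^sup>2 * k x y \<partial>lborel \<partial>lborel)"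
      by (rule lborel_pair.integral_snd[OF i2, symmetric])
    also have "\<dots> = 0" unfolding k_def by (simp add: div[OF e])
    finally show ?thesis .
  qed
  have I3: "?I (\<lambda>x y. (r t x * r t y) * k x y) = K \<epsilon> t t"
  proof -
    have "?I (\<lambda>x y. (r t x * r t y) * k x y) = (\<integral>y. \<integral>x. (r t x * r t y) * k x y \<partial>lborel \<partial>lborel)"
      by (rule lborel_pair.integral_snd[OF i3, symmetric])
    also have "\<dots> = (\<integral>y. m \<epsilon> t y * r t y \<partial>lborel)"
    proof (rule Bochner_Integration.integral_cong[OF refl])
      fix y
      have "(\<integral>x. (r t x * r t y) * k x y \<partial>lborel) = (\<integral>x. (r t x * (u t x \<bullet> moll_grad \<epsilon> (x - y))) * r t y \<partial>lborel)"
        by (simp only: k_def mult.commute mult.assoc mult.left_commute)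
      also have "\<dots> = m \<epsilon> t y * r t y" unfolding m_eq[OF t] by (rule integral_mult_left_zero)
      finally show "(\<integral>x. (r t x * r t y) * k x y \<partial>lborel) = m \<epsilon> t y * r t y" .
    qed
    finally show ?thesis by (simp add: K_def)
  qed
  define q where "q x y = (r t x - r t y)\<^sup>2 * k x y" for x y
  have q_split: "(\<lambda>(x, y). q x y) = (\<lambda>p. ((case p of (x, y) \<Rightarrow> (r t x)\<^sup>2 * k x y) + (case p of (x, y) \<Rightarrow> (r t y)\<^sup>2 * k x y))
     - 2 * (case p of (x, y) \<Rightarrow> (r t x * r t y) * k x y))"
    by (auto simp: q_def fun_eq_iff power2_diff algebra_simps)
  have iq: "integrable (lborel \<Otimes>\<^sub>M lborel) (\<lambda>(x, y). q x y)"
    unfolding q_split by (intro Bochner_Integration.integrable_diff Bochner_Integration.integrable_add integrable_mult_right i1 i2 i3)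
  have Iq: "?I q = - 2 * K \<epsilon> t t"
    unfolding q_split
    by (subst Bochner_Integration.integral_diff)
      (use i1 i2 i3 I1 I2 I3 in \<open>auto intro!: Bochner_Integration.integrable_add integrable_mult_right\<close>)
  have iq': "integrable (lborel \<Otimes>\<^sub>M lborel) (\<lambda>(x, y). q y x)"
    using lborel_pair.integrable_product_swap[OF iq] by simp
  have Iq': "?I (\<lambda>x y. q y x) = ?I q"
    using lborel_pair.integral_product_swap[of "\<lambda>(x, y). q x y"] iq by simp
  \<comment> \<open>Exchanging x and y reverses the sign of the odd gradient, so the sum of the two
    integrands contains u t x - u t y.\<close>
  have sym: "(r t x - r t y)\<^sup>2 * ((u t x - u t y) \<bullet> moll_grad \<epsilon> (x - y)) = q x y + q y x" for x y
  proof -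
    have "moll_grad \<epsilon> (x - y) = - moll_grad \<epsilon> (y - x)" using moll_grad_odd[of \<epsilon> "y - x"] by simp
    then have "u t y \<bullet> moll_grad \<epsilon> (x - y) = - k y x" by (simp add: k_def)
    moreover have "(r t y - r t x)\<^sup>2 = (r t x - r t y)\<^sup>2" by (rule power2_commute)
    ultimately show ?thesis by (simp add: q_def k_def inner_diff_left algebra_simps)
  qed
  have iqq: "integrable (lborel \<Otimes>\<^sub>M lborel) (\<lambda>(x, y). q x y + q y x)"
    using Bochner_Integration.integrable_add[OF iq iq'] by (simp add: split_beta')
  have "(\<integral>x. \<integral>y. q x y + q y x \<partial>lborel \<partial>lborel) = ?I (\<lambda>x y. q x y + q y x)"
    by (rule integral_pair_fst[OF iqq, symmetric])
  also have "\<dots> = ?I q + ?I (\<lambda>x y. q y x)"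
    using Bochner_Integration.integral_add[OF iq iq'] by (simp add: split_beta')
  also have "\<dots> = - 4 * K \<epsilon> t t" unfolding Iq' Iq by simp
  finally show ?thesis by (simp add: sym)
qed

section \<open>The commutator estimate and the limit of vanishing mollification\<close>

lemma difference_product_bound:
  assumes d: "(\<integral>x. \<bar>r t x - r t (x - z)\<bar> \<partial>lborel) \<le> d"
  shows "(\<integral>\<^sup>+x. ennreal ((r t x - r t (x - z))\<^sup>2 * norm (u t x - u t (x - z))) \<partial>lborel)
    \<le> ennreal (sqrt (8 * C ^ 3 * d) * (D * norm z))"
proof -
  have d0: "d \<ge> 0"
    by (rule order_trans[OF _ d]) simp
  define a where "a x = (r t x - r t (x - z))\<^sup>2" for x
  define b where "b x = norm (u t x - u t (x - z))" for x
  have [measurable]: "a \<in> borel_measurable lborel" "b \<in> borel_measurable lborel"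
    unfolding a_def b_def by measurable
  have diff: "\<bar>r t x - r t (x - z)\<bar> \<le> 2 * C" for x
    using r_bound[of t x] r_bound[of t "x - z"] by linarith
  \<comment> \<open>Three of the four powers of the density difference are absorbed by the bound 2
    C, so that smallness in L^1 is enough. This is the source of the constant 8 C^3.\<close>
  have a2: "(a x)\<^sup>2 \<le> 8 * C ^ 3 * \<bar>r t x - r t (x - z)\<bar>" for x
  proof -
    have "(a x)\<^sup>2 = \<bar>r t x - r t (x - z)\<bar> ^ 3 * \<bar>r t x - r t (x - z)\<bar>"
    proof -
      have "(w\<^sup>2)\<^sup>2 = \<bar>w\<bar> ^ 3 * \<bar>w\<bar>" for w :: real
      proof -
        have "(w\<^sup>2)\<^sup>2 = \<bar>w\<bar> ^ 4" by (simp add: power_even_abs flip: power_mult)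
        also have "\<dots> = \<bar>w\<bar> ^ 3 * \<bar>w\<bar>" by (simp add: eval_nat_numeral)
        finally show ?thesis .
      qed
      then show ?thesis unfolding a_def .
    qed
    also have "\<dots> \<le> (2 * C) ^ 3 * \<bar>r t x - r t (x - z)\<bar>"
      by (intro mult_right_mono power_mono diff) auto
    finally show ?thesis by (simp add: power_mult_distrib)
  qed
  have ri: "integrable lborel (\<lambda>x. r t (x - z))"
    using integral_translation(2)[of "r t" z] r_int by simp
  have ia: "integrable lborel (\<lambda>x. (a x)\<^sup>2)"
    by (rule Bochner_Integration.integrable_bound[of _ "\<lambda>x. 8 * C ^ 3 * \<bar>r t x - r t (x - z)\<bar>"])
      (use ri r_int a2 in \<open>auto intro!: AE_I2 order_trans[OF a2 abs_ge_self]\<close>)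
  have ib: "integrable lborel (\<lambda>x. (b x)\<^sup>2)"
  proof (rule Bochner_Integration.integrable_bound)
    show "integrable lborel (\<lambda>x. 2 * (norm (u t x))\<^sup>2 + 2 * (norm (u t (x - z)))\<^sup>2)"
      using u_int integral_translation(2)[of "\<lambda>x. (norm (u t x))\<^sup>2" z] by simp
    show "AE x in lborel. norm ((b x)\<^sup>2) \<le> norm (2 * (norm (u t x))\<^sup>2 + 2 * (norm (u t (x - z)))\<^sup>2)"
      unfolding b_def using norm_add_sq_le[of "u t x" "- u t (x - z)" for x] by (intro AE_I2) simp
  qed simp
  have "(\<integral>x. (a x)\<^sup>2 \<partial>lborel) \<le> (\<integral>x. 8 * C ^ 3 * \<bar>r t x - r t (x - z)\<bar> \<partial>lborel)"
    by (rule integral_mono[OF ia _ a2]) (use ri r_int in auto)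
  also have "\<dots> \<le> 8 * C ^ 3 * d" using d C0 by (simp add: mult_left_mono)
  finally have A: "(\<integral>x. (a x)\<^sup>2 \<partial>lborel) \<le> 8 * C ^ 3 * d" .
  have B: "sqrt (\<integral>x. (b x)\<^sup>2 \<partial>lborel) \<le> D * norm z"
    using real_sqrt_le_mono[OF u_trans[of t z]] D by (simp add: b_def real_sqrt_mult)
  have "(\<integral>\<^sup>+x. ennreal (a x * b x) \<partial>lborel) = ennreal (\<integral>x. a x * b x \<partial>lborel)"
    by (rule nn_integral_eq_integral[OF integral_Cauchy_Schwarz(1)[OF _ _ ia ib]]) (auto simp: a_def b_def)
  also have "\<dots> \<le> ennreal (sqrt (8 * C ^ 3 * d) * (D * norm z))"
  proof (rule ennreal_leI)
    have "(\<integral>x. a x * b x \<partial>lborel) = (\<integral>x. \<bar>a x * b x\<bar> \<partial>lborel)" by (simp add: a_def b_def abs_mult)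
    also have "\<dots> \<le> sqrt (\<integral>x. (a x)\<^sup>2 \<partial>lborel) * sqrt (\<integral>x. (b x)\<^sup>2 \<partial>lborel)"
      by (rule integral_Cauchy_Schwarz(2)[OF _ _ ia ib]) auto
    also have "\<dots> \<le> sqrt (8 * C ^ 3 * d) * (D * norm z)"
      by (intro mult_mono real_sqrt_le_mono A B) (use D C0 d0 in auto)
    finally show "(\<integral>x. a x * b x \<partial>lborel) \<le> sqrt (8 * C ^ 3 * d) * (D * norm z)" .
  qed
  finally show ?thesis by (simp add: a_def b_def)
qed

text \<open>The kernel has the size of the mollifier gradient, but the velocity difference
  contributes a factor \<open>norm z\<close>. What remains is the first moment of the gradient,
  which \<open>moll_grad_moment\<close> compares with the mass.\<close>

lemma commutator_bound:
  assumes e: "0 < \<epsilon>" "\<epsilon> \<le> \<epsilon>\<^sub>0" and t: "t \<in> {0..T}"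
    and d: "\<And>z. norm z \<le> \<epsilon> \<Longrightarrow> (\<integral>x. \<bar>r t x - r t (x - z)\<bar> \<partial>lborel) \<le> d"
  shows "4 * \<bar>K \<epsilon> t t\<bar> \<le> sqrt (8 * C ^ 3 * d) * D * (\<integral>z. norm z * norm (moll_grad \<epsilon> (z::'a)) \<partial>lborel)"
proof -
  have d0: "d \<ge> 0"
  proof -
    have "0 \<le> (\<integral>x. \<bar>r t x - r t (x - 0)\<bar> \<partial>lborel)" by simp
    also have "\<dots> \<le> d" by (rule d) (use e in simp)
    finally show ?thesis .
  qed
  define f where "f x y = (r t x - r t y)\<^sup>2 * ((u t x - u t y) \<bullet> moll_grad \<epsilon> (x - y))" for x y
  define c where "c = sqrt (8 * C ^ 3 * d) * D"
  have c0: "c \<ge> 0" unfolding c_def using D C0 d0 by simp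
  have fm[measurable]: "(\<lambda>p. f (fst p) (snd p)) \<in> borel_measurable (borel \<Otimes>\<^sub>M borel)"
    unfolding f_def by measurable
  let ?k = "\<lambda>z::'a. norm (moll_grad \<epsilon> z)"
  have zk: "norm z \<le> \<epsilon>" if "?k z \<noteq> 0" for z
    using that moll_support(2)[OF e(1), of z] by (force simp: not_le)
  have zki: "integrable lborel (\<lambda>z. norm z * ?k z)"
  proof (rule Bochner_Integration.integrable_bound)
    show "integrable lborel (\<lambda>z::'a. \<epsilon> * ?k z)"
      using integrable_moll_grad[OF e(1), where 'a='a] by (intro integrable_mult_right integrable_norm)
    show "AE z in lborel. norm (norm z * ?k z) \<le> norm (\<epsilon> * ?k z)"
    proof (rule AE_I2)
      fix z :: 'a
      show "norm (norm z * ?k z) \<le> norm (\<epsilon> * ?k z)"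
        using zk[of z] e by (cases "?k z = 0") (auto simp: abs_mult intro!: mult_right_mono)
    qed
  qed measurable
  have "ennreal \<bar>4 * K \<epsilon> t t\<bar> = ennreal \<bar>\<integral>x. \<integral>y. f x y \<partial>lborel \<partial>lborel\<bar>"
    using K_symmetrized[OF e t] by (simp add: f_def abs_mult)
  also have "\<dots> \<le> (\<integral>\<^sup>+x. ennreal (norm (\<integral>y. f x y \<partial>lborel)) \<partial>lborel)"
    unfolding real_norm_def[symmetric] by (rule integral_norm_le_nn_integral)
  also have "\<dots> \<le> (\<integral>\<^sup>+x. \<integral>\<^sup>+y. ennreal (norm (f x y)) \<partial>lborel \<partial>lborel)"
    by (intro nn_integral_mono integral_norm_le_nn_integral)
  also have "\<dots> \<le> (\<integral>\<^sup>+x. \<integral>\<^sup>+y. (case (x, y) of (x, y) \<Rightarrow> ennreal ((r t x - r t y)\<^sup>2 * norm (u t x - u t y))) * ennreal (?k (x - y)) \<partial>lborel \<partial>lborel)"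
  proof (intro nn_integral_mono)
    fix x y
    have "norm (f x y) \<le> (r t x - r t y)\<^sup>2 * (norm (u t x - u t y) * ?k (x - y))"
      unfolding f_def norm_mult by (intro mult_mono) (auto intro: Cauchy_Schwarz_ineq2)
    then show "ennreal (norm (f x y)) \<le> (case (x, y) of (x, y) \<Rightarrow> ennreal ((r t x - r t y)\<^sup>2 * norm (u t x - u t y))) * ennreal (?k (x - y))"
      by (simp add: ennreal_mult[symmetric] mult.assoc ennreal_leI)
  qed
  also have "\<dots> \<le> (\<integral>\<^sup>+z. ennreal (sqrt (8 * C ^ 3 * d) * (D * norm z)) * ennreal (?k z) \<partial>lborel)"
  proof (rule nn_integral_convolution_bound)
    show "(\<lambda>(x, y). ennreal ((r t x - r t y)\<^sup>2 * norm (u t x - u t y))) \<in> borel_measurable borel"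
      unfolding borel_prod[symmetric] by measurable
    show "(\<integral>\<^sup>+x. (case (x, x - z) of (x, y) \<Rightarrow> ennreal ((r t x - r t y)\<^sup>2 * norm (u t x - u t y))) \<partial>lborel)
      \<le> ennreal (sqrt (8 * C ^ 3 * d) * (D * norm z))" if "?k z \<noteq> 0" for z
      using difference_product_bound[OF d[OF zk[OF that]]] by simp
  qed auto
  also have "\<dots> = (\<integral>\<^sup>+z. ennreal (c * (norm z * ?k z)) \<partial>lborel)"
    using D C0 d0 by (intro nn_integral_cong) (simp add: c_def ennreal_mult[symmetric] mult_ac)
  also have "\<dots> = ennreal (\<integral>z. c * (norm z * ?k z) \<partial>lborel)"
    by (rule nn_integral_eq_integral) (use zki c0 in auto)
  finally have "\<bar>4 * K \<epsilon> t t\<bar> \<le> (\<integral>z. c * (norm z * ?k z) \<partial>lborel)"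
    using c0 by (subst (asm) ennreal_le_iff) auto
  then show ?thesis by (simp add: c_def abs_mult)
qed

text \<open>Replacing r(y) by r(x) under the mollifier costs, per unit of mass, at most C times the
  L^1 modulus of translation.\<close>

lemma B_diagonal_close:
  assumes e: "0 < \<epsilon>"
    and d: "\<And>z. norm z \<le> \<epsilon> \<Longrightarrow> (\<integral>x. \<bar>r t x - r t (x - z)\<bar> \<partial>lborel) \<le> d"
  shows "\<bar>B \<epsilon> t t - moll_mass TYPE('a) \<epsilon> * (\<integral>x. (r t x)\<^sup>2 \<partial>lborel)\<bar> \<le> C * d * moll_mass TYPE('a) \<epsilon>"
proof -
  let ?c = "moll_mass TYPE('a) \<epsilon>"
  have c0: "?c > 0" by (rule moll_mass_pos[OF e])
  have d0: "d \<ge> 0"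
  proof -
    have "0 \<le> (\<integral>x. \<bar>r t x - r t (x - 0)\<bar> \<partial>lborel)" by simp
    also have "\<dots> \<le> d" by (rule d) (use e in simp)
    finally show ?thesis .
  qed
  define f where "f x y = r t x * moll \<epsilon> (x - y) * (r t y - r t x)" for x y
  have r2: "integrable lborel (\<lambda>x. (r t x)\<^sup>2)"
    by (rule integrable_bounded_compact_support[where C="C\<^sup>2" and S="cball 0 M"])
      (use r_out r_sq_bound in auto)
  have i1: "integrable (lborel \<Otimes>\<^sub>M lborel) (\<lambda>(x, y). r t x * moll \<epsilon> (x - y) * r t y)"
    by (rule moll_product_integrable[OF e r_int r_meas r_bound])
  have i2: "integrable (lborel \<Otimes>\<^sub>M lborel) (\<lambda>(x, y). (r t x)\<^sup>2 * moll \<epsilon> (x - y))"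
    by (rule integrable_convolution_product[OF r2 integrable_moll[OF e]])
  have "B \<epsilon> t t = (\<integral>x. \<integral>y. r t x * moll \<epsilon> (x - y) * r t y \<partial>lborel \<partial>lborel)"
    unfolding B_eq_pair[OF e] by (rule lborel_pair.Fubini_integral[OF i1])
  also have "\<dots> = integral\<^sup>L (lborel \<Otimes>\<^sub>M lborel) (\<lambda>(x, y). r t x * moll \<epsilon> (x - y) * r t y)"
    by (rule integral_pair_fst[OF i1, symmetric])
  finally have Beq: "B \<epsilon> t t = integral\<^sup>L (lborel \<Otimes>\<^sub>M lborel) (\<lambda>(x, y). r t x * moll \<epsilon> (x - y) * r t y)" .
  have my: "(\<integral>y. moll \<epsilon> (x - y) \<partial>lborel) = ?c" for x :: 'a
    using integral_reflect(1)[of "moll \<epsilon>" x] by (simp add: moll_mass_def)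
  have "?c * (\<integral>x. (r t x)\<^sup>2 \<partial>lborel) = (\<integral>x. \<integral>y. (r t x)\<^sup>2 * moll \<epsilon> (x - y) \<partial>lborel \<partial>lborel)"
    by (simp add: my)
  also have "\<dots> = integral\<^sup>L (lborel \<Otimes>\<^sub>M lborel) (\<lambda>(x, y). (r t x)\<^sup>2 * moll \<epsilon> (x - y))"
    by (rule integral_pair_fst[OF i2, symmetric])
  finally have Ceq: "?c * (\<integral>x. (r t x)\<^sup>2 \<partial>lborel) = integral\<^sup>L (lborel \<Otimes>\<^sub>M lborel) (\<lambda>(x, y). (r t x)\<^sup>2 * moll \<epsilon> (x - y))" .
  have fs: "(\<lambda>(x, y). f x y) = (\<lambda>p. (case p of (x, y) \<Rightarrow> r t x * moll \<epsilon> (x - y) * r t y) - (case p of (x, y) \<Rightarrow> (r t x)\<^sup>2 * moll \<epsilon> (x - y)))"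
    by (auto simp: f_def fun_eq_iff power2_eq_square algebra_simps)
  have if_: "integrable (lborel \<Otimes>\<^sub>M lborel) (\<lambda>(x, y). f x y)"
    unfolding fs by (rule Bochner_Integration.integrable_diff[OF i1 i2])
  have "B \<epsilon> t t - ?c * (\<integral>x. (r t x)\<^sup>2 \<partial>lborel) = integral\<^sup>L (lborel \<Otimes>\<^sub>M lborel) (\<lambda>(x, y). f x y)"
    unfolding Beq Ceq fs by (rule Bochner_Integration.integral_diff[OF i1 i2, symmetric])
  also have "\<dots> = (\<integral>x. \<integral>y. f x y \<partial>lborel \<partial>lborel)"
    by (rule integral_pair_fst[OF if_])
  finally have main: "B \<epsilon> t t - ?c * (\<integral>x. (r t x)\<^sup>2 \<partial>lborel) = (\<integral>x. \<integral>y. f x y \<partial>lborel \<partial>lborel)" .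
  have "ennreal \<bar>\<integral>x. \<integral>y. f x y \<partial>lborel \<partial>lborel\<bar> \<le> (\<integral>\<^sup>+x. ennreal (norm (\<integral>y. f x y \<partial>lborel)) \<partial>lborel)"
    unfolding real_norm_def[symmetric] by (rule integral_norm_le_nn_integral)
  also have "\<dots> \<le> (\<integral>\<^sup>+x. \<integral>\<^sup>+y. ennreal (norm (f x y)) \<partial>lborel \<partial>lborel)"
    by (intro nn_integral_mono integral_norm_le_nn_integral)
  also have "\<dots> \<le> (\<integral>\<^sup>+x. \<integral>\<^sup>+y. (case (x, y) of (x, y) \<Rightarrow> ennreal (C * \<bar>r t x - r t y\<bar>)) * ennreal (moll \<epsilon> (x - y)) \<partial>lborel \<partial>lborel)"
  proof (intro nn_integral_mono)
    fix x y
    have "norm (f x y) \<le> C * \<bar>r t x - r t y\<bar> * moll \<epsilon> (x - y)"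
      unfolding f_def norm_mult real_norm_def
      using mult_right_mono[OF r_bound[of t x], of "moll \<epsilon> (x - y) * \<bar>r t x - r t y\<bar>"] moll_nonneg[of \<epsilon> "x - y"]
      by (simp add: mult_ac abs_minus_commute abs_mult)
    then show "ennreal (norm (f x y)) \<le> (case (x, y) of (x, y) \<Rightarrow> ennreal (C * \<bar>r t x - r t y\<bar>)) * ennreal (moll \<epsilon> (x - y))"
      using C0 moll_nonneg[of \<epsilon> "x - y"] by (simp add: ennreal_mult[symmetric] ennreal_leI)
  qed
  also have "\<dots> \<le> (\<integral>\<^sup>+z. ennreal (C * d) * ennreal (moll \<epsilon> (z::'a)) \<partial>lborel)"
  proof (rule nn_integral_convolution_bound)
    show "(\<lambda>(x, y). ennreal (C * \<bar>r t x - r t y\<bar>)) \<in> borel_measurable borel"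
      unfolding borel_prod[symmetric] by measurable
    fix z :: 'a assume "moll \<epsilon> z \<noteq> 0"
    then have "norm z \<le> \<epsilon>" using moll_support(1)[OF e, of z] by (force simp: not_le)
    then have dz: "(\<integral>x. \<bar>r t x - r t (x - z)\<bar> \<partial>lborel) \<le> d" by (rule d)
    have "integrable lborel (\<lambda>x. r t (x - z))"
      using integral_translation(2)[of "r t" z] r_int by simp
    then have "(\<integral>\<^sup>+x. ennreal (C * \<bar>r t x - r t (x - z)\<bar>) \<partial>lborel) = ennreal (\<integral>x. C * \<bar>r t x - r t (x - z)\<bar> \<partial>lborel)"
      using r_int C0 by (intro nn_integral_eq_integral) auto
    also have "\<dots> \<le> ennreal (C * d)" using dz C0 by (intro ennreal_leI) (simp add: mult_left_mono)
    finally show "(\<integral>\<^sup>+x. (case (x, x - z) of (x, y) \<Rightarrow> ennreal (C * \<bar>r t x - r t y\<bar>)) \<partial>lborel) \<le> ennreal (C * d)" by simp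
  qed (auto simp: moll_nonneg)
  also have "\<dots> = (\<integral>\<^sup>+z. ennreal (C * d * moll \<epsilon> (z::'a)) \<partial>lborel)"
    using C0 d0 by (intro nn_integral_cong) (simp add: ennreal_mult[symmetric] moll_nonneg)
  also have "\<dots> = ennreal (\<integral>z. C * d * moll \<epsilon> (z::'a) \<partial>lborel)"
    by (rule nn_integral_eq_integral) (use integrable_moll[OF e] C0 d0 in \<open>auto simp: moll_nonneg\<close>)
  also have "(\<integral>z. C * d * moll \<epsilon> (z::'a) \<partial>lborel) = C * d * ?c" by (simp add: moll_mass_def)
  finally have "\<bar>\<integral>x. \<integral>y. f x y \<partial>lborel \<partial>lborel\<bar> \<le> C * d * ?c"
    using C0 d0 c0 by (subst (asm) ennreal_le_iff) auto
  then show ?thesis unfolding main .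
qed

text \<open>Crude but uniform in time and shift: it supplies the dominating constant, whereas
  \<open>small_mollifier\<close> gives smallness at each time separately.\<close>

lemma r_difference_bound: "(\<integral>x. \<bar>r t x - r t (x - z)\<bar> \<partial>lborel) \<le> 2 * (C * measure lborel (cball (0::'a) M))"
proof -
  have ri: "integrable lborel (\<lambda>x. r t (x - z))"
    using integral_translation(2)[of "r t" z] r_int by simp
  have "(\<integral>x. \<bar>r t x - r t (x - z)\<bar> \<partial>lborel) \<le> (\<integral>x. \<bar>r t x\<bar> + \<bar>r t (x - z)\<bar> \<partial>lborel)"
    by (rule integral_mono) (use ri r_int in auto)
  also have "\<dots> = 2 * (\<integral>x. \<bar>r t x\<bar> \<partial>lborel)"
    using ri r_int integral_translation(1)[of "\<lambda>x. \<bar>r t x\<bar>" z] by simp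
  also have "(\<integral>x. \<bar>r t x\<bar> \<partial>lborel) \<le> (\<integral>x. indicator (cball (0::'a) M) x * C \<partial>lborel)"
  proof (rule integral_mono[OF _ integrable_indicator_cball])
    show "\<bar>r t x\<bar> \<le> indicator (cball 0 M) x * C" for x
      using r_bound[of t x] r_out[of x t] by (cases "x \<in> cball 0 M") auto
  qed (use r_int in auto)
  finally show ?thesis by (simp add: mult.commute)
qed

lemma small_mollifier:
  assumes "d > 0"
  shows "eventually (\<lambda>n. \<forall>z. norm z \<le> \<epsilon>\<^sub>0 / real (Suc n) \<longrightarrow> (\<integral>x. \<bar>r t x - r t (x - z)\<bar> \<partial>lborel) \<le> d) sequentially"
proof -
  obtain \<delta> where \<delta>: "\<delta> > 0" "\<And>z. norm z \<le> \<delta> \<Longrightarrow> (\<integral>x. \<bar>r t x - r t (x - z)\<bar> \<partial>lborel) < d"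
    using translation_continuous_L1[OF r_int assms] by blast
  have "(\<lambda>n. \<epsilon>\<^sub>0 / real (Suc n)) \<longlonglongrightarrow> 0"
    using tendsto_mult[OF tendsto_const[of \<epsilon>\<^sub>0] LIMSEQ_inverse_real_of_nat] by (simp add: divide_inverse)
  then have "eventually (\<lambda>n. \<epsilon>\<^sub>0 / real (Suc n) < \<delta>) sequentially"
    using \<delta>(1) by (rule order_tendstoD(2))
  then show ?thesis by eventually_elim (use \<delta>(2) in \<open>auto intro!: less_imp_le\<close>)
qed

text \<open>The diagonal identity is divided by the mass of the mollifier. The commutator then tends
  to zero at each time and stays bounded, so its time integral tends to zero, while the diagonal of
  \<open>B\<close> tends to the integral of the squared density.\<close>

theorem energy_conserved: "(\<integral>x. (r T x)\<^sup>2 \<partial>lborel) = (\<integral>x. (r 0 x)\<^sup>2 \<partial>lborel)"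
proof -
  define \<epsilon> where "\<epsilon> n = \<epsilon>\<^sub>0 / real (Suc n)" for n
  define c where "c n = moll_mass TYPE('a) (\<epsilon> n)" for n
  have e: "0 < \<epsilon> n" "\<epsilon> n \<le> \<epsilon>\<^sub>0" for n using \<epsilon>\<^sub>0 by (auto simp: \<epsilon>_def divide_simps)
  have c: "c n > 0" for n unfolding c_def by (rule moll_mass_pos[OF e(1)])
  obtain A where A: "A > 0" "\<And>\<epsilon>. \<epsilon> > 0 \<Longrightarrow>
    (\<integral>z. norm (z::'a) * norm (moll_grad \<epsilon> z) \<partial>lborel) \<le> A * moll_mass TYPE('a) \<epsilon>"
    using moll_grad_moment by blast
  have Kb: "\<bar>2 * K (\<epsilon> n) t t / c n\<bar> \<le> sqrt (8 * C ^ 3 * d) * D * A"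
    if t: "t \<in> {0..T}" and d: "\<And>z. norm z \<le> \<epsilon> n \<Longrightarrow> (\<integral>x. \<bar>r t x - r t (x - z)\<bar> \<partial>lborel) \<le> d" for n t d
  proof -
    have "0 \<le> (\<integral>x. \<bar>r t x - r t (x - 0)\<bar> \<partial>lborel)" by simp
    also have "\<dots> \<le> d" by (rule d) (use e in \<open>simp add: less_imp_le\<close>)
    finally have d0: "d \<ge> 0" .
    have "2 * \<bar>K (\<epsilon> n) t t\<bar> \<le> 4 * \<bar>K (\<epsilon> n) t t\<bar>" by simp
    also have "\<dots> \<le> sqrt (8 * C ^ 3 * d) * D * (\<integral>z. norm (z::'a) * norm (moll_grad (\<epsilon> n) z) \<partial>lborel)"
      by (rule commutator_bound[OF e t d])
    also have "\<dots> \<le> sqrt (8 * C ^ 3 * d) * D * (A * c n)"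
      unfolding c_def using D C0 d0 by (intro mult_left_mono A e) auto
    finally show ?thesis using c[of n] by (simp add: abs_mult field_simps)
  qed
  have hi: "((\<lambda>\<tau>. 2 * K (\<epsilon> n) \<tau> \<tau> / c n) has_integral (B (\<epsilon> n) T T - B (\<epsilon> n) 0 0) / c n) {0..T}" for n
    using has_integral_mult_left[OF diagonal_has_integral[OF e, of n], of "inverse (c n)"] by (simp add: divide_inverse)
  have tend: "(\<lambda>n. 2 * K (\<epsilon> n) \<tau> \<tau> / c n) \<longlonglongrightarrow> 0" if \<tau>: "\<tau> \<in> {0..T}" for \<tau>
  proof (rule tendstoI)
    fix \<eta> :: real assume \<eta>: "\<eta> > 0"
    \<comment> \<open>Continuity of the square root at 0 provides a modulus d for which the
      commutator bound is below \<eta>.\<close>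
    have "((\<lambda>d. sqrt (8 * C ^ 3 * d) * D * A) \<longlongrightarrow> sqrt (8 * C ^ 3 * 0) * D * A) (at_right 0)"
      by (intro tendsto_intros)
    then have "eventually (\<lambda>d. sqrt (8 * C ^ 3 * d) * D * A < \<eta>) (at_right 0)"
      using \<eta> by (intro order_tendstoD(2)) auto
    then have "eventually (\<lambda>d. sqrt (8 * C ^ 3 * d) * D * A < \<eta> \<and> d > 0) (at_right 0)"
      by (intro eventually_conj) (auto simp: eventually_at_right_less)
    then obtain d where d: "sqrt (8 * C ^ 3 * d) * D * A < \<eta>" "d > 0"
      using eventually_happens trivial_limit_at_right_real by blast
    show "eventually (\<lambda>n. dist (2 * K (\<epsilon> n) \<tau> \<tau> / c n) 0 < \<eta>) sequentially"
      using small_mollifier[OF d(2), of \<tau>]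
    proof eventually_elim
      case (elim n)
      then have "\<bar>2 * K (\<epsilon> n) \<tau> \<tau> / c n\<bar> \<le> sqrt (8 * C ^ 3 * d) * D * A"
        by (intro Kb[OF \<tau>]) (auto simp: \<epsilon>_def)
      then show ?case using d(1) by (simp add: dist_real_def)
    qed
  qed
  define d0 where "d0 = 2 * (C * measure lborel (cball (0::'a) M))"
  have "(\<lambda>n. integral {0..T} (\<lambda>\<tau>. 2 * K (\<epsilon> n) \<tau> \<tau> / c n)) \<longlonglongrightarrow> integral {0..T} (\<lambda>\<tau>. 0)"
  proof (rule dominated_convergence(2))
    show "(\<lambda>\<tau>. 2 * K (\<epsilon> n) \<tau> \<tau> / c n) integrable_on {0..T}" for n using hi by blast
    show "(\<lambda>\<tau>. sqrt (8 * C ^ 3 * d0) * D * A) integrable_on {0..T}" by auto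
    show "norm (2 * K (\<epsilon> n) \<tau> \<tau> / c n) \<le> sqrt (8 * C ^ 3 * d0) * D * A" if "\<tau> \<in> {0..T}" for n \<tau>
      unfolding real_norm_def by (rule Kb[OF that]) (simp add: d0_def r_difference_bound)
  qed (use tend in auto)
  then have lim0: "(\<lambda>n. (B (\<epsilon> n) T T - B (\<epsilon> n) 0 0) / c n) \<longlonglongrightarrow> 0"
    by (simp only: integral_unique[OF hi] Henstock_Kurzweil_Integration.integral_0)
  have Blim: "(\<lambda>n. B (\<epsilon> n) t t / c n) \<longlonglongrightarrow> (\<integral>x. (r t x)\<^sup>2 \<partial>lborel)" for t
  proof (rule tendstoI)
    fix \<eta> :: real assume \<eta>: "\<eta> > 0"
    \<comment> \<open>\<open>C + 1\<close> covers the case C = 0.\<close>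
    define d where "d = \<eta> / (2 * (C + 1))"
    have d: "d > 0" using \<eta> C0 by (simp add: d_def)
    have "C * d \<le> (C + 1) * d" using d by simp
    also have "\<dots> = \<eta> / 2" using C0 by (simp add: d_def divide_simps)
    finally have Cd: "C * d < \<eta>" using \<eta> by linarith
    show "eventually (\<lambda>n. dist (B (\<epsilon> n) t t / c n) (\<integral>x. (r t x)\<^sup>2 \<partial>lborel) < \<eta>) sequentially"
      using small_mollifier[OF d, of t]
    proof eventually_elim
      case (elim n)
      have "\<bar>B (\<epsilon> n) t t - c n * (\<integral>x. (r t x)\<^sup>2 \<partial>lborel)\<bar> \<le> C * d * c n"
        unfolding c_def by (rule B_diagonal_close[OF e(1)]) (use elim in \<open>auto simp: \<epsilon>_def\<close>)
      moreover have "B (\<epsilon> n) t t / c n - (\<integral>x. (r t x)\<^sup>2 \<partial>lborel) = (B (\<epsilon> n) t t - c n * (\<integral>x. (r t x)\<^sup>2 \<partial>lborel)) / c n"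
        using c[of n] by (simp add: diff_divide_distrib)
      ultimately have "\<bar>B (\<epsilon> n) t t / c n - (\<integral>x. (r t x)\<^sup>2 \<partial>lborel)\<bar> \<le> C * d"
        using c[of n] by (simp add: abs_divide pos_divide_le_eq)
      then show ?case using Cd by (simp add: dist_real_def)
    qed
  qed
  have "(\<lambda>n. (B (\<epsilon> n) T T - B (\<epsilon> n) 0 0) / c n) \<longlonglongrightarrow> (\<integral>x. (r T x)\<^sup>2 \<partial>lborel) - (\<integral>x. (r 0 x)\<^sup>2 \<partial>lborel)"
    unfolding diff_divide_distrib by (intro tendsto_diff Blim)
  then show ?thesis using LIMSEQ_unique[OF lim0] by fastforce
qed

end

section \<open>Test functions up to the boundary\<close>

lemma smooth_fun_on_compose_real:
  fixes f :: "'a::euclidean_space \<Rightarrow> real" and h :: "real \<Rightarrow> real"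
  assumes "open S" "smooth_fun_on UNIV h" "smooth_fun_on S f"
  shows "smooth_fun_on S (\<lambda>x. h (f x))"
  using assms unfolding smooth_fun_on_def by (metis Ck_on_compose_real)

lemma smooth_fun_on_linear: "bounded_linear L \<Longrightarrow> smooth_fun_on S L"
  by (simp add: smooth_fun_on_def Ck_on_linear)

lemma smooth_fun_on_diff_fun:
  "open S \<Longrightarrow> smooth_fun_on S f \<Longrightarrow> smooth_fun_on S g \<Longrightarrow> smooth_fun_on S (\<lambda>x. f x - g x)"
  for f g :: "'a::euclidean_space \<Rightarrow> 'b::real_normed_vector"
  by (simp add: smooth_fun_on_def Ck_on_diff)

lemma smooth_fun_on_mult:
  "open S \<Longrightarrow> smooth_fun_on S f \<Longrightarrow> smooth_fun_on S g \<Longrightarrow> smooth_fun_on S (\<lambda>x. f x * g x)"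
  for f g :: "'a::euclidean_space \<Rightarrow> real"
  by (simp add: smooth_fun_on_def Ck_on_mult)

lemma smooth_fun_on_const: "smooth_fun_on S (\<lambda>x. c)"
  by (simp add: smooth_fun_on_def Ck_on_const)

lemma smooth_step: "smooth_fun_on UNIV step"
  by (simp add: smooth_fun_on_def Ck_on_step)

text \<open>On \<open>S\<close> the function coincides with its increment, because the translate
  vanishes there; Cauchy-Schwarz against the indicator of \<open>S\<close> gives the square root of
  its measure.\<close>

lemma strip_integral_bound:
  fixes U :: "'a::euclidean_space \<Rightarrow> 'b::euclidean_space"
  assumes U[measurable]: "U \<in> borel_measurable borel" and U2: "integrable lborel (\<lambda>x. (norm (U x))\<^sup>2)"
    and tr: "\<And>z. (\<integral>x. (norm (U x - U (x - z)))\<^sup>2 \<partial>lborel) \<le> D\<^sup>2 * (norm z)\<^sup>2" and D: "D \<ge> 0"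
    and S: "S \<in> sets borel" "bounded S" and z: "\<And>x. x \<in> S \<Longrightarrow> U (x - z) = 0"
  shows "integrable lborel (\<lambda>x. indicator S x * norm (U x))"
    and "(\<integral>x. indicator S x * norm (U x) \<partial>lborel) \<le> sqrt (measure lborel S) * (D * norm z)"
proof -
  note [measurable] = S(1)
  have sq: "(\<lambda>x. (indicat_real S x)\<^sup>2) = indicat_real S" by (auto simp: indicator_def fun_eq_iff)
  have fin: "emeasure lborel S < \<infinity>" using S by (intro emeasure_bounded_finite)
  have i1: "integrable lborel (\<lambda>x. (indicat_real S x)\<^sup>2)"
    unfolding sq using S fin by (intro integrable_real_indicator) auto
  have m1: "indicat_real S \<in> borel_measurable lborel"
    using S by (intro borel_measurable_indicator) auto
  have i2: "integrable lborel (\<lambda>x. (norm (U x - U (x - z)))\<^sup>2)"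
  proof (rule Bochner_Integration.integrable_bound)
    show "integrable lborel (\<lambda>x. 2 * (norm (U x))\<^sup>2 + 2 * (norm (U (x - z)))\<^sup>2)"
      using U2 integral_translation(2)[of "\<lambda>x. (norm (U x))\<^sup>2" z] by simp
    show "AE x in lborel. norm ((norm (U x - U (x - z)))\<^sup>2) \<le> norm (2 * (norm (U x))\<^sup>2 + 2 * (norm (U (x - z)))\<^sup>2)"
      using norm_add_sq_le[of "U x" "- U (x - z)" for x] by (intro AE_I2) simp
  qed simp
  have m2: "(\<lambda>x. norm (U x - U (x - z))) \<in> borel_measurable lborel" by measurable
  have e: "(\<lambda>x. indicator S x * norm (U x)) = (\<lambda>x. indicat_real S x * norm (U x - U (x - z)))"
    using z by (auto simp: indicator_def fun_eq_iff)
  show "integrable lborel (\<lambda>x. indicator S x * norm (U x))"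
    unfolding e by (rule integral_Cauchy_Schwarz(1)[OF m1 m2 i1 i2])
  have "(\<integral>x. indicator S x * norm (U x) \<partial>lborel) = (\<integral>x. \<bar>indicat_real S x * norm (U x - U (x - z))\<bar> \<partial>lborel)"
    unfolding e by (simp add: abs_mult)
  also have "\<dots> \<le> sqrt (\<integral>x. (indicat_real S x)\<^sup>2 \<partial>lborel) * sqrt (\<integral>x. (norm (U x - U (x - z)))\<^sup>2 \<partial>lborel)"
    by (rule integral_Cauchy_Schwarz(2)[OF m1 m2 i1 i2])
  also have "\<dots> \<le> sqrt (measure lborel S) * sqrt (D\<^sup>2 * (norm z)\<^sup>2)"
  proof -
    have "integral\<^sup>L lborel (indicat_real S) = measure lborel S" using S by simp
    then show ?thesis unfolding sq by (simp only:) (intro mult_left_mono real_sqrt_le_mono tr, simp)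
  qed
  also have "sqrt (D\<^sup>2 * (norm z)\<^sup>2) = D * norm z" using D by (simp add: real_sqrt_mult)
  finally show "(\<integral>x. indicator S x * norm (U x) \<partial>lborel) \<le> sqrt (measure lborel S) * (D * norm z)" .
qed

text \<open>The translation estimate for \<open>U\<close> is all that is used of the velocity belonging to \<open>H\<^sup>1\<^sub>0\<close>.\<close>

definition approximable_from_inside :: "'a::euclidean_space set \<Rightarrow> ('a \<Rightarrow> real) \<Rightarrow> ('a \<Rightarrow> 'a) \<Rightarrow> bool" where
  "approximable_from_inside S \<psi> \<psi>' \<longleftrightarrow> (\<exists>\<psi>n \<delta>. (\<forall>n. test_fun S (\<psi>n n)) \<and> (\<forall>n x. \<bar>\<psi>n n x\<bar> \<le> 1) \<and>
    (\<forall>x\<in>S. (\<lambda>n. \<psi>n n x) \<longlonglongrightarrow> \<psi> x) \<and> \<delta> \<longlonglongrightarrow> 0 \<and>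
    (\<forall>(U::'a \<Rightarrow> 'a) D n. U \<in> borel_measurable borel \<longrightarrow> (\<forall>x. x \<notin> S \<longrightarrow> U x = 0) \<longrightarrow> integrable lborel (\<lambda>x. (norm (U x))\<^sup>2) \<longrightarrow>
       D \<ge> 0 \<longrightarrow> (\<forall>z. (\<integral>x. (norm (U x - U (x - z)))\<^sup>2 \<partial>lborel) \<le> D\<^sup>2 * (norm z)\<^sup>2) \<longrightarrow>
       integrable lborel (\<lambda>x. norm (U x) * norm (grad (\<psi>n n) x - \<psi>' x)) \<and>
       (\<integral>x. norm (U x) * norm (grad (\<psi>n n) x - \<psi>' x) \<partial>lborel) \<le> D * \<delta> n))"

lemma approximable_interior:
  fixes y :: "'a::euclidean_space"
  assumes "\<epsilon> > 0" "cball y \<epsilon> \<subseteq> S"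
  shows "approximable_from_inside S (\<lambda>x. moll \<epsilon> (x - y)) (\<lambda>x. moll_grad \<epsilon> (x - y))"
  unfolding approximable_from_inside_def
  by (rule exI[of _ "\<lambda>n x. moll \<epsilon> (x - y)"], rule exI[of _ "\<lambda>n. 0"])
    (use moll_shift_test[OF assms] in \<open>auto simp: moll_nonneg moll_le_1 grad_moll_shift abs_of_nonneg\<close>)

text \<open>The zero sequence suffices although the mollifier is not zero: convergence is asked on
  \<open>S\<close> only, and the gradient error is weighted with a U that vanishes off
  \<open>S\<close>.\<close>

lemma approximable_exterior:
  fixes y :: "'a::euclidean_space"
  assumes "\<epsilon> > 0" "cball y \<epsilon> \<inter> S = {}"
  shows "approximable_from_inside S (\<lambda>x. moll \<epsilon> (x - y)) (\<lambda>x. moll_grad \<epsilon> (x - y))"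
proof -
  have z: "moll \<epsilon> (x - y) = 0" "moll_grad \<epsilon> (x - y) = 0" if "x \<in> S" for x
  proof -
    have "x \<notin> cball y \<epsilon>" using assms that by blast
    then have "x - y \<notin> cball 0 \<epsilon>" by (simp add: dist_norm norm_minus_commute)
    then show "moll \<epsilon> (x - y) = 0" "moll_grad \<epsilon> (x - y) = 0" using moll_support[OF assms(1)] by auto
  qed
  have g0: "grad (\<lambda>x::'a. 0) = (\<lambda>x. 0)" by (rule ext) (rule grad_eqI, simp)
  have t0: "test_fun S (\<lambda>x::'a. 0::real)"
    by (rule test_funI[of _ "{}"]) (auto simp: smooth_fun_on_const)
  have e: "(\<lambda>x. norm (U x) * norm (0 - moll_grad \<epsilon> (x - y))) = (\<lambda>x. 0)" if "\<forall>x. x \<notin> S \<longrightarrow> U x = 0" for U :: "'a \<Rightarrow> 'a"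
    using that z by (fastforce simp: fun_eq_iff)
  show ?thesis
    unfolding approximable_from_inside_def
    by (rule exI[of _ "\<lambda>n x. 0"], rule exI[of _ "\<lambda>n. 0"]) (auto simp: t0 g0 z(1) e simp del: diff_0)
qed

text \<open>Cutting off in a strip of width \<open>s\<close> along the boundary graph costs a gradient of size \<open>1/s\<close>, but there
  \<open>U\<close> differs by \<open>O(s)\<close> in \<open>L\<^sup>2\<close> from a translate that vanishes, and the area of the strip gives a further \<open>\<surd>s\<close>.\<close>

lemma approximable_boundary:
  fixes \<Omega> :: "(real^2) set" and R :: "real^2 \<Rightarrow> real^2" and h :: "real \<Rightarrow> real"
  assumes R: "orthogonal_transformation R" and h: "smooth_fun_on UNIV h"
    and loc: "\<And>x. x \<in> G \<Longrightarrow> x \<in> \<Omega> \<longleftrightarrow> h (R x $ 1) < R x $ 2"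
    and \<epsilon>: "\<epsilon> > 0" and s0: "s0 > 0" and G: "\<And>x. dist y x \<le> \<epsilon> + s0 \<Longrightarrow> x \<in> G"
  shows "approximable_from_inside \<Omega> (\<lambda>x. moll \<epsilon> (x - y)) (\<lambda>x. moll_grad \<epsilon> (x - y))"
proof -
  have Rl: "linear R" using R by (rule orthogonal_transformation_linear)
  have Rb: "bounded_linear R" using Rl linear_conv_bounded_linear by blast
  \<comment> \<open>The height above the boundary graph in rotated coordinates. It is positive
    exactly in \<Omega> within the chart, and it stands in for the distance to the boundary while
    being smooth everywhere.\<close>
  define d where "d x = R x $ 2 - h (R x $ 1)" for x
  have comp: "bounded_linear (\<lambda>x. R x $ i)" for i
    using bounded_linear_compose[OF bounded_linear_vec_nth Rb] .
  have d_smooth: "smooth_fun_on UNIV d"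
    unfolding d_def[abs_def]
    by (rule smooth_fun_on_diff_fun[OF open_UNIV smooth_fun_on_linear[OF comp]
          smooth_fun_on_compose_real[OF open_UNIV h smooth_fun_on_linear[OF comp]]])
  have d_cont: "continuous_on UNIV d" by (rule smooth_fun_on_continuous[OF d_smooth])
  \<comment> \<open>The vertical unit vector of the chart: moving against it lowers \<open>d\<close>
    at unit rate, whatever the slope of the graph.\<close>
  obtain e where e: "R e = axis 2 1" using orthogonal_transformation_surj[OF R] by (metis surjD)
  have ne: "norm e = 1"
    using orthogonal_transformation_norm[OF R, of e] e by simp
  have d_shift: "d (x - \<sigma> *\<^sub>R e) = d x - \<sigma>" for x \<sigma>
    unfolding d_def linear_diff[OF Rl] linear_cmul[OF Rl] e by (simp add: axis_def)
  have G_in: "x \<in> G" if "x \<in> cball y \<epsilon>" for x using that s0 by (intro G) auto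
  have \<Omega>_iff: "x \<in> \<Omega> \<longleftrightarrow> 0 < d x" if "x \<in> G" for x using loc[OF that] by (simp add: d_def)
  \<comment> \<open>The factor 1/2 ensures 2 * s n \<le> s0, so that the shift by 2 * s n used below
    stays inside the chart.\<close>
  define s where "s n = s0 / 2 / real (Suc n)" for n
  have s_pos: "s n > 0" for n using s0 by (simp add: s_def)
  have s_le: "2 * s n \<le> s0" for n
  proof -
    have "s0 / real (Suc n) \<le> s0 / 1" using s0 by (intro divide_left_mono) auto
    moreover have "2 * s n = s0 / real (Suc n)" by (simp add: s_def del: of_nat_Suc)
    ultimately show ?thesis by simp
  qed
  have s_lim: "s \<longlonglongrightarrow> 0"
  proof -
    have "s = (\<lambda>n. s0 / 2 * inverse (real (Suc n)))"
      by (rule ext) (simp only: s_def divide_inverse)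
    moreover have "(\<lambda>n. s0 / 2 * inverse (real (Suc n))) \<longlonglongrightarrow> s0 / 2 * 0"
      by (intro tendsto_mult tendsto_const LIMSEQ_inverse_real_of_nat)
    ultimately show ?thesis by simp
  qed
  define \<psi> where "\<psi> x = moll \<epsilon> (x - y)" for x :: "real^2"
  define \<psi>' where "\<psi>' x = moll_grad \<epsilon> (x - y)" for x :: "real^2"
  \<comment> \<open>Zero up to height s n and one from height 2 * s n on. Vanishing already at a
    positive height puts the support compactly inside \<Omega>.\<close>
  define \<chi>n where "\<chi>n n x = step (inverse (s n) * d x - 1)" for n x
  define \<psi>n where "\<psi>n n x = \<chi>n n x * \<psi> x" for n x
  have \<psi>0: "\<psi> x = 0" "\<psi>' x = 0" if "x \<notin> cball y \<epsilon>" for x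
  proof -
    have "x - y \<notin> cball 0 \<epsilon>" using that by (simp add: dist_norm norm_minus_commute)
    then show "\<psi> x = 0" "\<psi>' x = 0" using moll_support[OF \<epsilon>] by (auto simp: \<psi>_def \<psi>'_def)
  qed
  have \<psi>_smooth: "smooth_fun_on UNIV \<psi>"
    using moll_shift_test[OF \<epsilon>, of y UNIV] by (simp add: test_fun_def \<psi>_def[abs_def])
  have grad\<psi>: "grad \<psi> x = \<psi>' x" for x unfolding \<psi>_def[abs_def] \<psi>'_def by (rule grad_moll_shift)
  have \<chi>_smooth: "smooth_fun_on UNIV (\<chi>n n)" for n
    unfolding \<chi>n_def[abs_def]
    by (rule smooth_fun_on_compose_real[OF open_UNIV smooth_step])
      (intro smooth_fun_on_diff_fun smooth_fun_on_mult smooth_fun_on_const d_smooth open_UNIV)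
  have \<psi>n_smooth: "smooth_fun_on UNIV (\<psi>n n)" for n
    unfolding \<psi>n_def[abs_def] by (intro smooth_fun_on_mult \<chi>_smooth \<psi>_smooth open_UNIV)
  have \<chi>01: "0 \<le> \<chi>n n x" "\<chi>n n x \<le> 1" for n x unfolding \<chi>n_def by (rule step_bounds)+
  have \<psi>01: "0 \<le> \<psi> x" "\<psi> x \<le> 1" for x unfolding \<psi>_def by (rule moll_nonneg moll_le_1)+
  have \<chi>0: "\<chi>n n x = 0" if "d x \<le> s n" for n x
    unfolding \<chi>n_def by (rule step_0) (use that s_pos[of n] in \<open>simp add: field_simps\<close>)
  have \<chi>1: "\<chi>n n x = 1" if "2 * s n \<le> d x" for n x
    unfolding \<chi>n_def by (rule step_1) (use that s_pos[of n] in \<open>simp add: field_simps\<close>)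
  obtain s' E where s': "\<And>x. (step has_real_derivative s' x) (at x)" "\<And>x. \<bar>s' x\<bar> \<le> E" "E > 0" "\<And>x. x < 0 \<or> x > 1 \<Longrightarrow> s' x = 0"
    using step_deriv_exists by metis
  have grad\<chi>: "grad (\<chi>n n) x = (s' (inverse (s n) * d x - 1) * inverse (s n)) *\<^sub>R grad d x" for n x
  proof (rule grad_eqI)
    have dd: "(d has_derivative (\<lambda>v. v \<bullet> grad d x)) (at x)"
      by (rule has_derivative_grad) (use smooth_fun_on_diff[OF d_smooth] in auto)
    have "((\<lambda>x. inverse (s n) * d x - 1) has_derivative (\<lambda>v. inverse (s n) * (v \<bullet> grad d x) - 0)) (at x)"
      by (intro has_derivative_diff has_derivative_mult_right dd has_derivative_const)
    from has_derivative_compose[OF this s'(1)[unfolded has_field_derivative_def]]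
    show "(\<chi>n n has_derivative (\<lambda>v. v \<bullet> (s' (inverse (s n) * d x - 1) * inverse (s n)) *\<^sub>R grad d x)) (at x)"
      unfolding \<chi>n_def[abs_def] by (simp add: mult.assoc)
  qed
  have grad\<psi>n: "grad (\<psi>n n) x = \<chi>n n x *\<^sub>R \<psi>' x + \<psi> x *\<^sub>R grad (\<chi>n n) x" for n x
    unfolding \<psi>n_def[abs_def]
    by (subst grad_mult) (use smooth_fun_on_diff[OF \<chi>_smooth] smooth_fun_on_diff[OF \<psi>_smooth] grad\<psi> in auto)
  obtain Gd where Gd: "\<And>x. x \<in> cball y \<epsilon> \<Longrightarrow> norm (grad d x) \<le> Gd"
  proof -
    have "compact (grad d ` cball y \<epsilon>)"
      by (intro compact_continuous_image continuous_on_subset[OF continuous_on_grad[OF d_smooth]]) auto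
    then show thesis using compact_imp_bounded bounded_iff that by (metis imageI)
  qed
  have Gd0: "Gd \<ge> 0"
  proof -
    have "norm (grad d y) \<le> Gd" by (rule Gd) (use \<epsilon> in simp)
    then show ?thesis using norm_ge_zero order_trans by blast
  qed
  obtain E1 where E1: "E1 > 0" "\<And>\<epsilon> z::real^2. \<epsilon> > 0 \<Longrightarrow> norm (moll_grad \<epsilon> z) \<le> E1 / \<epsilon>" using moll_grad_bound by blast
  \<comment> \<open>Inside \<Omega> and the support of the mollifier, only on this strip can the
    cutoff differ from 1 or have a nonzero gradient.\<close>
  define S where "S n = cball y \<epsilon> \<inter> {x. 0 < d x} \<inter> {x. d x \<le> 2 * s n}" for n
  have dm[measurable]: "d \<in> borel_measurable borel" by (rule borel_measurable_continuous_onI[OF d_cont])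
  have S_sets[measurable]: "S n \<in> sets borel" for n
  proof -
    have "{x. 0 < d x} \<in> sets borel" "{x. d x \<le> 2 * s n} \<in> sets borel" by measurable
    then show ?thesis unfolding S_def by auto
  qed
  have S_bdd: "bounded (S n)" for n unfolding S_def by (auto intro: bounded_subset[OF bounded_cball])
  \<comment> \<open>A / s n dominates both gradient errors: E * Gd comes from the cutoff, and the
    bounded error E1 / \<epsilon> is brought to the same form by the factor s0 / s n \<ge>
    1.\<close>
  define A where "A = E1 / \<epsilon> * s0 + E * Gd"
  have A0: "A \<ge> 0" unfolding A_def using E1 \<epsilon> s0 s' Gd0 by simp
  have bound: "norm (grad (\<psi>n n) x - \<psi>' x) \<le> indicator (S n) x * (A / s n)" if x: "x \<in> \<Omega>" for n x
  proof (cases "x \<in> S n")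
    case True
    then have xb: "x \<in> cball y \<epsilon>" by (simp add: S_def)
    have e1: "grad (\<psi>n n) x - \<psi>' x = \<psi> x *\<^sub>R grad (\<chi>n n) x - (1 - \<chi>n n x) *\<^sub>R \<psi>' x"
      unfolding grad\<psi>n by (simp add: algebra_simps)
    have "norm ((1 - \<chi>n n x) *\<^sub>R \<psi>' x) \<le> 1 * (E1 / \<epsilon>)"
      unfolding norm_scaleR using \<chi>01[of n x] E1 \<epsilon> by (intro mult_mono) (auto simp: \<psi>'_def)
    also have "\<dots> \<le> E1 / \<epsilon> * s0 / s n"
    proof -
      have "s n \<le> s0" using s_le[of n] s_pos[of n] by linarith
      then have "E1 / \<epsilon> * s n \<le> E1 / \<epsilon> * s0" using E1 \<epsilon> by (intro mult_left_mono) auto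
      then show ?thesis using s_pos[of n] by (simp only: pos_le_divide_eq mult_1_left)
    qed
    finally have b1: "norm ((1 - \<chi>n n x) *\<^sub>R \<psi>' x) \<le> E1 / \<epsilon> * s0 / s n" .
    have "norm (\<psi> x *\<^sub>R grad (\<chi>n n) x) \<le> 1 * ((E * inverse (s n)) * Gd)"
      unfolding grad\<chi> norm_scaleR real_norm_def abs_mult
      using \<psi>01[of x] s'(2,3) Gd[OF xb] s_pos[of n] by (intro mult_mono) auto
    then have b2: "norm (\<psi> x *\<^sub>R grad (\<chi>n n) x) \<le> E * Gd / s n" by (simp add: divide_inverse mult_ac)
    have "norm (grad (\<psi>n n) x - \<psi>' x) \<le> E * Gd / s n + E1 / \<epsilon> * s0 / s n"
      unfolding e1 using norm_triangle_ineq4[of "\<psi> x *\<^sub>R grad (\<chi>n n) x" "(1 - \<chi>n n x) *\<^sub>R \<psi>' x"] b1 b2 by linarith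
    also have "\<dots> = A / s n" by (simp add: A_def add_divide_distrib)
    finally show ?thesis using True by simp
  next
    case False
    have "grad (\<psi>n n) x - \<psi>' x = 0"
    proof (cases "x \<in> cball y \<epsilon>")
      case True
      then have "0 < d x" using \<Omega>_iff[OF G_in[OF True]] x by simp
      then have dx: "d x > 2 * s n" using False True by (auto simp: S_def)
      then have "inverse (s n) * d x - 1 > 1" using s_pos[of n] by (simp add: field_simps)
      then have "grad (\<chi>n n) x = 0" unfolding grad\<chi> by (simp add: s'(4))
      then show ?thesis unfolding grad\<psi>n using \<chi>1[of n x] dx by simp
    next
      case False
      then show ?thesis unfolding grad\<psi>n using \<psi>0 by simp
    qed
    then show ?thesis using False by simp
  qed
  \<comment> \<open>The width cancels: the gradient error is of size A / s n and the shift has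
    length 2 * s n. Convergence to zero comes from the area of the strip alone.\<close>
  define \<delta> where "\<delta> n = 2 * A * sqrt (measure lborel (S n))" for n
  \<comment> \<open>A point of positive height leaves the strips eventually, and the others never
    belong to one.\<close>
  have meas_lim: "(\<lambda>n. measure lborel (S n)) \<longlonglongrightarrow> 0"
  proof -
    have "(\<lambda>n. \<integral>x. indicat_real (S n) x \<partial>lborel) \<longlonglongrightarrow> (\<integral>x. 0 \<partial>(lborel :: (real^2) measure))"
    proof (rule integral_dominated_convergence)
      show "integrable lborel (\<lambda>x. indicat_real (cball y \<epsilon>) x)"
        using emeasure_bounded_finite[OF bounded_cball[of y \<epsilon>]] by (intro integrable_real_indicator) auto
      show "AE x in lborel. (\<lambda>n. indicat_real (S n) x) \<longlonglongrightarrow> 0"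
      proof (rule AE_I2)
        fix x
        show "(\<lambda>n. indicat_real (S n) x) \<longlonglongrightarrow> 0"
        proof (cases "0 < d x")
          case True
          have "eventually (\<lambda>n. s n < d x / 2) sequentially"
            by (rule order_tendstoD(2)[OF s_lim]) (use True in simp)
          then have "eventually (\<lambda>n. indicat_real (S n) x = 0) sequentially"
            by eventually_elim (auto simp: S_def indicator_def)
          then show ?thesis by (rule tendsto_eventually)
        qed (simp add: S_def)
      qed
    qed (auto simp: S_def indicator_def)
    then show ?thesis by simp
  qed
  have \<delta>_lim: "\<delta> \<longlonglongrightarrow> 0"
    unfolding \<delta>_def using tendsto_mult[OF tendsto_const[of "2 * A"] tendsto_real_sqrt[OF meas_lim]] by simp
  have main: "integrable lborel (\<lambda>x. norm (U x) * norm (grad (\<psi>n n) x - \<psi>' x))"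
      "(\<integral>x. norm (U x) * norm (grad (\<psi>n n) x - \<psi>' x) \<partial>lborel) \<le> D * \<delta> n"
    if U: "U \<in> borel_measurable borel" "\<forall>x. x \<notin> \<Omega> \<longrightarrow> U x = 0" "integrable lborel (\<lambda>x. (norm (U x))\<^sup>2)" "D \<ge> 0"
       "\<forall>z. (\<integral>x. (norm (U x - U (x - z)))\<^sup>2 \<partial>lborel) \<le> D\<^sup>2 * (norm z)\<^sup>2" for U :: "real^2 \<Rightarrow> real^2" and D n
  proof -
    note [measurable] = U(1)
    \<comment> \<open>On the strip \<open>d\<close> is at most 2 * s n, so after this shift it is
      nonpositive and the point lies outside \<Omega>.\<close>
    have out: "U (x - (2 * s n) *\<^sub>R e) = 0" if "x \<in> S n" for x
    proof -
      let ?x = "x - (2 * s n) *\<^sub>R e"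
      have "dist y ?x \<le> dist y x + dist x ?x" by (rule dist_triangle)
      also have "dist x ?x = 2 * s n" using s_pos[of n] by (simp add: dist_norm ne)
      finally have "?x \<in> G" using that s_le[of n] by (intro G) (auto simp: S_def)
      moreover have "d ?x \<le> 0" unfolding d_shift using that by (simp add: S_def)
      ultimately have "?x \<notin> \<Omega>" using \<Omega>_iff by simp
      then show ?thesis using U(2) by blast
    qed
    note sb = strip_integral_bound[OF U(1,3) spec[OF U(5)] U(4) S_sets S_bdd out]
    have gm[measurable]: "grad (\<psi>n n) \<in> borel_measurable borel" "\<psi>' \<in> borel_measurable borel"
      unfolding \<psi>'_def[abs_def]
      by (rule borel_measurable_continuous_onI[OF continuous_on_grad[OF \<psi>n_smooth]], measurable)
    have pt: "norm (U x) * norm (grad (\<psi>n n) x - \<psi>' x) \<le> (indicator (S n) x * norm (U x)) * (A / s n)" for x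
    proof (cases "x \<in> \<Omega>")
      case True
      show ?thesis using mult_left_mono[OF bound[OF True, of n], of "norm (U x)"] by (simp add: mult_ac)
    next
      case False
      then show ?thesis using U(2) by simp
    qed
    have ib: "integrable lborel (\<lambda>x. (indicator (S n) x * norm (U x)) * (A / s n))"
      by (rule integrable_mult_left) (rule sb(1))
    show i: "integrable lborel (\<lambda>x. norm (U x) * norm (grad (\<psi>n n) x - \<psi>' x))"
    proof (rule Bochner_Integration.integrable_bound[OF ib])
      show "AE x in lborel. norm (norm (U x) * norm (grad (\<psi>n n) x - \<psi>' x)) \<le> norm ((indicator (S n) x * norm (U x)) * (A / s n))"
      proof (rule AE_I2)
        fix x
        show "norm (norm (U x) * norm (grad (\<psi>n n) x - \<psi>' x)) \<le> norm ((indicator (S n) x * norm (U x)) * (A / s n))"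
          using order_trans[OF pt[of x] abs_ge_self] by (simp only: real_norm_def abs_mult abs_norm_cancel)
      qed
    qed measurable
    have "(\<integral>x. norm (U x) * norm (grad (\<psi>n n) x - \<psi>' x) \<partial>lborel) \<le> (\<integral>x. (indicator (S n) x * norm (U x)) * (A / s n) \<partial>lborel)"
      by (rule integral_mono[OF i ib pt])
    also have "\<dots> = (\<integral>x. indicator (S n) x * norm (U x) \<partial>lborel) * (A / s n)" by (rule integral_mult_left_zero)
    also have "\<dots> \<le> (sqrt (measure lborel (S n)) * (D * norm ((2 * s n) *\<^sub>R e))) * (A / s n)"
      using A0 s_pos[of n] by (intro mult_right_mono sb(2)) auto
    also have "\<dots> = D * \<delta> n" using s_pos[of n] by (simp add: \<delta>_def ne)
    finally show "(\<integral>x. norm (U x) * norm (grad (\<psi>n n) x - \<psi>' x) \<partial>lborel) \<le> D * \<delta> n" .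
  qed
  have test: "test_fun \<Omega> (\<psi>n n)" for n
  proof (rule test_funI[OF \<psi>n_smooth])
    have "closed {x. s n \<le> d x}" by (intro closed_Collect_le continuous_on_const d_cont)
    then show "compact (cball y \<epsilon> \<inter> {x. s n \<le> d x})" by (intro compact_Int_closed compact_cball)
    show "cball y \<epsilon> \<inter> {x. s n \<le> d x} \<subseteq> \<Omega>"
      using \<Omega>_iff[OF G_in] s_pos[of n] by force
    show "\<psi>n n x = 0" if "x \<notin> cball y \<epsilon> \<inter> {x. s n \<le> d x}" for x
      using that \<psi>0(1)[of x] \<chi>0[of x n] by (auto simp: \<psi>n_def)
  qed
  have conv: "(\<lambda>n. \<psi>n n x) \<longlonglongrightarrow> \<psi> x" if "x \<in> \<Omega>" for x
  proof (cases "x \<in> cball y \<epsilon>")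
    case True
    then have "0 < d x" using \<Omega>_iff[OF G_in[OF True]] that by simp
    then have "eventually (\<lambda>n. s n < d x / 2) sequentially"
      by (intro order_tendstoD(2)[OF s_lim]) simp
    then have "eventually (\<lambda>n. \<psi>n n x = \<psi> x) sequentially"
      by eventually_elim (simp add: \<psi>n_def \<chi>1)
    then show ?thesis by (rule tendsto_eventually)
  qed (simp add: \<psi>n_def \<psi>0)
  have le1: "\<bar>\<psi>n n x\<bar> \<le> 1" for n x
    unfolding \<psi>n_def abs_mult using mult_mono[OF \<chi>01(2)[of n x] \<psi>01(2)[of x]] \<chi>01[of n x] \<psi>01[of x] by simp
  show ?thesis
    unfolding approximable_from_inside_def \<psi>_def[symmetric] \<psi>'_def[symmetric]
    by (rule exI[of _ \<psi>n], rule exI[of _ \<delta>]) (use test le1 conv \<delta>_lim main in blast)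
qed

text \<open>A Lebesgue number for the charts covering the compact boundary gives one radius for all
  centres. A ball neither contained in \<Omega> nor disjoint from it meets the boundary, and so lies
  in a single chart.\<close>

lemma smooth_domain_approximable:
  assumes "smooth_bounded_domain \<Omega>"
  obtains \<epsilon>\<^sub>0 where "\<epsilon>\<^sub>0 > 0" "\<And>\<epsilon> y. 0 < \<epsilon> \<Longrightarrow> \<epsilon> \<le> \<epsilon>\<^sub>0 \<Longrightarrow>
    approximable_from_inside \<Omega> (\<lambda>x. moll \<epsilon> (x - y)) (\<lambda>x. moll_grad \<epsilon> (x - y))"
proof -
  have \<Omega>: "open \<Omega>" "bounded \<Omega>" "smooth_boundary \<Omega>" using assms by (auto simp: smooth_bounded_domain_def)
  define good where "good p r \<longleftrightarrow> r > 0 \<and> (\<exists>R :: real^2 \<Rightarrow> real^2. \<exists>h :: real \<Rightarrow> real.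
        orthogonal_transformation R \<and> smooth_fun_on UNIV h \<and>
        (\<forall>x \<in> ball p r. x \<in> \<Omega> \<longleftrightarrow> h (R x $ 1) < R x $ 2))" for p :: "real^2" and r
  have ex: "\<exists>r. good p r" if "p \<in> frontier \<Omega>" for p
    using \<Omega>(3) that unfolding smooth_boundary_def good_def by blast
  define \<G> where "\<G> = {ball p r | p r. good p r}"
  have "compact (frontier \<Omega>)" using \<Omega>(2) by (rule compact_frontier_bounded)
  moreover have "frontier \<Omega> \<subseteq> \<Union>\<G>"
  proof
    fix p assume "p \<in> frontier \<Omega>"
    then obtain r where r: "good p r" using ex by blast
    then have "p \<in> ball p r" by (simp add: good_def)
    then show "p \<in> \<Union>\<G>" using r unfolding \<G>_def by blast
  qed
  ultimately obtain e where e: "0 < e" "\<And>x. x \<in> frontier \<Omega> \<Longrightarrow> \<exists>G\<in>\<G>. ball x e \<subseteq> G"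
    by (rule Heine_Borel_lemma) (auto simp: \<G>_def)
  show thesis
  \<comment> \<open>If q is a boundary point within \<epsilon> of y, points within \<epsilon> + e/4
    of y are within 3 e/4 of q. So the Lebesgue number e covers the mollifier together with the
    shifts.\<close>
  proof (rule that[of "e / 4"])
    fix \<epsilon> y assume \<epsilon>: "0 < \<epsilon>" "\<epsilon> \<le> e / 4"
    consider "cball y \<epsilon> \<subseteq> \<Omega>" | "cball y \<epsilon> \<inter> \<Omega> = {}" | "cball y \<epsilon> \<inter> \<Omega> \<noteq> {}" "\<not> cball y \<epsilon> \<subseteq> \<Omega>" by blast
    then show "approximable_from_inside \<Omega> (\<lambda>x. moll \<epsilon> (x - y)) (\<lambda>x. moll_grad \<epsilon> (x - y))"
    proof cases
      case 1
      then show ?thesis by (rule approximable_interior[OF \<epsilon>(1)])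
    next
      case 2
      then show ?thesis by (rule approximable_exterior[OF \<epsilon>(1)])
    next
      case 3
      have "cball y \<epsilon> \<inter> frontier \<Omega> \<noteq> {}"
        by (rule connected_Int_frontier[OF connected_cball]) (use 3 in blast)+
      then obtain q where q: "q \<in> cball y \<epsilon>" "q \<in> frontier \<Omega>" by blast
      then obtain p r where pr: "good p r" "ball q e \<subseteq> ball p r" using e(2)[OF q(2)] unfolding \<G>_def by blast
      then obtain R :: "real^2 \<Rightarrow> real^2" and h where Rh: "orthogonal_transformation R" "smooth_fun_on UNIV h"
        "\<And>x. x \<in> ball p r \<Longrightarrow> x \<in> \<Omega> \<longleftrightarrow> h (R x $ 1) < R x $ 2" unfolding good_def by blast
      show ?thesis
      proof (rule approximable_boundary[OF Rh \<epsilon>(1)])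
        show "e / 4 > 0" using e by simp
        fix x assume x: "dist y x \<le> \<epsilon> + e / 4"
        have "dist q x \<le> dist q y + dist y x" by (rule dist_triangle)
        also have "\<dots> < e" using x q(1) \<epsilon> e(1) by (simp add: dist_commute)
        finally show "x \<in> ball p r" using pr(2) by auto
      qed
    qed
  qed (use e in simp)
qed

text \<open>The approximation from inside carries the divergence condition and the equation from
  test functions in \<Omega> to mollifiers with arbitrary centres. Since |W| \<le> C |u| almost
  everywhere, the error in the flux is at most C D \<delta> n, uniformly in time.\<close>

lemma transported_densityI:
  fixes \<Omega> :: "(real^2) set"
  assumes dom: "smooth_bounded_domain \<Omega>" and T: "T > 0"
    and r_meas: "\<And>t. r t \<in> borel_measurable borel"
    and r_bound: "\<And>t x. \<bar>r t x\<bar> \<le> C"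
    and r_supp: "\<And>t x. x \<notin> \<Omega> \<Longrightarrow> r t x = 0"
    and r_weak: "\<And>g B. g \<in> borel_measurable borel \<Longrightarrow> (\<And>x. \<bar>g x\<bar> \<le> B) \<Longrightarrow>
      continuous_on {0..T} (\<lambda>t. \<integral>x. r t x * g x \<partial>lborel)"
    and u_meas: "\<And>t. u t \<in> borel_measurable borel"
    and u_supp: "\<And>t x. x \<notin> \<Omega> \<Longrightarrow> u t x = 0"
    and u_int: "\<And>t. integrable lborel (\<lambda>x. (norm (u t x))\<^sup>2)"
    and u_bound: "\<And>t. (\<integral>x. (norm (u t x))\<^sup>2 \<partial>lborel) \<le> D\<^sup>2"
    and u_trans: "\<And>t z. (\<integral>x. (norm (u t x - u t (x - z)))\<^sup>2 \<partial>lborel) \<le> D\<^sup>2 * (norm z)\<^sup>2"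
    and D: "D \<ge> 0"
    and W_meas: "W \<in> borel_measurable borel"
    and W_eq: "\<And>t. t \<in> {0..T} \<Longrightarrow> AE x in lborel. W (t, x) = r t x *\<^sub>R u t x"
    and div: "\<And>t \<psi>. test_fun \<Omega> \<psi> \<Longrightarrow> (\<integral>x. u t x \<bullet> grad \<psi> x \<partial>lborel) = 0"
    and eq: "\<And>t \<psi>. test_fun \<Omega> \<psi> \<Longrightarrow> t \<in> {0..T} \<Longrightarrow>
      ((\<lambda>s. \<integral>x. W (s, x) \<bullet> grad \<psi> x \<partial>lborel) has_integral
        (\<integral>x. r t x * \<psi> x \<partial>lborel) - (\<integral>x. r 0 x * \<psi> x \<partial>lborel)) {0..t}"
  shows "\<exists>M \<epsilon>\<^sub>0. transported_density \<Omega> T M C D \<epsilon>\<^sub>0 r u W"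
proof -
  note [measurable] = r_meas u_meas
  obtain \<epsilon>\<^sub>0 where \<epsilon>\<^sub>0: "\<epsilon>\<^sub>0 > 0" and appr: "\<And>\<epsilon> y. 0 < \<epsilon> \<Longrightarrow> \<epsilon> \<le> \<epsilon>\<^sub>0 \<Longrightarrow>
    approximable_from_inside \<Omega> (\<lambda>x. moll \<epsilon> (x - y)) (\<lambda>x. moll_grad \<epsilon> (x - y))"
    using smooth_domain_approximable[OF dom] by blast
  have "bounded \<Omega>" using dom by (simp add: smooth_bounded_domain_def)
  then obtain M where M: "\<Omega> \<subseteq> cball 0 M" unfolding bounded_iff by (auto simp: subset_iff)
  have C0: "C \<ge> 0" using r_bound[of 0 0] by linarith
  have Wm[measurable]: "(\<lambda>x. W (t, x)) \<in> borel_measurable borel" for t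
  proof -
    have [measurable]: "W \<in> borel_measurable (borel \<Otimes>\<^sub>M borel)" using W_meas by (simp add: borel_prod)
    show ?thesis by measurable
  qed
  \<comment> \<open>One sequence serves all times, because \<open>approximable_from_inside\<close>
    fixes the sequence before it quantifies over \<open>U\<close>.\<close>
  have approx: "\<exists>\<psi>n \<delta>. (\<forall>n. test_fun \<Omega> (\<psi>n n)) \<and> (\<forall>n x. \<bar>\<psi>n n x\<bar> \<le> 1) \<and>
    (\<forall>x\<in>\<Omega>. (\<lambda>n. \<psi>n n x) \<longlonglongrightarrow> moll \<epsilon> (x - y)) \<and> \<delta> \<longlonglongrightarrow> 0 \<and>
    (\<forall>t n. integrable lborel (\<lambda>x. norm (u t x) * norm (grad (\<psi>n n) x - moll_grad \<epsilon> (x - y))) \<and>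
       (\<integral>x. norm (u t x) * norm (grad (\<psi>n n) x - moll_grad \<epsilon> (x - y)) \<partial>lborel) \<le> D * \<delta> n)" if \<epsilon>: "0 < \<epsilon>" "\<epsilon> \<le> \<epsilon>\<^sub>0" for \<epsilon> y
    using appr[OF \<epsilon>, of y] unfolding approximable_from_inside_def
    using u_meas u_supp u_int D u_trans by meson
  have k2: "integrable lborel (\<lambda>x::real^2. (norm (moll_grad \<epsilon> (x - y)))\<^sup>2)" if "\<epsilon> > 0" for \<epsilon> y
    proof -
      obtain E where E: "\<And>\<epsilon> z::real^2. \<epsilon> > 0 \<Longrightarrow> norm (moll_grad \<epsilon> z) \<le> E / \<epsilon>" using moll_grad_bound by blast
      have "integrable lborel (\<lambda>x::real^2. (norm (moll_grad \<epsilon> x))\<^sup>2)"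
      proof (rule integrable_bounded_compact_support[where C="(E / \<epsilon>)\<^sup>2" and S="cball 0 \<epsilon>"])
        show "norm ((norm (moll_grad \<epsilon> x))\<^sup>2) \<le> (E / \<epsilon>)\<^sup>2" for x :: "real^2"
          using power_mono[OF E[OF that, of x] norm_ge_zero, of 2] by simp
      qed (use moll_support(2)[OF that] in auto)
      then show ?thesis using integral_translation(2)[of "\<lambda>x. (norm (moll_grad \<epsilon> x))\<^sup>2" y] by simp
    qed
  have uk_int: "integrable lborel (\<lambda>x. norm (u t x) * norm (moll_grad \<epsilon> (x - y)))" if "\<epsilon> > 0" for t \<epsilon> y
    by (intro integral_Cauchy_Schwarz(1) u_int k2 that) auto
  have uk_bound: "\<exists>V. \<forall>t. (\<integral>x. norm (u t x) * norm (moll_grad \<epsilon> (x - y)) \<partial>lborel) \<le> V" if "\<epsilon> > 0" for \<epsilon> y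
  proof (intro exI allI)
    fix t
    have "(\<integral>x. norm (u t x) * norm (moll_grad \<epsilon> (x - y)) \<partial>lborel) = (\<integral>x. \<bar>norm (u t x) * norm (moll_grad \<epsilon> (x - y))\<bar> \<partial>lborel)"
      by (simp add: abs_mult)
    also have "\<dots> \<le> sqrt (\<integral>x. (norm (u t x))\<^sup>2 \<partial>lborel) * sqrt (\<integral>x. (norm (moll_grad \<epsilon> (x - y)))\<^sup>2 \<partial>lborel)"
      by (rule integral_Cauchy_Schwarz(2)[OF _ _ u_int k2[OF that]]) auto
    also have "\<dots> \<le> D * sqrt (\<integral>x. (norm (moll_grad \<epsilon> (x - y)))\<^sup>2 \<partial>lborel)"
      using real_sqrt_le_mono[OF u_bound[of t]] D by (intro mult_right_mono) auto
    finally show "(\<integral>x. norm (u t x) * norm (moll_grad \<epsilon> (x - y)) \<partial>lborel) \<le> D * sqrt (\<integral>x. (norm (moll_grad \<epsilon> (x - y)))\<^sup>2 \<partial>lborel)" .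
  qed
  have div': "(\<integral>x. u t x \<bullet> moll_grad \<epsilon> (x - y) \<partial>lborel) = 0" if \<epsilon>: "0 < \<epsilon>" "\<epsilon> \<le> \<epsilon>\<^sub>0" for t \<epsilon> y
  proof -
    obtain \<psi>n \<delta> where a: "\<And>n. test_fun \<Omega> (\<psi>n n)" "\<delta> \<longlonglongrightarrow> 0"
      "\<And>n. integrable lborel (\<lambda>x. norm (u t x) * norm (grad (\<psi>n n) x - moll_grad \<epsilon> (x - y)))"
      "\<And>n. (\<integral>x. norm (u t x) * norm (grad (\<psi>n n) x - moll_grad \<epsilon> (x - y)) \<partial>lborel) \<le> D * \<delta> n"
      using approx[OF \<epsilon>, of y] by blast
    have "\<bar>\<integral>x. u t x \<bullet> moll_grad \<epsilon> (x - y) \<partial>lborel\<bar> \<le> D * \<delta> n" for n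
    proof -
      have [measurable]: "grad (\<psi>n n) \<in> borel_measurable borel"
        using a(1)[of n] by (intro borel_measurable_continuous_onI continuous_on_grad) (simp add: test_fun_def)
      have i1: "integrable lborel (\<lambda>x. u t x \<bullet> moll_grad \<epsilon> (x - y))"
        by (rule Bochner_Integration.integrable_bound[OF uk_int[OF \<epsilon>(1)]])
          (auto intro!: AE_I2 Cauchy_Schwarz_ineq2 simp: abs_mult)
      have i2: "integrable lborel (\<lambda>x. u t x \<bullet> (grad (\<psi>n n) x - moll_grad \<epsilon> (x - y)))"
        by (rule Bochner_Integration.integrable_bound[OF a(3)[of n]])
          (auto intro!: AE_I2 Cauchy_Schwarz_ineq2 simp: abs_mult)
      have "(\<integral>x. u t x \<bullet> (grad (\<psi>n n) x - moll_grad \<epsilon> (x - y)) \<partial>lborel) + (\<integral>x. u t x \<bullet> moll_grad \<epsilon> (x - y) \<partial>lborel)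
        = (\<integral>x. u t x \<bullet> grad (\<psi>n n) x \<partial>lborel)"
        by (subst Bochner_Integration.integral_add[OF i2 i1, symmetric]) (simp add: inner_diff_right)
      then have "\<bar>\<integral>x. u t x \<bullet> moll_grad \<epsilon> (x - y) \<partial>lborel\<bar> = norm (\<integral>x. u t x \<bullet> (grad (\<psi>n n) x - moll_grad \<epsilon> (x - y)) \<partial>lborel)"
        using div[OF a(1)[of n], of t] by (simp add: abs_minus_commute eq_neg_iff_add_eq_0[symmetric])
      also have "\<dots> \<le> (\<integral>x. norm (u t x) * norm (grad (\<psi>n n) x - moll_grad \<epsilon> (x - y)) \<partial>lborel)"
        by (rule integral_norm_le_integral[OF _ a(3)]) (auto intro: Cauchy_Schwarz_ineq2)
      also have "\<dots> \<le> D * \<delta> n" by (rule a(4))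
      finally show ?thesis .
    qed
    moreover have "(\<lambda>n. D * \<delta> n) \<longlonglongrightarrow> 0" using tendsto_mult[OF tendsto_const[of D] a(2)] by simp
    ultimately have "\<bar>\<integral>x. u t x \<bullet> moll_grad \<epsilon> (x - y) \<partial>lborel\<bar> \<le> 0"
      using LIMSEQ_le_const by blast
    then show ?thesis by simp
  qed
  have eq': "((\<lambda>s. \<integral>x. W (s, x) \<bullet> moll_grad \<epsilon> (x - y) \<partial>lborel) has_integral
        (\<integral>x. r t x * moll \<epsilon> (x - y) \<partial>lborel) - (\<integral>x. r 0 x * moll \<epsilon> (x - y) \<partial>lborel)) {0..t}"
    if \<epsilon>: "0 < \<epsilon>" "\<epsilon> \<le> \<epsilon>\<^sub>0" and t: "t \<in> {0..T}" for t \<epsilon> y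
  proof -
    obtain \<psi>n \<delta> where a: "\<And>n. test_fun \<Omega> (\<psi>n n)" "\<delta> \<longlonglongrightarrow> 0"
      "\<And>n s. integrable lborel (\<lambda>x. norm (u s x) * norm (grad (\<psi>n n) x - moll_grad \<epsilon> (x - y)))"
      "\<And>n s. (\<integral>x. norm (u s x) * norm (grad (\<psi>n n) x - moll_grad \<epsilon> (x - y)) \<partial>lborel) \<le> D * \<delta> n"
      and b: "\<And>n x. \<bar>\<psi>n n x\<bar> \<le> 1" "\<And>x. x \<in> \<Omega> \<Longrightarrow> (\<lambda>n. \<psi>n n x) \<longlonglongrightarrow> moll \<epsilon> (x - y)"
      using approx[OF \<epsilon>, of y] by blast
    have gm[measurable]: "grad (\<psi>n n) \<in> borel_measurable borel" "\<psi>n n \<in> borel_measurable borel" for n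
    proof -
      have sm: "smooth_fun_on UNIV (\<psi>n n)" using a(1)[of n] by (simp add: test_fun_def)
      show "grad (\<psi>n n) \<in> borel_measurable borel"
        by (rule borel_measurable_continuous_onI[OF continuous_on_grad[OF sm]])
      show "\<psi>n n \<in> borel_measurable borel" by (rule borel_measurable_smooth[OF sm])
    qed
    let ?w = "\<lambda>s. \<integral>x. W (s, x) \<bullet> moll_grad \<epsilon> (x - y) \<partial>lborel"
    let ?wn = "\<lambda>n s. \<integral>x. W (s, x) \<bullet> grad (\<psi>n n) x \<partial>lborel"
    have diff: "\<bar>?wn n s - ?w s\<bar> \<le> C * (D * \<delta> n)" and wb: "\<bar>?w s\<bar> \<le> C * (\<integral>x. norm (u s x) * norm (moll_grad \<epsilon> (x - y)) \<partial>lborel)"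
      if s: "s \<in> {0..T}" for n s
    proof -
      have ae: "AE x in lborel. norm (W (s, x)) \<le> C * norm (u s x)"
        using W_eq[OF s] by eventually_elim (auto intro!: mult_right_mono r_bound)
      have bd: "integrable lborel (\<lambda>x. W (s, x) \<bullet> k x)" "\<bar>\<integral>x. W (s, x) \<bullet> k x \<partial>lborel\<bar> \<le> C * (\<integral>x. norm (u s x) * norm (k x) \<partial>lborel)"
        if [measurable]: "k \<in> borel_measurable borel" and k: "integrable lborel (\<lambda>x. norm (u s x) * norm (k x))" for k
      proof -
        have ae': "AE x in lborel. norm (W (s, x) \<bullet> k x) \<le> C * (norm (u s x) * norm (k x))"
          using ae
        proof eventually_elim
          case (elim x)
          have "norm (W (s, x) \<bullet> k x) \<le> norm (W (s, x)) * norm (k x)" using Cauchy_Schwarz_ineq2 by simp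
          also have "\<dots> \<le> C * norm (u s x) * norm (k x)" by (rule mult_right_mono[OF elim]) simp
          finally show ?case by (simp add: mult.assoc)
        qed
        have ki: "integrable lborel (\<lambda>x. C * (norm (u s x) * norm (k x)))" using k by (rule integrable_mult_right)
        show i: "integrable lborel (\<lambda>x. W (s, x) \<bullet> k x)"
          by (rule Bochner_Integration.integrable_bound[OF ki])
            (use ae' in \<open>auto elim!: eventually_mono intro: order_trans[OF _ abs_ge_self]\<close>)
        have "\<bar>\<integral>x. W (s, x) \<bullet> k x \<partial>lborel\<bar> \<le> (\<integral>x. \<bar>W (s, x) \<bullet> k x\<bar> \<partial>lborel)" by (rule integral_abs_bound)
        also have "\<dots> \<le> (\<integral>x. C * (norm (u s x) * norm (k x)) \<partial>lborel)"
          by (rule integral_mono_AE) (use i ki ae' in auto)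
        finally show "\<bar>\<integral>x. W (s, x) \<bullet> k x \<partial>lborel\<bar> \<le> C * (\<integral>x. norm (u s x) * norm (k x) \<partial>lborel)" by simp
      qed
      have km: "(\<lambda>x. moll_grad \<epsilon> (x - y)) \<in> borel_measurable borel" by measurable
      have dm: "(\<lambda>x. grad (\<psi>n n) x - moll_grad \<epsilon> (x - y)) \<in> borel_measurable borel" by measurable
      note b1 = bd[OF km uk_int[OF \<epsilon>(1)]] and b2 = bd[OF dm a(3)[of s n]]
      show "\<bar>?w s\<bar> \<le> C * (\<integral>x. norm (u s x) * norm (moll_grad \<epsilon> (x - y)) \<partial>lborel)" by (rule b1(2))
      have "?wn n s = (\<integral>x. W (s, x) \<bullet> (grad (\<psi>n n) x - moll_grad \<epsilon> (x - y)) + W (s, x) \<bullet> moll_grad \<epsilon> (x - y) \<partial>lborel)"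
        by (simp add: inner_diff_right)
      also have "\<dots> = (\<integral>x. W (s, x) \<bullet> (grad (\<psi>n n) x - moll_grad \<epsilon> (x - y)) \<partial>lborel) + ?w s"
        by (rule Bochner_Integration.integral_add[OF b2(1) b1(1)])
      finally have "\<bar>?wn n s - ?w s\<bar> = \<bar>\<integral>x. W (s, x) \<bullet> (grad (\<psi>n n) x - moll_grad \<epsilon> (x - y)) \<partial>lborel\<bar>" by simp
      also have "\<dots> \<le> C * (D * \<delta> n)"
        using b2(2) mult_left_mono[OF a(4)[of s n] C0] by linarith
      finally show "\<bar>?wn n s - ?w s\<bar> \<le> C * (D * \<delta> n)" .
    qed
    have hi: "(?wn n has_integral (\<integral>x. r t x * \<psi>n n x \<partial>lborel) - (\<integral>x. r 0 x * \<psi>n n x \<partial>lborel)) {0..t}" for n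
      by (rule eq[OF a(1) t])
    have CD: "(\<lambda>n. C * (D * \<delta> n)) \<longlonglongrightarrow> 0"
      using tendsto_mult[OF tendsto_const[of C] tendsto_mult[OF tendsto_const[of D] a(2)]] by simp
    have tend: "(\<lambda>n. ?wn n s) \<longlonglongrightarrow> ?w s" if "s \<in> {0..t}" for s
    proof -
      have s: "s \<in> {0..T}" using that t by auto
      have "(\<lambda>n. ?wn n s - ?w s) \<longlonglongrightarrow> 0"
        by (rule Lim_null_comparison[OF _ CD]) (use diff[OF s] in auto)
      then show ?thesis by (simp add: LIM_zero_iff)
    qed
    obtain \<Delta> where \<Delta>: "\<And>n. \<bar>\<delta> n\<bar> \<le> \<Delta>"
      using convergent_imp_Bseq[OF convergentI[OF a(2)]] by (auto simp: Bseq_def)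
    obtain V where V: "\<And>s. (\<integral>x. norm (u s x) * norm (moll_grad \<epsilon> (x - y)) \<partial>lborel) \<le> V"
      using uk_bound[OF \<epsilon>(1), of y] by blast
    \<comment> \<open>A bound uniform in n and s: the error is bounded because \<delta> converges,
      the limit by Cauchy-Schwarz.\<close>
    have dom: "norm (?wn n s) \<le> C * (D * \<Delta>) + C * V" if "s \<in> {0..t}" for n s
    proof -
      have s: "s \<in> {0..T}" using that t by auto
      have "C * (D * \<delta> n) \<le> C * (D * \<Delta>)" using C0 D \<Delta>[of n] by (intro mult_left_mono) auto
      moreover have "\<bar>?w s\<bar> \<le> C * V" by (rule order_trans[OF wb[OF s] mult_left_mono[OF V C0]])
      ultimately show ?thesis using diff[OF s, of n] unfolding real_norm_def by linarith
    qed
    have wi: "?w integrable_on {0..t}"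
      by (rule dominated_convergence(1)[OF has_integral_integrable[OF hi] _ dom tend]) auto
    have lim: "(\<lambda>n. integral {0..t} (?wn n)) \<longlonglongrightarrow> integral {0..t} ?w"
      by (rule dominated_convergence(2)[OF has_integral_integrable[OF hi] _ dom tend]) auto
    have rlim: "(\<lambda>n. \<integral>x. r t' x * \<psi>n n x \<partial>lborel) \<longlonglongrightarrow> (\<integral>x. r t' x * moll \<epsilon> (x - y) \<partial>lborel)" for t'
    proof (rule integral_dominated_convergence)
      show "integrable lborel (\<lambda>x. \<bar>r t' x\<bar>)"
        by (rule integrable_bounded_compact_support[where C=C and S=\<Omega>]) (use r_bound r_supp \<open>bounded \<Omega>\<close> in auto)
      show "AE x in lborel. norm (r t' x * \<psi>n n x) \<le> \<bar>r t' x\<bar>" for n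
        using mult_left_mono[OF b(1), of "\<bar>r t' x\<bar>" for x] by (intro AE_I2) (simp add: abs_mult)
      show "AE x in lborel. (\<lambda>n. r t' x * \<psi>n n x) \<longlonglongrightarrow> r t' x * moll \<epsilon> (x - y)"
      proof (rule AE_I2)
        fix x show "(\<lambda>n. r t' x * \<psi>n n x) \<longlonglongrightarrow> r t' x * moll \<epsilon> (x - y)"
          by (cases "x \<in> \<Omega>") (auto intro: tendsto_mult_left b simp: r_supp)
      qed
    qed auto
    have "(\<lambda>n. integral {0..t} (?wn n)) \<longlonglongrightarrow> (\<integral>x. r t x * moll \<epsilon> (x - y) \<partial>lborel) - (\<integral>x. r 0 x * moll \<epsilon> (x - y) \<partial>lborel)"
      unfolding integral_unique[OF hi] by (intro tendsto_diff rlim)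
    then have "integral {0..t} ?w = (\<integral>x. r t x * moll \<epsilon> (x - y) \<partial>lborel) - (\<integral>x. r 0 x * moll \<epsilon> (x - y) \<partial>lborel)"
      using lim LIMSEQ_unique by blast
    then show ?thesis using integrable_integral[OF wi] by simp
  qed
  have "transported_density \<Omega> T M C D \<epsilon>\<^sub>0 r u W"
    by (unfold_locales) (fact T \<epsilon>\<^sub>0 M r_meas r_bound r_supp r_weak u_meas u_supp u_int u_bound u_trans D W_meas W_eq div' eq')+
  then show ?thesis by blast
qed

section \<open>From the weak formulation to the integrated transport equation\<close>

text \<open>A smoothed indicator of (s, t] with ramps of width 1/k to the right of each end point;
  the assumption on \<open>t + inverse k\<close> ends the second ramp before T.\<close>

lemma test_fun_real_step:
  assumes "0 < s" "s < t" "t + inverse k < T" "k > 0"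
  shows "test_fun {0<..<T} (\<lambda>\<tau>. step (k * \<tau> - k * s) - step (k * \<tau> - k * t))"
proof (rule test_funI)
  have sm: "smooth_fun_on UNIV (\<lambda>\<tau>. step (k * \<tau> - k * c))" for c
    by (rule smooth_fun_on_compose_real[OF open_UNIV smooth_step])
      (intro smooth_fun_on_diff_fun smooth_fun_on_linear bounded_linear_mult_right smooth_fun_on_const open_UNIV)
  show "smooth_fun_on UNIV (\<lambda>\<tau>. step (k * \<tau> - k * s) - step (k * \<tau> - k * t))"
    by (rule smooth_fun_on_diff_fun[OF open_UNIV sm sm])
  show "compact {s..t + inverse k}" by simp
  show "{s..t + inverse k} \<subseteq> {0<..<T}" using assms by auto
  show "step (k * \<tau> - k * s) - step (k * \<tau> - k * t) = 0" if "\<tau> \<notin> {s..t + inverse k}" for \<tau>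
  proof (cases "\<tau> < s")
    case True
    have "k * \<tau> \<le> k * s" "k * \<tau> \<le> k * t" using True assms by (auto intro!: mult_left_mono)
    then show ?thesis by (simp add: step_0)
  next
    case False
    then have "\<tau> > t + inverse k" using that by simp
    then have "k * \<tau> \<ge> k * (t + inverse k)" using assms by (intro mult_left_mono) auto
    moreover have "k * (t + inverse k) = k * t + 1" using assms by (simp add: distrib_left)
    moreover have "k * s < k * t" using assms by simp
    ultimately show ?thesis by (simp add: step_1)
  qed
qed

text \<open>Trapezoidal test functions with steepening ramps have derivatives concentrating at s and
  t. They turn the weak equation into the integrated one for 0 < s < t < T, and continuity of
  \<open>m\<close> extends it to the closed interval.\<close>

lemma weak_time_derivative:
  fixes m n :: "real \<Rightarrow> real"
  assumes T: "T > 0" and m: "continuous_on {0..T} m" and n[measurable]: "n \<in> borel_measurable borel"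
    and nb: "\<And>\<tau>. \<bar>n \<tau>\<bar> \<le> B"
    and w: "\<And>a. test_fun {0<..<T} a \<Longrightarrow>
      (\<integral>\<tau>. indicator {0<..<T} \<tau> * (pderiv_dir 1 a \<tau> * m \<tau> + a \<tau> * n \<tau>) \<partial>lborel) = 0"
    and t: "t \<in> {0..T}"
  shows "(n has_integral (m t - m 0)) {0..t}"
proof -
  define mm where "mm \<tau> = indicator {0..T} \<tau> * m \<tau>" for \<tau>
  have mm_meas[measurable]: "mm \<in> borel_measurable borel"
    unfolding mm_def using borel_measurable_continuous_on_indicator[OF _ m] by (simp add: mult.commute)
  have B0: "B \<ge> 0" using nb[of 0] by linarith
  obtain Mb where Mb: "\<And>\<tau>. \<bar>mm \<tau>\<bar> \<le> Mb"
  proof -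
    have "compact (m ` {0..T})" by (rule compact_continuous_image[OF m]) simp
    then obtain b where b: "\<And>\<tau>. \<tau> \<in> {0..T} \<Longrightarrow> \<bar>m \<tau>\<bar> \<le> b"
      using compact_imp_bounded[OF \<open>compact (m ` {0..T})\<close>] unfolding bounded_iff by fastforce
    have "\<bar>mm \<tau>\<bar> \<le> max b 0" for \<tau> using b[of \<tau>] by (auto simp: mm_def indicator_def)
    then show thesis using that by blast
  qed
  obtain s' E where s': "\<And>x. (step has_real_derivative s' x) (at x)" "continuous_on UNIV s'" "\<And>x. \<bar>s' x\<bar> \<le> E" "E > 0"
    "\<And>x. x < 0 \<or> x > 1 \<Longrightarrow> s' x = 0" using step_deriv_exists by blast
  have [measurable]: "s' \<in> borel_measurable borel" by (rule borel_measurable_continuous_onI[OF s'(2)])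
  have s'_int: "(\<integral>x. s' x \<partial>lborel) = 1"
  proof -
    have "(\<integral>x. indicator {0..1} x *\<^sub>R s' x \<partial>lborel) = step 1 - step 0"
    proof (rule integral_FTC_atLeastAtMost)
      show "(step has_vector_derivative s' x) (at x within {0..1})" for x
        by (rule has_vector_derivative_at_within[OF s'(1)[unfolded has_real_derivative_iff_has_vector_derivative]])
      show "continuous_on {0..1} s'" by (rule continuous_on_subset[OF s'(2)]) simp
    qed simp
    also have "(\<lambda>x. indicator {0..1} x *\<^sub>R s' x) = s'"
    proof
      fix x show "indicator {0..1} x *\<^sub>R s' x = s' x"
        using s'(5)[of x] by (cases "x \<in> {0..1}") auto
    qed
    finally show ?thesis by (simp add: step_0 step_1)
  qed
  \<comment> \<open>The rescaled derivative of \<open>step\<close> is an approximate identity: it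
    has integral 1 and its support shrinks to c. As c is an interior time, the extension
    \<open>mm\<close> is continuous there.\<close>
  have delta: "(\<lambda>j. \<integral>\<tau>. real (Suc j) * s' (real (Suc j) * \<tau> - real (Suc j) * c) * mm \<tau> \<partial>lborel) \<longlonglongrightarrow> m c"
    if c: "0 < c" "c < T" for c
  proof -
    have sub: "(\<integral>\<tau>. real (Suc j) * s' (real (Suc j) * \<tau> - real (Suc j) * c) * mm \<tau> \<partial>lborel) = (\<integral>\<sigma>. s' \<sigma> * mm (c + inverse (real (Suc j)) * \<sigma>) \<partial>lborel)" for j
    proof -
      let ?k = "real (Suc j)"
      have k: "?k > 0" by simp
      have e: "?k * (c + inverse ?k * \<sigma>) - ?k * c = \<sigma>" for \<sigma>
        using k by (simp add: distrib_left del: of_nat_Suc)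
      have "(\<integral>\<tau>. ?k * s' (?k * \<tau> - ?k * c) * mm \<tau> \<partial>lborel) =
          \<bar>inverse ?k\<bar> *\<^sub>R (\<integral>\<sigma>. ?k * s' (?k * (c + inverse ?k * \<sigma>) - ?k * c) * mm (c + inverse ?k * \<sigma>) \<partial>lborel)"
        by (rule lborel_integral_real_affine) simp
      also have "\<dots> = inverse ?k * (?k * (\<integral>\<sigma>. s' \<sigma> * mm (c + inverse ?k * \<sigma>) \<partial>lborel))"
        unfolding e by (simp add: mult.assoc del: of_nat_Suc)
      also have "\<dots> = (\<integral>\<sigma>. s' \<sigma> * mm (c + inverse ?k * \<sigma>) \<partial>lborel)" using k by (simp del: of_nat_Suc)
      finally show ?thesis .
    qed
    have "(\<lambda>j. \<integral>\<sigma>. s' \<sigma> * mm (c + inverse (real (Suc j)) * \<sigma>) \<partial>lborel) \<longlonglongrightarrow> (\<integral>\<sigma>. s' \<sigma> * mm c \<partial>lborel)"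
    proof (rule integral_dominated_convergence)
      have "integrable lborel (indicat_real {0..1::real})" by (rule integrable_real_indicator) auto
      then show "integrable lborel (\<lambda>\<sigma>. E * Mb * indicat_real {0..1::real} \<sigma>)" by simp
      show "AE \<sigma> in lborel. norm (s' \<sigma> * mm (c + inverse (real (Suc j)) * \<sigma>)) \<le> E * Mb * indicat_real {0..1} \<sigma>" for j
      proof (rule AE_I2)
        fix \<sigma>
        have "\<bar>s' \<sigma>\<bar> * \<bar>mm (c + inverse (real (Suc j)) * \<sigma>)\<bar> \<le> E * Mb" using s' Mb by (intro mult_mono) auto
        then show "norm (s' \<sigma> * mm (c + inverse (real (Suc j)) * \<sigma>)) \<le> E * Mb * indicat_real {0..1} \<sigma>"
          using s'(5)[of \<sigma>] by (cases "\<sigma> \<in> {0..1}") (auto simp: abs_mult)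
      qed
      show "AE \<sigma> in lborel. (\<lambda>j. s' \<sigma> * mm (c + inverse (real (Suc j)) * \<sigma>)) \<longlonglongrightarrow> s' \<sigma> * mm c"
      proof (rule AE_I2)
        fix \<sigma>
        have "isCont m c"
          using m c by (intro continuous_on_interior[of "{0..T}"]) auto
        then have "isCont mm c"
        proof -
          have "\<forall>\<^sub>F x in nhds c. mm x = m x"
            using eventually_nhds_in_open[of "{0<..<T}" c] c by (auto elim!: eventually_mono simp: mm_def)
          then show ?thesis using \<open>isCont m c\<close> isCont_cong by blast
        qed
        moreover have "(\<lambda>j. c + inverse (real (Suc j)) * \<sigma>) \<longlonglongrightarrow> c + 0 * \<sigma>"
          by (intro tendsto_intros LIMSEQ_inverse_real_of_nat)
        then have "(\<lambda>j. c + inverse (real (Suc j)) * \<sigma>) \<longlonglongrightarrow> c" by simp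
        ultimately have "(\<lambda>j. mm (c + inverse (real (Suc j)) * \<sigma>)) \<longlonglongrightarrow> mm c"
          by (rule isCont_tendsto_compose)
        then show "(\<lambda>j. s' \<sigma> * mm (c + inverse (real (Suc j)) * \<sigma>)) \<longlonglongrightarrow> s' \<sigma> * mm c"
          by (rule tendsto_mult_left)
      qed
    qed measurable
    also have "(\<integral>\<sigma>. s' \<sigma> * mm c \<partial>lborel) = m c" using s'_int c by (simp add: mm_def)
    finally show ?thesis unfolding sub .
  qed
  have ni: "n integrable_on {a..b}" for a b
  proof -
    have "integrable lborel (\<lambda>\<tau>. indicator {a..b} \<tau> * n \<tau>)"
      by (rule integrable_bounded_compact_support[where C=B and S="{a..b}"]) (use nb B0 in \<open>auto simp: indicator_def\<close>)
    then have "(\<lambda>\<tau>. indicator {a..b} \<tau> * n \<tau>) integrable_on UNIV"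
      using has_integral_integral_lborel by blast
    moreover have "(\<lambda>\<tau>. indicator {a..b} \<tau> * n \<tau>) = (\<lambda>\<tau>. if \<tau> \<in> {a..b} then n \<tau> else 0)"
      by (auto simp: indicator_def fun_eq_iff)
    ultimately show ?thesis by (simp only: integrable_restrict_UNIV)
  qed
  have key: "m t - m s = (\<integral>\<tau>. indicator {s<..t} \<tau> * n \<tau> \<partial>lborel)" if st: "0 < s" "s < t" "t < T" for s t
  proof -
    let ?k = "\<lambda>j. real (Suc j)"
    let ?a = "\<lambda>j \<tau>. step (?k j * \<tau> - ?k j * s) - step (?k j * \<tau> - ?k j * t)"
    have ev: "eventually (\<lambda>j. t + inverse (?k j) < T) sequentially"
    proof -
      have "(\<lambda>j. t + inverse (?k j)) \<longlonglongrightarrow> t + 0" by (intro tendsto_intros LIMSEQ_inverse_real_of_nat)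
      then show ?thesis using order_tendstoD(2)[of _ "t + 0" sequentially T] st by simp
    qed
    define P where "P c j = (\<integral>\<tau>. ?k j * s' (?k j * \<tau> - ?k j * c) * mm \<tau> \<partial>lborel)" for c j
    have ev2: "eventually (\<lambda>j. P s j - P t j + (\<integral>\<tau>. indicator {0<..<T} \<tau> * (?a j \<tau> * n \<tau>) \<partial>lborel) = 0) sequentially"
      using ev
    proof eventually_elim
      case (elim j)
      have k: "?k j > 0" by simp
      have tf: "test_fun {0<..<T} (?a j)" by (rule test_fun_real_step[OF st(1,2) elim k])
      have der: "pderiv_dir 1 (?a j) \<tau> = ?k j * s' (?k j * \<tau> - ?k j * s) - ?k j * s' (?k j * \<tau> - ?k j * t)" for \<tau>
      proof -
        have "((\<lambda>\<tau>. step (?k j * \<tau> - ?k j * c)) has_real_derivative s' (?k j * \<tau> - ?k j * c) * ?k j) (at \<tau>)" for c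
          by (rule DERIV_chain2[OF s'(1)]) (auto intro!: derivative_eq_intros)
        from DERIV_diff[OF this[of s] this[of t]]
        show ?thesis using pderiv_dir_eq[of "?a j" _ \<tau> 1] by (auto simp: has_field_derivative_def mult.commute)
      qed
      have Pi: "integrable lborel (\<lambda>\<tau>. ?k j * s' (?k j * \<tau> - ?k j * c) * mm \<tau>)" for c
      proof (rule integrable_bounded_compact_support[where C="?k j * E * Mb" and S="{0..T}"])
        show "norm (?k j * s' (?k j * \<tau> - ?k j * c) * mm \<tau>) \<le> ?k j * E * Mb" for \<tau>
          unfolding norm_mult using s' Mb k by (intro mult_mono) (auto simp del: of_nat_Suc)
        show "(\<lambda>\<tau>. ?k j * s' (?k j * \<tau> - ?k j * c) * mm \<tau>) \<in> borel_measurable borel" by measurable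
        show "?k j * s' (?k j * \<tau> - ?k j * c) * mm \<tau> = 0" if "\<tau> \<notin> {0..T}" for \<tau>
          using that by (simp add: mm_def)
      qed simp
      have sb: "\<bar>?a j \<tau>\<bar> \<le> 1" for \<tau>
        using step_bounds[of "?k j * \<tau> - ?k j * s"] step_bounds[of "?k j * \<tau> - ?k j * t"] by linarith
      have step_m[measurable]: "step \<in> borel_measurable borel" by (rule borel_measurable_smooth[OF smooth_step])
      have ai: "integrable lborel (\<lambda>\<tau>. indicator {0<..<T} \<tau> * (?a j \<tau> * n \<tau>))"
      proof (rule integrable_bounded_compact_support[where C="1 * B" and S="{0<..<T}"])
        show "norm (indicator {0<..<T} \<tau> * (?a j \<tau> * n \<tau>)) \<le> 1 * B" for \<tau>
          using mult_mono[OF sb nb, of \<tau> \<tau>] B0 by (auto simp: abs_mult indicator_def)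
      qed auto
      have z: "indicator {0<..<T} \<tau> * (pderiv_dir 1 (?a j) \<tau> * m \<tau> + ?a j \<tau> * n \<tau>)
        = (?k j * s' (?k j * \<tau> - ?k j * s) * mm \<tau> - ?k j * s' (?k j * \<tau> - ?k j * t) * mm \<tau>) + indicator {0<..<T} \<tau> * (?a j \<tau> * n \<tau>)" for \<tau>
      proof (cases "\<tau> \<in> {0<..<T}")
        case True
        then show ?thesis unfolding der by (simp add: mm_def algebra_simps)
      next
        case False
        have z0: "pderiv_dir 1 (?a j) \<tau> = 0"
        proof -
          obtain L where "compact L" "L \<subseteq> {0<..<T}" "\<And>x. x \<notin> L \<Longrightarrow> pderiv_dir 1 (?a j) x = 0"
            by (rule test_fun_compactE[OF test_fun_pderiv[OF tf, of 1]]) auto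
          then show ?thesis using False by blast
        qed
        have "(?k j * s' (?k j * \<tau> - ?k j * s) * mm \<tau> - ?k j * s' (?k j * \<tau> - ?k j * t) * mm \<tau>) = pderiv_dir 1 (?a j) \<tau> * mm \<tau>"
          unfolding der by (simp add: left_diff_distrib)
        then show ?thesis using False z0 by simp
      qed
      show ?case
        using w[OF tf] unfolding z P_def using Pi ai
        by (simp add: Bochner_Integration.integral_add Bochner_Integration.integral_diff del: of_nat_Suc)
    qed
    have step_m[measurable]: "step \<in> borel_measurable borel" by (rule borel_measurable_smooth[OF smooth_step])
    have al: "(\<lambda>j. \<integral>\<tau>. indicator {0<..<T} \<tau> * (?a j \<tau> * n \<tau>) \<partial>lborel) \<longlonglongrightarrow> (\<integral>\<tau>. indicator {s<..t} \<tau> * n \<tau> \<partial>lborel)"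
    proof (rule integral_dominated_convergence)
      have "integrable lborel (indicat_real {0<..<T})"
        using T by (intro integrable_real_indicator) auto
      then show "integrable lborel (\<lambda>\<tau>. B * indicat_real {0<..<T} \<tau>)" by simp
      show "AE \<tau> in lborel. norm (indicator {0<..<T} \<tau> * (?a j \<tau> * n \<tau>)) \<le> B * indicat_real {0<..<T} \<tau>" for j
      proof (rule AE_I2)
        fix \<tau>
        have "\<bar>?a j \<tau>\<bar> \<le> 1"
          using step_bounds[of "?k j * \<tau> - ?k j * s"] step_bounds[of "?k j * \<tau> - ?k j * t"] by linarith
        from mult_mono[OF this nb[of \<tau>]] show "norm (indicator {0<..<T} \<tau> * (?a j \<tau> * n \<tau>)) \<le> B * indicat_real {0<..<T} \<tau>"
          by (auto simp: abs_mult indicator_def)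
      qed
      \<comment> \<open>At \<tau> = c the value is 0 for every j, which is why the half-open
        interval {s<..t} appears in the limit.\<close>
      have lim_step: "(\<lambda>j. step (?k j * \<tau> - ?k j * c)) \<longlonglongrightarrow> (if \<tau> > c then 1 else 0)" for \<tau> c
      proof (cases "\<tau> > c")
        case True
        have "eventually (\<lambda>j. inverse (?k j) < \<tau> - c) sequentially"
          using order_tendstoD(2)[OF LIMSEQ_inverse_real_of_nat] True by simp
        then have "eventually (\<lambda>j. step (?k j * \<tau> - ?k j * c) = 1) sequentially"
        proof eventually_elim
          case (elim j)
          have "1 < (\<tau> - c) * ?k j" using elim by (simp add: field_simps del: of_nat_Suc)
          then show ?case by (intro step_1) (simp add: algebra_simps)
        qed
        then show ?thesis using True by (simp add: tendsto_eventually)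
      next
        case False
        have "step (?k j * \<tau> - ?k j * c) = 0" for j
          by (intro step_0) (use False in \<open>simp add: mult_left_mono del: of_nat_Suc\<close>)
        then show ?thesis using False by simp
      qed
      show "AE \<tau> in lborel. (\<lambda>j. indicator {0<..<T} \<tau> * (?a j \<tau> * n \<tau>)) \<longlonglongrightarrow> indicator {s<..t} \<tau> * n \<tau>"
      proof (rule AE_I2)
        fix \<tau>
        have "(\<lambda>j. indicator {0<..<T} \<tau> * (?a j \<tau> * n \<tau>)) \<longlonglongrightarrow>
            indicator {0<..<T} \<tau> * (((if \<tau> > s then 1 else 0) - (if \<tau> > t then 1 else 0)) * n \<tau>)"
          by (intro tendsto_mult tendsto_diff tendsto_const lim_step)
        also have "indicator {0<..<T} \<tau> * (((if \<tau> > s then 1 else 0) - (if \<tau> > t then 1 else 0)) * n \<tau>) = indicator {s<..t} \<tau> * n \<tau>"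
          using st by (auto simp: indicator_def)
        finally show "(\<lambda>j. indicator {0<..<T} \<tau> * (?a j \<tau> * n \<tau>)) \<longlonglongrightarrow> indicator {s<..t} \<tau> * n \<tau>" .
      qed
    qed measurable
    have "(\<lambda>j. P s j - P t j + (\<integral>\<tau>. indicator {0<..<T} \<tau> * (?a j \<tau> * n \<tau>) \<partial>lborel)) \<longlonglongrightarrow> m s - m t + (\<integral>\<tau>. indicator {s<..t} \<tau> * n \<tau> \<partial>lborel)"
      unfolding P_def by (intro tendsto_add tendsto_diff delta al) (use st in auto)
    moreover have "(\<lambda>j. P s j - P t j + (\<integral>\<tau>. indicator {0<..<T} \<tau> * (?a j \<tau> * n \<tau>) \<partial>lborel)) \<longlonglongrightarrow> 0"
      by (rule tendsto_eventually[OF ev2])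
    ultimately have "m s - m t + (\<integral>\<tau>. indicator {s<..t} \<tau> * n \<tau> \<partial>lborel) = 0" by (rule LIMSEQ_unique)
    then show ?thesis by simp
  qed
  \<comment> \<open>By \<open>key\<close> this is constant on the open interval, and by continuity
    on its closure; comparing times t and 0 gives the claim.\<close>
  define H where "H \<tau> = m \<tau> - integral {0..\<tau>} n" for \<tau>
  have Hc: "continuous_on {0..T} H"
    unfolding H_def by (intro continuous_on_diff m indefinite_integral_continuous_1 ni)
  have Hs: "H t = H s" if st: "0 < s" "s < t" "t < T" for s t
  proof -
    have i: "integrable lborel (\<lambda>\<tau>. indicator {s<..t} \<tau> * n \<tau>)"
      by (rule integrable_bounded_compact_support[where C=B and S="{s..t}"]) (use nb B0 in \<open>auto simp: indicator_def\<close>)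
    have "((\<lambda>\<tau>. indicator {s<..t} \<tau> * n \<tau>) has_integral (m t - m s)) UNIV"
      unfolding key[OF st] by (rule has_integral_integral_lborel[OF i])
    then have "((\<lambda>\<tau>. if \<tau> \<in> {s..t} then n \<tau> else 0) has_integral (m t - m s)) UNIV"
      by (rule has_integral_spike_finite[of "{s}", rotated 2]) (auto simp: indicator_def)
    then have "(n has_integral (m t - m s)) {s..t}" by (simp only: has_integral_restrict_UNIV)
    then have "integral {s..t} n = m t - m s" by (rule integral_unique)
    moreover have "integral {0..s} n + integral {s..t} n = integral {0..t} n"
      by (rule Henstock_Kurzweil_Integration.integral_combine) (use st ni in auto)
    ultimately show ?thesis by (simp add: H_def)
  qed
  define c where "c = H (T / 2)"
  have Hopen: "H \<tau> = c" if "\<tau> \<in> {0<..<T}" for \<tau>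
  proof -
    consider "\<tau> < T / 2" | "\<tau> = T / 2" | "\<tau> > T / 2" by linarith
    then show ?thesis
      unfolding c_def using Hs[of \<tau> "T / 2"] Hs[of "T / 2" \<tau>] that T by cases auto
  qed
  have cl: "closure {0<..<T} = {0..T}" using T by simp
  have Hconst: "H \<tau> = c" if "\<tau> \<in> {0..T}" for \<tau>
    by (rule continuous_constant_on_closure[of "{0<..<T}" H c \<tau>]) (use Hc Hopen that cl in auto)
  have "H t = H 0" using Hconst t T by simp
  then have "integral {0..t} n = m t - m 0" by (simp add: H_def)
  then show ?thesis using integrable_integral[OF ni[of 0 t]] by simp
qed

text \<open>The set of interior times where the bound fails is open, and a nonempty open set is not
  null; the end points follow by continuity.\<close>

lemma continuous_le_of_AE:
  fixes \<phi> :: "real \<Rightarrow> real"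
  assumes T: "T > 0" and c: "continuous_on {0..T} \<phi>"
    and ae: "AE t in lborel. t \<in> {0<..<T} \<longrightarrow> \<phi> t \<le> C" and s: "s \<in> {0..T}"
  shows "\<phi> s \<le> C"
proof -
  define Z where "Z = {t \<in> {0<..<T}. C < \<phi> t}"
  have "open Z"
  proof -
    have "continuous_on {0<..<T} \<phi>" using c by (rule continuous_on_subset) auto
    then have "openin (top_of_set {0<..<T}) ({0<..<T} \<inter> \<phi> -` {C<..})"
      by (rule continuous_openin_preimage_gen) simp
    moreover have "{0<..<T} \<inter> \<phi> -` {C<..} = Z" by (auto simp: Z_def)
    ultimately show ?thesis using openin_open_trans open_greaterThanLessThan by metis
  qed
  have "Z = {}"
  proof (rule ccontr)
    assume "Z \<noteq> {}"
    then have "\<not> negligible Z" using \<open>open Z\<close> open_not_negligible by blast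
    moreover have "AE t in lborel. t \<notin> Z" using ae by eventually_elim (auto simp: Z_def)
    then have "Z \<in> null_sets lborel" using \<open>open Z\<close> by (subst (asm) AE_iff_null_sets[symmetric]) auto
    then have "negligible Z" by (simp add: negligible_iff_null_sets null_sets_completionI)
    ultimately show False by blast
  qed
  then have le: "\<phi> t \<le> C" if "t \<in> {0<..<T}" for t using that by (force simp: Z_def)
  have cl: "closure {0<..<T} = {0..T}" using T by simp
  show ?thesis
    by (rule continuous_le_on_closure[of "{0<..<T}" \<phi> s C]) (use c le s cl in auto)
qed

section \<open>Borel versions, time slices and product test functions\<close>

lemma lebesgue_on_ex_borel:
  fixes h :: "'a::euclidean_space \<Rightarrow> 'b::euclidean_space"
  assumes S: "S \<in> sets borel" and h: "h \<in> borel_measurable (lebesgue_on S)"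
  obtains g where "g \<in> borel_measurable borel" "AE x in lborel. g x = indicator S x *\<^sub>R h x" "\<And>x. x \<notin> S \<Longrightarrow> g x = 0"
proof -
  have "(\<lambda>x. indicator S x *\<^sub>R h x) \<in> borel_measurable lebesgue"
    using h S integrable_lebesgue_on(3)[of S h] by auto
  then obtain g where g: "g \<in> borel_measurable borel" "AE x in lborel. indicator S x *\<^sub>R h x = g x"
    using lebesgue_ex_borel by blast
  show thesis
  proof (rule that[of "\<lambda>x. indicator S x *\<^sub>R g x"])
    show "(\<lambda>x. indicator S x *\<^sub>R g x) \<in> borel_measurable borel" using g(1) S by measurable
    show "AE x in lborel. indicator S x *\<^sub>R g x = indicator S x *\<^sub>R h x"
      using g(2) by eventually_elim (auto simp: indicator_def)
  qed simp
qed

lemma lebesgue_on_integral_borel: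
  fixes h :: "'a::euclidean_space \<Rightarrow> 'b::euclidean_space"
  assumes S: "S \<in> sets borel" and h: "h \<in> borel_measurable (lebesgue_on S)"
    and g: "g \<in> borel_measurable borel" "AE x in lborel. g x = indicator S x *\<^sub>R h x"
  shows "(\<integral>x. h x \<partial>lebesgue_on S) = (\<integral>x. g x \<partial>lborel)"
proof -
  have SL: "S \<in> sets lebesgue" using S by auto
  have m: "(\<lambda>x. indicator S x *\<^sub>R h x) \<in> borel_measurable lebesgue"
    using h integrable_lebesgue_on(3)[OF SL, of h] by simp
  have ae: "AE x in lborel. indicator S x *\<^sub>R h x = g x" using g(2) by eventually_elim simp
  show ?thesis unfolding integrable_lebesgue_on(2)[OF SL] by (rule lebesgue_integral_borel_rep(1)[OF m g(1) ae])
qed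

text \<open>Almost every time slice of a null set is null. This provides the good times at which
  statements about single slices hold.\<close>

lemma AE_lebesgue_on_prod:
  fixes P :: "real \<times> 'a::euclidean_space \<Rightarrow> bool"
  assumes "AE p in lborel. p \<in> I \<times> S \<longrightarrow> P p"
  shows "AE t in lborel. t \<in> I \<longrightarrow> (AE x in lborel. x \<in> S \<longrightarrow> P (t, x))"
proof -
  have "AE p in lborel \<Otimes>\<^sub>M lborel. p \<in> I \<times> S \<longrightarrow> P p"
    using assms unfolding lborel_prod .
  then have "AE t in lborel. AE x in lborel. (t, x) \<in> I \<times> S \<longrightarrow> P (t, x)"
    by (rule lborel_pair.AE_pair)
  then show ?thesis
  proof eventually_elim
    case (elim t)
    show ?case
    proof
      assume "t \<in> I"
      show "AE x in lborel. x \<in> S \<longrightarrow> P (t, x)" using elim by eventually_elim (use \<open>t \<in> I\<close> in simp)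
    qed
  qed
qed

lemma tensor_has_derivative:
  fixes a :: "real \<Rightarrow> real" and \<psi> :: "'a::euclidean_space \<Rightarrow> real"
  assumes a: "a differentiable (at t)" and \<psi>: "\<psi> differentiable (at x)"
  shows "((\<lambda>p. a (fst p) * \<psi> (snd p)) has_derivative
     (\<lambda>h. a t * (snd h \<bullet> grad \<psi> x) + (fst h * pderiv_dir 1 a t) * \<psi> x)) (at (t, x))"
proof -
  have la: "frechet_derivative a (at t) h = h * pderiv_dir 1 a t" for h
    using frechet_derivative_Basis_sum[OF a, of h] by simp
  have "(a has_derivative (\<lambda>h. h * pderiv_dir 1 a t)) (at t)"
    using a[unfolded frechet_derivative_works] la by (metis (no_types, lifting) ext)
  then have 1: "((\<lambda>p. a (fst p)) has_derivative (\<lambda>h. fst h * pderiv_dir 1 a t)) (at (t, x))"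
    using has_derivative_compose[of fst fst "(t, x)" UNIV a "\<lambda>h. h * pderiv_dir 1 a t"]
    by (simp add: bounded_linear_imp_has_derivative bounded_linear_fst)
  have 2: "((\<lambda>p. \<psi> (snd p)) has_derivative (\<lambda>h. snd h \<bullet> grad \<psi> x)) (at (t, x))"
    using has_derivative_compose[of snd snd "(t, x)" UNIV \<psi> "\<lambda>v. v \<bullet> grad \<psi> x"] has_derivative_grad[OF \<psi>]
    by (simp add: bounded_linear_imp_has_derivative bounded_linear_snd)
  show ?thesis using has_derivative_mult[OF 1 2] by simp
qed

lemma test_fun_tensor:
  fixes a :: "real \<Rightarrow> real" and \<psi> :: "'a::euclidean_space \<Rightarrow> real"
  assumes a: "test_fun I a" and \<psi>: "test_fun S \<psi>"
  shows "test_fun (I \<times> S) (\<lambda>p. a (fst p) * \<psi> (snd p))"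
proof -
  obtain K where K: "compact K" "K \<subseteq> I" "\<And>x. x \<notin> K \<Longrightarrow> a x = 0"
    by (rule test_fun_compactE[OF a]) blast
  obtain L where L: "compact L" "L \<subseteq> S" "\<And>x. x \<notin> L \<Longrightarrow> \<psi> x = 0"
    by (rule test_fun_compactE[OF \<psi>]) blast
  show ?thesis
  proof (rule test_funI)
    have sa: "smooth_fun_on UNIV (\<lambda>p::real \<times> 'a. a (fst p))"
      by (rule smooth_fun_on_compose_real[OF open_UNIV _ smooth_fun_on_linear[OF bounded_linear_fst]])
        (use a in \<open>simp add: test_fun_def\<close>)
    have "smooth_fun_on UNIV (\<lambda>p::real \<times> 'a. \<psi> (snd p + 0))"
      unfolding smooth_fun_on_def
      by (intro allI Ck_on_compose_affine[OF bounded_linear_snd]) (use \<psi> in \<open>simp add: test_fun_def smooth_fun_on_def\<close>)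
    then have sp: "smooth_fun_on UNIV (\<lambda>p::real \<times> 'a. \<psi> (snd p))" by simp
    show "smooth_fun_on UNIV (\<lambda>p::real \<times> 'a. a (fst p) * \<psi> (snd p))"
      by (rule smooth_fun_on_mult[OF open_UNIV sa sp])
    show "compact (K \<times> L)" by (rule compact_Times[OF K(1) L(1)])
    show "K \<times> L \<subseteq> I \<times> S" using K L by blast
    show "a (fst p) * \<psi> (snd p) = 0" if "p \<notin> K \<times> L" for p
      using that K(3)[of "fst p"] L(3)[of "snd p"] by (cases p) auto
  qed
qed

lemma bounded_of_compact_support:
  fixes h :: "'a::euclidean_space \<Rightarrow> 'b::real_normed_vector"
  assumes K: "compact K" and hc: "continuous_on K h" and hz: "\<And>x. x \<notin> K \<Longrightarrow> h x = 0"
  shows "\<exists>B\<ge>0. \<forall>x. norm (h x) \<le> B"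
proof -
  obtain b where b: "\<forall>x\<in>K. norm (h x) \<le> b"
    using compact_imp_bounded[OF compact_continuous_image[OF hc K]] unfolding bounded_iff by fastforce
  have "norm (h x) \<le> max b 0" for x using b hz[of x] by (cases "x \<in> K") auto
  then show ?thesis by (intro exI[of _ "max b 0"]) auto
qed

lemma integrable_inner_bounded:
  fixes h V :: "'a::euclidean_space \<Rightarrow> 'b::euclidean_space"
  assumes "integrable lborel (\<lambda>x. norm (h x))" "h \<in> borel_measurable borel" "V \<in> borel_measurable borel" "\<And>x. norm (V x) \<le> B"
  shows "integrable lborel (\<lambda>x. h x \<bullet> V x)" "\<bar>\<integral>x. h x \<bullet> V x \<partial>lborel\<bar> \<le> B * (\<integral>x. norm (h x) \<partial>lborel)"
proof -
  have b: "norm (h x \<bullet> V x) \<le> B * norm (h x)" for x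
  proof -
    have "norm (h x \<bullet> V x) \<le> norm (h x) * norm (V x)" using Cauchy_Schwarz_ineq2 by simp
    also have "\<dots> \<le> norm (h x) * B" by (intro mult_left_mono assms) auto
    finally show ?thesis by (simp add: mult.commute)
  qed
  have i: "integrable lborel (\<lambda>x. B * norm (h x))" using assms by simp
  have m: "(\<lambda>x. h x \<bullet> V x) \<in> borel_measurable lborel" using assms by measurable
  show "integrable lborel (\<lambda>x. h x \<bullet> V x)"
    by (rule Bochner_Integration.integrable_bound[OF i m]) (rule AE_I2, rule order_trans[OF b], simp)
  show "\<bar>\<integral>x. h x \<bullet> V x \<partial>lborel\<bar> \<le> B * (\<integral>x. norm (h x) \<partial>lborel)"
    using integral_norm_le_integral[OF m i b] by simp
qed

text \<open>The hypotheses are those of a strong solution on \<open>[0, T]\<close>, rephrased for Borel functions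
  on all of space: \<open>U\<close> and \<open>Q\<close> are versions of the velocity and of the density perturbation that
  vanish outside of \<open>J \<times> \<Omega>\<close>, where \<open>J\<close> is the set of good times.\<close>

lemma integrated_transport_equation:
  fixes \<Omega> :: "(real^2) set" and U :: "real \<times> (real^2) \<Rightarrow> real^2" and Q :: "real \<times> (real^2) \<Rightarrow> real"
  assumes \<Omega>: "open \<Omega>" "\<Omega> \<subseteq> cball 0 M" and T: "T > 0" and D: "D \<ge> 0"
    and tr: "transport_equation \<Omega> \<rho>\<^sub>s u \<rho>"
    and \<rho>s: "smooth_fun_on \<Omega> \<rho>\<^sub>s"
    and U: "U \<in> borel_measurable borel" and Q: "Q \<in> borel_measurable borel"
    and Qb: "\<And>p. \<bar>Q p\<bar> \<le> C1"
    and UQ: "AE p in lborel. U p = indicator ({0<..<T} \<times> \<Omega>) p *\<^sub>R u (fst p) (snd p) \<and>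
      Q p = indicator ({0<..<T} \<times> \<Omega>) p * \<rho> (fst p) (snd p)"
    and J: "J \<subseteq> {0<..<T}" "AE t in lborel. t \<in> {0<..<T} \<longrightarrow> t \<in> J"
    and U0: "\<And>t x. t \<notin> J \<or> x \<notin> \<Omega> \<Longrightarrow> U (t, x) = 0"
    and Q0: "\<And>t x. t \<notin> J \<or> x \<notin> \<Omega> \<Longrightarrow> Q (t, x) = 0"
    and U2: "\<And>t. integrable lborel (\<lambda>x. (norm (U (t, x)))\<^sup>2)" "\<And>t. (\<integral>x. (norm (U (t, x)))\<^sup>2 \<partial>lborel) \<le> D\<^sup>2"
    and div: "\<And>t \<psi>. test_fun \<Omega> \<psi> \<Longrightarrow> (\<integral>x. U (t, x) \<bullet> grad \<psi> x \<partial>lborel) = 0"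
    and r_cont: "continuous_on {0..T} (\<lambda>t. \<integral>x. r t x * \<psi> x \<partial>lborel)"
    and r_eq: "\<And>t. t \<in> J \<Longrightarrow> AE x in lborel. r t x = Q (t, x) + indicator \<Omega> x * \<rho>\<^sub>s x"
    and r_meas: "\<And>t. r t \<in> borel_measurable borel" and rb: "\<And>t x. \<bar>r t x\<bar> \<le> C"
    and \<psi>: "test_fun \<Omega> \<psi>" and t: "t \<in> {0..T}"
  shows "((\<lambda>s. \<integral>x. ((Q (s, x) + indicator \<Omega> x * \<rho>\<^sub>s x) *\<^sub>R U (s, x)) \<bullet> grad \<psi> x \<partial>lborel) has_integral
        (\<integral>x. r t x * \<psi> x \<partial>lborel) - (\<integral>x. r 0 x * \<psi> x \<partial>lborel)) {0..t}"
proof -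
  let ?n = "\<lambda>s. \<integral>x. ((Q (s, x) + indicator \<Omega> x * \<rho>\<^sub>s x) *\<^sub>R U (s, x)) \<bullet> grad \<psi> x \<partial>lborel"
  let ?I = "{0<..<T}"
  have Ibd: "bounded ?I" by (rule bounded_subset[of "{0..T}"]) auto
  have Um[measurable]: "U \<in> borel_measurable (borel \<Otimes>\<^sub>M borel)" and Qm[measurable]: "Q \<in> borel_measurable (borel \<Otimes>\<^sub>M borel)"
    using U Q by (simp_all add: borel_prod)
  have \<Omega>b[measurable]: "\<Omega> \<in> sets borel" using \<Omega>(1) by simp
  define \<sigma> where "\<sigma> x = indicator \<Omega> x * \<rho>\<^sub>s x" for x
  have \<sigma>m[measurable]: "\<sigma> \<in> borel_measurable borel"
    unfolding \<sigma>_def using borel_measurable_continuous_on_indicator[OF \<Omega>b smooth_fun_on_continuous[OF \<rho>s]] by simp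
  define G where "G x = indicator \<Omega> x *\<^sub>R grad \<rho>\<^sub>s x" for x
  have Gm[measurable]: "G \<in> borel_measurable borel"
    unfolding G_def by (rule borel_measurable_continuous_on_indicator[OF \<Omega>b continuous_on_grad[OF \<rho>s]])
  obtain K where K: "compact K" "K \<subseteq> \<Omega>" "\<And>x. x \<notin> K \<Longrightarrow> \<psi> x = 0"
    by (rule test_fun_compactE[OF \<psi>]) blast
  have \<psi>s: "smooth_fun_on UNIV \<psi>" using \<psi> by (simp add: test_fun_def)
  have \<psi>m[measurable]: "\<psi> \<in> borel_measurable borel" by (rule borel_measurable_smooth[OF \<psi>s])
  have gm[measurable]: "grad \<psi> \<in> borel_measurable borel"
    by (rule borel_measurable_continuous_onI[OF continuous_on_grad[OF \<psi>s]])
  have g0: "grad \<psi> x = 0" if "x \<notin> K" for x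
    by (rule grad_zero_outside[OF compact_imp_closed[OF K(1)] K(3) that])
  note bdd_on_K = bounded_of_compact_support[OF K(1)]
  have cK: "continuous_on K \<rho>\<^sub>s" "continuous_on K (grad \<rho>\<^sub>s)" "continuous_on K \<psi>" "continuous_on K (grad \<psi>)"
    using K(2) continuous_on_subset[OF smooth_fun_on_continuous[OF \<rho>s]] continuous_on_subset[OF continuous_on_grad[OF \<rho>s]]
      continuous_on_subset[OF smooth_fun_on_continuous[OF \<psi>s]] continuous_on_subset[OF continuous_on_grad[OF \<psi>s]] by auto
  obtain B\<psi> where B\<psi>: "B\<psi> \<ge> 0" "\<And>x. norm (\<psi> x) \<le> B\<psi>" using bdd_on_K[OF cK(3) K(3)] by blast
  obtain Bg where Bg: "Bg \<ge> 0" "\<And>x. norm (grad \<psi> x) \<le> Bg" using bdd_on_K[OF cK(4) g0] by blast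
  have "\<exists>B\<ge>0. \<forall>x. norm (\<psi> x *\<^sub>R G x) \<le> B"
  proof (rule bdd_on_K)
    have "continuous_on K (\<lambda>x. \<psi> x *\<^sub>R grad \<rho>\<^sub>s x)" by (intro continuous_on_scaleR cK)
    then show "continuous_on K (\<lambda>x. \<psi> x *\<^sub>R G x)"
      by (rule continuous_on_eq) (use K(2) in \<open>auto simp: G_def\<close>)
  qed (use K(3) in auto)
  then obtain BG where BG: "BG \<ge> 0" "\<And>x. norm (\<psi> x *\<^sub>R G x) \<le> BG" by blast
  have "\<exists>B\<ge>0. \<forall>x. norm (\<sigma> x *\<^sub>R grad \<psi> x) \<le> B"
  proof (rule bdd_on_K)
    have "continuous_on K (\<lambda>x. \<rho>\<^sub>s x *\<^sub>R grad \<psi> x)" by (intro continuous_on_scaleR cK)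
    then show "continuous_on K (\<lambda>x. \<sigma> x *\<^sub>R grad \<psi> x)"
      by (rule continuous_on_eq) (use K(2) in \<open>auto simp: \<sigma>_def\<close>)
  qed (use g0 in auto)
  then obtain Bs where Bs: "Bs \<ge> 0" "\<And>x. norm (\<sigma> x *\<^sub>R grad \<psi> x) \<le> Bs" by blast
  have C10: "C1 \<ge> 0" using Qb[of "(0, 0)"] by linarith
  have Ux[measurable]: "(\<lambda>x. U (s, x)) \<in> borel_measurable borel" for s by measurable
  have Uz: "U (s, x) = 0" if "x \<notin> cball 0 M" for s x using U0[of s x] \<Omega>(2) that by blast
  define L where "L = sqrt (measure lborel (cball (0::real^2) M)) * D"
  have UL: "integrable lborel (\<lambda>x. norm (U (s, x)))" "(\<integral>x. norm (U (s, x)) \<partial>lborel) \<le> L" for s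
    using L1_bound_of_L2[OF Ux U2 D Uz] unfolding L_def by auto
  have QV: "norm (Q (s, x) *\<^sub>R grad \<psi> x) \<le> C1 * Bg" for s x
    unfolding norm_scaleR real_norm_def by (intro mult_mono Qb Bg C10) auto
  have nV: "norm ((Q (s, x) + \<sigma> x) *\<^sub>R grad \<psi> x) \<le> C1 * Bg + Bs" for s x
    unfolding scaleR_left_distrib using norm_triangle_le[OF add_mono[OF QV[of s x] Bs(2)[of x]]] .
  have n_eq: "?n s = (\<integral>x. U (s, x) \<bullet> ((Q (s, x) + \<sigma> x) *\<^sub>R grad \<psi> x) \<partial>lborel)" for s
    by (simp only: \<sigma>_def inner_scaleR_left inner_scaleR_right)
  have n_meas: "?n \<in> borel_measurable borel"
    unfolding \<sigma>_def[symmetric] by measurable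
  have n_bound: "\<bar>?n s\<bar> \<le> (C1 * Bg + Bs) * L" for s
  proof -
    have "\<bar>?n s\<bar> \<le> (C1 * Bg + Bs) * (\<integral>x. norm (U (s, x)) \<partial>lborel)"
      unfolding n_eq by (rule integrable_inner_bounded(2)[OF UL(1) Ux _ nV]) measurable
    also have "\<dots> \<le> (C1 * Bg + Bs) * L" using C10 Bg Bs UL by (intro mult_left_mono) auto
    finally show ?thesis .
  qed
  \<comment> \<open>The contribution of the steady density does not depend on time and cancels in
    the final difference.\<close>
  define cs where "cs = (\<integral>x. \<sigma> x * \<psi> x \<partial>lborel)"
  have \<sigma>\<psi>: "integrable lborel (\<lambda>x. \<sigma> x * \<psi> x)"
  proof -
    have "\<exists>B\<ge>0. \<forall>x. norm (\<sigma> x * \<psi> x) \<le> B"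
    proof (rule bdd_on_K)
      have "continuous_on K (\<lambda>x. \<rho>\<^sub>s x * \<psi> x)" by (intro continuous_on_mult cK)
      then show "continuous_on K (\<lambda>x. \<sigma> x * \<psi> x)"
        by (rule continuous_on_eq) (use K(2) in \<open>auto simp: \<sigma>_def\<close>)
    qed (use K(3) in auto)
    then obtain B where "\<And>x. norm (\<sigma> x * \<psi> x) \<le> B" by blast
    then show ?thesis
      by (rule integrable_bounded_compact_support[rotated, OF _ compact_imp_bounded[OF K(1)]]) (use K(3) in auto)
  qed
  have Q\<psi>: "(\<integral>x. Q (s, x) * \<psi> x \<partial>lborel) = (\<integral>x. r s x * \<psi> x \<partial>lborel) - cs" if "s \<in> J" for s
  proof -
    have [measurable]: "r s \<in> borel_measurable borel" by (rule r_meas)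
    have ri: "integrable lborel (\<lambda>x. r s x * \<psi> x)"
    proof (rule integrable_bounded_compact_support[where C="C * B\<psi>", OF _ _ compact_imp_bounded[OF K(1)]])
      show "norm (r s x * \<psi> x) \<le> C * B\<psi>" for x
        unfolding norm_mult using rb[of s x] B\<psi>(2)[of x] order_trans[OF abs_ge_zero rb[of s x]] by (intro mult_mono) auto
    qed (use K(3) in auto)
    have "(\<integral>x. r s x * \<psi> x \<partial>lborel) - cs = (\<integral>x. r s x * \<psi> x - \<sigma> x * \<psi> x \<partial>lborel)"
      unfolding cs_def using ri \<sigma>\<psi> by simp
    also have "\<dots> = (\<integral>x. Q (s, x) * \<psi> x \<partial>lborel)"
    proof (rule integral_cong_AE)
      show "AE x in lborel. r s x * \<psi> x - \<sigma> x * \<psi> x = Q (s, x) * \<psi> x"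
        using r_eq[OF that] by eventually_elim (simp add: \<sigma>_def distrib_right)
    qed measurable
    finally show ?thesis by simp
  qed
  \<comment> \<open>Smoothness of \<open>\<rho>\<^sub>s\<close> inside \<Omega> suffices for a test
    function, because \<psi> has compact support there.\<close>
  define \<theta> where "\<theta> x = \<rho>\<^sub>s x * \<psi> x" for x
  have \<theta>0: "\<theta> x = 0" if "x \<notin> K" for x using K(3)[OF that] by (simp add: \<theta>_def)
  have \<theta>_test: "test_fun \<Omega> \<theta>"
  proof (rule test_funI[OF _ K(1,2) \<theta>0])
    have "smooth_fun_on \<Omega> \<psi>" using \<psi>s Ck_on_subset[of _ UNIV \<psi> \<Omega>] by (auto simp: smooth_fun_on_def)
    then have "smooth_fun_on \<Omega> \<theta>" unfolding \<theta>_def[abs_def] by (rule smooth_fun_on_mult[OF \<Omega>(1) \<rho>s])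
    then show "smooth_fun_on UNIV \<theta>"
      by (rule smooth_fun_on_cutoff[OF \<Omega>(1) _ compact_imp_closed[OF K(1)] K(2) \<theta>0])
  qed
  have \<theta>_grad: "U (s, x) \<bullet> grad \<theta> x = U (s, x) \<bullet> (\<sigma> x *\<^sub>R grad \<psi> x) + U (s, x) \<bullet> (\<psi> x *\<^sub>R G x)" for s x
  proof (cases "x \<in> \<Omega>")
    case True
    have "grad \<theta> x = \<rho>\<^sub>s x *\<^sub>R grad \<psi> x + \<psi> x *\<^sub>R grad \<rho>\<^sub>s x"
      unfolding \<theta>_def[abs_def]
      by (rule grad_mult[OF smooth_fun_on_diff[OF \<rho>s True] smooth_fun_on_diff[OF \<psi>s]]) simp
    then show ?thesis using True by (simp add: \<sigma>_def G_def inner_add_right)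
  qed (simp add: U0)
  have Ui1: "integrable lborel (\<lambda>x. U (s, x) \<bullet> (\<sigma> x *\<^sub>R grad \<psi> x))" for s
    by (rule integrable_inner_bounded(1)[OF UL(1) Ux _ Bs(2)]) measurable
  have Ui2: "integrable lborel (\<lambda>x. U (s, x) \<bullet> (\<psi> x *\<^sub>R G x))" for s
    by (rule integrable_inner_bounded(1)[OF UL(1) Ux _ BG(2)]) measurable
  have Ui3: "integrable lborel (\<lambda>x. U (s, x) \<bullet> (Q (s, x) *\<^sub>R grad \<psi> x))" for s
    by (rule integrable_inner_bounded(1)[OF UL(1) Ux _ QV]) measurable
  \<comment> \<open>The divergence condition tested with \<theta> moves the gradient from the steady
    density to \<psi>. The source term thus becomes the flux of the steady density, and the total
    density obeys a pure transport equation.\<close>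
  have swap: "(\<integral>x. U (s, x) \<bullet> (\<psi> x *\<^sub>R G x) \<partial>lborel) = - (\<integral>x. U (s, x) \<bullet> (\<sigma> x *\<^sub>R grad \<psi> x) \<partial>lborel)" for s
  proof -
    have "0 = (\<integral>x. U (s, x) \<bullet> (\<sigma> x *\<^sub>R grad \<psi> x) + U (s, x) \<bullet> (\<psi> x *\<^sub>R G x) \<partial>lborel)"
      using div[OF \<theta>_test, of s] unfolding \<theta>_grad by simp
    also have "\<dots> = (\<integral>x. U (s, x) \<bullet> (\<sigma> x *\<^sub>R grad \<psi> x) \<partial>lborel) + (\<integral>x. U (s, x) \<bullet> (\<psi> x *\<^sub>R G x) \<partial>lborel)"
      by (rule Bochner_Integration.integral_add[OF Ui1 Ui2])
    finally show ?thesis by simp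
  qed
  \<comment> \<open>Test functions of product form a(\<tau>) \<psi>(x) reduce the equation in
    space-time to a weak equation in time.\<close>
  have weak: "(\<integral>\<tau>. indicator ?I \<tau> * (pderiv_dir 1 a \<tau> * ((\<integral>x. r \<tau> x * \<psi> x \<partial>lborel) - cs) + a \<tau> * ?n \<tau>) \<partial>lborel) = 0"
    if a: "test_fun ?I a" for a
  proof -
    have da: "test_fun ?I (pderiv_dir 1 a)" by (rule test_fun_pderiv[OF a]) simp
    have as: "smooth_fun_on UNIV a" using a by (simp add: test_fun_def)
    have [measurable]: "a \<in> borel_measurable borel" "pderiv_dir 1 a \<in> borel_measurable borel"
      using a da by (auto simp: test_fun_def intro: borel_measurable_smooth)
    obtain Ka where Ka: "compact Ka" "Ka \<subseteq> ?I" "\<And>x. x \<notin> Ka \<Longrightarrow> a x = 0"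
      by (rule test_fun_compactE[OF a]) blast
    obtain Kd where Kd: "compact Kd" "Kd \<subseteq> ?I" "\<And>x. x \<notin> Kd \<Longrightarrow> pderiv_dir 1 a x = 0"
      by (rule test_fun_compactE[OF da]) blast
    have kI: "a \<tau> = 0 \<and> pderiv_dir 1 a \<tau> = 0" if "\<tau> \<notin> ?I" for \<tau>
      using that Ka(2) Kd(2) Ka(3)[of \<tau>] Kd(3)[of \<tau>] by blast
    obtain Ba where Ba: "\<And>x. norm (a x) \<le> Ba" by (rule test_fun_bounded[OF a]) blast
    obtain Bd where Bd: "\<And>x. norm (pderiv_dir 1 a x) \<le> Bd" by (rule test_fun_bounded[OF da]) blast
    have Ba0: "Ba \<ge> 0" and Bd0: "Bd \<ge> 0"
      using Ba[of 0] Bd[of 0] norm_ge_zero order_trans by blast+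
    define \<phi> where "\<phi> p = a (fst p) * \<psi> (snd p)" for p :: "real \<times> (real^2)"
    have "test_fun (?I \<times> \<Omega>) \<phi>" unfolding \<phi>_def[abs_def] by (rule test_fun_tensor[OF a \<psi>])
    \<comment> \<open>The support involves times below T only, so the function is admissible on the
      whole half line.\<close>
    then have \<phi>_test: "test_fun ({0<..} \<times> \<Omega>) \<phi>" unfolding test_fun_def by auto
    have fr: "frechet_derivative \<phi> (at (\<tau>, x)) (1, v) = a \<tau> * (v \<bullet> grad \<psi> x) + pderiv_dir 1 a \<tau> * \<psi> x" for \<tau> x v
    proof -
      have "(\<phi> has_derivative (\<lambda>h. a \<tau> * (snd h \<bullet> grad \<psi> x) + (fst h * pderiv_dir 1 a \<tau>) * \<psi> x)) (at (\<tau>, x))"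
        unfolding \<phi>_def[abs_def]
        by (rule tensor_has_derivative[OF smooth_fun_on_diff[OF as] smooth_fun_on_diff[OF \<psi>s]]) auto
      from frechet_derivative_at[OF this, symmetric] show ?thesis by simp
    qed
    define \<Phi> where "\<Phi> p = Q p * (a (fst p) * (U p \<bullet> grad \<psi> (snd p)) + pderiv_dir 1 a (fst p) * \<psi> (snd p))
       - (U p \<bullet> G (snd p)) * (a (fst p) * \<psi> (snd p))" for p
    have \<Phi>m: "\<Phi> \<in> borel_measurable (borel \<Otimes>\<^sub>M borel)" unfolding \<Phi>_def by measurable
    let ?F = "\<lambda>(t, x). \<rho> t x * frechet_derivative \<phi> (at (t, x)) (1, u t x) - (u t x \<bullet> grad \<rho>\<^sub>s x) * \<phi> (t, x)"
    let ?IO = "{0::real<..} \<times> \<Omega>"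
    have IO: "?IO \<in> sets lebesgue" using \<Omega>(1) by (intro open_sets_lebesgue open_Times) auto
    have ae: "AE p in lborel. \<Phi> p = indicator ?IO p *\<^sub>R ?F p"
      using UQ
    proof eventually_elim
      case (elim p)
      obtain \<tau> x where p: "p = (\<tau>, x)" by (cases p)
      show ?case
      proof (cases "p \<in> ?I \<times> \<Omega>")
        case True
        then show ?thesis using elim by (simp add: p \<Phi>_def fr \<phi>_def G_def)
      next
        case False
        then have U0': "U p = 0" "Q p = 0" using elim by auto
        have "a \<tau> = 0 \<and> pderiv_dir 1 a \<tau> = 0" if "x \<in> \<Omega>" using False that kI[of \<tau>] unfolding p mem_Times_iff fst_conv snd_conv by blast
        then show ?thesis using U0' by (auto simp: p \<Phi>_def fr \<phi>_def indicator_def)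
      qed
    qed
    have "0 = (\<integral>p. ?F p \<partial>lebesgue_on ?IO)"
      using tr \<phi>_test unfolding transport_equation_def by (metis (no_types, lifting))
    also have "\<dots> = (\<integral>p. indicator ?IO p *\<^sub>R ?F p \<partial>lebesgue)" by (rule integrable_lebesgue_on(2)[OF IO])
    also have "\<dots> = (\<integral>p. \<Phi> p \<partial>lborel)"
    proof (rule lebesgue_integral_borel_rep(1))
      have \<Phi>b: "\<Phi> \<in> borel_measurable borel" using \<Phi>m by (simp add: borel_prod)
      then show "\<Phi> \<in> borel_measurable borel" .
      have "\<Phi> \<in> borel_measurable lebesgue" using \<Phi>b by (auto intro: measurable_completion)
      then show "(\<lambda>p. indicator ?IO p *\<^sub>R ?F p) \<in> borel_measurable lebesgue"
        by (rule borel_measurable_AE) (rule AE_lborel_imp_lebesgue[OF ae])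
      show "AE p in lborel. indicator ?IO p *\<^sub>R ?F p = \<Phi> p" using ae by eventually_elim (simp only:)
    qed
    finally have int0: "(\<integral>p. \<Phi> p \<partial>(lborel \<Otimes>\<^sub>M lborel)) = 0" by (simp add: lborel_prod)
    have ui: "integrable (lborel \<Otimes>\<^sub>M lborel) (\<lambda>p. norm (U p))"
    proof (rule lborel_pair.Fubini_integrable)
      show "integrable lborel (\<lambda>t. \<integral>x. norm (norm (U (t, x))) \<partial>lborel)"
      proof (rule integrable_bounded_compact_support[where C=L and S="?I"])
        show "norm (\<integral>x. norm (norm (U (t, x))) \<partial>lborel) \<le> L" for t using UL(2)[of t] by simp
        show "(\<integral>x. norm (norm (U (t, x))) \<partial>lborel) = 0" if "t \<notin> ?I" for t
        proof -
          have "t \<notin> J" using that J(1) by blast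
          then show ?thesis by (simp add: U0)
        qed
        show "(\<lambda>t. \<integral>x. norm (norm (U (t, x))) \<partial>lborel) \<in> borel_measurable borel" by measurable
      qed (rule Ibd)
      show "AE t in lborel. integrable lborel (\<lambda>x. norm (U (t, x)))" using UL(1) by simp
    qed measurable
    \<comment> \<open>The terms are grouped by integrability: \<open>\<Phi>1\<close> is bounded with
      bounded support, while \<open>\<Phi>2\<close> is only dominated by a multiple of |U|.\<close>
    define \<Phi>1 where "\<Phi>1 p = pderiv_dir 1 a (fst p) * (Q p * \<psi> (snd p))" for p
    define \<Phi>2 where "\<Phi>2 p = a (fst p) * (U p \<bullet> (Q p *\<^sub>R grad \<psi> (snd p) - \<psi> (snd p) *\<^sub>R G (snd p)))" for p
    have split: "\<Phi> p = \<Phi>1 p + \<Phi>2 p" for p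
      by (simp add: \<Phi>_def \<Phi>1_def \<Phi>2_def inner_diff_right algebra_simps)
    have i1: "integrable (lborel \<Otimes>\<^sub>M lborel) \<Phi>1"
      unfolding lborel_prod
    proof (rule integrable_bounded_compact_support[where C="Bd * (C1 * B\<psi>)" and S="?I \<times> K"])
      show "\<Phi>1 \<in> borel_measurable borel" unfolding borel_prod[symmetric] \<Phi>1_def by measurable
      show "norm (\<Phi>1 p) \<le> Bd * (C1 * B\<psi>)" for p
        unfolding \<Phi>1_def norm_mult using Bd Qb B\<psi> C10 Bd0 by (intro mult_mono) auto
      show "bounded (?I \<times> K)" by (intro bounded_Times compact_imp_bounded[OF K(1)] Ibd)
      show "\<Phi>1 p = 0" if "p \<notin> ?I \<times> K" for p
        using that K(3)[of "snd p"] kI[of "fst p"] unfolding mem_Times_iff \<Phi>1_def by (metis mult_eq_0_iff)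
    qed
    have i2: "integrable (lborel \<Otimes>\<^sub>M lborel) \<Phi>2"
    proof (rule Bochner_Integration.integrable_bound)
      show "integrable (lborel \<Otimes>\<^sub>M lborel) (\<lambda>p. Ba * (C1 * Bg + BG) * norm (U p))"
        by (rule integrable_mult_right) (rule ui)
      show "\<Phi>2 \<in> borel_measurable (lborel \<Otimes>\<^sub>M lborel)" unfolding \<Phi>2_def by measurable
      show "AE p in lborel \<Otimes>\<^sub>M lborel. norm (\<Phi>2 p) \<le> norm (Ba * (C1 * Bg + BG) * norm (U p))"
      proof (rule AE_I2)
        fix p :: "real \<times> (real^2)"
        let ?V = "Q p *\<^sub>R grad \<psi> (snd p) - \<psi> (snd p) *\<^sub>R G (snd p)"
        have V: "norm ?V \<le> C1 * Bg + BG"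
          using norm_triangle_ineq4[of "Q p *\<^sub>R grad \<psi> (snd p)" "\<psi> (snd p) *\<^sub>R G (snd p)"] QV[of "fst p" "snd p"] BG(2)[of "snd p"] by simp
        have "norm (\<Phi>2 p) \<le> Ba * (norm (U p) * (C1 * Bg + BG))"
          unfolding \<Phi>2_def norm_mult
          by (intro mult_mono Ba Ba0) (auto intro!: order_trans[OF Cauchy_Schwarz_ineq2] mult_left_mono V)
        then show "norm (\<Phi>2 p) \<le> norm (Ba * (C1 * Bg + BG) * norm (U p))"
          using Ba0 C10 Bg BG by (simp add: abs_mult mult_ac)
      qed
    qed
    \<comment> \<open>The premise excludes the times of (0,T) outside \<open>J\<close>, where
      \<open>Q\<close> has been set to zero and no longer represents the density; they form a null
      set.\<close>
    have inner: "(\<integral>x. \<Phi> (\<tau>, x) \<partial>lborel) = indicator ?I \<tau> * (pderiv_dir 1 a \<tau> * ((\<integral>x. r \<tau> x * \<psi> x \<partial>lborel) - cs) + a \<tau> * ?n \<tau>)"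
      if "\<tau> \<in> ?I \<longrightarrow> \<tau> \<in> J" for \<tau>
    proof (cases "\<tau> \<in> J")
      case True
      have q: "integrable lborel (\<lambda>x. Q (\<tau>, x) * \<psi> x)"
      proof (rule integrable_bounded_compact_support[where C="C1 * B\<psi>", OF _ _ compact_imp_bounded[OF K(1)]])
        show "norm (Q (\<tau>, x) * \<psi> x) \<le> C1 * B\<psi>" for x
          unfolding norm_mult using Qb B\<psi> C10 by (intro mult_mono) auto
      qed (measurable, use K(3) in simp)
      have "(\<integral>x. \<Phi> (\<tau>, x) \<partial>lborel) = (\<integral>x. pderiv_dir 1 a \<tau> * (Q (\<tau>, x) * \<psi> x) +
          a \<tau> * (U (\<tau>, x) \<bullet> (Q (\<tau>, x) *\<^sub>R grad \<psi> x) - U (\<tau>, x) \<bullet> (\<psi> x *\<^sub>R G x)) \<partial>lborel)"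
        by (simp add: split \<Phi>1_def \<Phi>2_def inner_diff_right)
      also have "\<dots> = pderiv_dir 1 a \<tau> * (\<integral>x. Q (\<tau>, x) * \<psi> x \<partial>lborel) +
          a \<tau> * ((\<integral>x. U (\<tau>, x) \<bullet> (Q (\<tau>, x) *\<^sub>R grad \<psi> x) \<partial>lborel) - (\<integral>x. U (\<tau>, x) \<bullet> (\<psi> x *\<^sub>R G x) \<partial>lborel))"
        by (simp only: Bochner_Integration.integral_add Bochner_Integration.integral_diff Bochner_Integration.integrable_diff
            integrable_mult_right integral_mult_right_zero q Ui2 Ui3)
      also have "(\<integral>x. U (\<tau>, x) \<bullet> (Q (\<tau>, x) *\<^sub>R grad \<psi> x) \<partial>lborel) - (\<integral>x. U (\<tau>, x) \<bullet> (\<psi> x *\<^sub>R G x) \<partial>lborel) = ?n \<tau>"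
      proof -
        have "?n \<tau> = (\<integral>x. U (\<tau>, x) \<bullet> (Q (\<tau>, x) *\<^sub>R grad \<psi> x) + U (\<tau>, x) \<bullet> (\<sigma> x *\<^sub>R grad \<psi> x) \<partial>lborel)"
          unfolding n_eq[of \<tau>] by (simp only: scaleR_left_distrib inner_add_right)
        also have "\<dots> = (\<integral>x. U (\<tau>, x) \<bullet> (Q (\<tau>, x) *\<^sub>R grad \<psi> x) \<partial>lborel) + (\<integral>x. U (\<tau>, x) \<bullet> (\<sigma> x *\<^sub>R grad \<psi> x) \<partial>lborel)"
          by (rule Bochner_Integration.integral_add[OF Ui3 Ui1])
        finally show ?thesis unfolding swap by simp
      qed
      finally show ?thesis using True J(1) Q\<psi>[OF True] by (simp add: subset_iff)
    next
      case False
      then have "\<tau> \<notin> ?I" using that by blast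
      then show ?thesis using False by (simp add: \<Phi>_def U0 Q0)
    qed
    have i\<Phi>: "integrable (lborel \<Otimes>\<^sub>M lborel) \<Phi>"
      using Bochner_Integration.integrable_add[OF i1 i2] by (simp add: split[abs_def])
    have "(\<integral>\<tau>. \<integral>x. \<Phi> (\<tau>, x) \<partial>lborel \<partial>lborel) = 0"
      using lborel_pair.integral_fst'[OF i\<Phi>] int0 by simp
    moreover have "(\<integral>\<tau>. \<integral>x. \<Phi> (\<tau>, x) \<partial>lborel \<partial>lborel) =
      (\<integral>\<tau>. indicator ?I \<tau> * (pderiv_dir 1 a \<tau> * ((\<integral>x. r \<tau> x * \<psi> x \<partial>lborel) - cs) + a \<tau> * ?n \<tau>) \<partial>lborel)"
    proof (rule integral_cong_AE)
      show "(\<lambda>\<tau>. \<integral>x. \<Phi> (\<tau>, x) \<partial>lborel) \<in> borel_measurable lborel" using \<Phi>m by measurable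
      show "(\<lambda>\<tau>. indicator ?I \<tau> * (pderiv_dir 1 a \<tau> * ((\<integral>x. r \<tau> x * \<psi> x \<partial>lborel) - cs) + a \<tau> * ?n \<tau>)) \<in> borel_measurable lborel"
      proof -
        have "continuous_on ?I (\<lambda>\<tau>. \<integral>x. r \<tau> x * \<psi> x \<partial>lborel)"
          by (rule continuous_on_subset[OF r_cont]) auto
        then have rcm: "(\<lambda>\<tau>. indicator ?I \<tau> *\<^sub>R (\<integral>x. r \<tau> x * \<psi> x \<partial>lborel)) \<in> borel_measurable borel"
          by (intro borel_measurable_continuous_on_indicator) auto
        note n_meas[measurable]
        have "(\<lambda>\<tau>. pderiv_dir 1 a \<tau> * (indicator ?I \<tau> *\<^sub>R (\<integral>x. r \<tau> x * \<psi> x \<partial>lborel) - indicator ?I \<tau> * cs) + indicator ?I \<tau> * (a \<tau> * ?n \<tau>)) \<in> borel_measurable borel"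
          by (intro borel_measurable_add borel_measurable_times borel_measurable_diff borel_measurable_const
              borel_measurable_indicator n_meas rcm) (use rcm in auto)
        also have "(\<lambda>\<tau>. pderiv_dir 1 a \<tau> * (indicator ?I \<tau> *\<^sub>R (\<integral>x. r \<tau> x * \<psi> x \<partial>lborel) - indicator ?I \<tau> * cs) + indicator ?I \<tau> * (a \<tau> * ?n \<tau>)) =
          (\<lambda>\<tau>. indicator ?I \<tau> * (pderiv_dir 1 a \<tau> * ((\<integral>x. r \<tau> x * \<psi> x \<partial>lborel) - cs) + a \<tau> * ?n \<tau>))"
          by (rule ext) (simp add: algebra_simps)
        finally show ?thesis by simp
      qed
      show "AE \<tau> in lborel. (\<integral>x. \<Phi> (\<tau>, x) \<partial>lborel) =
        indicator ?I \<tau> * (pderiv_dir 1 a \<tau> * ((\<integral>x. r \<tau> x * \<psi> x \<partial>lborel) - cs) + a \<tau> * ?n \<tau>)"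
        using J(2) by eventually_elim (rule inner)
    qed
    ultimately show ?thesis by simp
  qed
  have "(?n has_integral (((\<integral>x. r t x * \<psi> x \<partial>lborel) - cs) - ((\<integral>x. r 0 x * \<psi> x \<partial>lborel) - cs))) {0..t}"
    by (rule weak_time_derivative[OF T _ n_meas n_bound weak t]) (intro continuous_on_diff r_cont continuous_on_const)
  then show ?thesis by simp
qed

section \<open>Bounds at every time and conservation for the strong solution\<close>

lemma L2_integrable_bounded_domain:
  fixes h :: "'a::euclidean_space \<Rightarrow> 'b::euclidean_space"
  assumes h: "in_L2 S h" and S: "S \<in> sets borel" "bounded S"
  shows "integrable (lebesgue_on S) h"
proof (rule Bochner_Integration.integrable_bound)
  have SL: "S \<in> sets lebesgue" using S by auto
  have c: "integrable (lebesgue_on S) (\<lambda>x. 1::real)"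
  proof -
    have "emeasure lborel S < \<infinity>" using S(2) by (rule emeasure_bounded_finite)
    then have "integrable lebesgue (indicat_real S)" using S by (intro integrable_real_indicator) auto
    then show ?thesis using integrable_lebesgue_on(1)[OF SL, of "\<lambda>x. 1::real"] by simp
  qed
  show "integrable (lebesgue_on S) (\<lambda>x. 1 + (norm (h x))\<^sup>2)"
    using h c by (intro Bochner_Integration.integrable_add) (auto simp: in_L2_def)
  show "AE x in lebesgue_on S. norm (h x) \<le> norm (1 + (norm (h x))\<^sup>2)"
  proof (rule AE_I2)
    fix x
    have "2 * norm (h x) \<le> 1 + (norm (h x))\<^sup>2"
      using zero_le_power2[of "norm (h x) - 1"] by (simp add: power2_diff)
    then have "norm (h x) \<le> 1 + (norm (h x))\<^sup>2" using norm_ge_zero[of "h x"] by linarith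
    then show "norm (h x) \<le> norm (1 + (norm (h x))\<^sup>2)" by simp
  qed
qed (use h in \<open>simp add: in_L2_def\<close>)

text \<open>The bound is known at almost every time. Testing with the indicator of the set where k
  times the density at time s exceeds C, and using weak continuity, transfers it to the time s; the
  two signs of k give both inequalities.\<close>

lemma L2_bounded_of_AE:
  fixes \<rho> :: "real \<Rightarrow> 'a::euclidean_space \<Rightarrow> real"
  assumes \<Omega>: "\<Omega> \<in> sets borel" "bounded \<Omega>" and T: "T > 0" and wc: "L2_weakly_continuous \<Omega> \<rho>"
    and ae: "AE t in lborel. t \<in> {0<..<T} \<longrightarrow> (AE x in lborel. x \<in> \<Omega> \<longrightarrow> \<bar>\<rho> t x\<bar> \<le> C)"
    and s: "s \<in> {0..T}"
  shows "AE x in lborel. x \<in> \<Omega> \<longrightarrow> \<bar>\<rho> s x\<bar> \<le> C"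
proof -
  have \<Omega>L: "\<Omega> \<in> sets lebesgue" using \<Omega> by auto
  have L2: "in_L2 \<Omega> (\<rho> t)" if "t \<ge> 0" for t using wc that by (simp add: L2_weakly_continuous_def)
  have c1: "integrable (lebesgue_on \<Omega>) (\<lambda>x. 1::real)"
  proof -
    have "emeasure lborel \<Omega> < \<infinity>" using \<Omega>(2) by (rule emeasure_bounded_finite)
    then have "integrable lebesgue (indicat_real \<Omega>)" using \<Omega> by (intro integrable_real_indicator) auto
    then show ?thesis using integrable_lebesgue_on(1)[OF \<Omega>L, of "\<lambda>x. 1::real"] by simp
  qed
  have one: "AE x in lborel. x \<in> \<Omega> \<longrightarrow> k * \<rho> s x \<le> C" if k: "k = 1 \<or> k = -1" for k :: real
  proof -
    define g where "g x = (if k * \<rho> s x > C then 1 else 0 :: real)" for x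
    have \<rho>sm[measurable]: "\<rho> s \<in> borel_measurable (lebesgue_on \<Omega>)" using L2[of s] s by (simp add: in_L2_def)
    have gm[measurable]: "g \<in> borel_measurable (lebesgue_on \<Omega>)" unfolding g_def by measurable
    have g01: "0 \<le> g x" "g x \<le> 1" for x by (auto simp: g_def)
    have gi: "integrable (lebesgue_on \<Omega>) g"
      by (rule Bochner_Integration.integrable_bound[OF c1 gm]) (auto simp: g_def)
    have g2: "(\<lambda>x. (norm (g x))\<^sup>2) = g" by (auto simp: g_def)
    have gL2: "in_L2 \<Omega> g" unfolding in_L2_def g2 using gi gm by blast
    have i: "integrable (lebesgue_on \<Omega>) (\<lambda>x. \<rho> t x * g x)" if t: "t \<ge> 0" for t
    proof (rule Bochner_Integration.integrable_bound[OF L2_integrable_bounded_domain[OF L2[OF t] \<Omega>]])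
      show "(\<lambda>x. \<rho> t x * g x) \<in> borel_measurable (lebesgue_on \<Omega>)" using L2[OF t] gm by (auto simp: in_L2_def)
      show "AE x in lebesgue_on \<Omega>. norm (\<rho> t x * g x) \<le> norm (\<rho> t x)"
        using mult_left_le[OF g01(2)] by (intro AE_I2) (auto simp: abs_mult g_def)
    qed
    define \<phi> where "\<phi> t = k * (\<integral>x. \<rho> t x * g x \<partial>lebesgue_on \<Omega>)" for t
    have "continuous_on {0..} (\<lambda>t. \<integral>x. \<rho> t x * g x \<partial>lebesgue_on \<Omega>)"
      using wc gL2 by (simp add: L2_weakly_continuous_def)
    then have "continuous_on {0..T} (\<lambda>t. \<integral>x. \<rho> t x * g x \<partial>lebesgue_on \<Omega>)"
      by (rule continuous_on_subset) auto
    then have c: "continuous_on {0..T} \<phi>" unfolding \<phi>_def by (intro continuous_intros)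
    have "\<phi> s \<le> C * (\<integral>x. g x \<partial>lebesgue_on \<Omega>)"
    proof (rule continuous_le_of_AE[OF T c _ s])
      show "AE t in lborel. t \<in> {0<..<T} \<longrightarrow> \<phi> t \<le> C * (\<integral>x. g x \<partial>lebesgue_on \<Omega>)"
        using ae
      proof eventually_elim
        case (elim t)
        show ?case
        proof
          assume t: "t \<in> {0<..<T}"
          then have aet: "AE x in lebesgue_on \<Omega>. \<bar>\<rho> t x\<bar> \<le> C"
            using elim integrable_lebesgue_on(4)[OF \<Omega>L, of "\<lambda>x. \<bar>\<rho> t x\<bar> \<le> C"] by simp
          have "\<phi> t = (\<integral>x. k * (\<rho> t x * g x) \<partial>lebesgue_on \<Omega>)" by (simp add: \<phi>_def)
          also have "\<dots> \<le> (\<integral>x. C * g x \<partial>lebesgue_on \<Omega>)"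
          proof (rule integral_mono_AE)
            show "integrable (lebesgue_on \<Omega>) (\<lambda>x. k * (\<rho> t x * g x))" using i[of t] t by simp
            show "integrable (lebesgue_on \<Omega>) (\<lambda>x. C * g x)" using gi by simp
            show "AE x in lebesgue_on \<Omega>. k * (\<rho> t x * g x) \<le> C * g x"
              using aet
            proof eventually_elim
              case (elim x)
              have "k * \<rho> t x \<le> C" using elim k by auto
              from mult_right_mono[OF this g01(1)[of x]] show ?case by (simp add: mult.assoc)
            qed
          qed
          finally show "\<phi> t \<le> C * (\<integral>x. g x \<partial>lebesgue_on \<Omega>)" by simp
        qed
      qed
    qed
    moreover have isg: "integrable (lebesgue_on \<Omega>) (\<lambda>x. k * (\<rho> s x * g x))" using i[of s] s by simp
    have id: "integrable (lebesgue_on \<Omega>) (\<lambda>x. k * (\<rho> s x * g x) - C * g x)"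
      using isg gi by simp
    have "(\<integral>x. k * (\<rho> s x * g x) - C * g x \<partial>lebesgue_on \<Omega>) = \<phi> s - C * (\<integral>x. g x \<partial>lebesgue_on \<Omega>)"
      using isg gi by (simp add: \<phi>_def)
    ultimately have le0: "(\<integral>x. k * (\<rho> s x * g x) - C * g x \<partial>lebesgue_on \<Omega>) \<le> 0" by simp
    \<comment> \<open>On the set indicated by \<open>g\<close> the integrand is positive, so a
      nonpositive integral forces this set to be null.\<close>
    have nn: "0 \<le> k * (\<rho> s x * g x) - C * g x" for x by (simp add: g_def)
    have "0 \<le> (\<integral>x. k * (\<rho> s x * g x) - C * g x \<partial>lebesgue_on \<Omega>)" by (rule Bochner_Integration.integral_nonneg) (rule nn)
    then have "(\<integral>x. k * (\<rho> s x * g x) - C * g x \<partial>lebesgue_on \<Omega>) = 0" using le0 by simp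
    then have "AE x in lebesgue_on \<Omega>. k * (\<rho> s x * g x) - C * g x = 0"
      by (subst (asm) integral_nonneg_eq_0_iff_AE[OF id]) (use nn in auto)
    then have "AE x in lebesgue_on \<Omega>. k * \<rho> s x \<le> C"
      by eventually_elim (auto simp: g_def split: if_splits)
    then show ?thesis using integrable_lebesgue_on(4)[OF \<Omega>L, of "\<lambda>x. k * \<rho> s x \<le> C"] by simp
  qed
  from one[of 1] one[of "-1"] show ?thesis by (auto elim!: eventually_elim2)
qed

text \<open>The fields of the strong solution are Lebesgue measurable with bounds almost everywhere
  at almost every time. They are exchanged for Borel versions whose bounds hold everywhere and which
  satisfy the transport locale.\<close>

lemma density_conservation:
  fixes \<Omega> :: "(real^2) set"
  assumes dom: "smooth_bounded_domain \<Omega>" and \<rho>s: "smooth_fun_on \<Omega> \<rho>\<^sub>s"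
    and \<rho>sb: "AE x in lebesgue_on \<Omega>. \<bar>\<rho>\<^sub>s x\<bar> \<le> Cs"
    and sol: "strong_solution \<Omega> \<nu> f \<rho>\<^sub>s u\<^sub>0 \<rho>\<^sub>0 u \<rho> P" and T: "T > 0"
  shows "(\<integral>x. \<rho> T x + \<rho>\<^sub>s x \<partial>lebesgue_on \<Omega>) = (\<integral>x. \<rho> 0 x + \<rho>\<^sub>s x \<partial>lebesgue_on \<Omega>)"
    and "(\<integral>x. (\<rho> T x + \<rho>\<^sub>s x)\<^sup>2 \<partial>lebesgue_on \<Omega>) = (\<integral>x. (\<rho> 0 x + \<rho>\<^sub>s x)\<^sup>2 \<partial>lebesgue_on \<Omega>)"
proof -
  let ?I = "{0<..<T}"
  have \<Omega>o: "open \<Omega>" and \<Omega>bd: "bounded \<Omega>" using dom by (auto simp: smooth_bounded_domain_def)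
  have \<Omega>b[measurable]: "\<Omega> \<in> sets borel" using \<Omega>o by simp
  have \<Omega>L: "\<Omega> \<in> sets lebesgue" by (rule open_sets_lebesgue[OF \<Omega>o])
  obtain M where M: "\<Omega> \<subseteq> cball 0 M" using \<Omega>bd unfolding bounded_iff by (auto simp: subset_iff)
  have IOo: "open (?I \<times> \<Omega>)" using \<Omega>o by (intro open_Times) auto
  have IOb: "?I \<times> \<Omega> \<in> sets borel" using IOo by simp
  have IOL: "?I \<times> \<Omega> \<in> sets lebesgue" by (rule open_sets_lebesgue[OF IOo])
  have uT: "in_Linf_time T \<Omega> (in_H 2 \<Omega>) (Hnorm 2 \<Omega>) u" and \<rho>T: "in_Linf (?I \<times> \<Omega>) (\<lambda>(t, x). \<rho> t x)"
    and tr: "transport_equation \<Omega> \<rho>\<^sub>s u \<rho>"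
    and divu: "AE t in lebesgue_on {0<..}. AE x in lebesgue_on \<Omega>. weak_div \<Omega> (u t) x = 0"
    and H10: "AE t in lebesgue_on {0<..}. in_H10 \<Omega> (u t)"
    and wc: "L2_weakly_continuous \<Omega> \<rho>"
    using sol T unfolding strong_solution_def by blast+
  have L2: "in_L2 \<Omega> (\<rho> t)" if "t \<ge> 0" for t using wc that by (simp add: L2_weakly_continuous_def)
  obtain Cu where Cu: "AE t in lebesgue_on ?I. in_H 2 \<Omega> (u t) \<and> Hnorm 2 \<Omega> (u t) \<le> Cu"
    and um: "(\<lambda>(t, x). u t x) \<in> borel_measurable (lebesgue_on (?I \<times> \<Omega>))"
    using uT unfolding in_Linf_time_def jointly_measurable_def by blast
  obtain C1' where C1': "AE p in lebesgue_on (?I \<times> \<Omega>). norm (case p of (t, x) \<Rightarrow> \<rho> t x) \<le> C1'"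
    and \<rho>m: "(\<lambda>(t, x). \<rho> t x) \<in> borel_measurable (lebesgue_on (?I \<times> \<Omega>))"
    using \<rho>T unfolding in_Linf_def by blast
  define C1 where "C1 = max C1' 0"
  define C2 where "C2 = max Cs 0"
  have C0: "C1 \<ge> 0" "C2 \<ge> 0" by (auto simp: C1_def C2_def)
  obtain U0 where U0: "U0 \<in> borel_measurable borel"
    "AE p in lborel. U0 p = indicator (?I \<times> \<Omega>) p *\<^sub>R (case p of (t, x) \<Rightarrow> u t x)" "\<And>p. p \<notin> ?I \<times> \<Omega> \<Longrightarrow> U0 p = 0"
    using lebesgue_on_ex_borel[OF IOb um] by blast
  obtain Q0 where Q0: "Q0 \<in> borel_measurable borel"
    "AE p in lborel. Q0 p = indicator (?I \<times> \<Omega>) p *\<^sub>R (case p of (t, x) \<Rightarrow> \<rho> t x)" "\<And>p. p \<notin> ?I \<times> \<Omega> \<Longrightarrow> Q0 p = 0"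
    using lebesgue_on_ex_borel[OF IOb \<rho>m] by blast
  have C1ae: "AE p in lborel. p \<in> ?I \<times> \<Omega> \<longrightarrow> \<bar>case p of (t, x) \<Rightarrow> \<rho> t x\<bar> \<le> C1"
    using C1' unfolding integrable_lebesgue_on(4)[OF IOL]
    by eventually_elim (auto simp: C1_def)
  define good where "good t \<longleftrightarrow> in_H 2 \<Omega> (u t) \<and> Hnorm 2 \<Omega> (u t) \<le> Cu \<and> in_H10 \<Omega> (u t) \<and>
    (AE x in lebesgue_on \<Omega>. weak_div \<Omega> (u t) x = 0) \<and>
    (AE x in lborel. x \<in> \<Omega> \<longrightarrow> U0 (t, x) = u t x) \<and> (AE x in lborel. x \<in> \<Omega> \<longrightarrow> Q0 (t, x) = \<rho> t x) \<and>
    (AE x in lborel. x \<in> \<Omega> \<longrightarrow> \<bar>\<rho> t x\<bar> \<le> C1)" for t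
  have g1: "AE t in lborel. t \<in> ?I \<longrightarrow> in_H 2 \<Omega> (u t) \<and> Hnorm 2 \<Omega> (u t) \<le> Cu"
    using Cu integrable_lebesgue_on(4)[of ?I "\<lambda>t. in_H 2 \<Omega> (u t) \<and> Hnorm 2 \<Omega> (u t) \<le> Cu"] by simp
  have g2: "AE t in lborel. t \<in> {0<..} \<longrightarrow> (AE x in lebesgue_on \<Omega>. weak_div \<Omega> (u t) x = 0)"
    using divu integrable_lebesgue_on(4)[of "{0<..}" "\<lambda>t. AE x in lebesgue_on \<Omega>. weak_div \<Omega> (u t) x = 0"] by simp
  have g3: "AE t in lborel. t \<in> {0<..} \<longrightarrow> in_H10 \<Omega> (u t)"
    using H10 integrable_lebesgue_on(4)[of "{0<..}" "\<lambda>t. in_H10 \<Omega> (u t)"] by simp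
  have "AE p in lborel. p \<in> ?I \<times> \<Omega> \<longrightarrow> U0 p = (case p of (t, x) \<Rightarrow> u t x)"
    using U0(2) by eventually_elim simp
  from AE_lebesgue_on_prod[OF this]
  have g4: "AE t in lborel. t \<in> ?I \<longrightarrow> (AE x in lborel. x \<in> \<Omega> \<longrightarrow> U0 (t, x) = u t x)" by simp
  have "AE p in lborel. p \<in> ?I \<times> \<Omega> \<longrightarrow> Q0 p = (case p of (t, x) \<Rightarrow> \<rho> t x)"
    using Q0(2) by eventually_elim simp
  from AE_lebesgue_on_prod[OF this]
  have g5: "AE t in lborel. t \<in> ?I \<longrightarrow> (AE x in lborel. x \<in> \<Omega> \<longrightarrow> Q0 (t, x) = \<rho> t x)" by simp
  from AE_lebesgue_on_prod[OF C1ae]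
  have g6: "AE t in lborel. t \<in> ?I \<longrightarrow> (AE x in lborel. x \<in> \<Omega> \<longrightarrow> \<bar>\<rho> t x\<bar> \<le> C1)" by simp
  have "AE t in lborel. t \<in> ?I \<longrightarrow> good t"
    using g1 g2 g3 g4 g5 g6 by eventually_elim (auto simp: good_def)
  then obtain N where N: "{t \<in> space lborel. \<not> (t \<in> ?I \<longrightarrow> good t)} \<subseteq> N" "emeasure lborel N = 0" "N \<in> sets lborel"
    by (rule AE_E)
  \<comment> \<open>The removed null set \<open>N\<close> is Borel, so \<open>J\<close> is Borel and
    restricting to it preserves joint measurability.\<close>
  define J where "J = ?I - N"
  have Jb[measurable]: "J \<in> sets borel" using N(3) by (simp add: J_def)
  have JI: "J \<subseteq> ?I" by (auto simp: J_def)
  have Jgood: "good t" if "t \<in> J" for t using that N(1) by (auto simp: J_def)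
  have NN: "N \<in> null_sets lborel" using N by auto
  have Jae: "AE t in lborel. t \<in> ?I \<longrightarrow> t \<in> J"
    using AE_not_in[OF NN] by eventually_elim (simp add: J_def)
  define U where "U p = (if fst p \<in> J \<and> snd p \<in> \<Omega> then U0 p else 0)" for p
  \<comment> \<open>The clamp and the restriction to \<open>J\<close> alter the density on a null
    set only, and the bound now holds at every point.\<close>
  define Q where "Q p = (if fst p \<in> J \<and> snd p \<in> \<Omega> then max (- C1) (min C1 (Q0 p)) else 0)" for p
  have [measurable]: "U0 \<in> borel_measurable (borel \<Otimes>\<^sub>M borel)" "Q0 \<in> borel_measurable (borel \<Otimes>\<^sub>M borel)"
    using U0(1) Q0(1) by (simp_all add: borel_prod)
  have Um[measurable]: "U \<in> borel_measurable (borel \<Otimes>\<^sub>M borel)" unfolding U_def by measurable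
  have Qm[measurable]: "Q \<in> borel_measurable (borel \<Otimes>\<^sub>M borel)" unfolding Q_def by measurable
  have Ux[measurable]: "(\<lambda>x. U (t, x)) \<in> borel_measurable borel" for t by measurable
  have U_0: "U (t, x) = 0" if "t \<notin> J \<or> x \<notin> \<Omega>" for t x using that by (auto simp: U_def)
  have Q_0: "Q (t, x) = 0" if "t \<notin> J \<or> x \<notin> \<Omega>" for t x using that by (auto simp: Q_def)
  have Qb: "\<bar>Q p\<bar> \<le> C1" for p using C0 by (auto simp: Q_def)
  have U_ae: "AE x in lborel. U (t, x) = indicator \<Omega> x *\<^sub>R u t x" if t: "t \<in> J" for t
    using Jgood[OF t] unfolding good_def by (auto elim!: eventually_mono simp: U_def indicator_def t)
  have Q_ae: "AE x in lborel. Q (t, x) = indicator \<Omega> x * \<rho> t x" if t: "t \<in> J" for t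
  proof -
    have "AE x in lborel. x \<in> \<Omega> \<longrightarrow> Q0 (t, x) = \<rho> t x" "AE x in lborel. x \<in> \<Omega> \<longrightarrow> \<bar>\<rho> t x\<bar> \<le> C1"
      using Jgood[OF t] by (auto simp: good_def)
    then show ?thesis by eventually_elim (auto simp: Q_def indicator_def t)
  qed
  have Npair: "AE p in (lborel :: (real \<times> (real^2)) measure). fst p \<notin> N"
  proof -
    have nb: "N \<in> sets borel" using N(3) by simp
    have "AE p in (lborel :: real measure) \<Otimes>\<^sub>M (lborel :: (real^2) measure). fst p \<notin> N"
    proof (rule lborel_pair.AE_pair_measure)
      show "{p \<in> space ((lborel :: real measure) \<Otimes>\<^sub>M (lborel :: (real^2) measure)). fst p \<notin> N} \<in> sets (lborel \<Otimes>\<^sub>M lborel)"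
        using nb by measurable
      show "AE t in (lborel :: real measure). AE x in (lborel :: (real^2) measure). fst (t, x) \<notin> N"
        using AE_not_in[OF NN] by eventually_elim simp
    qed
    then show ?thesis unfolding lborel_prod .
  qed
  have UQ: "AE p in lborel. U p = indicator (?I \<times> \<Omega>) p *\<^sub>R u (fst p) (snd p) \<and> Q p = indicator (?I \<times> \<Omega>) p * \<rho> (fst p) (snd p)"
    using U0(2) Q0(2) C1ae Npair
  proof eventually_elim
    case (elim p)
    show ?case
    proof (cases "p \<in> ?I \<times> \<Omega>")
      case True
      then show ?thesis using elim by (cases p) (auto simp: U_def Q_def J_def)
    next
      case False
      then have nj: "\<not> (fst p \<in> J \<and> snd p \<in> \<Omega>)" using JI by (cases p) auto
      have "U p = 0" "Q p = 0" by (simp_all only: U_def Q_def nj if_False)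
      then show ?thesis using False by simp
    qed
  qed
  \<comment> \<open>\<open>H10_translation\<close> yields 8 * 2 * Cu^2 in the plane, which is the
    square of 4 * Cu; the absolute value makes D nonnegative.\<close>
  define D where "D = 4 * \<bar>Cu\<bar>"
  have D0: "D \<ge> 0" by (simp add: D_def)
  have Uprops: "integrable lborel (\<lambda>x. (norm (U (t, x)))\<^sup>2) \<and> (\<integral>x. (norm (U (t, x)))\<^sup>2 \<partial>lborel) \<le> D\<^sup>2 \<and>
      (\<forall>z. (\<integral>x. (norm (U (t, x) - U (t, x - z)))\<^sup>2 \<partial>lborel) \<le> D\<^sup>2 * (norm z)\<^sup>2) \<and>
      (\<forall>\<psi>. test_fun \<Omega> \<psi> \<longrightarrow> (\<integral>x. U (t, x) \<bullet> grad \<psi> x \<partial>lborel) = 0)" for t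
  proof (cases "t \<in> J")
    case False
    then show ?thesis by (simp add: U_0)
  next
    case True
    have gd: "in_H (Suc 1) \<Omega> (u t)" "Hnorm (Suc 1) \<Omega> (u t) \<le> Cu" "in_H10 \<Omega> (u t)" "AE x in lebesgue_on \<Omega>. weak_div \<Omega> (u t) x = 0"
      using Jgood[OF True] by (simp_all add: good_def numeral_2_eq_2)
    note ae = U_ae[OF True]
    have um: "u t \<in> borel_measurable (lebesgue_on \<Omega>)" using in_H_imp_in_L2[OF gd(1)] by (simp add: in_L2_def)
    have w: "L2norm \<Omega> (weak_pderiv \<Omega> i (u t)) \<le> Cu" if "i \<in> Basis" for i
      using L2norm_weak_pderiv_le_Hnorm[OF that, of \<Omega> "u t" 1] gd(2) by linarith
    have 1: "integrable lborel (\<lambda>x. (norm (U (t, x)))\<^sup>2)"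
      by (rule H10_translation(1)[OF \<Omega>o gd(3) Ux ae w])
    have "(\<integral>x. (norm (U (t, x)))\<^sup>2 \<partial>lborel) = (L2norm \<Omega> (u t))\<^sup>2"
      by (rule L2norm_borel_rep(1)[OF \<Omega>L um Ux ae, symmetric])
    also have "\<dots> \<le> Cu\<^sup>2"
      using L2norm_le_Hnorm[of \<Omega> "u t" "Suc 1"] gd(2) L2norm_nonneg[of \<Omega> "u t"] by (intro power_mono) auto
    also have "\<dots> \<le> D\<^sup>2" by (simp add: D_def power_mult_distrib)
    finally have 2: "(\<integral>x. (norm (U (t, x)))\<^sup>2 \<partial>lborel) \<le> D\<^sup>2" .
    have 3: "(\<integral>x. (norm (U (t, x) - U (t, x - z)))\<^sup>2 \<partial>lborel) \<le> D\<^sup>2 * (norm z)\<^sup>2" for z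
      using H10_translation(2)[OF \<Omega>o gd(3) Ux ae w, of z] by (simp add: D_def power_mult_distrib)
    have 4: "(\<integral>x. U (t, x) \<bullet> grad \<psi> x \<partial>lborel) = 0" if "test_fun \<Omega> \<psi>" for \<psi>
      by (rule weak_div_zero_test[OF \<Omega>o gd(1,4) Ux ae that])
    show ?thesis using 1 2 3 4 by blast
  qed
  define \<sigma> where "\<sigma> x = indicator \<Omega> x * \<rho>\<^sub>s x" for x
  have \<sigma>m[measurable]: "\<sigma> \<in> borel_measurable borel"
    unfolding \<sigma>_def using borel_measurable_continuous_on_indicator[OF \<Omega>b smooth_fun_on_continuous[OF \<rho>s]] by simp
  have \<sigma>b: "AE x in lborel. \<bar>\<sigma> x\<bar> \<le> C2"
    using \<rho>sb unfolding integrable_lebesgue_on(4)[OF \<Omega>L]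
    by eventually_elim (auto simp: \<sigma>_def indicator_def C2_def)
  \<comment> \<open>A Borel version is chosen at every time separately, so nothing is known about
    \<open>q\<close> jointly in time and space.\<close>
  have "\<forall>t. \<exists>g. t \<ge> 0 \<longrightarrow> g \<in> borel_measurable borel \<and> (AE x in lborel. g x = indicator \<Omega> x *\<^sub>R \<rho> t x) \<and> (\<forall>x. x \<notin> \<Omega> \<longrightarrow> g x = 0)"
  proof
    fix t
    show "\<exists>g. t \<ge> 0 \<longrightarrow> g \<in> borel_measurable borel \<and> (AE x in lborel. g x = indicator \<Omega> x *\<^sub>R \<rho> t x) \<and> (\<forall>x. x \<notin> \<Omega> \<longrightarrow> g x = 0)"
    proof (cases "t \<ge> 0")
      case True
      have "\<rho> t \<in> borel_measurable (lebesgue_on \<Omega>)" using L2[OF True] by (simp add: in_L2_def)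
      then obtain g where "g \<in> borel_measurable borel" "AE x in lborel. g x = indicator \<Omega> x *\<^sub>R \<rho> t x" "\<And>x. x \<notin> \<Omega> \<Longrightarrow> g x = 0"
        using lebesgue_on_ex_borel[OF \<Omega>b] by blast
      then show ?thesis by blast
    qed simp
  qed
  then obtain q where "\<forall>t. t \<ge> 0 \<longrightarrow> q t \<in> borel_measurable borel \<and> (AE x in lborel. q t x = indicator \<Omega> x *\<^sub>R \<rho> t x) \<and> (\<forall>x. x \<notin> \<Omega> \<longrightarrow> q t x = 0)"
    by (rule choice[THEN exE])
  then have q: "q t \<in> borel_measurable borel" "AE x in lborel. q t x = indicator \<Omega> x *\<^sub>R \<rho> t x" "x \<notin> \<Omega> \<Longrightarrow> q t x = 0" if "t \<ge> 0" for t x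
    using that by auto
  have qb: "AE x in lborel. \<bar>q t x\<bar> \<le> C1" if t: "t \<in> {0..T}" for t
  proof -
    have "AE x in lborel. x \<in> \<Omega> \<longrightarrow> \<bar>\<rho> t x\<bar> \<le> C1"
      by (rule L2_bounded_of_AE[OF \<Omega>b \<Omega>bd T wc g6 t])
    moreover have "AE x in lborel. q t x = indicator \<Omega> x *\<^sub>R \<rho> t x" using q(2) t by auto
    ultimately show ?thesis by eventually_elim (use C0 in \<open>auto simp: indicator_def\<close>)
  qed
  define C where "C = C1 + C2"
  have C00: "C \<ge> 0" using C0 by (simp add: C_def)
  \<comment> \<open>The clamp alters the sum on a null set only, by the bound valid at every time of
    [0,T]. Unlike \<open>Q\<close>, this function represents the density at each such time,
    including 0 and T.\<close>
  define r where "r t x = (if t \<in> {0..T} \<and> x \<in> \<Omega> then max (- C) (min C (q t x + \<sigma> x)) else 0)" for t x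
  have rm[measurable]: "r t \<in> borel_measurable borel" for t
  proof (cases "t \<in> {0..T}")
    case True
    then have [measurable]: "q t \<in> borel_measurable borel" using q(1) by simp
    show ?thesis unfolding r_def by measurable
  next
    case False
    then have "r t = (\<lambda>x. 0)" by (auto simp: r_def fun_eq_iff)
    then show ?thesis by simp
  qed
  have rb: "\<bar>r t x\<bar> \<le> C" for t x using C00 by (auto simp: r_def)
  have r_q: "AE x in lborel. r t x = q t x + \<sigma> x" if t: "t \<in> {0..T}" for t
    using qb[OF t] \<sigma>b
  proof eventually_elim
    case (elim x)
    then have "\<bar>q t x + \<sigma> x\<bar> \<le> C" unfolding C_def by linarith
    then show ?case using t q(3)[of t x] by (auto simp: r_def \<sigma>_def)
  qed
  have r_rho: "AE x in lborel. r t x = indicator \<Omega> x *\<^sub>R (\<rho> t x + \<rho>\<^sub>s x)" if t: "t \<in> {0..T}" for t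
  proof -
    have "AE x in lborel. q t x = indicator \<Omega> x *\<^sub>R \<rho> t x" using q(2) t by auto
    with r_q[OF t] show ?thesis by eventually_elim (simp add: \<sigma>_def distrib_left)
  qed
  have r_Q: "AE x in lborel. r t x = Q (t, x) + \<sigma> x" if t: "t \<in> J" for t
  proof -
    have "t \<in> {0..T}" using t JI by auto
    from r_rho[OF this] Q_ae[OF t] show ?thesis by eventually_elim (simp add: \<sigma>_def distrib_left)
  qed
  have r_weak: "continuous_on {0..T} (\<lambda>t. \<integral>x. r t x * g x \<partial>lborel)"
    if g[measurable]: "g \<in> borel_measurable borel" and gb: "\<And>x. \<bar>g x\<bar> \<le> B" for g B
  proof -
    have gi: "integrable lborel (\<lambda>x. (indicator \<Omega> x * g x)\<^sup>2)"
    proof (rule integrable_bounded_compact_support[where C="B\<^sup>2" and S=\<Omega>])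
      show "norm ((indicator \<Omega> x * g x)\<^sup>2) \<le> B\<^sup>2" for x
        using power_mono[OF gb[of x] abs_ge_zero, of 2] by (auto simp: indicator_def)
    qed (use \<Omega>bd in auto)
    have gm: "g \<in> borel_measurable (lebesgue_on \<Omega>)"
      by (rule measurable_restrict_space1) (rule measurable_completion, simp)
    have gL2: "in_L2 \<Omega> g"
      using L2norm_borel_rep(2)[OF \<Omega>L gm, of "\<lambda>x. indicator \<Omega> x * g x"] gi by simp
    have "continuous_on {0..} (\<lambda>t. \<integral>x. \<rho> t x * g x \<partial>lebesgue_on \<Omega>)"
      using wc gL2 by (simp add: L2_weakly_continuous_def)
    then have "continuous_on {0..T} (\<lambda>t. \<integral>x. \<rho> t x * g x \<partial>lebesgue_on \<Omega>)"
      by (rule continuous_on_subset) auto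
    \<comment> \<open>The added constant is the integral of \<sigma> g, expressed through the values
      at time 0.\<close>
    then have "continuous_on {0..T} (\<lambda>t. (\<integral>x. \<rho> t x * g x \<partial>lebesgue_on \<Omega>) + (\<integral>x. r 0 x * g x - q 0 x * g x \<partial>lborel))"
      by (intro continuous_on_add continuous_on_const)
    then show ?thesis
    proof (rule continuous_on_eq)
      fix t assume t: "t \<in> {0..T}"
      have [measurable]: "q t \<in> borel_measurable borel" "q 0 \<in> borel_measurable borel" using q(1) t by auto
      have "\<rho> t \<in> borel_measurable (lebesgue_on \<Omega>)" using L2[of t] t by (simp add: in_L2_def)
      then have e1: "(\<integral>x. \<rho> t x * g x \<partial>lebesgue_on \<Omega>) = (\<integral>x. q t x * g x \<partial>lborel)"
        using gm q(2)[of t] t by (intro lebesgue_on_integral_borel) (auto elim!: eventually_mono)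
      have "(\<integral>x. r 0 x * g x - q 0 x * g x \<partial>lborel) = (\<integral>x. r t x * g x - q t x * g x \<partial>lborel)"
      proof (rule integral_cong_AE)
        show "AE x in lborel. r 0 x * g x - q 0 x * g x = r t x * g x - q t x * g x"
          using r_q[OF t] r_q[of 0] T by (auto elim!: eventually_elim2 simp: algebra_simps)
      qed measurable
      also have "\<dots> = (\<integral>x. r t x * g x \<partial>lborel) - (\<integral>x. q t x * g x \<partial>lborel)"
      proof (rule Bochner_Integration.integral_diff)
        show "integrable lborel (\<lambda>x. r t x * g x)"
        proof (rule integrable_bounded_compact_support[where C="C * B" and S=\<Omega>])
          show "norm (r t x * g x) \<le> C * B" for x unfolding norm_mult using rb gb C00 by (intro mult_mono) auto
        qed (use \<Omega>bd in \<open>auto simp: r_def\<close>)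
        have "integrable lborel (\<lambda>x. max (- C1) (min C1 (q t x)) * g x)"
        proof (rule integrable_bounded_compact_support[where C="C1 * B" and S=\<Omega>])
          show "norm (max (- C1) (min C1 (q t x)) * g x) \<le> C1 * B" for x
            unfolding norm_mult using gb C0 by (intro mult_mono) auto
        qed (use \<Omega>bd q(3)[of t] t C0 in auto)
        moreover have "AE x in lborel. max (- C1) (min C1 (q t x)) * g x = q t x * g x"
          using qb[OF t] by eventually_elim auto
        ultimately show "integrable lborel (\<lambda>x. q t x * g x)"
          by (subst integrable_cong_AE[symmetric, of "\<lambda>x. max (- C1) (min C1 (q t x)) * g x"]) auto
      qed
      finally show "(\<integral>x. \<rho> t x * g x \<partial>lebesgue_on \<Omega>) + (\<integral>x. r 0 x * g x - q 0 x * g x \<partial>lborel) = (\<integral>x. r t x * g x \<partial>lborel)"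
        using e1 by simp
    qed
  qed
  \<comment> \<open>Built from the jointly measurable \<open>Q\<close>, it agrees with
    \<open>r\<close> times the velocity at good times; at all other times the velocity is
    zero.\<close>
  define W where "W p = (Q p + \<sigma> (snd p)) *\<^sub>R U p" for p
  have Wm: "W \<in> borel_measurable borel" unfolding W_def borel_prod[symmetric] by measurable
  have Ub: "U \<in> borel_measurable borel" and Qbm: "Q \<in> borel_measurable borel"
    using Um Qm by (simp_all add: borel_prod)
  have "\<exists>M \<epsilon>\<^sub>0. transported_density \<Omega> T M C D \<epsilon>\<^sub>0 r (\<lambda>t x. U (t, x)) W"
  proof (rule transported_densityI[OF dom T rm rb _ r_weak Ux])
    show "r t x = 0" if "x \<notin> \<Omega>" for t x using that by (simp add: r_def)
    show "AE x in lborel. W (t, x) = r t x *\<^sub>R U (t, x)" if "t \<in> {0..T}" for t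
    proof (cases "t \<in> J")
      case True
      from r_Q[OF True] show ?thesis by eventually_elim (simp add: W_def)
    qed (simp add: W_def U_0)
    show "((\<lambda>s. \<integral>x. W (s, x) \<bullet> grad \<psi> x \<partial>lborel) has_integral
        (\<integral>x. r t x * \<psi> x \<partial>lborel) - (\<integral>x. r 0 x * \<psi> x \<partial>lborel)) {0..t}"
      if \<psi>: "test_fun \<Omega> \<psi>" and t: "t \<in> {0..T}" for t \<psi>
    proof -
      obtain B where B: "\<And>x. norm (\<psi> x) \<le> B" by (rule test_fun_bounded[OF \<psi>]) blast
      have "\<psi> \<in> borel_measurable borel" using \<psi> by (simp add: test_fun_def borel_measurable_smooth)
      then have rc: "continuous_on {0..T} (\<lambda>t. \<integral>x. r t x * \<psi> x \<partial>lborel)"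
        by (rule r_weak) (use B in simp)
      show ?thesis
        unfolding W_def \<sigma>_def snd_conv
        by (rule integrated_transport_equation[OF \<Omega>o M T D0 tr \<rho>s Ub Qbm Qb UQ JI Jae U_0 Q_0 _ _ _ rc r_Q[unfolded \<sigma>_def] rm rb \<psi> t])
          (use Uprops in auto)
    qed
  qed (use Uprops U_0 D0 Wm in auto)
  then obtain M' \<epsilon>\<^sub>0 where td: "transported_density \<Omega> T M' C D \<epsilon>\<^sub>0 r (\<lambda>t x. U (t, x)) W" by blast
  have conv1: "(\<integral>x. \<rho> t x + \<rho>\<^sub>s x \<partial>lebesgue_on \<Omega>) = (\<integral>x. r t x \<partial>lborel)"
    and conv2: "(\<integral>x. (\<rho> t x + \<rho>\<^sub>s x)\<^sup>2 \<partial>lebesgue_on \<Omega>) = (\<integral>x. (r t x)\<^sup>2 \<partial>lborel)" if t: "t \<in> {0..T}" for t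
  proof -
    have "\<rho>\<^sub>s \<in> borel_measurable (lebesgue_on \<Omega>)"
      by (rule continuous_imp_measurable_on_sets_lebesgue[OF smooth_fun_on_continuous[OF \<rho>s] \<Omega>L])
    then have m: "(\<lambda>x. \<rho> t x + \<rho>\<^sub>s x) \<in> borel_measurable (lebesgue_on \<Omega>)"
      using L2[of t] t by (auto simp: in_L2_def)
    show "(\<integral>x. \<rho> t x + \<rho>\<^sub>s x \<partial>lebesgue_on \<Omega>) = (\<integral>x. r t x \<partial>lborel)"
      by (rule lebesgue_on_integral_borel[OF \<Omega>b m rm r_rho[OF t]])
    have m2: "(\<lambda>x. (\<rho> t x + \<rho>\<^sub>s x)\<^sup>2) \<in> borel_measurable (lebesgue_on \<Omega>)" using m by measurable
    show "(\<integral>x. (\<rho> t x + \<rho>\<^sub>s x)\<^sup>2 \<partial>lebesgue_on \<Omega>) = (\<integral>x. (r t x)\<^sup>2 \<partial>lborel)"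
    proof (rule lebesgue_on_integral_borel[OF \<Omega>b m2])
      show "AE x in lborel. (r t x)\<^sup>2 = indicator \<Omega> x *\<^sub>R (\<rho> t x + \<rho>\<^sub>s x)\<^sup>2"
        using r_rho[OF t] by eventually_elim (simp add: indicator_def)
    qed measurable
  qed
  show "(\<integral>x. \<rho> T x + \<rho>\<^sub>s x \<partial>lebesgue_on \<Omega>) = (\<integral>x. \<rho> 0 x + \<rho>\<^sub>s x \<partial>lebesgue_on \<Omega>)"
    using transported_density.mass_conserved[OF td] conv1[of T] conv1[of 0] T by simp
  show "(\<integral>x. (\<rho> T x + \<rho>\<^sub>s x)\<^sup>2 \<partial>lebesgue_on \<Omega>) = (\<integral>x. (\<rho> 0 x + \<rho>\<^sub>s x)\<^sup>2 \<partial>lebesgue_on \<Omega>)"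
    using transported_density.energy_conserved[OF td] conv2[of T] conv2[of 0] T by simp
qed

section \<open>The two equivalences\<close>

lemma in_L2_bounded:
  fixes h :: "'a::euclidean_space \<Rightarrow> real"
  assumes S: "S \<in> sets borel" "bounded S" and m: "h \<in> borel_measurable (lebesgue_on S)"
    and b: "AE x in lebesgue_on S. \<bar>h x\<bar> \<le> C"
  shows "in_L2 S h"
  unfolding in_L2_def
proof
  have SL: "S \<in> sets lebesgue" using S by auto
  have "emeasure lborel S < \<infinity>" using S(2) by (rule emeasure_bounded_finite)
  then have "integrable lebesgue (indicat_real S)" using S by (intro integrable_real_indicator) auto
  then have c: "integrable (lebesgue_on S) (\<lambda>x. C\<^sup>2)"
    using integrable_lebesgue_on(1)[OF SL, of "\<lambda>x. C\<^sup>2"] by simp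
  show "integrable (lebesgue_on S) (\<lambda>x. (norm (h x))\<^sup>2)"
  proof (rule Bochner_Integration.integrable_bound[OF c])
    show "AE x in lebesgue_on S. norm ((norm (h x))\<^sup>2) \<le> norm (C\<^sup>2)"
      using b
    proof eventually_elim
      case (elim x)
      then show ?case using power_mono[OF elim abs_ge_zero, of 2] by simp
    qed
  qed (use m in simp)
qed (rule m)

lemma in_L2_mult_integrable:
  fixes g h :: "'a::euclidean_space \<Rightarrow> real"
  assumes "in_L2 S g" "in_L2 S h"
  shows "integrable (lebesgue_on S) (\<lambda>x. g x * h x)"
  using assms by (intro integral_Cauchy_Schwarz(1)) (auto simp: in_L2_def)

text \<open>With the total density as \<open>g\<close>, the first and third terms are conserved and
  the last does not involve \<open>g\<close>, so only the second one varies in time.\<close>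

lemma L2norm_affine_expand:
  fixes g f :: "'a::euclidean_space \<Rightarrow> real"
  assumes S: "S \<in> sets borel" "bounded S" and g: "in_L2 S g" and f: "in_L2 S f"
  shows "(L2norm S (\<lambda>x. g x + \<gamma> * f x - \<beta>))\<^sup>2 = (\<integral>x. (g x)\<^sup>2 \<partial>lebesgue_on S) + 2 * \<gamma> * (\<integral>x. g x * f x \<partial>lebesgue_on S)
    - 2 * \<beta> * (\<integral>x. g x \<partial>lebesgue_on S) + (\<integral>x. (\<gamma> * f x - \<beta>)\<^sup>2 \<partial>lebesgue_on S)"
proof -
  have one: "in_L2 S (\<lambda>x. 1::real)" by (rule in_L2_bounded[OF S, of _ 1]) auto
  have i1: "integrable (lebesgue_on S) (\<lambda>x. (g x)\<^sup>2)" using g by (simp add: in_L2_def)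
  have i2: "integrable (lebesgue_on S) (\<lambda>x. g x * f x)" by (rule in_L2_mult_integrable[OF g f])
  have i3: "integrable (lebesgue_on S) g" by (rule L2_integrable_bounded_domain[OF g S])
  have i4: "integrable (lebesgue_on S) f" by (rule L2_integrable_bounded_domain[OF f S])
  have i5: "integrable (lebesgue_on S) (\<lambda>x. (f x)\<^sup>2)" using f by (simp add: in_L2_def)
  have i6: "integrable (lebesgue_on S) (\<lambda>x. c)" for c :: real
    using integrable_mult_right[of c, OF L2_integrable_bounded_domain[OF one S]] by simp
  have i7: "integrable (lebesgue_on S) (\<lambda>x. (\<gamma> * f x - \<beta>)\<^sup>2)"
  proof -
    have "integrable (lebesgue_on S) (\<lambda>x. \<gamma>\<^sup>2 * (f x)\<^sup>2 - (2 * \<gamma> * \<beta>) * f x + \<beta>\<^sup>2)"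
      by (intro Bochner_Integration.integrable_add Bochner_Integration.integrable_diff integrable_mult_right i4 i5 i6)
    moreover have "(\<lambda>x. \<gamma>\<^sup>2 * (f x)\<^sup>2 - (2 * \<gamma> * \<beta>) * f x + \<beta>\<^sup>2) = (\<lambda>x. (\<gamma> * f x - \<beta>)\<^sup>2)"
      by (rule ext) (simp add: power2_eq_square algebra_simps)
    ultimately show ?thesis by simp
  qed
  have "(L2norm S (\<lambda>x. g x + \<gamma> * f x - \<beta>))\<^sup>2 = (\<integral>x. (g x + \<gamma> * f x - \<beta>)\<^sup>2 \<partial>lebesgue_on S)"
    by (simp add: L2norm_power2)
  also have "\<dots> = (\<integral>x. (g x)\<^sup>2 + 2 * \<gamma> * (g x * f x) - 2 * \<beta> * g x + (\<gamma> * f x - \<beta>)\<^sup>2 \<partial>lebesgue_on S)"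
    by (intro Bochner_Integration.integral_cong) (auto simp: power2_eq_square algebra_simps)
  also have "\<dots> = (\<integral>x. (g x)\<^sup>2 \<partial>lebesgue_on S) + 2 * \<gamma> * (\<integral>x. g x * f x \<partial>lebesgue_on S)
    - 2 * \<beta> * (\<integral>x. g x \<partial>lebesgue_on S) + (\<integral>x. (\<gamma> * f x - \<beta>)\<^sup>2 \<partial>lebesgue_on S)"
    by (simp only: Bochner_Integration.integral_add Bochner_Integration.integral_diff Bochner_Integration.integrable_add
        Bochner_Integration.integrable_diff integrable_mult_right integral_mult_right_zero i1 i2 i3 i7)
  finally show ?thesis .
qed

theorem theorem1p3:
  fixes \<Omega> :: "(real^2) set" and \<nu> \<alpha>\<^sub>1 \<alpha>\<^sub>2 :: real
    and f \<rho>\<^sub>s p\<^sub>s \<rho>\<^sub>0 :: "real^2 \<Rightarrow> real" and u\<^sub>0 :: "real^2 \<Rightarrow> real^2"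
    and u :: "real \<Rightarrow> real^2 \<Rightarrow> real^2" and \<rho> P :: "real \<Rightarrow> real^2 \<Rightarrow> real"
  assumes domain: "smooth_bounded_domain \<Omega>" and "\<nu> > 0"
    and f: "smooth_fun_on \<Omega> f" "\<And>x. x \<in> \<Omega> \<Longrightarrow> f x > 0" "in_Winf 2 \<Omega> f"
    and steady: "steady_state \<Omega> f \<rho>\<^sub>s p\<^sub>s"
    and bounds: "0 < \<alpha>\<^sub>1"
      "AE x in lebesgue_on \<Omega>. \<alpha>\<^sub>1 \<le> \<rho>\<^sub>0 x + \<rho>\<^sub>s x \<and> \<rho>\<^sub>0 x + \<rho>\<^sub>s x \<le> \<alpha>\<^sub>2"
    and u0: "in_H 2 \<Omega> u\<^sub>0" "in_H10 \<Omega> u\<^sub>0" "AE x in lebesgue_on \<Omega>. weak_div \<Omega> u\<^sub>0 x = 0"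
    and \<rho>0: "in_Linf \<Omega> \<rho>\<^sub>0"
    and solution: "strong_solution \<Omega> \<nu> f \<rho>\<^sub>s u\<^sub>0 \<rho>\<^sub>0 u \<rho> P"
  shows "(((\<lambda>t. \<integral>x. \<rho> t x * f x \<partial>lebesgue_on \<Omega>) \<longlongrightarrow> 0) at_top \<longleftrightarrow>
      (\<exists>\<gamma>>0. \<exists>\<beta>. \<exists>L.
         ((\<lambda>t. (L2norm \<Omega> (\<lambda>x. \<rho> t x + \<rho>\<^sub>s x + \<gamma> * f x - \<beta>))\<^sup>2) \<longlongrightarrow> L) at_top \<and>
         (L2norm \<Omega> (\<lambda>x. \<rho>\<^sub>0 x + \<rho>\<^sub>s x + \<gamma> * f x - \<beta>))\<^sup>2 - L =
           2 * \<gamma> * (\<integral>x. \<rho>\<^sub>0 x * f x \<partial>lebesgue_on \<Omega>)))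
    \<and>
    ((\<exists>\<gamma>>0. \<exists>\<beta>.
         ((\<lambda>t. L2norm \<Omega> (\<lambda>x. \<rho> t x + \<rho>\<^sub>s x - (- \<gamma> * f x + \<beta>))) \<longlongrightarrow> 0) at_top) \<longleftrightarrow>
      (\<exists>\<gamma>>0. \<exists>\<beta>.
         ((\<lambda>t. 2 * \<gamma> * (\<integral>x. (\<rho>\<^sub>0 x - \<rho> t x) * f x \<partial>lebesgue_on \<Omega>))
            \<longlongrightarrow> (L2norm \<Omega> (\<lambda>x. \<rho>\<^sub>0 x + \<rho>\<^sub>s x + \<gamma> * f x - \<beta>))\<^sup>2) at_top))"
proof -
  have \<Omega>o: "open \<Omega>" and \<Omega>bd: "bounded \<Omega>" using domain by (auto simp: smooth_bounded_domain_def)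
  have \<Omega>b: "\<Omega> \<in> sets borel" using \<Omega>o by simp
  have \<Omega>L: "\<Omega> \<in> sets lebesgue" by (rule open_sets_lebesgue[OF \<Omega>o])
  have \<rho>s: "smooth_fun_on \<Omega> \<rho>\<^sub>s" using steady by (simp add: steady_state_def)
  have \<rho>sm: "\<rho>\<^sub>s \<in> borel_measurable (lebesgue_on \<Omega>)"
    by (rule continuous_imp_measurable_on_sets_lebesgue[OF smooth_fun_on_continuous[OF \<rho>s] \<Omega>L])
  obtain C0 where C0: "AE x in lebesgue_on \<Omega>. norm (\<rho>\<^sub>0 x) \<le> C0" using \<rho>0 by (auto simp: in_Linf_def)
  \<comment> \<open>Smoothness inside \<Omega> does not bound the steady density up to the boundary;
    the bound comes from those on the initial total density and on the initial perturbation.\<close>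
  have \<rho>sb: "AE x in lebesgue_on \<Omega>. \<bar>\<rho>\<^sub>s x\<bar> \<le> \<bar>\<alpha>\<^sub>2\<bar> + C0"
    using bounds(2) C0 by eventually_elim (use bounds(1) in auto)
  have \<rho>sL2: "in_L2 \<Omega> \<rho>\<^sub>s" by (rule in_L2_bounded[OF \<Omega>b \<Omega>bd \<rho>sm \<rho>sb])
  have "in_Linf \<Omega> f" using f(3) by (simp add: numeral_2_eq_2)
  then obtain Cf where fm: "f \<in> borel_measurable (lebesgue_on \<Omega>)" and Cf: "AE x in lebesgue_on \<Omega>. \<bar>f x\<bar> \<le> Cf"
    by (auto simp: in_Linf_def)
  have fL2: "in_L2 \<Omega> f" by (rule in_L2_bounded[OF \<Omega>b \<Omega>bd fm Cf])
  have wc: "L2_weakly_continuous \<Omega> \<rho>" and init: "AE x in lebesgue_on \<Omega>. \<rho> 0 x = \<rho>\<^sub>0 x"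
    using solution by (auto simp: strong_solution_def)
  have L2: "in_L2 \<Omega> (\<rho> t)" if "t \<ge> 0" for t using wc that by (simp add: L2_weakly_continuous_def)
  have \<rho>0L2: "in_L2 \<Omega> \<rho>\<^sub>0" by (rule in_L2_cong_AE(1)[OF \<Omega>L L2[OF order_refl] init])
  have sumL2: "in_L2 \<Omega> (\<lambda>x. h x + \<rho>\<^sub>s x)" if h: "in_L2 \<Omega> h" for h
    unfolding in_L2_def
  proof
    show m: "(\<lambda>x. h x + \<rho>\<^sub>s x) \<in> borel_measurable (lebesgue_on \<Omega>)"
      using h \<rho>sm by (auto simp: in_L2_def)
    show "integrable (lebesgue_on \<Omega>) (\<lambda>x. (norm (h x + \<rho>\<^sub>s x))\<^sup>2)"
    proof (rule Bochner_Integration.integrable_bound)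
      show "integrable (lebesgue_on \<Omega>) (\<lambda>x. 2 * (norm (h x))\<^sup>2 + 2 * (norm (\<rho>\<^sub>s x))\<^sup>2)"
        using h \<rho>sL2 by (simp add: in_L2_def)
      show "AE x in lebesgue_on \<Omega>. norm ((norm (h x + \<rho>\<^sub>s x))\<^sup>2) \<le> norm (2 * (norm (h x))\<^sup>2 + 2 * (norm (\<rho>\<^sub>s x))\<^sup>2)"
        using norm_add_sq_le[of "h x" "\<rho>\<^sub>s x" for x] by (intro AE_I2) simp
    qed (use m in simp)
  qed
  define I where "I t = (\<integral>x. \<rho> t x * f x \<partial>lebesgue_on \<Omega>)" for t
  define I0 where "I0 = (\<integral>x. \<rho>\<^sub>0 x * f x \<partial>lebesgue_on \<Omega>)"
  define A where "A \<gamma> \<beta> t = (L2norm \<Omega> (\<lambda>x. \<rho> t x + \<rho>\<^sub>s x + \<gamma> * f x - \<beta>))\<^sup>2" for \<gamma> \<beta> t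
  define A0 where "A0 \<gamma> \<beta> = (L2norm \<Omega> (\<lambda>x. \<rho>\<^sub>0 x + \<rho>\<^sub>s x + \<gamma> * f x - \<beta>))\<^sup>2" for \<gamma> \<beta>
  have I_0: "I 0 = I0"
    unfolding I_def I0_def
  proof (rule integral_cong_AE)
    show "AE x in lebesgue_on \<Omega>. \<rho> 0 x * f x = \<rho>\<^sub>0 x * f x" using init by eventually_elim simp
  qed (use L2[of 0] \<rho>0L2 fm in \<open>auto simp: in_L2_def\<close>)
  have A_0: "A \<gamma> \<beta> 0 = A0 \<gamma> \<beta>" for \<gamma> \<beta>
    unfolding A_def A0_def L2norm_power2
  proof (rule integral_cong_AE)
    show "AE x in lebesgue_on \<Omega>. (norm (\<rho> 0 x + \<rho>\<^sub>s x + \<gamma> * f x - \<beta>))\<^sup>2 = (norm (\<rho>\<^sub>0 x + \<rho>\<^sub>s x + \<gamma> * f x - \<beta>))\<^sup>2"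
      using init by eventually_elim simp
  qed (use L2[of 0] \<rho>0L2 fm \<rho>sm in \<open>auto simp: in_L2_def\<close>)
  have split: "(\<integral>x. (\<rho> t x + \<rho>\<^sub>s x) * f x \<partial>lebesgue_on \<Omega>) = I t + (\<integral>x. \<rho>\<^sub>s x * f x \<partial>lebesgue_on \<Omega>)" if "t \<ge> 0" for t
    unfolding I_def distrib_right
    by (rule Bochner_Integration.integral_add[OF in_L2_mult_integrable[OF L2[OF that] fL2] in_L2_mult_integrable[OF \<rho>sL2 fL2]])
  \<comment> \<open>The conserved terms of the expansion cancel between times 0 and t, leaving the
    change of the potential energy.\<close>
  have key: "A \<gamma> \<beta> t = A0 \<gamma> \<beta> - 2 * \<gamma> * (I0 - I t)" if t: "t \<ge> 0" for \<gamma> \<beta> t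
  proof (cases "t = 0")
    case True
    then show ?thesis by (simp add: A_0 I_0)
  next
    case False
    then have "t > 0" using t by simp
    note cons = density_conservation[OF domain \<rho>s \<rho>sb solution this]
    show ?thesis
      using L2norm_affine_expand[OF \<Omega>b \<Omega>bd sumL2[OF L2[OF t]] fL2, of \<gamma> \<beta>]
        L2norm_affine_expand[OF \<Omega>b \<Omega>bd sumL2[OF L2[OF order_refl]] fL2, of \<gamma> \<beta>]
        cons split[OF t] split[OF order_refl] A_0[of \<gamma> \<beta>] I_0
      by (simp add: A_def algebra_simps)
  qed
  have ev: "eventually (\<lambda>t::real. t \<ge> 0) at_top" by (rule eventually_ge_at_top)
  have diffI: "(\<integral>x. (\<rho>\<^sub>0 x - \<rho> t x) * f x \<partial>lebesgue_on \<Omega>) = I0 - I t" if "t \<ge> 0" for t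
    unfolding I_def I0_def left_diff_distrib
    by (rule Bochner_Integration.integral_diff[OF in_L2_mult_integrable[OF \<rho>0L2 fL2] in_L2_mult_integrable[OF L2[OF that] fL2]])
  have Alim: "((A \<gamma> \<beta>) \<longlongrightarrow> L) at_top \<longleftrightarrow> ((\<lambda>t. A0 \<gamma> \<beta> - 2 * \<gamma> * (I0 - I t)) \<longlongrightarrow> L) at_top" for \<gamma> \<beta> L
    by (rule tendsto_cong) (use ev in \<open>eventually_elim, simp add: key\<close>)
  have part1: "(I \<longlongrightarrow> 0) at_top \<longleftrightarrow> (\<exists>\<gamma>>0. \<exists>\<beta>. \<exists>L. ((A \<gamma> \<beta>) \<longlongrightarrow> L) at_top \<and> A0 \<gamma> \<beta> - L = 2 * \<gamma> * I0)"
  proof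
    assume "(I \<longlongrightarrow> 0) at_top"
    \<comment> \<open>The relation \<open>key\<close> holds for every \<gamma> and \<beta>; 1 and 0
      are the simplest witnesses.\<close>
    then have "((\<lambda>t. A0 1 0 - 2 * 1 * (I0 - I t)) \<longlongrightarrow> A0 1 0 - 2 * 1 * (I0 - 0)) at_top"
      by (intro tendsto_intros)
    then have "((A 1 0) \<longlongrightarrow> A0 1 0 - 2 * I0) at_top" unfolding Alim by simp
    then show "\<exists>\<gamma>>0. \<exists>\<beta>. \<exists>L. ((A \<gamma> \<beta>) \<longlongrightarrow> L) at_top \<and> A0 \<gamma> \<beta> - L = 2 * \<gamma> * I0"
      by (intro exI[of _ 1] conjI exI[of _ 0] exI[of _ "A0 1 0 - 2 * I0"]) auto
  next
    assume "\<exists>\<gamma>>0. \<exists>\<beta>. \<exists>L. ((A \<gamma> \<beta>) \<longlongrightarrow> L) at_top \<and> A0 \<gamma> \<beta> - L = 2 * \<gamma> * I0"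
    then obtain \<gamma> \<beta> L where g: "\<gamma> > 0" and l: "((A \<gamma> \<beta>) \<longlongrightarrow> L) at_top" and e: "A0 \<gamma> \<beta> - L = 2 * \<gamma> * I0" by blast
    \<comment> \<open>The relation is solved for \<open>I\<close>, which is possible because
      \<gamma> is positive.\<close>
    have "((\<lambda>t. (A0 \<gamma> \<beta> - 2 * \<gamma> * (I0 - I t) - A0 \<gamma> \<beta> + 2 * \<gamma> * I0) / (2 * \<gamma>)) \<longlongrightarrow> (L - A0 \<gamma> \<beta> + 2 * \<gamma> * I0) / (2 * \<gamma>)) at_top"
      using l[unfolded Alim] g by (intro tendsto_intros) auto
    moreover have "(\<lambda>t. (A0 \<gamma> \<beta> - 2 * \<gamma> * (I0 - I t) - A0 \<gamma> \<beta> + 2 * \<gamma> * I0) / (2 * \<gamma>)) = I"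
      using g by (auto simp: fun_eq_iff field_simps)
    moreover have "(L - A0 \<gamma> \<beta> + 2 * \<gamma> * I0) / (2 * \<gamma>) = 0" using e by simp
    ultimately show "(I \<longlongrightarrow> 0) at_top" by simp
  qed
  \<comment> \<open>The equivalence is proved for each pair \<gamma>, \<beta>, so the existential
    statements are equivalent with the same witnesses.\<close>
  have part2: "((\<lambda>t. L2norm \<Omega> (\<lambda>x. \<rho> t x + \<rho>\<^sub>s x - (- \<gamma> * f x + \<beta>))) \<longlongrightarrow> 0) at_top \<longleftrightarrow>
      ((\<lambda>t. 2 * \<gamma> * (\<integral>x. (\<rho>\<^sub>0 x - \<rho> t x) * f x \<partial>lebesgue_on \<Omega>)) \<longlongrightarrow> A0 \<gamma> \<beta>) at_top" for \<gamma> \<beta>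
  proof -
    have sgn: "(\<lambda>x. \<rho> t x + \<rho>\<^sub>s x - (- \<gamma> * f x + \<beta>)) = (\<lambda>x. \<rho> t x + \<rho>\<^sub>s x + \<gamma> * f x - \<beta>)" for t
      by (auto simp: fun_eq_iff)
    have sq: "((\<lambda>t. L2norm \<Omega> (\<lambda>x. \<rho> t x + \<rho>\<^sub>s x + \<gamma> * f x - \<beta>)) \<longlongrightarrow> 0) at_top \<longleftrightarrow> ((A \<gamma> \<beta>) \<longlongrightarrow> 0) at_top"
    proof
      assume "((\<lambda>t. L2norm \<Omega> (\<lambda>x. \<rho> t x + \<rho>\<^sub>s x + \<gamma> * f x - \<beta>)) \<longlongrightarrow> 0) at_top"
      from tendsto_power[OF this, of 2] show "((A \<gamma> \<beta>) \<longlongrightarrow> 0) at_top" by (simp add: A_def[abs_def])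
    next
      assume "((A \<gamma> \<beta>) \<longlongrightarrow> 0) at_top"
      from tendsto_real_sqrt[OF this] show "((\<lambda>t. L2norm \<Omega> (\<lambda>x. \<rho> t x + \<rho>\<^sub>s x + \<gamma> * f x - \<beta>)) \<longlongrightarrow> 0) at_top"
        by (simp add: A_def[abs_def] L2norm_nonneg)
    qed
    have "((A \<gamma> \<beta>) \<longlongrightarrow> 0) at_top \<longleftrightarrow> ((\<lambda>t. 2 * \<gamma> * (I0 - I t)) \<longlongrightarrow> A0 \<gamma> \<beta>) at_top"
    proof
      assume "((A \<gamma> \<beta>) \<longlongrightarrow> 0) at_top"
      from tendsto_diff[OF tendsto_const[of "A0 \<gamma> \<beta>"] this[unfolded Alim]]
      show "((\<lambda>t. 2 * \<gamma> * (I0 - I t)) \<longlongrightarrow> A0 \<gamma> \<beta>) at_top" by simp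
    next
      assume "((\<lambda>t. 2 * \<gamma> * (I0 - I t)) \<longlongrightarrow> A0 \<gamma> \<beta>) at_top"
      from tendsto_diff[OF tendsto_const[of "A0 \<gamma> \<beta>"] this]
      show "((A \<gamma> \<beta>) \<longlongrightarrow> 0) at_top" unfolding Alim by simp
    qed
    also have "\<dots> \<longleftrightarrow> ((\<lambda>t. 2 * \<gamma> * (\<integral>x. (\<rho>\<^sub>0 x - \<rho> t x) * f x \<partial>lebesgue_on \<Omega>)) \<longlongrightarrow> A0 \<gamma> \<beta>) at_top"
      by (rule tendsto_cong) (use ev in \<open>eventually_elim, simp add: diffI\<close>)
    finally show ?thesis unfolding sgn sq .
  qed
  show ?thesis
    using part1 unfolding part2 I_def I0_def A_def A0_def by simp
qed

end
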